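(* Let $p\geq 1$ be an integer and let $q>0$ satisfy $p\geq \max\{\frac12,\frac1{2q}\}$, so that $L_q\mathfrak g\subset \mathfrak{gl}_p$ (via multiplication operators). Let $\tilde c_p$ be the Lie algebra 2-cocycle on $\mathfrak{gl}_p$, with values in functions on the space $\mathcal B_p$ of flat connections, $$\tilde c_p(X,Y;B)=2^{2p}\,\mathrm{Str}\Big(\sum_{k=0}^{p}(-1)^k\big(B^{2p+1-k}XB^kY-B^{2p+1-k}YB^kX\big)\Big).$$ Then $\tilde c_p$ is cohomologous (i.e. equal up to adding $\delta\eta$ for some 1-cochain $\eta$) to a 2-cocycle $c_p$ with the property that $c_p(X,Y;B)=0$ for all $B\in\mathcal B_p$ whenever $X$ and $Y$ are both in $L_q\mathfrak g_-$, and also whenever $X$ and $Y$ are both in $L_q\mathfrak g_+$.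
   Context: $G$ is a compact semisimple Lie group with Lie algebra $\mathfrak g$, $\rho:G\to GL(V)$ a faithful representation on a finite-dimensional complex vector space, and $\mathcal H=L^2(S^1,V)$. The operator $\epsilon$ on $\mathcal H$ is $\epsilon(ve^{ikx})=ve^{ikx}$ for $k\ge 0$ and $\epsilon(ve^{ikx})=-ve^{ikx}$ for $k<0$; so $\epsilon=\epsilon^*$, $\epsilon^2=1$. $L_r$ denotes the Schatten ideal of bounded operators $T$ with $\mathrm{Tr}\,|T|^r<\infty$. For $p\ge\frac12$, $$GL_p=\{A\in GL(\mathcal H): [\epsilon,A]\in L_{2p}\},\qquad \mathfrak{gl}_p=\{X\in\mathcal B(\mathcal H):[\epsilon,X]\in L_{2p}\}.$$ Loops act on $\mathcal H$ by pointwise multiplication through $\rho$ (resp. $d\rho$). For $q>0$, $L_q\mathfrak g$ is the Lie algebra of continuous loops in $\mathfrak g$ (complexified, when Fourier modes are considered) whose multiplication operators lie in $\mathfrak{gl}_{p_q}$, $p_q=\max\{\frac12,\frac1{2q}\}$; note $\mathfrak{gl}_{p_q}\subset\mathfrak{gl}_p$ for $p\ge p_q$. $L_q\mathfrak g_-$ (resp. $L_q\mathfrak g_+$) is the subalgebra of loops whose Fourier coefficients $X_n$ vanish for $n\ge 0$ (resp. for $n<0$). Flat connections: $\mathcal B_p=\{B=g^{-1}[\epsilon,g]=g^{-1}\epsilon g-\epsilon : g\in GL_p\}\subset L_{2p}$. The Lie algebra $\mathfrak{gl}_p$ acts on (differentiable) functions $f$ on $\mathcal B_p$ by $\mathcal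 L_Xf(B)=\frac{d}{dt}\big|_{t=0} f\big(e^{-tX}(\epsilon+B)e^{tX}-\epsilon\big)$, i.e. differentiation along $[B,X]+[\epsilon,X]$. A $k$-cochain is an alternating $k$-linear map from $\mathfrak{gl}_p$ to such functions, and the coboundary is $$\delta\omega(X_1,\dots,X_{k};B)=\sum_{j}(-1)^{j+1}\mathcal L_{X_j}\omega(\dots,\hat X_j,\dots;B)+\sum_{i<j}(-1)^{i+j}\omega([X_i,X_j],\dots,\hat X_i,\dots,\hat X_j,\dots;B).$$ In particular $(\delta\eta)(X,Y;B)=\mathcal L_X\eta(Y;B)-\mathcal L_Y\eta(X;B)-\eta([X,Y];B)$ for a 1-cochain $\eta$. A cocycle is a cochain with $\delta\omega=0$. In the expressions considered here, $\mathrm{Str}(T)=\mathrm{Tr}_C(T)=\frac12\mathrm{Tr}(T+\epsilon T\epsilon)$ is the conditional trace. *)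

theory Defs
  imports "HOL-Analysis.Analysis" "HOL-Computational_Algebra.Polynomial" "HOL-Algebra.Group"
begin

section \<open>The Hilbert space of square integrable functions on the circle\<close>

text \<open>The circle is parametrised by \<open>x \<in> [0, 2\<pi>]\<close> and carries its normalised Haar measure; a function
  on the circle is a function of a real variable, of which only the values on \<open>[0, 2\<pi>]\<close> matter. The
  representation space \<open>V\<close> is \<open>\<complex>\<^sup>n\<close> with its standard Hermitian inner product; another inner product on
  \<open>V\<close>, or another normalisation of the measure, gives an equivalent norm and the same operators,
  Schatten ideals and traces.\<close>

definition circle :: "real measure" where
  "circle = density lborel (\<lambda>x. ennreal (indicator {0..2*pi} x / (2*pi)))"

definition square_integrable :: "(real \<Rightarrow> complex^'n) \<Rightarrow> bool" where
  "square_integrable f \<longleftrightarrow> f \<in> borel_measurable borel \<and> integrable circle (\<lambda>x. (norm (f x))\<^sup>2)"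

definition l2_rel :: "(real \<Rightarrow> complex^'n) \<Rightarrow> (real \<Rightarrow> complex^'n) \<Rightarrow> bool" where
  "l2_rel f g \<longleftrightarrow> square_integrable f \<and> square_integrable g \<and> (AE x in circle. f x = g x)"

lemma sets_circle [measurable_cong, simp]: "sets circle = sets borel"
  by (simp add: circle_def)

lemma space_circle [simp]: "space circle = UNIV"
  by (simp add: circle_def)

lemma emeasure_circle_space: "emeasure circle UNIV = 1"
proof -
  have "emeasure circle UNIV = (\<integral>\<^sup>+x. ennreal (1/(2*pi)) * indicator {0..2*pi} x \<partial>lborel)"
    unfolding circle_def
    by (subst emeasure_density) (auto intro!: nn_integral_cong split: split_indicator)
  also have "\<dots> = ennreal (1/(2*pi)) * emeasure lborel {0..2*pi}"
    by (rule nn_integral_cmult_indicator) simp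
  also have "\<dots> = 1"
    by (simp add: ennreal_mult[symmetric])
  finally show ?thesis .
qed

interpretation circle: finite_measure circle
  by (rule finite_measureI) (simp add: emeasure_circle_space)

lemma measure_circle_space [simp]: "measure circle UNIV = 1"
  by (simp add: measure_def emeasure_circle_space)

lemma square_integrable_measurable [measurable_dest]:
  "square_integrable f \<Longrightarrow> f \<in> borel_measurable borel"
  by (simp add: square_integrable_def)

lemma square_integrable_zero: "square_integrable (\<lambda>_. 0)"
  by (simp add: square_integrable_def)

lemma square_integrable_bound:
  fixes f :: "real \<Rightarrow> complex^'n" and g :: "real \<Rightarrow> complex^'m"
  assumes g: "square_integrable g" and f: "f \<in> borel_measurable borel"
    and le: "\<And>x. norm (f x) \<le> c * norm (g x)"
  shows "square_integrable f"
  unfolding square_integrable_def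
proof (intro conjI f)
  show "integrable circle (\<lambda>x. (norm (f x))\<^sup>2)"
  proof (rule Bochner_Integration.integrable_bound)
    show "integrable circle (\<lambda>x. c\<^sup>2 * (norm (g x))\<^sup>2)"
      using g by (simp add: square_integrable_def)
    show "AE x in circle. norm ((norm (f x))\<^sup>2) \<le> norm (c\<^sup>2 * (norm (g x))\<^sup>2)"
    proof (rule AE_I2)
      fix x
      have "(norm (f x))\<^sup>2 \<le> (c * norm (g x))\<^sup>2"
        by (rule power_mono[OF le]) simp
      then show "norm ((norm (f x))\<^sup>2) \<le> norm (c\<^sup>2 * (norm (g x))\<^sup>2)"
        by (simp add: power_mult_distrib abs_mult)
    qed
  qed (use f in measurable)
qed

lemma square_integrable_add:
  assumes f: "square_integrable f" and g: "square_integrable g"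
  shows "square_integrable (\<lambda>x. f x + g x)"
  unfolding square_integrable_def
proof (intro conjI)
  show m: "(\<lambda>x. f x + g x) \<in> borel_measurable borel"
    using f g by measurable
  show "integrable circle (\<lambda>x. (norm (f x + g x))\<^sup>2)"
  proof (rule Bochner_Integration.integrable_bound)
    show "integrable circle (\<lambda>x. 2 * (norm (f x))\<^sup>2 + 2 * (norm (g x))\<^sup>2)"
      using f g by (simp add: square_integrable_def)
    show "AE x in circle. norm ((norm (f x + g x))\<^sup>2) \<le> norm (2 * (norm (f x))\<^sup>2 + 2 * (norm (g x))\<^sup>2)"
    proof (rule AE_I2)
      fix x
      have "(norm (f x + g x))\<^sup>2 \<le> (norm (f x) + norm (g x))\<^sup>2"
        by (intro power_mono norm_triangle_ineq) simp
      also have "\<dots> \<le> 2 * (norm (f x))\<^sup>2 + 2 * (norm (g x))\<^sup>2"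
        using sum_squares_bound[of "norm (f x)" "norm (g x)"] by (simp add: power2_sum)
      finally show "norm ((norm (f x + g x))\<^sup>2) \<le> norm (2 * (norm (f x))\<^sup>2 + 2 * (norm (g x))\<^sup>2)"
        by simp
    qed
  qed (use m in measurable)
qed

lemma norm_vector_scalar_mult: "norm (c *s v) = cmod c * norm (v :: complex^'n)"
  by (simp add: norm_vec_def L2_set_def norm_mult power_mult_distrib sum_distrib_left[symmetric]
      real_sqrt_mult)

lemma measurable_vec_nth [measurable]: "(\<lambda>v::complex^'n. v $ i) \<in> borel_measurable borel"
  by (intro borel_measurable_continuous_onI continuous_intros)

lemma measurable_vecI:
  fixes f :: "'a \<Rightarrow> complex^'n"
  assumes "\<And>i. (\<lambda>x. f x $ i) \<in> borel_measurable M"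
  shows "f \<in> borel_measurable M"
proof (subst borel_measurable_euclidean_space, rule ballI)
  fix b :: "complex^'n" assume "b \<in> Basis"
  have "(\<lambda>x. f x \<bullet> b) = (\<lambda>x. \<Sum>i\<in>UNIV. f x $ i \<bullet> b $ i)"
    by (simp add: inner_vec_def)
  also have "\<dots> \<in> borel_measurable M"
    using assms by (intro borel_measurable_sum borel_measurable_inner) auto
  finally show "(\<lambda>x. f x \<bullet> b) \<in> borel_measurable M" .
qed

lemma square_integrable_scale:
  assumes "square_integrable f" shows "square_integrable (\<lambda>x. c *s f x)"
proof (rule square_integrable_bound[OF assms, where c="cmod c"])
  show "(\<lambda>x. c *s f x) \<in> borel_measurable borel"
    using assms by (intro measurable_vecI) (simp, measurable)
qed (simp add: norm_vector_scalar_mult)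

lemma square_integrable_scaleR:
  assumes "square_integrable f" shows "square_integrable (\<lambda>x. r *\<^sub>R f x)"
  by (rule square_integrable_bound[OF assms, where c="\<bar>r\<bar>"]) (use assms in auto)

lemma square_integrable_uminus:
  assumes "square_integrable f" shows "square_integrable (\<lambda>x. - f x)"
  by (rule square_integrable_bound[OF assms, where c=1]) (use assms in auto)

lemma square_integrable_diff:
  assumes f: "square_integrable f" and g: "square_integrable g"
  shows "square_integrable (\<lambda>x. f x - g x)"
  using square_integrable_add[OF f square_integrable_uminus[OF g]] by simp

lemma integrable_inner_square_integrable:
  assumes f: "square_integrable f" and g: "square_integrable g"
  shows "integrable circle (\<lambda>x. f x \<bullet> g x)"
proof (rule Bochner_Integration.integrable_bound)
  show "integrable circle (\<lambda>x. (norm (f x))\<^sup>2 + (norm (g x))\<^sup>2)"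
    using f g by (simp add: square_integrable_def)
  show "(\<lambda>x. f x \<bullet> g x) \<in> borel_measurable circle"
    using f g by measurable
  show "AE x in circle. norm (f x \<bullet> g x) \<le> norm ((norm (f x))\<^sup>2 + (norm (g x))\<^sup>2)"
  proof (rule AE_I2)
    fix x
    have "\<bar>f x \<bullet> g x\<bar> \<le> norm (f x) * norm (g x)" by (rule Cauchy_Schwarz_ineq2)
    also have "\<dots> \<le> (norm (f x))\<^sup>2 + (norm (g x))\<^sup>2"
      using sum_squares_bound[of "norm (f x)" "norm (g x)"]
        mult_nonneg_nonneg[OF norm_ge_zero[of "f x"] norm_ge_zero[of "g x"]] by linarith
    finally show "norm (f x \<bullet> g x) \<le> norm ((norm (f x))\<^sup>2 + (norm (g x))\<^sup>2)" by simp
  qed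
qed

quotient_type 'n l2 = "real \<Rightarrow> complex^('n::finite)" / partial: l2_rel
proof (rule part_equivpI)
  show "\<exists>f. l2_rel f f"
    by (rule exI[of _ "\<lambda>_. 0"]) (simp add: l2_rel_def square_integrable_zero)
  show "symp l2_rel" by (auto simp: symp_def l2_rel_def elim: AE_mp)
  show "transp l2_rel" by (auto simp: transp_def l2_rel_def elim: AE_mp)
qed

text \<open>The class of a square integrable function (meaningless for other functions).\<close>

abbreviation l2_class :: "(real \<Rightarrow> complex^'n) \<Rightarrow> 'n l2" where
  "l2_class \<equiv> abs_l2"

instantiation l2 :: (finite) real_vector
begin

lift_definition zero_l2 :: "'a l2" is "\<lambda>_. 0"
  by (simp add: l2_rel_def square_integrable_zero)

lift_definition plus_l2 :: "'a l2 \<Rightarrow> 'a l2 \<Rightarrow> 'a l2" is "\<lambda>f g x. f x + g x"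
  by (auto simp: l2_rel_def square_integrable_add)

lift_definition minus_l2 :: "'a l2 \<Rightarrow> 'a l2 \<Rightarrow> 'a l2" is "\<lambda>f g x. f x - g x"
  by (auto simp: l2_rel_def square_integrable_diff)

lift_definition uminus_l2 :: "'a l2 \<Rightarrow> 'a l2" is "\<lambda>f x. - f x"
  by (auto simp: l2_rel_def square_integrable_uminus)

lift_definition scaleR_l2 :: "real \<Rightarrow> 'a l2 \<Rightarrow> 'a l2" is "\<lambda>r f x. r *\<^sub>R f x"
  by (auto simp: l2_rel_def square_integrable_scaleR)

instance
proof
  fix a b c :: "'a l2" and r s :: real
  show "a + b + c = a + (b + c)"
    by transfer (simp add: l2_rel_def square_integrable_add add.assoc)
  show "a + b = b + a"
    by transfer (simp add: l2_rel_def square_integrable_add add.commute)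
  show "0 + a = a"
    by transfer (simp add: l2_rel_def)
  show "- a + a = 0"
    by transfer (simp add: l2_rel_def square_integrable_zero)
  show "a - b = a + - b"
    by transfer (simp add: l2_rel_def square_integrable_diff)
  show "r *\<^sub>R (a + b) = r *\<^sub>R a + r *\<^sub>R b"
    by transfer (simp add: l2_rel_def square_integrable_add square_integrable_scaleR scaleR_add_right)
  show "(r + s) *\<^sub>R a = r *\<^sub>R a + s *\<^sub>R a"
    by transfer (simp add: l2_rel_def square_integrable_add square_integrable_scaleR scaleR_add_left)
  show "r *\<^sub>R s *\<^sub>R a = (r * s) *\<^sub>R a"
    by transfer (simp add: l2_rel_def square_integrable_scaleR)
  show "1 *\<^sub>R a = a"
    by transfer (simp add: l2_rel_def)
qed

end

lemma AE_eq_integral_inner: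
  assumes "l2_rel f f'" "l2_rel g g'"
  shows "(\<integral>x. f x \<bullet> g x \<partial>circle) = (\<integral>x. f' x \<bullet> g' x \<partial>circle)"
proof (rule integral_cong_AE)
  show "AE x in circle. f x \<bullet> g x = f' x \<bullet> g' x"
    using assms by (auto simp: l2_rel_def)
qed (use assms in \<open>auto simp: l2_rel_def\<close>)

instantiation l2 :: (finite) real_inner
begin

lift_definition inner_l2 :: "'a l2 \<Rightarrow> 'a l2 \<Rightarrow> real" is "\<lambda>f g. \<integral>x. f x \<bullet> g x \<partial>circle"
  by (rule AE_eq_integral_inner)

definition norm_l2 :: "'a l2 \<Rightarrow> real" where "norm_l2 f = sqrt (f \<bullet> f)"
definition sgn_l2 :: "'a l2 \<Rightarrow> 'a l2" where "sgn_l2 f = f /\<^sub>R norm f"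
definition dist_l2 :: "'a l2 \<Rightarrow> 'a l2 \<Rightarrow> real" where "dist_l2 f g = norm (f - g)"
definition uniformity_l2 :: "('a l2 \<times> 'a l2) filter" where
  "uniformity_l2 = (INF e\<in>{0<..}. principal {(f, g). dist f g < e})"
definition open_l2 :: "'a l2 set \<Rightarrow> bool" where
  "open_l2 U \<longleftrightarrow> (\<forall>f\<in>U. \<forall>\<^sub>F (f', g) in uniformity. f' = f \<longrightarrow> g \<in> U)"

instance
proof
  fix a b c :: "'a l2" and r s :: real and U :: "'a l2 set"
  show "sgn a = a /\<^sub>R norm a" by (rule sgn_l2_def)
  show "dist a b = norm (a - b)" by (rule dist_l2_def)
  show "uniformity = (INF e\<in>{0<..}. principal {(f, g). dist (f::'a l2) g < e})"
    by (rule uniformity_l2_def)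
  show "open U \<longleftrightarrow> (\<forall>f\<in>U. \<forall>\<^sub>F (f', g) in uniformity. f' = f \<longrightarrow> g \<in> U)"
    by (rule open_l2_def)
  show "a \<bullet> b = b \<bullet> a"
    by transfer (simp add: inner_commute)
  show "(a + b) \<bullet> c = a \<bullet> c + b \<bullet> c"
    by transfer (simp add: l2_rel_def inner_add_left integrable_inner_square_integrable)
  show "(r *\<^sub>R a) \<bullet> b = r * (a \<bullet> b)"
    by transfer (simp add: l2_rel_def integrable_inner_square_integrable)
  show "0 \<le> a \<bullet> a"
    by transfer (simp add: integral_nonneg)
  show "(a \<bullet> a = 0) = (a = 0)"
  proof transfer
    fix f :: "real \<Rightarrow> complex^'a" assume "l2_rel f f"
    then have f: "square_integrable f" by (simp add: l2_rel_def)
    have "(\<integral>x. f x \<bullet> f x \<partial>circle) = 0 \<longleftrightarrow> (AE x in circle. f x \<bullet> f x = 0)"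
      by (rule integral_nonneg_eq_0_iff_AE) (auto simp: integrable_inner_square_integrable f)
    then show "(\<integral>x. f x \<bullet> f x \<partial>circle) = 0 \<longleftrightarrow> l2_rel f (\<lambda>_. 0)"
      using f by (simp add: l2_rel_def square_integrable_zero)
  qed
  show "norm a = sqrt (a \<bullet> a)" by (rule norm_l2_def)
qed

end


lemma l2_rep:
  obtains f where "square_integrable f" "u = l2_class f"
proof
  show "square_integrable (rep_l2 u)"
    using Quotient3_rep_reflp[OF Quotient3_l2, of u] by (simp add: l2_rel_def)
  show "u = l2_class (rep_l2 u)"
    using Quotient3_abs_rep[OF Quotient3_l2, of u] by simp
qed

lemma l2_class_minus:
  "square_integrable f \<Longrightarrow> square_integrable g \<Longrightarrow> l2_class f - l2_class g = l2_class (\<lambda>x. f x - g x)"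
  by (simp add: minus_l2.abs_eq l2_rel_def)

lemma norm_l2_class:
  assumes "square_integrable f"
  shows "(norm (l2_class f))\<^sup>2 = (\<integral>x. (norm (f x))\<^sup>2 \<partial>circle)"
  using assms by (simp add: power2_norm_eq_inner inner_l2.abs_eq l2_rel_def)

lemma nn_integral_norm_l2_class:
  assumes "square_integrable f"
  shows "(\<integral>\<^sup>+x. ennreal ((norm (f x))\<^sup>2) \<partial>circle) = ennreal ((norm (l2_class f))\<^sup>2)"
  using assms by (simp add: norm_l2_class nn_integral_eq_integral square_integrable_def)

lemma nn_integral_norm_le_l2:
  assumes f: "square_integrable f" and a: "norm (l2_class f) \<le> a" "a > 0"
  shows "(\<integral>\<^sup>+x. ennreal (norm (f x)) \<partial>circle) \<le> ennreal a"
proof -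
  have int: "integrable circle (\<lambda>x. (norm (f x))\<^sup>2 / (2 * a))"
    using f by (simp add: square_integrable_def)
  have "(\<integral>\<^sup>+x. ennreal (norm (f x)) \<partial>circle) \<le> (\<integral>\<^sup>+x. ennreal (a / 2 + (norm (f x))\<^sup>2 / (2 * a)) \<partial>circle)"
  proof (intro nn_integral_mono ennreal_leI)
    fix x
    have "2 * (norm (f x) * a) \<le> a\<^sup>2 + (norm (f x))\<^sup>2"
      using sum_squares_bound[of "norm (f x)" a] by simp
    then show "norm (f x) \<le> a / 2 + (norm (f x))\<^sup>2 / (2 * a)"
      using a by (simp add: field_simps power2_eq_square)
  qed
  also have "\<dots> = ennreal (\<integral>x. a / 2 + (norm (f x))\<^sup>2 / (2 * a) \<partial>circle)"
    using a int by (intro nn_integral_eq_integral) auto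
  also have "(\<integral>x. a / 2 + (norm (f x))\<^sup>2 / (2 * a) \<partial>circle) = a / 2 + (norm (l2_class f))\<^sup>2 / (2 * a)"
    using int by (simp add: norm_l2_class[OF f])
  also have "\<dots> \<le> a / 2 + a\<^sup>2 / (2 * a)"
    using a by (intro add_left_mono divide_right_mono power_mono) auto
  also have "\<dots> = a"
    using a by (simp add: power2_eq_square)
  finally show ?thesis using a by (simp add: ennreal_leI)
qed

instance l2 :: (finite) complete_space
proof
  fix X :: "nat \<Rightarrow> 'a l2" assume X: "Cauchy X"
  have "\<forall>k. \<exists>N. \<forall>m\<ge>N. \<forall>n\<ge>N. dist (X m) (X n) < (1/2)^k"
    using X by (auto simp: Cauchy_def)
  then obtain N where N: "\<And>k m n. m \<ge> N k \<Longrightarrow> n \<ge> N k \<Longrightarrow> dist (X m) (X n) < (1/2)^k"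
    by metis
  define r where "r k = (\<Sum>i\<le>k. N i) + k" for k
  have r_ge: "r j \<ge> N k" if "k \<le> j" for j k
    using member_le_sum[of k "{..j}" N] that by (simp add: r_def)
  have r_mono: "strict_mono r"
    by (rule strict_monoI_Suc) (simp add: r_def)
  define F where "F k = rep_l2 (X (r k))" for k
  have F: "square_integrable (F k)" and XF: "X (r k) = l2_class (F k)" for k
    using Quotient3_rep_reflp[OF Quotient3_l2, of "X (r k)"] Quotient3_abs_rep[OF Quotient3_l2, of "X (r k)"]
    by (simp_all add: l2_rel_def F_def)
  have F_meas [measurable]: "F k \<in> borel_measurable borel" for k
    using F by (simp add: square_integrable_def)
  define f where "f x = lim (\<lambda>k. F k x)" for x
  have f_meas [measurable]: "f \<in> borel_measurable borel"
    unfolding f_def by measurable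
  have FF: "norm (l2_class (\<lambda>x. F j x - F k x)) \<le> (1/2)^k" if "k \<le> j" for j k
    using N[of k "r j" "r k"] r_ge[of k j] r_ge[of k k] that
    by (simp add: XF dist_norm l2_class_minus F)
  have "(\<integral>\<^sup>+x. (\<Sum>k. ennreal (norm (F (Suc k) x - F k x))) \<partial>circle)
      = (\<Sum>k. \<integral>\<^sup>+x. ennreal (norm (F (Suc k) x - F k x)) \<partial>circle)"
    by (rule nn_integral_suminf) measurable
  also have "\<dots> \<le> (\<Sum>k. ennreal ((1/2)^k))"
    by (intro suminf_le nn_integral_norm_le_l2 square_integrable_diff F FF) auto
  also have "\<dots> = ennreal (\<Sum>k. (1/2)^k)"
    by (rule suminf_ennreal2) (auto intro: summable_geometric)
  finally have "(\<integral>\<^sup>+x. (\<Sum>k. ennreal (norm (F (Suc k) x - F k x))) \<partial>circle) \<noteq> \<infinity>"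
    by (auto simp: top_unique)
  then have "AE x in circle. (\<Sum>k. ennreal (norm (F (Suc k) x - F k x))) \<noteq> \<infinity>"
    by (intro nn_integral_noteq_infinite) measurable
  then have lim: "AE x in circle. (\<lambda>k. F k x) \<longlonglongrightarrow> f x"
  proof eventually_elim
    case (elim x)
    have "summable (\<lambda>k. norm (F (Suc k) x - F k x))"
      using elim by (intro summable_suminf_not_top) auto
    then have "summable (\<lambda>k. F (Suc k) x - F k x)"
      by (rule summable_norm_cancel)
    then have "convergent (\<lambda>n. (\<Sum>k<n. F (Suc k) x - F k x) + F 0 x)"
      by (intro convergent_add convergent_const) (simp add: summable_iff_convergent)
    then have "convergent (\<lambda>k. F k x)"
      by (simp only: sum_lessThan_telescope[of "\<lambda>k. F k x"] diff_add_cancel)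
    then show ?case by (simp add: f_def convergent_LIMSEQ_iff)
  qed
  have bound: "(\<integral>\<^sup>+x. ennreal ((norm (f x - F k x))\<^sup>2) \<partial>circle) \<le> ennreal (((1/2)^k)\<^sup>2)" for k
  proof -
    have "(\<integral>\<^sup>+x. ennreal ((norm (f x - F k x))\<^sup>2) \<partial>circle)
        = (\<integral>\<^sup>+x. liminf (\<lambda>j. ennreal ((norm (F j x - F k x))\<^sup>2)) \<partial>circle)"
    proof (rule nn_integral_cong_AE, use lim in eventually_elim)
      case (elim x)
      then have "(\<lambda>j. ennreal ((norm (F j x - F k x))\<^sup>2)) \<longlonglongrightarrow> ennreal ((norm (f x - F k x))\<^sup>2)"
        by (intro tendsto_intros)
      from lim_imp_Liminf[OF sequentially_bot this] show ?case by (rule sym)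
    qed
    also have "\<dots> \<le> liminf (\<lambda>j. \<integral>\<^sup>+x. ennreal ((norm (F j x - F k x))\<^sup>2) \<partial>circle)"
      by (rule nn_integral_liminf) measurable
    also have "\<dots> \<le> liminf (\<lambda>j. ennreal (((1/2)^k)\<^sup>2))"
    proof (rule Liminf_mono)
      show "\<forall>\<^sub>F j in sequentially. (\<integral>\<^sup>+x. ennreal ((norm (F j x - F k x))\<^sup>2) \<partial>circle) \<le> ennreal (((1/2)^k)\<^sup>2)"
        using eventually_ge_at_top[of k]
      proof eventually_elim
        case (elim j)
        then show ?case
          by (subst nn_integral_norm_l2_class) (auto intro!: ennreal_leI power_mono FF square_integrable_diff F)
      qed
    qed
    finally show ?thesis by (simp add: Liminf_const)
  qed
  have fF: "square_integrable (\<lambda>x. f x - F k x)" for k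
    unfolding square_integrable_def
  proof (intro conjI integrableI_bounded)
    show "(\<integral>\<^sup>+x. ennreal (norm ((norm (f x - F k x))\<^sup>2)) \<partial>circle) < \<infinity>"
      using bound[of k] by (auto intro: le_less_trans simp: ennreal_less_top)
  qed measurable
  have f: "square_integrable f"
    using square_integrable_add[OF fF[of 0] F[of 0]] by simp
  have "(\<lambda>k. X (r k)) \<longlonglongrightarrow> l2_class f"
  proof (rule metric_LIMSEQ_I)
    fix e :: real assume "e > 0"
    then obtain K where K: "(1/2)^K < e"
      using real_arch_pow_inv[of e "1/2"] by auto
    have "dist (X (r k)) (l2_class f) < e" if "k \<ge> K" for k
    proof -
      have "ennreal ((norm (l2_class (\<lambda>x. f x - F k x)))\<^sup>2) \<le> ennreal (((1/2)^k)\<^sup>2)"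
        using bound[of k] by (simp add: nn_integral_norm_l2_class fF)
      then have "norm (l2_class (\<lambda>x. f x - F k x)) \<le> (1/2)^k"
        by (simp add: power2_le_iff_abs_le)
      also have "(1/2::real)^k \<le> (1/2)^K"
        using that by (intro power_decreasing) auto
      finally show ?thesis
        using K by (subst dist_commute) (simp add: XF dist_norm l2_class_minus F f)
    qed
    then show "\<exists>K. \<forall>k\<ge>K. dist (X (r k)) (l2_class f) < e" by blast
  qed
  then show "convergent X"
    using Cauchy_converges_subseq[OF X r_mono] by (auto simp: convergent_def o_def)
qed

instance l2 :: (finite) banach ..

text \<open>The complex structure of the Hilbert space. The inner product is linear in the second argument;
  its real part is the real inner product from class \<^class>\<open>real_inner\<close>.\<close>

lift_definition cscale :: "complex \<Rightarrow> 'n::finite l2 \<Rightarrow> 'n l2" is "\<lambda>c f x. c *s f x"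
  by (auto simp: l2_rel_def square_integrable_scale)

lift_definition cinner :: "'n::finite l2 \<Rightarrow> 'n l2 \<Rightarrow> complex"
  is "\<lambda>f g. \<integral>x. (\<Sum>i\<in>UNIV. cnj (f x $ i) * g x $ i) \<partial>circle"
proof (rule integral_cong_AE)
  fix f f' g g' :: "real \<Rightarrow> complex^'n" assume *: "l2_rel f f'" "l2_rel g g'"
  then have [measurable]: "f \<in> borel_measurable borel" "f' \<in> borel_measurable borel"
      "g \<in> borel_measurable borel" "g' \<in> borel_measurable borel"
    by (auto simp: l2_rel_def)
  have [measurable]: "cnj \<in> borel_measurable borel"
    by (intro borel_measurable_continuous_onI continuous_intros)
  show "(\<lambda>x. \<Sum>i\<in>UNIV. cnj (f x $ i) * g x $ i) \<in> borel_measurable circle"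
    "(\<lambda>x. \<Sum>i\<in>UNIV. cnj (f' x $ i) * g' x $ i) \<in> borel_measurable circle"
    by measurable
  show "AE x in circle. (\<Sum>i\<in>UNIV. cnj (f x $ i) * g x $ i) = (\<Sum>i\<in>UNIV. cnj (f' x $ i) * g' x $ i)"
    using * by (auto simp: l2_rel_def)
qed

lemma cscale_add: "cscale c (u + v) = cscale c u + cscale c v"
  by transfer (simp add: l2_rel_def square_integrable_add square_integrable_scale vector_add_ldistrib)

lemma cscale_scaleR: "cscale c (r *\<^sub>R u) = r *\<^sub>R cscale c u"
  by transfer (simp add: l2_rel_def square_integrable_scaleR square_integrable_scale vec_eq_iff)

lemma cscale_zero: "cscale c 0 = 0"
  using cscale_scaleR[of c 0 0] by simp

lemma cscale_uminus: "cscale c (- u) = - cscale c u"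
  using cscale_scaleR[of c "-1" u] by simp

lemma cscale_diff: "cscale c (u - v) = cscale c u - cscale c v"
  using cscale_add[of c u "- v"] by (simp add: cscale_uminus)

lemma norm_cscale: "norm (cscale c u) = cmod c * norm u"
proof (rule l2_rep[of u])
  fix f assume f: "square_integrable f" "u = l2_class f"
  have "(norm (cscale c u))\<^sup>2 = (cmod c * norm u)\<^sup>2"
    using f by (simp add: cscale.abs_eq l2_rel_def norm_l2_class square_integrable_scale
        norm_vector_scalar_mult power_mult_distrib)
  then show ?thesis by (simp add: power2_eq_iff_nonneg)
qed

lemma continuous_cscale: "continuous_on UNIV (cscale c)"
proof -
  have "bounded_linear (cscale c)"
    by (rule bounded_linear_intro[where K="cmod c"]) (simp_all add: cscale_add cscale_scaleR norm_cscale)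
  then show ?thesis by (rule linear_continuous_on)
qed

text \<open>The function \<open>x \<mapsto> v e\<^sup>i\<^sup>k\<^sup>x\<close>.\<close>

definition wave :: "complex^'n \<Rightarrow> int \<Rightarrow> 'n::finite l2" where
  "wave v k = l2_class (\<lambda>x. cis (real_of_int k * x) *s v)"

lemma square_integrable_wave: "square_integrable (\<lambda>x. cis (real_of_int k * x) *s v)"
proof (rule square_integrable_bound[where g="\<lambda>_. v" and c=1])
  show "(\<lambda>x. cis (real_of_int k * x) *s v) \<in> borel_measurable borel"
    by (intro measurable_vecI borel_measurable_continuous_onI) (auto intro!: continuous_intros simp: cis_conv_exp)
qed (auto simp: norm_vector_scalar_mult square_integrable_def)

lemma norm_wave: "norm (wave v k) = norm v"
  unfolding wave_def
  using norm_l2_class[OF square_integrable_wave, of k v]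
  by (simp add: norm_vector_scalar_mult power2_eq_iff_nonneg)

lemma norm_matrix_vector_mult_le:
  fixes A :: "complex^'n^'n"
  shows "norm (A *v v) \<le> real CARD('n) * real CARD('n) * norm A * norm v"
proof -
  have "norm (A *v v) \<le> (\<Sum>i\<in>UNIV. norm ((A *v v) $ i))"
    by (simp add: norm_vec_def L2_set_le_sum)
  also have "\<dots> \<le> (\<Sum>i\<in>(UNIV::'n set). \<Sum>j\<in>(UNIV::'n set). norm A * norm v)"
  proof (rule sum_mono)
    fix i
    have "norm ((A *v v) $ i) \<le> (\<Sum>j\<in>UNIV. norm (A $ i $ j * v $ j))"
      by (simp add: matrix_vector_mult_def norm_sum)
    also have "\<dots> \<le> (\<Sum>j\<in>(UNIV::'n set). norm A * norm v)"
    proof (rule sum_mono)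
      fix j
      have "norm (A $ i $ j) \<le> norm A"
        using Finite_Cartesian_Product.norm_nth_le[of A i] Finite_Cartesian_Product.norm_nth_le[of "A $ i" j] by linarith
      then show "norm (A $ i $ j * v $ j) \<le> norm A * norm v"
        by (simp add: norm_mult mult_mono Finite_Cartesian_Product.norm_nth_le)
    qed
    finally show "norm ((A *v v) $ i) \<le> (\<Sum>j\<in>(UNIV::'n set). norm A * norm v)" .
  qed
  finally show ?thesis by (simp add: mult.assoc)
qed

definition bdd_symbol :: "(real \<Rightarrow> complex^'n^'n) \<Rightarrow> bool" where
  "bdd_symbol X \<longleftrightarrow> bounded (range X) \<and> (\<forall>i j. (\<lambda>x. X x $ i $ j) \<in> borel_measurable borel)"

lemma bdd_symbol_bound:
  fixes X :: "real \<Rightarrow> complex^'n^'n"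
  assumes "bdd_symbol X"
  obtains K where "K \<ge> 0" "\<And>x v. norm (X x *v v) \<le> K * norm v"
proof -
  obtain K where K: "\<And>x. norm (X x) \<le> K"
    using assms by (auto simp: bdd_symbol_def bounded_iff)
  have "K \<ge> 0" using K[of 0] norm_ge_zero[of "X 0"] by linarith
  show thesis
  proof (rule that[of "real CARD('n) * real CARD('n) * K"])
    show "norm (X x *v v) \<le> real CARD('n) * real CARD('n) * K * norm v" for x v
      by (rule order_trans[OF norm_matrix_vector_mult_le])
        (intro mult_right_mono mult_left_mono K; simp)
  qed (use \<open>K \<ge> 0\<close> in simp)
qed

lemma square_integrable_mult:
  assumes X: "bdd_symbol X" and f: "square_integrable f"
  shows "square_integrable (\<lambda>x. X x *v f x)"
proof (rule bdd_symbol_bound[OF X])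
  fix K assume K: "\<And>x v. norm (X x *v v) \<le> K * norm v"
  have [measurable]: "f \<in> borel_measurable borel" "\<And>i j. (\<lambda>x. X x $ i $ j) \<in> borel_measurable borel"
    using X f by (auto simp: bdd_symbol_def)
  show ?thesis
    by (rule square_integrable_bound[OF f _ K], rule measurable_vecI)
      (simp add: matrix_vector_mult_def)
qed

text \<open>Pointwise multiplication by a bounded measurable matrix-valued function, and 0 for other functions, so
  that it is total.\<close>

lift_definition mult_l2 :: "(real \<Rightarrow> complex^'n^'n) \<Rightarrow> 'n::finite l2 \<Rightarrow> 'n l2"
  is "\<lambda>X f x. if bdd_symbol X then X x *v f x else 0"
proof -
  fix X and f g :: "real \<Rightarrow> complex^'n" assume "l2_rel f g"
  then show "l2_rel (\<lambda>x. if bdd_symbol X then X x *v f x else 0) (\<lambda>x. if bdd_symbol X then X x *v g x else 0)"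
    by (cases "bdd_symbol X") (auto simp: l2_rel_def square_integrable_mult square_integrable_zero)
qed

lemma mult_l2_class:
  "bdd_symbol X \<Longrightarrow> square_integrable f \<Longrightarrow> mult_l2 X (l2_class f) = l2_class (\<lambda>x. X x *v f x)"
  by (simp add: mult_l2.abs_eq l2_rel_def)

lemma mult_l2_trivial: "\<not> bdd_symbol X \<Longrightarrow> mult_l2 X u = 0"
  by transfer (simp add: l2_rel_def square_integrable_zero)

lemma bounded_linear_mult_l2: "bounded_linear (mult_l2 X)"
proof (cases "bdd_symbol X")
  case True
  then obtain K where K: "K \<ge> 0" "\<And>x v. norm (X x *v v) \<le> K * norm v"
    using bdd_symbol_bound by blast
  show ?thesis
  proof (rule bounded_linear_intro[where K=K])
    show "mult_l2 X (u + v) = mult_l2 X u + mult_l2 X v" for u v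
      by (rule l2_rep[of u], rule l2_rep[of v])
        (simp add: True mult_l2_class plus_l2.abs_eq l2_rel_def square_integrable_mult
          square_integrable_add matrix_vector_right_distrib)
    have "X x *v (r *\<^sub>R v) = r *\<^sub>R (X x *v v)" for x r and v :: "complex^'a"
      by (simp add: matrix_vector_mult_def vec_eq_iff scaleR_sum_right)
    then show "mult_l2 X (r *\<^sub>R u) = r *\<^sub>R mult_l2 X u" for r u
      by - (rule l2_rep[of u],
        simp add: True mult_l2_class scaleR_l2.abs_eq l2_rel_def square_integrable_mult
          square_integrable_scaleR)
    show "norm (mult_l2 X u) \<le> norm u * K" for u
    proof (rule l2_rep[of u])
      fix f assume f: "square_integrable f" "u = l2_class f"
      have "(norm (mult_l2 X u))\<^sup>2 = (\<integral>x. (norm (X x *v f x))\<^sup>2 \<partial>circle)"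
        using f True by (simp add: mult_l2_class norm_l2_class square_integrable_mult)
      also have "\<dots> \<le> (\<integral>x. K\<^sup>2 * (norm (f x))\<^sup>2 \<partial>circle)"
      proof (rule integral_mono)
        show "integrable circle (\<lambda>x. (norm (X x *v f x))\<^sup>2)"
          using square_integrable_mult[OF True f(1)] by (simp add: square_integrable_def)
        show "integrable circle (\<lambda>x. K\<^sup>2 * (norm (f x))\<^sup>2)"
          using f by (simp add: square_integrable_def)
        show "(norm (X x *v f x))\<^sup>2 \<le> K\<^sup>2 * (norm (f x))\<^sup>2" for x
          using power_mono[OF K(2), of x "f x" 2] by (simp add: power_mult_distrib)
      qed
      also have "\<dots> = (norm u * K)\<^sup>2"
        using f by (simp add: norm_l2_class power_mult_distrib)
      finally show ?thesis
        using K(1) by (simp add: power2_le_iff_abs_le)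
    qed
  qed
next
  case False
  then have "mult_l2 X = (\<lambda>_. 0)" by (simp add: fun_eq_iff mult_l2_trivial)
  then show ?thesis by simp
qed

lemma mult_l2_cscale: "mult_l2 X (cscale c u) = cscale c (mult_l2 X u)"
proof (cases "bdd_symbol X")
  case True
  then show ?thesis
    by - (rule l2_rep[of u],
        simp add: mult_l2_class cscale.abs_eq l2_rel_def square_integrable_mult
          square_integrable_scale vector_scalar_commute)
qed (simp add: mult_l2_trivial cscale_zero)

lifting_forget l2.lifting

section \<open>The algebra of bounded operators\<close>

typedef 'n bop = "{T :: 'n::finite l2 \<Rightarrow>\<^sub>L 'n l2. \<forall>c u. T (cscale c u) = cscale c (T u)}"
  by (rule exI[of _ 0]) (simp add: cscale_zero)

setup_lifting type_definition_bop

lift_definition app :: "'n::finite bop \<Rightarrow> 'n l2 \<Rightarrow> 'n l2" is blinfun_apply .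

instantiation bop :: (finite) real_normed_algebra_1
begin

lift_definition zero_bop :: "'a bop" is 0
  by (simp add: cscale_zero)
lift_definition one_bop :: "'a bop" is id_blinfun
  by simp
lift_definition plus_bop :: "'a bop \<Rightarrow> 'a bop \<Rightarrow> 'a bop" is "(+)"
  by (simp add: blinfun.add_left cscale_add)
lift_definition minus_bop :: "'a bop \<Rightarrow> 'a bop \<Rightarrow> 'a bop" is "(-)"
  by (simp add: blinfun.diff_left cscale_diff)
lift_definition uminus_bop :: "'a bop \<Rightarrow> 'a bop" is uminus
  by (simp add: blinfun.minus_left cscale_uminus)
lift_definition scaleR_bop :: "real \<Rightarrow> 'a bop \<Rightarrow> 'a bop" is "(*\<^sub>R)"
  by (simp add: blinfun.scaleR_left cscale_scaleR)
lift_definition times_bop :: "'a bop \<Rightarrow> 'a bop \<Rightarrow> 'a bop" is "(o\<^sub>L)"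
  by simp
lift_definition norm_bop :: "'a bop \<Rightarrow> real" is norm .

definition sgn_bop :: "'a bop \<Rightarrow> 'a bop" where "sgn_bop T = scaleR (inverse (norm T)) T"
definition dist_bop :: "'a bop \<Rightarrow> 'a bop \<Rightarrow> real" where "dist_bop S T = norm (S - T)"
definition uniformity_bop :: "('a bop \<times> 'a bop) filter" where
  "uniformity_bop = (INF e\<in>{0<..}. principal {(S, T). dist S T < e})"
definition open_bop :: "'a bop set \<Rightarrow> bool" where
  "open_bop U \<longleftrightarrow> (\<forall>S\<in>U. \<forall>\<^sub>F (S', T) in uniformity. S' = S \<longrightarrow> T \<in> U)"

instance
proof
  fix A B C :: "'a bop" and r s :: real and U :: "'a bop set"
  show "A + B + C = A + (B + C)" by transfer (rule add.assoc)
  show "A + B = B + A" by transfer (rule add.commute)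
  show "0 + A = A" by transfer simp
  show "- A + A = 0" by transfer simp
  show "A - B = A + - B" by transfer simp
  show "r *\<^sub>R (A + B) = r *\<^sub>R A + r *\<^sub>R B" by transfer (rule scaleR_add_right)
  show "(r + s) *\<^sub>R A = r *\<^sub>R A + s *\<^sub>R A" by transfer (rule scaleR_add_left)
  show "r *\<^sub>R s *\<^sub>R A = (r * s) *\<^sub>R A" by transfer simp
  show "1 *\<^sub>R A = A" by transfer simp
  show "A * B * C = A * (B * C)" by transfer (simp add: blinfun_eqI)
  show "(A + B) * C = A * C + B * C" by transfer (simp add: blinfun_eqI blinfun.add_left)
  show "A * (B + C) = A * B + A * C"
    by transfer (simp add: blinfun_eqI blinfun.add_left blinfun.add_right)
  show "r *\<^sub>R A * B = r *\<^sub>R (A * B)" by transfer (simp add: blinfun_eqI blinfun.scaleR_left)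
  show "A * r *\<^sub>R B = r *\<^sub>R (A * B)"
    by transfer (simp add: blinfun_eqI blinfun.scaleR_left blinfun.scaleR_right)
  show "1 * A = A" by transfer (simp add: blinfun_eqI)
  show "A * 1 = A" by transfer (simp add: blinfun_eqI)
  have "norm (1 :: 'a bop) = 1"
  proof transfer
    let ?I = "id_blinfun :: 'a l2 \<Rightarrow>\<^sub>L 'a l2"
    have "norm ?I \<le> 1" by (rule norm_blinfun_bound) simp_all
    moreover have "1 \<le> norm ?I"
      using norm_blinfun[of ?I "wave (axis undefined 1) 0"] by (simp add: norm_wave)
    ultimately show "norm ?I = 1" by simp
  qed
  then show "norm (1 :: 'a bop) = 1" .
  have "norm (0 :: 'a bop) = 0" by transfer simp
  with \<open>norm (1 :: 'a bop) = 1\<close> show "(0 :: 'a bop) \<noteq> 1" by force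
  show "sgn A = scaleR (inverse (norm A)) A" by (rule sgn_bop_def)
  show "dist A B = norm (A - B)" by (rule dist_bop_def)
  show "uniformity = (INF e\<in>{0<..}. principal {(S, T). dist (S::'a bop) T < e})"
    by (rule uniformity_bop_def)
  show "open U \<longleftrightarrow> (\<forall>S\<in>U. \<forall>\<^sub>F (S', T) in uniformity. S' = S \<longrightarrow> T \<in> U)"
    by (rule open_bop_def)
  show "norm A = 0 \<longleftrightarrow> A = 0" by transfer simp
  show "norm (A + B) \<le> norm A + norm B" by transfer (rule norm_triangle_ineq)
  show "norm (r *\<^sub>R A) = \<bar>r\<bar> * norm A" by transfer simp
  show "norm (A * B) \<le> norm A * norm B" by transfer (rule norm_blinfun_compose)
qed

end

lemma app_add: "app (S + T) u = app S u + app T u"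
  by transfer (simp add: blinfun.add_left)

lemma app_diff: "app (S - T) u = app S u - app T u"
  by transfer (simp add: blinfun.diff_left)

lemma app_times: "app (S * T) u = app S (app T u)"
  by transfer simp

lemma app_one: "app 1 u = u"
  by transfer simp

lemma app_scaleR: "app (r *\<^sub>R T) u = r *\<^sub>R app T u"
  by transfer (simp add: blinfun.scaleR_left)

lemma app_cscale: "app T (cscale c u) = cscale c (app T u)"
  by transfer simp

lemma bounded_linear_app: "bounded_linear (app T)"
  by transfer (rule blinfun.bounded_linear_right)

lemma norm_app: "norm (app T u) \<le> norm T * norm u"
  by transfer (rule norm_blinfun)

lemma bop_eqI: "(\<And>u. app S u = app T u) \<Longrightarrow> S = T"
  by transfer (rule blinfun_eqI)

instance bop :: (finite) complete_space
proof
  fix X :: "nat \<Rightarrow> 'a bop" assume X: "Cauchy X"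
  have dist: "dist (Rep_bop S) (Rep_bop T) = dist S T" for S T :: "'a bop"
    by (simp add: dist_norm norm_bop.rep_eq minus_bop.rep_eq)
  have "Cauchy (\<lambda>n. Rep_bop (X n))"
    using X by (simp add: Cauchy_def dist)
  then obtain L where L: "(\<lambda>n. Rep_bop (X n)) \<longlonglongrightarrow> L"
    using Cauchy_convergent convergentD by blast
  have "L (cscale c u) = cscale c (L u)" for c u
  proof (rule LIMSEQ_unique)
    show "(\<lambda>n. Rep_bop (X n) (cscale c u)) \<longlonglongrightarrow> L (cscale c u)"
      by (intro tendsto_intros L)
    have "(\<lambda>n. cscale c (Rep_bop (X n) u)) \<longlonglongrightarrow> cscale c (L u)"
      using continuous_cscale[of c]
      by (rule continuous_on_tendsto_compose) (auto intro!: tendsto_intros L)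
    also have "(\<lambda>n. cscale c (Rep_bop (X n) u)) = (\<lambda>n. Rep_bop (X n) (cscale c u))"
    proof
      show "cscale c (Rep_bop (X n) u) = Rep_bop (X n) (cscale c u)" for n
        using Rep_bop[of "X n"] by simp
    qed
    finally show "(\<lambda>n. Rep_bop (X n) (cscale c u)) \<longlonglongrightarrow> cscale c (L u)" .
  qed
  then have "Rep_bop (Abs_bop L) = L"
    by (simp add: Abs_bop_inverse)
  then have "X \<longlonglongrightarrow> Abs_bop L"
    using L by (simp add: lim_sequentially flip: dist)
  then show "convergent X" by (auto simp: convergent_def)
qed

instance bop :: (finite) banach ..

lift_definition mult_op :: "(real \<Rightarrow> complex^'n^'n) \<Rightarrow> 'n::finite bop" is "\<lambda>X. Blinfun (mult_l2 X)"
  by (simp add: bounded_linear_Blinfun_apply bounded_linear_mult_l2 mult_l2_cscale)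

lemma app_mult_op: "app (mult_op X) u = mult_l2 X u"
  by transfer (simp add: bounded_linear_Blinfun_apply bounded_linear_mult_l2)

definition cscale_op :: "complex \<Rightarrow> 'n::finite bop \<Rightarrow> 'n bop" where
  "cscale_op c T = mult_op (\<lambda>_. mat c) * T"

lemma app_cscale_op: "app (cscale_op c T) u = cscale c (app T u)"
proof (rule l2_rep[of "app T u"])
  fix f assume f: "square_integrable f" "app T u = l2_class f"
  have "bdd_symbol (\<lambda>_. mat c :: complex^'a^'a)"
    by (simp add: bdd_symbol_def)
  moreover have "mat c *v v = c *s v" for v :: "complex^'a"
    by (simp add: vec_eq_iff matrix_vector_mult_def mat_def if_distrib[of "\<lambda>t. t * _"] cong: if_cong)
  ultimately show ?thesis
    using f by (simp add: cscale_op_def app_times app_mult_op mult_l2_class cscale.abs_eq l2_rel_def)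
qed

definition commutator :: "'a::ring \<Rightarrow> 'a \<Rightarrow> 'a" where
  "commutator S T = S * T - T * S"

text \<open>The polarisation: \<open>+1\<close> on nonnegative and \<open>-1\<close> on negative Fourier modes. It exists and is unique
  because the trigonometric polynomials are dense.\<close>

definition pol :: "'n::finite bop" where
  "pol = (THE E. \<forall>v. \<forall>k::int. app E (wave v k) = (if k \<ge> 0 then wave v k else - wave v k))"

section \<open>Traces and Schatten ideals\<close>

text \<open>The diagonal matrix elements in the orthonormal Fourier basis \<open>e\<^sub>i e\<^sup>i\<^sup>k\<^sup>x\<close>. For positive operators
  and for trace class operators the trace does not depend on the orthonormal basis.\<close>

definition diag_entry :: "'n::finite bop \<Rightarrow> int \<times> 'n \<Rightarrow> complex" where
  "diag_entry T = (\<lambda>(k, i). cinner (wave (axis i 1) k) (app T (wave (axis i 1) k)))"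

definition trace_op :: "'n::finite bop \<Rightarrow> complex" where
  "trace_op T = infsum (diag_entry T) UNIV"

definition cond_trace :: "'n::finite bop \<Rightarrow> complex" where
  "cond_trace T = trace_op (T + pol * T * pol) / 2"

definition adj :: "'n::finite bop \<Rightarrow> 'n bop" where
  "adj T = (THE S. \<forall>u v. cinner (app S u) v = cinner u (app T v))"

definition poly_op :: "real poly \<Rightarrow> 'n::finite bop \<Rightarrow> 'n bop" where
  "poly_op P A = (\<Sum>i\<le>degree P. coeff P i *\<^sub>R A ^ i)"

text \<open>Continuous functional calculus \<open>f(A)\<close> of a positive operator \<open>A\<close>, whose spectrum lies in
  \<open>[0, \<parallel>A\<parallel>]\<close>: the norm limit of \<open>P\<^sub>n(A)\<close> for polynomials \<open>P\<^sub>n\<close> that converge to \<open>f\<close> uniformly on \<open>[0, \<parallel>A\<parallel>]\<close>.\<close>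

definition fun_calc :: "(real \<Rightarrow> real) \<Rightarrow> 'n::finite bop \<Rightarrow> 'n bop" where
  "fun_calc f A = (THE C. \<exists>P. uniform_limit {0..norm A} (\<lambda>n. poly (P n)) f sequentially \<and>
                              (\<lambda>n. poly_op (P n) A) \<longlonglongrightarrow> C)"

text \<open>\<open>|T|\<^sup>r = (T\<^sup>* T)\<^bsup>r/2\<^esup>\<close>\<close>

definition abs_powr :: "'n::finite bop \<Rightarrow> real \<Rightarrow> 'n bop" where
  "abs_powr T r = fun_calc (\<lambda>x. x powr (r / 2)) (adj T * T)"

definition schatten :: "real \<Rightarrow> 'n::finite bop set" where
  "schatten r = {T. diag_entry (abs_powr T r) summable_on UNIV}"

definition schatten_norm :: "real \<Rightarrow> 'n::finite bop \<Rightarrow> real" where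
  "schatten_norm r T = (Re (trace_op (abs_powr T r))) powr (1 / r)"

section \<open>The groups, Lie algebras and flat connections\<close>

definition GL_res :: "real \<Rightarrow> 'n::finite bop set" where
  "GL_res p = {A. (\<exists>A'. A' * A = 1 \<and> A * A' = 1) \<and> commutator pol A \<in> schatten (2 * p)}"

definition gl_res :: "real \<Rightarrow> 'n::finite bop set" where
  "gl_res p = {X. commutator pol X \<in> schatten (2 * p)}"

definition flat_conn :: "real \<Rightarrow> 'n::finite bop set" where
  "flat_conn p = {g' * commutator pol g | g g'. g \<in> GL_res p \<and> g' * g = 1 \<and> g * g' = 1}"

section \<open>Cochains\<close>

text \<open>Cochains take their values in complex functions on \<open>flat_conn p\<close>; these and the cochains themselves
  are represented by total functions, of which only the values on \<open>flat_conn p\<close> and \<open>gl_res p\<close> matter.\<close>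

definition lie_deriv :: "'n::finite bop \<Rightarrow> ('n bop \<Rightarrow> complex) \<Rightarrow> 'n bop \<Rightarrow> complex" where
  "lie_deriv X f B =
    vector_derivative (\<lambda>t. f (exp (- (t *\<^sub>R X)) * (pol + B) * exp (t *\<^sub>R X) - pol)) (at 0)"

text \<open>Frechet differentiability on \<open>flat_conn p\<close> as a subset of the Banach space \<open>L\<^bsub>2p\<^esub>\<close>. The derivative is
  complex linear, so that \<open>lie_deriv X f\<close> depends complex linearly on \<open>X\<close> and the coboundary of a
  complex multilinear cochain is complex multilinear.\<close>

definition schatten_functional :: "real \<Rightarrow> ('n::finite bop \<Rightarrow> complex) \<Rightarrow> bool" where
  "schatten_functional r D \<longleftrightarrow>
     (\<forall>S\<in>schatten r. \<forall>T\<in>schatten r. D (S + T) = D S + D T) \<and>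
     (\<forall>c. \<forall>T\<in>schatten r. D (cscale_op c T) = c * D T) \<and>
     (\<exists>K. \<forall>T\<in>schatten r. cmod (D T) \<le> K * schatten_norm r T)"

definition differentiable_flat :: "real \<Rightarrow> ('n::finite bop \<Rightarrow> complex) \<Rightarrow> bool" where
  "differentiable_flat p f \<longleftrightarrow>
     (\<forall>B\<in>flat_conn p. \<exists>D. schatten_functional (2 * p) D \<and>
        (\<forall>e>0. \<exists>d>0. \<forall>B'\<in>flat_conn p. schatten_norm (2 * p) (B' - B) < d \<longrightarrow>
           cmod (f B' - f B - D (B' - B)) \<le> e * schatten_norm (2 * p) (B' - B)))"

definition gl_linear :: "real \<Rightarrow> ('n::finite bop \<Rightarrow> complex) \<Rightarrow> bool" where
  "gl_linear p \<phi> \<longleftrightarrow>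
     (\<forall>X\<in>gl_res p. \<forall>Y\<in>gl_res p. \<phi> (X + Y) = \<phi> X + \<phi> Y) \<and>
     (\<forall>c. \<forall>X\<in>gl_res p. \<phi> (cscale_op c X) = c * \<phi> X)"

definition cochain1 :: "real \<Rightarrow> ('n::finite bop \<Rightarrow> 'n bop \<Rightarrow> complex) \<Rightarrow> bool" where
  "cochain1 p \<eta> \<longleftrightarrow>
     (\<forall>X\<in>gl_res p. differentiable_flat p (\<eta> X)) \<and>
     (\<forall>B\<in>flat_conn p. gl_linear p (\<lambda>X. \<eta> X B))"

definition cochain2 :: "real \<Rightarrow> ('n::finite bop \<Rightarrow> 'n bop \<Rightarrow> 'n bop \<Rightarrow> complex) \<Rightarrow> bool" where
  "cochain2 p \<omega> \<longleftrightarrow>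
     (\<forall>X\<in>gl_res p. \<forall>Y\<in>gl_res p. differentiable_flat p (\<omega> X Y)) \<and>
     (\<forall>B\<in>flat_conn p. \<forall>Z\<in>gl_res p. gl_linear p (\<lambda>X. \<omega> X Z B) \<and> gl_linear p (\<lambda>X. \<omega> Z X B)) \<and>
     (\<forall>B\<in>flat_conn p. \<forall>X\<in>gl_res p. \<omega> X X B = 0)"

definition coboundary1 ::
  "('n::finite bop \<Rightarrow> 'n bop \<Rightarrow> complex) \<Rightarrow> 'n bop \<Rightarrow> 'n bop \<Rightarrow> 'n bop \<Rightarrow> complex" where
  "coboundary1 \<eta> X Y B =
     lie_deriv X (\<eta> Y) B - lie_deriv Y (\<eta> X) B - \<eta> (commutator X Y) B"

definition coboundary2 ::
  "('n::finite bop \<Rightarrow> 'n bop \<Rightarrow> 'n bop \<Rightarrow> complex) \<Rightarrow> 'n bop \<Rightarrow> 'n bop \<Rightarrow> 'n bop \<Rightarrow> 'n bop \<Rightarrow> complex"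
  where
  "coboundary2 \<omega> X Y Z B =
     lie_deriv X (\<omega> Y Z) B - lie_deriv Y (\<omega> X Z) B + lie_deriv Z (\<omega> X Y) B
     - \<omega> (commutator X Y) Z B + \<omega> (commutator X Z) Y B - \<omega> (commutator Y Z) X B"

definition cocycle2 :: "real \<Rightarrow> ('n::finite bop \<Rightarrow> 'n bop \<Rightarrow> 'n bop \<Rightarrow> complex) \<Rightarrow> bool" where
  "cocycle2 p \<omega> \<longleftrightarrow> cochain2 p \<omega> \<and>
     (\<forall>X\<in>gl_res p. \<forall>Y\<in>gl_res p. \<forall>Z\<in>gl_res p. \<forall>B\<in>flat_conn p. coboundary2 \<omega> X Y Z B = 0)"

definition cohomologous2 :: "real \<Rightarrow> ('n::finite bop \<Rightarrow> 'n bop \<Rightarrow> 'n bop \<Rightarrow> complex) \<Rightarrow>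
    ('n bop \<Rightarrow> 'n bop \<Rightarrow> 'n bop \<Rightarrow> complex) \<Rightarrow> bool" where
  "cohomologous2 p \<omega> \<omega>' \<longleftrightarrow> (\<exists>\<eta>. cochain1 p \<eta> \<and>
     (\<forall>X\<in>gl_res p. \<forall>Y\<in>gl_res p. \<forall>B\<in>flat_conn p. \<omega>' X Y B = \<omega> X Y B + coboundary1 \<eta> X Y B))"

definition c_tilde :: "nat \<Rightarrow> 'n::finite bop \<Rightarrow> 'n bop \<Rightarrow> 'n bop \<Rightarrow> complex" where
  "c_tilde p X Y B = 2 ^ (2 * p) * cond_trace (\<Sum>k\<le>p. (-1) ^ k *
     (B ^ (2 * p + 1 - k) * X * B ^ k * Y - B ^ (2 * p + 1 - k) * Y * B ^ k * X))"

section \<open>Compact semisimple Lie groups and loop algebras\<close>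

text \<open>A Lie group is a Hausdorff topological group that is locally homeomorphic to a Euclidean space: by
  the solution of Hilbert's fifth problem such a group carries exactly one compatible smooth
  structure, and continuous homomorphisms are smooth.\<close>

definition lie_group :: "('g, 'b) monoid_scheme \<Rightarrow> 'g topology \<Rightarrow> bool" where
  "lie_group G T \<longleftrightarrow> group G \<and> topspace T = carrier G \<and>
     continuous_map (prod_topology T T) T (\<lambda>(x, y). x \<otimes>\<^bsub>G\<^esub> y) \<and>
     continuous_map T T (\<lambda>x. inv\<^bsub>G\<^esub> x) \<and> Hausdorff_space T \<and>
     (\<exists>d. \<forall>x\<in>carrier G. \<exists>U W. openin T U \<and> x \<in> U \<and> openin (Euclidean_space d) W \<and>
        subtopology T U homeomorphic_space subtopology (Euclidean_space d) W)"

definition faithful_rep :: "('g, 'b) monoid_scheme \<Rightarrow> 'g topology \<Rightarrow> ('g \<Rightarrow> complex^'n^'n) \<Rightarrow> bool" where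
  "faithful_rep G T \<rho> \<longleftrightarrow> (\<forall>x\<in>carrier G. invertible (\<rho> x)) \<and>
     (\<forall>x\<in>carrier G. \<forall>y\<in>carrier G. \<rho> (x \<otimes>\<^bsub>G\<^esub> y) = \<rho> x ** \<rho> y) \<and>
     continuous_map T euclidean \<rho> \<and> inj_on \<rho> (carrier G)"

text \<open>The image of the Lie algebra of \<open>G\<close> under the derivative of \<open>\<rho>\<close>: the elements of the Lie algebra
  correspond to the one-parameter subgroups \<open>\<gamma>\<close> of \<open>G\<close>. For faithful \<open>\<rho>\<close> the derivative is injective,
  so this is the Lie algebra of \<open>G\<close>, acting on \<open>\<complex>\<^sup>n\<close>.\<close>

definition lie_algebra ::
  "('g, 'b) monoid_scheme \<Rightarrow> 'g topology \<Rightarrow> ('g \<Rightarrow> complex^'n^'n) \<Rightarrow> (complex^'n^'n) set" where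
  "lie_algebra G T \<rho> = {A. \<exists>\<gamma>. continuous_map euclideanreal T \<gamma> \<and>
     (\<forall>s t. \<gamma> (s + t) = \<gamma> s \<otimes>\<^bsub>G\<^esub> \<gamma> t) \<and>
     ((\<lambda>t. \<rho> (\<gamma> t)) has_vector_derivative A) (at 0)}"

definition mat_bracket :: "complex^'n^'n \<Rightarrow> complex^'n^'n \<Rightarrow> complex^'n^'n" where
  "mat_bracket A B = A ** B - B ** A"

definition lie_ideal :: "(complex^'n^'n) set \<Rightarrow> (complex^'n^'n) set \<Rightarrow> bool" where
  "lie_ideal I \<gg> \<longleftrightarrow> subspace I \<and> I \<subseteq> \<gg> \<and> (\<forall>A\<in>\<gg>. \<forall>B\<in>I. mat_bracket A B \<in> I)"

primrec derived_series :: "(complex^'n^'n) set \<Rightarrow> nat \<Rightarrow> (complex^'n^'n) set" where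
  "derived_series I 0 = I"
| "derived_series I (Suc m) =
     span {mat_bracket A B | A B. A \<in> derived_series I m \<and> B \<in> derived_series I m}"

definition semisimple :: "(complex^'n^'n) set \<Rightarrow> bool" where
  "semisimple \<gg> \<longleftrightarrow> (\<forall>I. lie_ideal I \<gg> \<and> (\<exists>m. derived_series I m = {0}) \<longrightarrow> I = {0})"

definition complexification :: "(complex^'n^'n) set \<Rightarrow> (complex^'n^'n) set" where
  "complexification \<gg> = {A + mat \<i> ** B | A B. A \<in> \<gg> \<and> B \<in> \<gg>}"

definition fourier_coeff :: "(real \<Rightarrow> complex^'n^'n) \<Rightarrow> int \<Rightarrow> complex^'n^'n" where
  "fourier_coeff X k = (\<chi> i j. \<integral>x. cis (- (real_of_int k * x)) * X x $ i $ j \<partial>circle)"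

text \<open>Loops in the complexification of \<open>\<gg>\<close>, as \<open>2\<pi>\<close>-periodic functions.\<close>

definition loop_algebra :: "(complex^'n^'n) set \<Rightarrow> real \<Rightarrow> (real \<Rightarrow> complex^'n::finite^'n) set" where
  "loop_algebra \<gg> q = {X. continuous_on UNIV X \<and> (\<forall>x. X (x + 2 * pi) = X x) \<and>
     (\<forall>x. X x \<in> complexification \<gg>) \<and> mult_op X \<in> gl_res (max (1/2) (1 / (2 * q)))}"

definition loop_algebra_minus :: "(complex^'n^'n) set \<Rightarrow> real \<Rightarrow> (real \<Rightarrow> complex^'n::finite^'n) set" where
  "loop_algebra_minus \<gg> q = {X \<in> loop_algebra \<gg> q. \<forall>k\<ge>0. fourier_coeff X k = 0}"

definition loop_algebra_plus :: "(complex^'n^'n) set \<Rightarrow> real \<Rightarrow> (real \<Rightarrow> complex^'n::finite^'n) set" where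
  "loop_algebra_plus \<gg> q = {X \<in> loop_algebra \<gg> q. \<forall>k<0. fourier_coeff X k = 0}"

end

theory Submission
  imports Defs
begin

text \<open>
  Put \<open>F = \<epsilon> + B\<close>, so that \<open>F\<^sup>2 = 1\<close>, and take \<open>c = c_tilde + \<delta>\<eta>\<close> with
  \<open>\<eta>(X; B) = 2\<^bsup>2p-1\<^esup> Tr (\<epsilon> B\<^bsup>2p+2\<^esup> X)\<close>. The relation \<open>\<epsilon>B + B\<epsilon> = -B\<^sup>2\<close> shows that \<open>B\<^sup>2\<close> commutes
  with \<open>\<epsilon>\<close> and that \<open>c(X, Y)\<close> vanishes as soon as one argument commutes with \<open>\<epsilon>\<close>. Hence \<open>c(X, Y)\<close> depends only
  on the parts \<open>X', Y'\<close> of \<open>X, Y\<close> that anticommute with \<open>\<epsilon>\<close>, and on these it is a combination of traces that contain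
  \<open>X' B\<^bsup>2b\<^esup> Y'\<close> or \<open>Y' B\<^bsup>2b\<^esup> X'\<close>. For two loops of negative modes \<open>X'\<close> and \<open>Y'\<close> both map the positive
  modes to the negative ones and annihilate the negative ones, so these products are zero; for two loops of nonnegative
  modes the roles are exchanged. The cocycle identity follows from the cyclicity of the trace.

  The ideals \<open>L\<^bsub>2p\<^esub>\<close> are handled through approximation numbers: a product of \<open>k\<close> elements of \<open>L\<^bsub>2p\<^esub>\<close> has
  approximation numbers dominated by \<open>k\<close>-th powers of a \<open>2p\<close>-summable sequence, and is nuclear for \<open>k \<ge> 2p\<close>. This
  makes all traces and their derivatives along \<open>B\<close> meaningful.
\<close>

section \<open>Hilbert space structure\<close>

text \<open>The constant in the coboundary is forced by the arguments Y that commute with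
  \<open>pol\<close>. With S the sum of (-1)^k B^(2p+1-k) Y B^k, the form \<open>alt_form\<close>
  equals -Tr(S X), while in the trace of \<open>exact_op\<close> all terms that still contain
  \<open>pol\<close> cancel and 2 Tr(S X) remains; the weights 4^p and 4^p/2 balance the two.

  The analytic obstacle is that the ideal is given through diagonal entries of |T|^(2p), a
  description that says little about sums and products, and that traces have to be rotated when
  neither factor is trace class. Approximation numbers behave well under both operations because
  ranks add; the price is a quasi-norm, whose constants have to be controlled in the exponential
  series. A greedily chosen orthonormal family and Jensen's inequality connect the two descriptions.

  In the cocycle identity the two summands are closed separately. The exact one is closed by a
  formal computation with operators. For the other, the words that contain \<open>pol\<close> cancel
  in a cyclic sum over the three arguments, and the rest cancels by the parity of the
  exponents.\<close>

lemma cinner_l2_class: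
  "square_integrable f \<Longrightarrow> square_integrable g \<Longrightarrow>
   cinner (l2_class f) (l2_class g) = (\<integral>x. (\<Sum>i\<in>UNIV. cnj (f x $ i) * g x $ i) \<partial>circle)"
  by (simp add: cinner.abs_eq l2_rel_def)

lemma integrable_component_product:
  fixes f g :: "real \<Rightarrow> complex^'n"
  assumes f: "square_integrable f" and g: "square_integrable g"
  shows "integrable circle (\<lambda>x. cnj (f x $ i) * g x $ j)"
proof (rule Bochner_Integration.integrable_bound)
  have [measurable]: "cnj \<in> borel_measurable borel"
    by (intro borel_measurable_continuous_onI continuous_intros)
  show "integrable circle (\<lambda>x. (norm (f x))\<^sup>2 + (norm (g x))\<^sup>2)"
    using f g by (simp add: square_integrable_def)
  show "(\<lambda>x. cnj (f x $ i) * g x $ j) \<in> borel_measurable circle"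
    using f g by measurable
  show "AE x in circle. norm (cnj (f x $ i) * g x $ j) \<le> norm ((norm (f x))\<^sup>2 + (norm (g x))\<^sup>2)"
  proof (rule AE_I2)
    fix x
    have "norm (cnj (f x $ i) * g x $ j) \<le> norm (f x) * norm (g x)"
      by (simp add: norm_mult mult_mono Finite_Cartesian_Product.norm_nth_le)
    also have "\<dots> \<le> (norm (f x))\<^sup>2 + (norm (g x))\<^sup>2"
      using sum_squares_bound[of "norm (f x)" "norm (g x)"]
        mult_nonneg_nonneg[OF norm_ge_zero[of "f x"] norm_ge_zero[of "g x"]] by linarith
    finally show "norm (cnj (f x $ i) * g x $ j) \<le> norm ((norm (f x))\<^sup>2 + (norm (g x))\<^sup>2)" by simp
  qed
qed

lemma integrable_cinner:
  fixes f g :: "real \<Rightarrow> complex^'n"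
  assumes "square_integrable f" "square_integrable g"
  shows "integrable circle (\<lambda>x. \<Sum>i\<in>UNIV. cnj (f x $ i) * g x $ i)"
  by (intro Bochner_Integration.integrable_sum integrable_component_product assms)

lemma Re_cinner: "Re (cinner u v) = u \<bullet> v"
proof (rule l2_rep[of u], rule l2_rep[of v])
  fix f g :: "real \<Rightarrow> complex^'a"
  assume f: "square_integrable f" "v = l2_class f" and g: "square_integrable g" "u = l2_class g"
  have "Re (cinner u v) = (\<integral>x. Re (\<Sum>i\<in>UNIV. cnj (g x $ i) * f x $ i) \<partial>circle)"
    using f g integral_bounded_linear[OF bounded_linear_Re integrable_cinner[OF g(1) f(1)]]
    by (simp only: cinner_l2_class)
  also have "\<dots> = (\<integral>x. g x \<bullet> f x \<partial>circle)"
    by (simp add: inner_vec_def inner_complex_def)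
  finally show ?thesis using f g by (simp add: inner_l2.abs_eq l2_rel_def)
qed

lemma cinner_commute: "cinner v u = cnj (cinner u v)"
proof (rule l2_rep[of u], rule l2_rep[of v])
  fix f g :: "real \<Rightarrow> complex^'a"
  assume f: "square_integrable f" "v = l2_class f" and g: "square_integrable g" "u = l2_class g"
  have "cnj (cinner u v) = (\<integral>x. cnj (\<Sum>i\<in>UNIV. cnj (g x $ i) * f x $ i) \<partial>circle)"
    using f g integral_bounded_linear[OF bounded_linear_cnj integrable_cinner[OF g(1) f(1)]]
    by (simp only: cinner_l2_class)
  then show ?thesis using f g by (simp add: cinner_l2_class mult.commute)
qed

lemma cinner_add_right: "cinner u (v + w) = cinner u v + cinner u w"
proof (rule l2_rep[of u], rule l2_rep[of v], rule l2_rep[of w])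
  fix f g h :: "real \<Rightarrow> complex^'a"
  assume f: "square_integrable f" "w = l2_class f" and g: "square_integrable g" "v = l2_class g"
    and h: "square_integrable h" "u = l2_class h"
  have "v + w = l2_class (\<lambda>x. g x + f x)"
    using f g by (simp add: plus_l2.abs_eq l2_rel_def)
  then show ?thesis
    using f g h Bochner_Integration.integral_add[OF integrable_cinner[OF h(1) g(1)] integrable_cinner[OF h(1) f(1)]]
    by (simp add: cinner_l2_class square_integrable_add distrib_left sum.distrib)
qed

lemma cinner_cscale_right: "cinner u (cscale c v) = c * cinner u v"
proof (rule l2_rep[of u], rule l2_rep[of v])
  fix f g :: "real \<Rightarrow> complex^'a"
  assume f: "square_integrable f" "v = l2_class f" and g: "square_integrable g" "u = l2_class g"
  have "cscale c v = l2_class (\<lambda>x. c *s f x)"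
    using f by (simp add: cscale.abs_eq l2_rel_def)
  then show ?thesis
    using f g by (simp add: cinner_l2_class square_integrable_scale mult.left_commute
        sum_distrib_left[symmetric])
qed

lemma cscale_of_real: "cscale (of_real r) u = r *\<^sub>R u"
proof (rule l2_rep[of u])
  fix f assume f: "square_integrable f" "u = l2_class f"
  have "complex_of_real r *s v = r *\<^sub>R v" for v :: "complex^'a"
    by (simp add: vec_eq_iff scaleR_conv_of_real[where 'a=complex])
  then show ?thesis using f by (simp add: cscale.abs_eq scaleR_l2.abs_eq l2_rel_def)
qed

lemma cscale_one: "cscale 1 u = u"
  using cscale_of_real[of 1 u] by simp

lemma cscale_minus_one: "cscale (-1) u = - u"
  using cscale_of_real[of "-1" u] by simp

lemma cscale_cscale: "cscale a (cscale b u) = cscale (a * b) u"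
  by (rule l2_rep[of u]) (simp add: cscale.abs_eq l2_rel_def square_integrable_scale
      vector_smult_assoc)

lemma cscale_add_left: "cscale (a + b) u = cscale a u + cscale b u"
  by (rule l2_rep[of u]) (simp add: cscale.abs_eq l2_rel_def square_integrable_scale plus_l2.abs_eq
      vector_sadd_rdistrib)

lemma cscale_sum: "cscale c (\<Sum>i\<in>A. f i) = (\<Sum>i\<in>A. cscale c (f i))"
  by (induction A rule: infinite_finite_induct) (simp_all add: cscale_zero cscale_add)

lemma cinner_scaleR_right: "cinner u (r *\<^sub>R v) = of_real r * cinner u v"
  using cinner_cscale_right[of u "of_real r" v] by (simp add: cscale_of_real)

lemma cinner_zero_right [simp]: "cinner u 0 = 0"
  using cinner_scaleR_right[of u 0 0] by simp

lemma cinner_zero_left [simp]: "cinner 0 u = 0"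
  using cinner_commute[of 0 u] by simp

lemma cinner_minus_right: "cinner u (- v) = - cinner u v"
  using cinner_scaleR_right[of u "-1" v] by simp

lemma cinner_diff_right: "cinner u (v - w) = cinner u v - cinner u w"
  using cinner_add_right[of u v "- w"] by (simp add: cinner_minus_right)

lemma cinner_add_left: "cinner (v + w) u = cinner v u + cinner w u"
  by (subst (1 2 3) cinner_commute) (simp add: cinner_add_right)

lemma cinner_diff_left: "cinner (v - w) u = cinner v u - cinner w u"
  by (subst (1 2 3) cinner_commute) (simp add: cinner_diff_right)

lemma cinner_cscale_left: "cinner (cscale c v) u = cnj c * cinner v u"
  by (subst (1 2) cinner_commute) (simp add: cinner_cscale_right)

lemma cinner_sum_right: "cinner u (\<Sum>i\<in>A. f i) = (\<Sum>i\<in>A. cinner u (f i))"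
  by (induction A rule: infinite_finite_induct) (simp_all add: cinner_add_right)

lemma cinner_sum_left: "cinner (\<Sum>i\<in>A. f i) u = (\<Sum>i\<in>A. cinner (f i) u)"
  by (induction A rule: infinite_finite_induct) (simp_all add: cinner_add_left)

lemma cinner_self: "cinner u u = of_real ((norm u)\<^sup>2)"
proof -
  have "Im (cinner u u) = 0"
    using cinner_commute[of u u] by (simp add: complex_eq_iff)
  then show ?thesis by (simp add: complex_eq_iff Re_cinner power2_norm_eq_inner)
qed

text \<open>Multiplying v by the unimodular phase \<open>?c\<close> makes the inner product equal to
  its modulus, hence to a real inner product, and the real Cauchy-Schwarz inequality
  applies.\<close>

lemma cmod_cinner_le: "cmod (cinner u v) \<le> norm u * norm v"
proof (cases "cinner u v = 0")
  case False
  let ?z = "cinner u v"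
  let ?c = "cnj ?z / of_real (cmod ?z)"
  have "?z * cnj ?z = of_real (cmod ?z) * of_real (cmod ?z)"
    using complex_norm_square[of ?z] by (simp add: power2_eq_square)
  then have "?c * ?z = of_real (cmod ?z)"
    using False by (simp add: mult.commute)
  then have "cmod ?z = u \<bullet> cscale ?c v"
    by (metis Re_cinner Re_complex_of_real cinner_cscale_right)
  also have "\<dots> \<le> norm u * norm (cscale ?c v)" by (rule norm_cauchy_schwarz)
  also have "norm (cscale ?c v) = norm v"
    using False by (simp add: norm_cscale norm_divide)
  finally show ?thesis .
qed simp

lemma bounded_linear_cinner_right: "bounded_linear (cinner u)"
  by (rule bounded_linear_intro[where K="norm u"])
    (simp_all add: cinner_add_right cinner_scaleR_right scaleR_conv_of_real cmod_cinner_le mult.commute[of "norm _" "norm u"])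

lemma tendsto_cinner_right [tendsto_intros]:
  "(f \<longlongrightarrow> a) F \<Longrightarrow> ((\<lambda>x. cinner u (f x)) \<longlongrightarrow> cinner u a) F"
  by (rule bounded_linear.tendsto[OF bounded_linear_cinner_right])

lemma tendsto_cinner_left [tendsto_intros]:
  "(f \<longlongrightarrow> a) F \<Longrightarrow> ((\<lambda>x. cinner (f x) u) \<longlongrightarrow> cinner a u) F"
  using tendsto_cnj[OF tendsto_cinner_right, of f a F u] by (simp add: cinner_commute[symmetric])

lemma tendsto_app [tendsto_intros]:
  "(f \<longlongrightarrow> a) F \<Longrightarrow> ((\<lambda>x. app T (f x)) \<longlongrightarrow> app T a) F"
  by (rule bounded_linear.tendsto[OF bounded_linear_app])

lemma bounded_linear_app_left: "bounded_linear (\<lambda>T. app T u)"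
  by (rule bounded_linear_intro[where K="norm u"])
    (simp_all add: app_add app_scaleR norm_app)

lemma tendsto_app_left [tendsto_intros]:
  "(f \<longlongrightarrow> T) F \<Longrightarrow> ((\<lambda>x. app (f x) u) \<longlongrightarrow> app T u) F"
  by (rule bounded_linear.tendsto[OF bounded_linear_app_left])

lemma app_zero [simp]: "app 0 u = 0"
  using app_scaleR[of 0 0 u] by simp

lemma app_zero_right [simp]: "app T 0 = 0"
  using app_cscale[of T 0 0] by (simp add: bounded_linear.linear linear_0 bounded_linear_app)

lemma app_add_right: "app T (u + v) = app T u + app T v"
  by (simp add: bounded_linear.linear linear_add bounded_linear_app)

lemma app_scaleR_right: "app T (r *\<^sub>R u) = r *\<^sub>R app T u"
  by (simp add: bounded_linear.linear linear_cmul bounded_linear_app)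

lemma app_sum: "app (\<Sum>i\<in>A. f i) u = (\<Sum>i\<in>A. app (f i) u)"
  by (induction A rule: infinite_finite_induct) (simp_all add: app_add)

lemma app_sum_right: "app T (\<Sum>i\<in>A. f i) = (\<Sum>i\<in>A. app T (f i))"
  by (simp add: bounded_linear.linear linear_sum bounded_linear_app)

lemma norm_bop_le:
  assumes "0 \<le> K" "\<And>u. norm (app T u) \<le> K * norm u"
  shows "norm T \<le> K"
  using assms by transfer (rule norm_blinfun_bound)

text \<open>Real homogeneity is the case of real scalars in \<open>sc\<close>. Adjoints, the
  polarisation and the projections of the greedy choice are produced through this lemma.\<close>

lemma bop_exists:
  fixes f :: "'n::finite l2 \<Rightarrow> 'n l2"
  assumes add: "\<And>u v. f (u + v) = f u + f v" and sc: "\<And>c u. f (cscale c u) = cscale c (f u)"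
    and K: "\<And>u. norm (f u) \<le> K * norm u"
  obtains T where "\<And>u. app T u = f u"
proof -
  have bl: "bounded_linear f"
    by (rule bounded_linear_intro[where K=K])
      (simp_all add: add K mult.commute flip: cscale_of_real sc)
  have "app (Abs_bop (Blinfun f)) u = f u" for u
    by (simp add: app.rep_eq Abs_bop_inverse bounded_linear_Blinfun_apply bl sc)
  then show thesis by (rule that)
qed

section \<open>The Fourier basis\<close>

definition basis_wave :: "int \<times> 'n::finite \<Rightarrow> 'n l2" where
  "basis_wave = (\<lambda>(k, i). wave (axis i 1) k)"

lemma norm_basis_wave [simp]: "norm (basis_wave b) = 1"
  by (cases b) (simp add: basis_wave_def norm_wave norm_axis_1)

lemma integral_circle:
  fixes f :: "real \<Rightarrow> 'b::euclidean_space"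
  assumes "continuous_on {0..2*pi} f" "f \<in> borel_measurable borel"
    and "\<And>x. (F has_vector_derivative f x) (at x within {0..2*pi})"
  shows "(\<integral>x. f x \<partial>circle) = (F (2*pi) - F 0) /\<^sub>R (2*pi)"
proof -
  have "(\<integral>x. f x \<partial>circle) = (\<integral>x. (indicator {0..2*pi} x / (2*pi)) *\<^sub>R f x \<partial>lborel)"
    unfolding circle_def using assms(2) by (intro integral_density) auto
  also have "\<dots> = (\<integral>x. (1/(2*pi)) *\<^sub>R (indicator {0..2*pi} x *\<^sub>R f x) \<partial>lborel)"
    by (simp only: scaleR_scaleR mult.commute[of "1 / (2*pi)"] times_divide_eq_right mult_1_right)
  also have "\<dots> = (1/(2*pi)) *\<^sub>R (\<integral>x. indicator {0..2*pi} x *\<^sub>R f x \<partial>lborel)"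
    by (rule integral_scaleR_right)
  also have "(\<integral>x. indicator {0..2*pi} x *\<^sub>R f x \<partial>lborel) = F (2*pi) - F 0"
    by (rule integral_FTC_Icc) (use assms in auto)
  finally show ?thesis by (simp only: inverse_eq_divide)
qed

lemma continuous_on_cis_mult: "continuous_on S (\<lambda>x. cis (real_of_int k * x))"
  by (simp add: cis_conv_exp) (intro continuous_intros)

lemma measurable_cis_mult [measurable]: "(\<lambda>x. cis (real_of_int k * x)) \<in> borel_measurable borel"
  by (intro borel_measurable_continuous_onI continuous_on_cis_mult)

lemma integral_cis: "(\<integral>x. cis (real_of_int k * x) \<partial>circle) = (if k = 0 then 1 else 0)"
proof (cases "k = 0")
  case False
  have "(\<integral>x. cis (real_of_int k * x) \<partial>circle)
      = (cis (real_of_int k * (2*pi)) / (\<i> * of_int k) - cis (real_of_int k * 0) / (\<i> * of_int k)) /\<^sub>R (2*pi)"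
  proof (rule integral_circle)
    show "((\<lambda>x. cis (real_of_int k * x) / (\<i> * of_int k)) has_vector_derivative cis (real_of_int k * x))
        (at x within {0..2 * pi})" for x
    proof -
      have "((\<lambda>z. exp (\<i> * of_int k * z) / (\<i> * of_int k)) has_field_derivative exp (\<i> * of_int k * of_real x)) (at (of_real x))"
        using False by (auto intro!: derivative_eq_intros)
      from has_vector_derivative_real_field[OF this]
      show ?thesis by (simp add: cis_conv_exp mult.assoc has_vector_derivative_at_within)
    qed
  qed (auto intro: continuous_on_cis_mult)
  also have "cis (real_of_int k * (2*pi)) = 1"
    by (metis cis_multiple_2pi Ints_of_int mult.commute mult.left_commute)
  finally show ?thesis using False by simp
qed simp

lemma cinner_wave: "cinner (wave v j) (wave w k) = (if j = k then \<Sum>i\<in>UNIV. cnj (v $ i) * w $ i else 0)"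
proof -
  have "cinner (wave v j) (wave w k)
      = (\<integral>x. (\<Sum>i\<in>UNIV. cnj (v $ i) * w $ i) * cis (real_of_int (k - j) * x) \<partial>circle)"
  proof -
    have *: "cnj (cis (real_of_int j * x)) * cis (real_of_int k * x) = cis (real_of_int (k - j) * x)" for x
      by (simp add: cis_cnj cis_mult algebra_simps)
    have "cnj ((cis (real_of_int j * x) *s v) $ i) * (cis (real_of_int k * x) *s w) $ i
        = cnj (v $ i) * w $ i * cis (real_of_int (k - j) * x)" for x i
      unfolding *[symmetric] by (simp add: mult_ac)
    then show ?thesis
      unfolding wave_def cinner_l2_class[OF square_integrable_wave square_integrable_wave]
      by (simp only: sum_distrib_right)
  qed
  also have "\<dots> = (\<Sum>i\<in>UNIV. cnj (v $ i) * w $ i) * (\<integral>x. cis (real_of_int (k - j) * x) \<partial>circle)"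
    by simp
  finally show ?thesis unfolding integral_cis by simp
qed

lemma cinner_basis_wave: "cinner (basis_wave b) (basis_wave c) = (if b = c then 1 else 0)"
  by (cases b, cases c)
    (auto simp: basis_wave_def cinner_wave axis_def if_distrib[of cnj] if_distrib[of "\<lambda>t. t * _"] cong: if_cong)

text \<open>A function is orthogonal to all trigonometric polynomials. By Stone--Weierstrass the property
  survives multiplication by functions that are continuous on the circle, hence the integral over every
  arc vanishes.\<close>

definition trig_orthogonal :: "(real \<Rightarrow> complex) \<Rightarrow> bool" where
  "trig_orthogonal G \<longleftrightarrow> integrable circle G \<and> (\<forall>k. (\<integral>x. G x * cis (real_of_int k * x) \<partial>circle) = 0)"

lemma integrable_mult_cis:
  assumes "integrable circle G" shows "integrable circle (\<lambda>x. G x * cis (real_of_int k * x))"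
  by (rule Bochner_Integration.integrable_bound[OF assms]) (use assms in \<open>auto simp: norm_mult\<close>)

lemma trig_orthogonal_shift:
  assumes "trig_orthogonal G" shows "trig_orthogonal (\<lambda>x. G x * cis (real_of_int m * x))"
proof -
  have "G x * cis (real_of_int m * x) * cis (real_of_int k * x) = G x * cis (real_of_int (m + k) * x)" for x k
    by (simp add: cis_mult algebra_simps)
  with assms show ?thesis
    unfolding trig_orthogonal_def using integrable_mult_cis by presburger
qed

lemma trig_orthogonal_cmult:
  assumes "trig_orthogonal G" shows "trig_orthogonal (\<lambda>x. c * G x)"
  using assms unfolding trig_orthogonal_def by (simp add: mult.assoc)

lemma trig_orthogonal_add:
  assumes "trig_orthogonal G" "trig_orthogonal H" shows "trig_orthogonal (\<lambda>x. G x + H x)"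
  using assms unfolding trig_orthogonal_def by (simp add: distrib_right integrable_mult_cis)

text \<open>Orthogonality is stable under sums, scalars and shifts of the frequency, which covers
  linear functions of \<open>cis x\<close>. Products work because G is arbitrary in the induction:
  multiplying by one factor gives a new orthogonal function for the other.\<close>

lemma trig_orthogonal_polynomial:
  fixes h :: "complex \<Rightarrow> real"
  assumes "real_polynomial_function h" "trig_orthogonal G"
  shows "trig_orthogonal (\<lambda>x. G x * of_real (h (cis x)))"
  using assms
proof (induction arbitrary: G)
  case (linear h)
  \<comment> \<open>On the circle a real linear function is h(1) cos x + h(i) sin x; Euler's
    formulas turn this into the frequencies 1 and -1.\<close>
  have "of_real (h (cis x)) = ((of_real (h 1) - \<i> * of_real (h \<i>)) / 2) * cis (real_of_int 1 * x)
      + ((of_real (h 1) + \<i> * of_real (h \<i>)) / 2) * cis (real_of_int (-1) * x)" for x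
  proof -
    have "cis x = cos x *\<^sub>R 1 + sin x *\<^sub>R \<i>"
      by (simp add: complex_eq_iff)
    then have "h (cis x) = h (cos x *\<^sub>R 1 + sin x *\<^sub>R \<i>)"
      by (rule arg_cong)
    also have "\<dots> = cos x * h 1 + sin x * h \<i>"
      using linear(1) by (simp add: bounded_linear.linear linear_add linear_cmul)
    finally show ?thesis by (simp add: complex_eq_iff field_simps)
  qed
  then have "(\<lambda>x. G x * of_real (h (cis x)))
    = (\<lambda>x. ((of_real (h 1) - \<i> * of_real (h \<i>)) / 2) * (G x * cis (real_of_int 1 * x))
      + ((of_real (h 1) + \<i> * of_real (h \<i>)) / 2) * (G x * cis (real_of_int (-1) * x)))"
    by (simp add: algebra_simps)
  then show ?case
    using linear.prems by (simp only:)
      (intro trig_orthogonal_add trig_orthogonal_cmult trig_orthogonal_shift)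
next
  case (const c)
  then show ?case using trig_orthogonal_cmult[of G "of_real c"] by (simp add: mult.commute)
next
  case (add f g)
  show ?case using trig_orthogonal_add[OF add.IH(1)[OF add.prems] add.IH(2)[OF add.prems]]
    by (simp add: algebra_simps)
next
  case (mult f g)
  show ?case using mult.IH(2)[OF mult.IH(1)[OF mult.prems]] by (simp add: mult.assoc)
qed

lemma measurable_cis [measurable]: "cis \<in> borel_measurable borel"
  using measurable_cis_mult[of 1] by simp

lemma trig_orthogonal_continuous:
  fixes h :: "complex \<Rightarrow> real"
  assumes h: "continuous_on UNIV h" and G: "trig_orthogonal G"
  shows "(\<integral>x. G x * of_real (h (cis x)) \<partial>circle) = 0"
proof (rule ccontr)
  assume nz: "(\<integral>x. G x * of_real (h (cis x)) \<partial>circle) \<noteq> 0" (is "?I \<noteq> 0")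
  have Gi: "integrable circle G" using G by (simp add: trig_orthogonal_def)
  then have [measurable]: "G \<in> borel_measurable borel" by auto
  have [measurable]: "h \<in> borel_measurable borel"
    using h by (rule borel_measurable_continuous_onI)
  define J where "J = (\<integral>x. norm (G x) \<partial>circle)"
  have J: "J \<ge> 0" by (simp add: J_def)
  \<comment> \<open>An error of e in h changes the integral by at most e J, which is below the
    modulus of \<open>?I\<close>; J + 1 avoids a zero denominator.\<close>
  define e where "e = cmod ?I / (2 * (J + 1))"
  have e: "e > 0" using nz J by (simp add: e_def)
  obtain g where g: "real_polynomial_function g" "\<And>z. z \<in> sphere 0 1 \<Longrightarrow> \<bar>h z - g z\<bar> < e"
    using Stone_Weierstrass_real_polynomial_function[OF compact_sphere[of 0 1] continuous_on_subset[OF h] e] by auto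
  have Gg: "trig_orthogonal (\<lambda>x. G x * of_real (g (cis x)))"
    by (rule trig_orthogonal_polynomial[OF g(1) G])
  then have gi: "integrable circle (\<lambda>x. G x * of_real (g (cis x)))"
    and g0: "(\<integral>x. G x * of_real (g (cis x)) \<partial>circle) = 0"
    using Gg[unfolded trig_orthogonal_def] by (auto dest: spec[of _ 0])
  have hb: "norm (G x * of_real (h (cis x)) - G x * of_real (g (cis x))) \<le> e * norm (G x)" for x
  proof -
    have "norm (G x * of_real (h (cis x)) - G x * of_real (g (cis x))) = norm (G x) * \<bar>h (cis x) - g (cis x)\<bar>"
      by (simp flip: right_diff_distrib of_real_diff add: norm_mult)
    also have "\<dots> \<le> norm (G x) * e"
      using g(2)[of "cis x"] by (intro mult_left_mono) auto
    finally show ?thesis by (simp add: mult.commute)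
  qed
  have di: "integrable circle (\<lambda>x. G x * of_real (h (cis x)) - G x * of_real (g (cis x)))"
    by (rule Bochner_Integration.integrable_bound[where f="\<lambda>x. e * norm (G x)"])
      (use Gi gi hb e in \<open>auto intro: order_trans\<close>)
  have hi: "integrable circle (\<lambda>x. G x * of_real (h (cis x)))"
    using Bochner_Integration.integrable_add[OF di gi] by simp
  have "cmod ?I = norm (\<integral>x. G x * of_real (h (cis x)) - G x * of_real (g (cis x)) \<partial>circle)"
    using hi gi g0 by simp
  also have "\<dots> \<le> (\<integral>x. norm (G x * of_real (h (cis x)) - G x * of_real (g (cis x))) \<partial>circle)"
    by (rule integral_norm_bound)
  also have "\<dots> \<le> (\<integral>x. e * norm (G x) \<partial>circle)"
    by (rule integral_mono) (use di Gi hb in auto)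
  also have "\<dots> = e * J" by (simp add: J_def)
  also have "\<dots> < cmod ?I"
    using nz J by (simp add: e_def field_simps) (simp add: add_pos_nonneg mult_pos_pos ring_distribs add_nonneg_pos)
  finally show False by simp
qed

text \<open>The indicator of C is the limit of the continuous functions max 0 (1 - n d(z, C)), and
  the absolute value of G dominates.\<close>

lemma trig_orthogonal_closed:
  assumes C: "closed C" and G: "trig_orthogonal G"
  shows "(\<integral>x. indicator C (cis x) *\<^sub>R G x \<partial>circle) = 0"
proof (cases "C = {}")
  case False
  define h where "h n z = max 0 (1 - real n * infdist z C)" for n z
  have Gi: "integrable circle G" using G by (simp add: trig_orthogonal_def)
  then have [measurable]: "G \<in> borel_measurable borel" by auto
  have cont: "continuous_on UNIV (h n)" for n
    unfolding h_def by (intro continuous_intros)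
  then have [measurable]: "h n \<in> borel_measurable borel" for n
    by (rule borel_measurable_continuous_onI)
  have [measurable]: "C \<in> sets borel" using C by simp
  have lim: "(\<lambda>n. h n z) \<longlonglongrightarrow> indicator C z" for z
  proof (cases "z \<in> C")
    case True
    then show ?thesis by (simp add: h_def)
  next
    case z: False
    then have "infdist z C > 0"
      using C False by (intro infdist_pos_not_in_closed) auto
    then obtain N where N: "1 < real N * infdist z C"
      using reals_Archimedean3 by blast
    have "h n z = 0" if "n \<ge> N" for n
    proof -
      have "real N * infdist z C \<le> real n * infdist z C"
        using that by (intro mult_right_mono infdist_nonneg) auto
      with N show ?thesis by (simp add: h_def)
    qed
    then have "\<forall>\<^sub>F n in sequentially. h n z = 0"
      by (auto simp: eventually_sequentially)
    then show ?thesis using z by (simp add: tendsto_eventually)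
  qed
  have "(\<lambda>n. \<integral>x. G x * of_real (h n (cis x)) \<partial>circle) \<longlonglongrightarrow> (\<integral>x. indicator C (cis x) *\<^sub>R G x \<partial>circle)"
  proof (rule integral_dominated_convergence[where w="\<lambda>x. norm (G x)"])
    show "integrable circle (\<lambda>x. norm (G x))" using Gi by simp
    show "AE x in circle. (\<lambda>n. G x * of_real (h n (cis x))) \<longlonglongrightarrow> indicator C (cis x) *\<^sub>R G x"
    proof (rule AE_I2)
      fix x
      have "(\<lambda>n. G x * of_real (h n (cis x))) \<longlonglongrightarrow> G x * of_real (indicator C (cis x))"
        by (intro tendsto_intros lim)
      then show "(\<lambda>n. G x * of_real (h n (cis x))) \<longlonglongrightarrow> indicator C (cis x) *\<^sub>R G x"
        by (simp add: scaleR_conv_of_real mult.commute)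
    qed
    show "AE x in circle. norm (G x * of_real (h n (cis x))) \<le> norm (G x)" for n
    proof (rule AE_I2)
      fix x
      have "\<bar>h n (cis x)\<bar> \<le> 1"
        using infdist_nonneg[of "cis x" C] by (simp add: h_def)
      then show "norm (G x * of_real (h n (cis x))) \<le> norm (G x)"
        by (simp add: norm_mult mult_left_le)
    qed
  qed measurable
  then show ?thesis
    by (simp add: trig_orthogonal_continuous[OF cont G] LIMSEQ_const_iff)
qed simp

text \<open>The parametrisation identifies 0 with 2 pi, so one of the two points has to be interior;
  \<open>AE_circle\<close> provides this almost everywhere.\<close>

lemma cis_inj_interval:
  assumes "0 < x" "x < 2*pi" "0 \<le> y" "y \<le> 2*pi" "cis x = cis y"
  shows "x = y"
proof -
  have "sin y = sin x \<and> cos y = cos x"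
    using assms(5) by (simp add: complex_eq_iff)
  then obtain n :: int where n: "y = x + 2 * pi * n"
    using sin_cos_eq_iff by blast
  have "n = 0"
  proof (rule ccontr)
    assume "n \<noteq> 0"
    then consider "n \<ge> 1" | "n \<le> -1" by linarith
    then show False
    proof cases
      case 1
      then have "2 * pi * real_of_int n \<ge> 2 * pi * 1" by (intro mult_left_mono) auto
      then show False using n assms by linarith
    next
      case 2
      then have "2 * pi * real_of_int n \<le> 2 * pi * (-1)" by (intro mult_left_mono) auto
      then show False using n assms by linarith
    qed
  qed
  with n show ?thesis by simp
qed

lemma AE_circle: "AE x in circle. 0 < x \<and> x < 2 * pi"
proof -
  have "AE x in lborel. 0 < ennreal (indicator {0..2*pi} x / (2*pi)) \<longrightarrow> 0 < x \<and> x < 2*pi"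
    using AE_lborel_singleton[of "0::real"] AE_lborel_singleton[of "2*pi"]
    by eventually_elim (auto split: split_indicator_asm)
  then show ?thesis
    unfolding circle_def by (subst AE_density) auto
qed

text \<open>Up to a null set, an interval of parameters is the preimage of a compact arc under
  \<open>cis\<close>.\<close>

lemma trig_orthogonal_interval:
  assumes G: "trig_orthogonal G"
  shows "(LINT x:{a..b}|circle. G x) = 0"
proof -
  define C where "C = cis ` {max a 0..min b (2*pi)}"
  have "compact C"
    unfolding C_def by (intro compact_continuous_image compact_Icc continuous_intros)
  then have "closed C" by (rule compact_imp_closed)
  then have [measurable]: "C \<in> sets borel" by simp
  have Gi: "integrable circle G" using G by (simp add: trig_orthogonal_def)
  then have [measurable]: "G \<in> borel_measurable borel" by auto
  have "(LINT x:{a..b}|circle. G x) = (\<integral>x. indicator C (cis x) *\<^sub>R G x \<partial>circle)"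
    unfolding set_lebesgue_integral_def
  proof (rule integral_cong_AE)
    show "AE x in circle. indicator {a..b} x *\<^sub>R G x = indicator C (cis x) *\<^sub>R G x"
      using AE_circle
    proof eventually_elim
      case (elim x)
      have "x \<in> {a..b} \<longleftrightarrow> cis x \<in> C"
      proof
        assume "cis x \<in> C"
        then obtain y where "y \<in> {max a 0..min b (2*pi)}" "cis x = cis y" by (auto simp: C_def)
        then show "x \<in> {a..b}" using cis_inj_interval[of x y] elim by auto
      qed (use elim in \<open>auto simp: C_def\<close>)
      then show ?case by (simp add: indicator_def)
    qed
  qed measurable
  also have "\<dots> = 0" by (rule trig_orthogonal_closed[OF \<open>closed C\<close> G])
  finally show ?thesis .
qed

text \<open>Dynkin's theorem: the sets over which G integrates to zero are closed under complements
  and countable disjoint unions, and the closed intervals form an intersection-stable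
  generator.\<close>

lemma trig_orthogonal_borel:
  assumes G: "trig_orthogonal G" and A: "A \<in> sets borel"
  shows "(LINT x:A|circle. G x) = 0"
proof -
  have Gi: "integrable circle G" using G by (simp add: trig_orthogonal_def)
  have si: "set_integrable circle A G" if "A \<in> sets borel" for A
    unfolding set_integrable_def by (rule integrable_mult_indicator) (use Gi that in auto)
  have G0: "(\<integral>x. G x \<partial>circle) = 0"
    using G unfolding trig_orthogonal_def by (auto dest: spec[of _ 0])
  have eq: "sets (borel :: real measure) = sigma_sets UNIV (range (\<lambda>(a,b). {a..b}))"
    by (subst borel_eq_atLeastAtMost) simp
  have A': "A \<in> sigma_sets UNIV (range (\<lambda>(a,b). {a..b}))" using A eq by simp
  have st: "Int_stable (range (\<lambda>(a,b). {a..b::real}))"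
    by (auto simp: Int_stable_def image_iff Int_atLeastAtMost)
  show ?thesis
  proof (rule sigma_sets_induct_disjoint[OF st _ A'], goal_cases)
    case 1 show ?case by simp
  next
    case (2 A) then show ?case by (auto simp: trig_orthogonal_interval[OF G])
  next
    case 3 show ?case by (simp add: set_lebesgue_integral_def)
  next
    case (4 A)
    then have "A \<in> sets borel" using eq by simp
    have "(LINT x:UNIV - A|circle. G x) = (\<integral>x. G x - indicator A x *\<^sub>R G x \<partial>circle)"
      unfolding set_lebesgue_integral_def
      by (rule Bochner_Integration.integral_cong) (auto simp: indicator_def)
    also have "\<dots> = (\<integral>x. G x \<partial>circle) - (LINT x:A|circle. G x)"
      unfolding set_lebesgue_integral_def
      by (rule Bochner_Integration.integral_diff[OF Gi si[OF \<open>A \<in> sets borel\<close>, unfolded set_integrable_def]])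
    finally show ?case using 4 G0 by simp
  next
    case (5 A)
    then have m: "A i \<in> sets borel" for i using eq by auto
    have "(LINT x:(\<Union>i. A i)|circle. G x) = (\<Sum>i. LINT x:A i|circle. G x)"
      by (rule lebesgue_integral_countable_add) (use 5 m si in \<open>auto simp: disjoint_family_on_def\<close>)
    then show ?case using 5 by simp
  qed
qed

text \<open>The real part integrates to zero over the set where it is positive, so this set is
  null.\<close>

lemma trig_orthogonal_imp_Re_le:
  assumes G: "trig_orthogonal G"
  shows "AE x in circle. Re (G x) \<le> 0"
proof -
  have Gi: "integrable circle G" using G by (simp add: trig_orthogonal_def)
  then have [measurable]: "G \<in> borel_measurable borel" by auto
  have [measurable]: "Re \<in> borel_measurable borel"
    by (intro borel_measurable_continuous_onI continuous_intros)
  define A where "A = {x. Re (G x) > 0}"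
  have A: "A \<in> sets borel" unfolding A_def by measurable
  have ii: "integrable circle (\<lambda>x. indicator A x *\<^sub>R G x)"
    by (rule integrable_mult_indicator) (use Gi A in auto)
  have "(\<integral>x. Re (indicator A x *\<^sub>R G x) \<partial>circle) = Re (LINT x:A|circle. G x)"
    unfolding set_lebesgue_integral_def by (rule integral_bounded_linear[OF bounded_linear_Re ii])
  then have "(\<integral>x. Re (indicator A x *\<^sub>R G x) \<partial>circle) = 0"
    by (simp add: trig_orthogonal_borel[OF G A])
  then have "AE x in circle. Re (indicator A x *\<^sub>R G x) = 0"
    by (subst (asm) integral_nonneg_eq_0_iff_AE)
      (use integrable_bounded_linear[OF bounded_linear_Re ii] in \<open>auto simp: A_def indicator_def\<close>)
  then show ?thesis
    by eventually_elim (auto simp: A_def indicator_def split: if_splits)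
qed

text \<open>Applied to G, -G, iG and -iG, the previous bound controls both signs of the real and of
  the imaginary part.\<close>

lemma trig_orthogonal_imp_AE_zero:
  assumes G: "trig_orthogonal G"
  shows "AE x in circle. G x = 0"
  using trig_orthogonal_imp_Re_le[OF G] trig_orthogonal_imp_Re_le[OF trig_orthogonal_cmult[OF G, of "-1"]]
    trig_orthogonal_imp_Re_le[OF trig_orthogonal_cmult[OF G, of "\<i>"]]
    trig_orthogonal_imp_Re_le[OF trig_orthogonal_cmult[OF G, of "- \<i>"]]
  by eventually_elim (simp add: complex_eq_iff)

lemma basis_wave_total:
  assumes "\<And>b. cinner (basis_wave b) u = 0"
  shows "u = 0"
proof (rule l2_rep[of u])
  fix f assume f: "square_integrable f" "u = l2_class f"
  have *: "(\<Sum>j\<in>UNIV. cnj ((cis (real_of_int k * x) *s axis i 1) $ j) * f x $ j)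
      = f x $ i * cis (real_of_int (- k) * x)" for k x i
    by (simp add: axis_def cis_cnj if_distrib[of cnj] if_distrib[of "\<lambda>t. _ * t"] if_distrib[of "\<lambda>t. t * _"] cong: if_cong)
  have int: "integrable circle (\<lambda>x. f x $ i * cis (real_of_int (- k) * x))" for k i
    using integrable_cinner[OF square_integrable_wave[of k "axis i 1"] f(1)] unfolding * .
  have "trig_orthogonal (\<lambda>x. f x $ i)" for i
    unfolding trig_orthogonal_def
  proof (intro conjI allI)
    show "integrable circle (\<lambda>x. f x $ i)" using int[of i 0] by simp
    fix k :: int
    have "cinner (basis_wave (- k, i)) u = (\<integral>x. f x $ i * cis (real_of_int k * x) \<partial>circle)"
      unfolding basis_wave_def wave_def f(2) prod.case
      by (subst cinner_l2_class[OF square_integrable_wave f(1)], subst *) simp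
    with assms show "(\<integral>x. f x $ i * cis (real_of_int k * x) \<partial>circle) = 0" by simp
  qed
  then have "AE x in circle. f x $ i = 0" for i
    by (rule trig_orthogonal_imp_AE_zero)
  then have "AE x in circle. \<forall>i\<in>UNIV. f x $ i = 0"
    by (intro AE_finite_allI) auto
  then have "AE x in circle. f x = 0"
    by eventually_elim (simp add: vec_eq_iff)
  then have "l2_rel f (\<lambda>_. 0)"
    using f by (simp add: l2_rel_def square_integrable_zero)
  then show "u = 0"
    using f(2) Quotient3_rel_abs[OF Quotient3_l2] by (metis zero_l2_def map_fun_apply id_apply)
qed

lemma mult_cnj_self: "z * cnj z = (complex_of_real (cmod z))\<^sup>2" "cnj z * z = (complex_of_real (cmod z))\<^sup>2"
  using complex_norm_square[of z] by (simp_all add: mult.commute)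

text \<open>Orthonormal families in which zero vectors are tolerated. Gram-Schmidt on dependent
  vectors and the greedy choice for an operator of finite rank then keep their index sets.\<close>

definition orthofamily :: "('i \<Rightarrow> 'n::finite l2) \<Rightarrow> 'i set \<Rightarrow> bool" where
  "orthofamily f I \<longleftrightarrow> (\<forall>i\<in>I. norm (f i) = 0 \<or> norm (f i) = 1) \<and>
     (\<forall>i\<in>I. \<forall>j\<in>I. i \<noteq> j \<longrightarrow> cinner (f i) (f j) = 0)"

lemma orthofamily_subset: "orthofamily f I \<Longrightarrow> J \<subseteq> I \<Longrightarrow> orthofamily f J"
  by (simp add: orthofamily_def subset_iff)

lemma orthofamily_basis_wave: "orthofamily basis_wave I"
  by (auto simp: orthofamily_def cinner_basis_wave)

lemma orthofamily_cinner_sum: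
  assumes "finite I" "orthofamily f I" "j \<in> I"
  shows "cinner (f j) (\<Sum>i\<in>I. cscale (c i) (f i)) = (if f j = 0 then 0 else c j)"
proof -
  have "cinner (f j) (\<Sum>i\<in>I. cscale (c i) (f i)) = (\<Sum>i\<in>I. if i = j then c j * cinner (f j) (f j) else 0)"
    unfolding cinner_sum_right
    using assms by (intro sum.cong) (auto simp: cinner_cscale_right orthofamily_def)
  also have "\<dots> = (if f j = 0 then 0 else c j)"
    using assms by (auto simp: cinner_self orthofamily_def)
  finally show ?thesis .
qed

lemma orthofamily_norm_sum:
  assumes "finite I" "orthofamily f I"
  shows "(norm (\<Sum>i\<in>I. cscale (c i) (f i)))\<^sup>2 = (\<Sum>i\<in>I. if f i = 0 then 0 else (cmod (c i))\<^sup>2)"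
proof -
  have "complex_of_real ((norm (\<Sum>i\<in>I. cscale (c i) (f i)))\<^sup>2)
      = (\<Sum>i\<in>I. cnj (c i) * cinner (f i) (\<Sum>j\<in>I. cscale (c j) (f j)))"
    unfolding cinner_self[symmetric] by (simp add: cinner_sum_left cinner_cscale_left)
  also have "\<dots> = (\<Sum>i\<in>I. of_real (if f i = 0 then 0 else (cmod (c i))\<^sup>2))"
    using assms by (intro sum.cong) (simp_all add: orthofamily_cinner_sum mult_cnj_self)
  also have "\<dots> = of_real (\<Sum>i\<in>I. if f i = 0 then 0 else (cmod (c i))\<^sup>2)"
    by simp
  finally show ?thesis by (simp only: of_real_eq_iff)
qed

lemma norm_diff_square:
  "(norm (u - v))\<^sup>2 = (norm u)\<^sup>2 - 2 * Re (cinner v u) + (norm v)\<^sup>2"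
  for u v :: "'n::finite l2"
  by (simp add: power2_norm_eq_inner Re_cinner inner_diff_left inner_diff_right inner_commute)

lemma bessel_remainder:
  assumes "finite I" "orthofamily f I"
  shows "(norm (u - (\<Sum>i\<in>I. cscale (cinner (f i) u) (f i))))\<^sup>2 = (norm u)\<^sup>2 - (\<Sum>i\<in>I. (cmod (cinner (f i) u))\<^sup>2)"
proof -
  let ?s = "\<Sum>i\<in>I. cscale (cinner (f i) u) (f i)"
  have "cinner ?s u = of_real (\<Sum>i\<in>I. (cmod (cinner (f i) u))\<^sup>2)"
    by (simp add: cinner_sum_left cinner_cscale_left mult_cnj_self)
  moreover have "(norm ?s)\<^sup>2 = (\<Sum>i\<in>I. (cmod (cinner (f i) u))\<^sup>2)"
    unfolding orthofamily_norm_sum[OF assms] by (intro sum.cong) auto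
  ultimately show ?thesis unfolding norm_diff_square by simp
qed

lemma bessel:
  assumes "finite I" "orthofamily f I"
  shows "(\<Sum>i\<in>I. (cmod (cinner (f i) u))\<^sup>2) \<le> (norm u)\<^sup>2"
  using bessel_remainder[OF assms, of u]
    zero_le_power2[of "norm (u - (\<Sum>i\<in>I. cscale (cinner (f i) u) (f i)))"] by linarith

lemma bessel_remainder_norm_le:
  assumes "finite I" "orthofamily f I"
  shows "norm (u - (\<Sum>i\<in>I. cscale (cinner (f i) u) (f i))) \<le> norm u"
proof (rule power2_le_imp_le)
  show "(norm (u - (\<Sum>i\<in>I. cscale (cinner (f i) u) (f i))))\<^sup>2 \<le> (norm u)\<^sup>2"
    unfolding bessel_remainder[OF assms] by (simp add: sum_nonneg)
qed simp

definition enum_basis :: "nat \<Rightarrow> int \<times> 'n::finite" where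
  "enum_basis = from_nat_into UNIV"

lemma bij_enum_basis: "bij (enum_basis :: nat \<Rightarrow> int \<times> 'n::finite)"
proof -
  have "countable (UNIV :: (int \<times> 'n) set)"
    by (subst UNIV_Times_UNIV[symmetric]) (intro countable_SIGMA countable_finite countableI_type; simp)
  moreover have "infinite (UNIV :: (int \<times> 'n) set)"
    by (simp add: finite_prod infinite_UNIV_int)
  ultimately show ?thesis unfolding enum_basis_def by (rule bij_betw_from_nat_into)
qed

lemma inj_enum_basis: "inj_on enum_basis A"
  using bij_enum_basis by (meson bij_is_inj inj_on_subset subset_UNIV)

text \<open>The theorem of Riesz and Fischer. It supplies the vectors behind the Fourier expansion,
  the adjoints and the polarisation.\<close>

lemma l2_of_coeffs:
  fixes c :: "int \<times> 'n::finite \<Rightarrow> complex"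
  assumes K: "\<And>F. finite F \<Longrightarrow> (\<Sum>b\<in>F. (cmod (c b))\<^sup>2) \<le> K"
  obtains w where "\<And>b. cinner (basis_wave b) w = c b" "(norm w)\<^sup>2 \<le> K"
    "(\<lambda>n. \<Sum>i<n. cscale (c (enum_basis i)) (basis_wave (enum_basis i))) \<longlonglongrightarrow> w"
    "(\<lambda>i. (cmod (c (enum_basis i)))\<^sup>2) sums (norm w)\<^sup>2"
proof -
  let ?\<beta> = "enum_basis :: nat \<Rightarrow> int \<times> 'n"
  define t where "t i = (cmod (c (?\<beta> i)))\<^sup>2" for i
  define s where "s n = (\<Sum>i<n. cscale (c (?\<beta> i)) (basis_wave (?\<beta> i)))" for n
  have of: "orthofamily (\<lambda>i. basis_wave (?\<beta> i)) I" for I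
    unfolding orthofamily_def using inj_enum_basis[of UNIV, where 'a='n] by (auto simp: cinner_basis_wave inj_def)
  have nz: "basis_wave b \<noteq> (0 :: 'n l2)" for b
    using norm_basis_wave[of b] by force
  have nrm: "(norm (\<Sum>i\<in>I. cscale (c (?\<beta> i)) (basis_wave (?\<beta> i))))\<^sup>2 = sum t I" if "finite I" for I
    using orthofamily_norm_sum[OF that of, of "\<lambda>i. c (?\<beta> i)"] by (simp add: nz t_def)
  have bd: "sum t {..<n} \<le> K" for n
    using K[of "?\<beta> ` {..<n}"] by (simp add: sum.reindex inj_enum_basis t_def)
  have sm: "summable t"
    by (rule summableI_nonneg_bounded[OF _ bd]) (simp add: t_def)
  have "Cauchy s"
  proof (rule metric_CauchyI)
    fix e :: real assume e: "e > 0"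
    have "Cauchy (\<lambda>n. sum t {..<n})"
      using sm by (simp add: summable_iff_convergent convergent_Cauchy)
    then obtain M where M: "\<And>m n. m \<ge> M \<Longrightarrow> n \<ge> M \<Longrightarrow> dist (sum t {..<m}) (sum t {..<n}) < e\<^sup>2"
      using e unfolding Cauchy_def by (metis zero_less_power)
    have *: "dist (s m) (s n) < e" if "m \<ge> M" "n \<ge> m" for m n
    proof -
      have "s n - s m = (\<Sum>i\<in>{m..<n}. cscale (c (?\<beta> i)) (basis_wave (?\<beta> i)))"
        unfolding s_def using sum_diff_nat_ivl[of 0 m n] that by (simp add: atLeast0LessThan)
      then have "(norm (s n - s m))\<^sup>2 = sum t {m..<n}" by (simp add: nrm)
      also have "\<dots> = sum t {..<n} - sum t {..<m}"
        using sum_diff_nat_ivl[of 0 m n t] that by (simp add: atLeast0LessThan)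
      also have "\<dots> < e\<^sup>2"
        using M[of n m] that by (auto simp: dist_real_def)
      finally have "norm (s n - s m) < e"
        using e by (simp add: power_less_imp_less_base)
      then show ?thesis by (simp add: dist_norm norm_minus_commute)
    qed
    have "dist (s m) (s n) < e" if "m \<ge> M" "n \<ge> M" for m n
      using *[of m n] *[of n m] that by (cases "m \<le> n") (auto simp: dist_commute)
    then show "\<exists>M. \<forall>m\<ge>M. \<forall>n\<ge>M. dist (s m) (s n) < e" by blast
  qed
  then obtain w where w: "s \<longlonglongrightarrow> w" using Cauchy_convergent convergentD by blast
  have coef: "cinner (basis_wave b) w = c b" for b
  proof (rule LIMSEQ_unique)
    show "(\<lambda>n. cinner (basis_wave b) (s n)) \<longlonglongrightarrow> cinner (basis_wave b) w"
      by (intro tendsto_intros w)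
    obtain j where j: "b = ?\<beta> j" using bij_enum_basis by (metis bij_pointE)
    have "cinner (basis_wave b) (s n) = c b" if "n > j" for n
      unfolding s_def j using orthofamily_cinner_sum[OF _ of, of "{..<n}" j "\<lambda>i. c (?\<beta> i)"] that
      by (simp add: nz)
    then show "(\<lambda>n. cinner (basis_wave b) (s n)) \<longlonglongrightarrow> c b"
      by (intro tendsto_eventually) (auto simp: eventually_sequentially intro!: exI[of _ "Suc j"])
  qed
  have "(\<lambda>n. (norm (s n))\<^sup>2) \<longlonglongrightarrow> (norm w)\<^sup>2"
    by (intro tendsto_intros w)
  then have sums: "t sums (norm w)\<^sup>2"
    by (simp add: sums_def s_def nrm)
  then have "(norm w)\<^sup>2 \<le> K"
    unfolding sums_def by (rule LIMSEQ_le_const2) (use bd in auto)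
  then show thesis
    using that[OF coef _ w[unfolded s_def] sums[unfolded t_def]] by blast
qed

text \<open>\<open>l2_of_coeffs\<close> yields some w that has the coefficients of u and is the sum
  of its own expansion; totality of the basis identifies w with u.\<close>

lemma basis_expansion_sums:
  "(\<lambda>i. cscale (cinner (basis_wave (enum_basis i)) u) (basis_wave (enum_basis i))) sums u"
    (is ?A)
  and parseval_sums: "(\<lambda>i. (cmod (cinner (basis_wave (enum_basis i)) u))\<^sup>2) sums (norm u)\<^sup>2" (is ?B)
proof -
  obtain w where w: "\<And>b. cinner (basis_wave b) w = cinner (basis_wave b) u"
    "(\<lambda>n. \<Sum>i<n. cscale (cinner (basis_wave (enum_basis i)) u) (basis_wave (enum_basis i))) \<longlonglongrightarrow> w"
    "(\<lambda>i. (cmod (cinner (basis_wave (enum_basis i)) u))\<^sup>2) sums (norm w)\<^sup>2"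
    by (rule l2_of_coeffs[of "\<lambda>b. cinner (basis_wave b) u" "(norm u)\<^sup>2"],
      rule bessel[OF _ orthofamily_basis_wave], assumption, blast)
  have "w - u = 0"
    by (rule basis_wave_total) (simp add: cinner_diff_right w)
  with w show ?A ?B by (simp_all add: sums_def)
qed

lemma sums_imp_has_sum_basis:
  fixes f :: "int \<times> 'n::finite \<Rightarrow> 'b::banach"
  assumes "summable (\<lambda>i. norm (f (enum_basis i)))" "(\<lambda>i. f (enum_basis i)) sums S"
  shows "(f has_sum S) UNIV"
  using norm_summable_imp_has_sum[OF assms] has_sum_reindex_bij_betw[OF bij_enum_basis, of f S] by simp

lemma parseval: "((\<lambda>b. (cmod (cinner (basis_wave b) u))\<^sup>2) has_sum (norm u)\<^sup>2) UNIV"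
  by (rule sums_imp_has_sum_basis) (use parseval_sums[of u] in \<open>simp_all add: sums_iff\<close>)

lemma parseval_cinner_abs:
  "(\<lambda>b. cmod (cnj (cinner (basis_wave b) u) * cinner (basis_wave b) v)) summable_on UNIV" (is ?A)
  "(\<Sum>\<^sub>\<infinity>b. cmod (cnj (cinner (basis_wave b) u) * cinner (basis_wave b) v)) \<le> norm u * norm v" (is ?B)
proof -
  have fin: "(\<Sum>b\<in>F. cmod (cnj (cinner (basis_wave b) u) * cinner (basis_wave b) v)) \<le> norm u * norm v"
    if "finite F" for F
  proof -
    have "(\<Sum>b\<in>F. cmod (cnj (cinner (basis_wave b) u) * cinner (basis_wave b) v))
        = (\<Sum>b\<in>F. cmod (cinner (basis_wave b) u) * cmod (cinner (basis_wave b) v))"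
      by (simp add: norm_mult)
    also have "\<dots> \<le> L2_set (\<lambda>b. cmod (cinner (basis_wave b) u)) F * L2_set (\<lambda>b. cmod (cinner (basis_wave b) v)) F"
      using L2_set_mult_ineq[of "\<lambda>b. cmod (cinner (basis_wave b) u)" "\<lambda>b. cmod (cinner (basis_wave b) v)" F] by simp
    also have "\<dots> \<le> norm u * norm v"
      unfolding L2_set_def
      by (intro mult_mono real_le_lsqrt bessel[OF that orthofamily_basis_wave]) (auto intro: sum_nonneg)
    finally show ?thesis .
  qed
  then show ?A
    by (intro nonneg_bdd_above_summable_on) (auto intro!: bdd_aboveI2[where M="norm u * norm v"])
  then show ?B
    by (rule infsum_le_finite_sums) (use fin in auto)
qed

lemma parseval_cinner:
  "((\<lambda>b. cnj (cinner (basis_wave b) u) * cinner (basis_wave b) v) has_sum cinner u v) UNIV"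
proof (rule sums_imp_has_sum_basis)
  have "(\<lambda>b. cmod (cnj (cinner (basis_wave b) u) * cinner (basis_wave b) v)) summable_on UNIV"
    using parseval_cinner_abs(1) .
  then have "(\<lambda>i. cmod (cnj (cinner (basis_wave (enum_basis i)) u) * cinner (basis_wave (enum_basis i)) v)) summable_on UNIV"
    using summable_on_reindex_bij_betw[OF bij_enum_basis, of "\<lambda>b. cmod (cnj (cinner (basis_wave b) u) * cinner (basis_wave b) v)"] by simp
  then show "summable (\<lambda>i. norm (cnj (cinner (basis_wave (enum_basis i)) u) * cinner (basis_wave (enum_basis i)) v))"
    by (rule summable_on_imp_summable)
  have "(\<lambda>n. cinner u (\<Sum>i<n. cscale (cinner (basis_wave (enum_basis i)) v) (basis_wave (enum_basis i)))) \<longlonglongrightarrow> cinner u v"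
    by (intro tendsto_intros) (use basis_expansion_sums[of v] in \<open>simp add: sums_def\<close>)
  then show "(\<lambda>i. cnj (cinner (basis_wave (enum_basis i)) u) * cinner (basis_wave (enum_basis i)) v) sums cinner u v"
    by (simp add: sums_def cinner_sum_right cinner_cscale_right cinner_commute[symmetric] mult.commute)
qed

lemma bop_eq_on_basis:
  fixes S T :: "'n::finite bop"
  assumes "\<And>b. app S (basis_wave b) = app T (basis_wave b)"
  shows "S = T"
proof (rule bop_eqI)
  fix u :: "'n l2"
  have *: "(\<lambda>n. app R (\<Sum>i<n. cscale (cinner (basis_wave (enum_basis i)) u) (basis_wave (enum_basis i)))) \<longlonglongrightarrow> app R u" for R :: "'n bop"
    by (intro tendsto_intros) (use basis_expansion_sums[of u] in \<open>simp add: sums_def\<close>)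
  have "app S (\<Sum>i<n. cscale (cinner (basis_wave (enum_basis i)) u) (basis_wave (enum_basis i)))
      = app T (\<Sum>i<n. cscale (cinner (basis_wave (enum_basis i)) u) (basis_wave (enum_basis i)))" for n
    by (simp add: app_sum_right app_cscale assms)
  then show "app S u = app T u" using *[of S] *[of T] LIMSEQ_unique by auto
qed

section \<open>Adjoints\<close>

lemma cinner_eqI: "(\<And>v. cinner v u = cinner v w) \<Longrightarrow> u = w"
  by (metis cinner_diff_right basis_wave_total right_minus_eq)

text \<open>Riesz representation: the would-be coefficients of w are square summable, as testing T
  on their own finite combinations shows.\<close>

lemma adjoint_vector_exists: "\<exists>w. \<forall>v. cinner (app T v) u = cinner v w"
proof -
  define c where "c b = cinner (app T (basis_wave b)) u" for b
  have "(\<Sum>b\<in>F. (cmod (c b))\<^sup>2) \<le> (norm T * norm u)\<^sup>2" if F: "finite F" for F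
  proof -
    \<comment> \<open>With q the sum of the squares, s has norm sqrt q and the inner product of T s
      with u equals q, so that q is at most |T| |u| sqrt q.\<close>
    define s where "s = (\<Sum>b\<in>F. cscale (c b) (basis_wave b))"
    define q where "q = (\<Sum>b\<in>F. (cmod (c b))\<^sup>2)"
    have nz: "basis_wave b \<noteq> (0 :: 'a l2)" for b
      using norm_basis_wave[of b] by force
    have q0: "q \<ge> 0" by (simp add: q_def sum_nonneg)
    have ns: "(norm s)\<^sup>2 = q"
      unfolding s_def q_def orthofamily_norm_sum[OF F orthofamily_basis_wave] by (simp add: nz)
    have "cinner (app T s) u = of_real q"
      by (simp add: s_def q_def app_sum_right app_cscale cinner_sum_left cinner_cscale_left c_def[symmetric]
          mult_cnj_self)
    then have "q \<le> norm (app T s) * norm u"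
      using cmod_cinner_le[of "app T s" u] q0 by simp
    also have "\<dots> \<le> (norm T * norm s) * norm u"
      by (intro mult_right_mono norm_app) simp
    finally have "q \<le> (norm T * norm u) * norm s" by (simp add: mult_ac)
    then have "q\<^sup>2 \<le> ((norm T * norm u) * norm s)\<^sup>2"
      using q0 by (intro power_mono)
    then have "q * q \<le> (norm T * norm u)\<^sup>2 * q"
      by (simp add: power_mult_distrib ns power2_eq_square[of q])
    then show ?thesis
      using q0 by (cases "q = 0") (auto simp: q_def[symmetric])
  qed
  then have "\<exists>w. \<forall>b. cinner (basis_wave b) w = c b"
    by (rule l2_of_coeffs) auto
  then obtain w where w: "\<And>b. cinner (basis_wave b) w = c b" by blast
  have "cinner (app T v) u = cinner v w" for v
  proof (rule LIMSEQ_unique)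
    let ?s = "\<lambda>n. \<Sum>i<n. cscale (cinner (basis_wave (enum_basis i)) v) (basis_wave (enum_basis i))"
    have s: "?s \<longlonglongrightarrow> v" using basis_expansion_sums[of v] by (simp add: sums_def)
    then show "(\<lambda>n. cinner (app T (?s n)) u) \<longlonglongrightarrow> cinner (app T v) u"
      by (intro tendsto_intros)
    have "cinner (app T (?s n)) u = cinner (?s n) w" for n
      by (simp add: app_sum_right app_cscale cinner_sum_left cinner_cscale_left w c_def)
    moreover have "(\<lambda>n. cinner (?s n) w) \<longlonglongrightarrow> cinner v w"
      using s by (intro tendsto_intros)
    ultimately show "(\<lambda>n. cinner (app T (?s n)) u) \<longlonglongrightarrow> cinner v w" by simp
  qed
  then show ?thesis by blast
qed

lemma cinner_adj: "cinner (app (adj T) u) v = cinner u (app T v)"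
proof -
  obtain f where f: "\<And>u v. cinner (app T v) u = cinner v (f u)"
    using adjoint_vector_exists[of T] by metis
  have "\<exists>S. \<forall>u. app S u = f u"
  proof -
    have "norm (f u) \<le> norm T * norm u" for u
    proof -
      have "(norm (f u))\<^sup>2 = cmod (cinner (f u) (f u))" by (simp only: cinner_self norm_of_real) simp
      also have "\<dots> = cmod (cinner (app T (f u)) u)" by (simp add: f)
      also have "\<dots> \<le> norm (app T (f u)) * norm u" by (rule cmod_cinner_le)
      also have "\<dots> \<le> (norm T * norm (f u)) * norm u" by (intro mult_right_mono norm_app) simp
      finally have "norm (f u) * norm (f u) \<le> (norm T * norm u) * norm (f u)"
        by (simp add: power2_eq_square mult_ac)
      then show ?thesis by (cases "f u = 0") auto
    qed
    moreover have "f (u + v) = f u + f v" for u v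
      by (rule cinner_eqI) (simp add: cinner_add_right f[symmetric])
    moreover have "f (cscale c u) = cscale c (f u)" for c u
      by (rule cinner_eqI) (simp add: cinner_cscale_right f[symmetric])
    ultimately show ?thesis using bop_exists[of f "norm T"] by metis
  qed
  then obtain S where S: "\<And>u. app S u = f u" by blast
  have ex: "\<forall>u v. cinner (app S u) v = cinner u (app T v)"
    by (metis S f cinner_commute)
  have "\<forall>u v. cinner (app (adj T) u) v = cinner u (app T v)"
    unfolding adj_def
  proof (rule theI[where a=S])
    show "\<forall>u v. cinner (app S u) v = cinner u (app T v)" by (rule ex)
    fix R assume R: "\<forall>u v. cinner (app R u) v = cinner u (app T v)"
    show "R = S"
      by (rule bop_eqI, rule cinner_eqI) (metis R ex cinner_commute)
  qed
  then show ?thesis by blast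
qed

lemma cinner_adj_right: "cinner u (app (adj T) v) = cinner (app T u) v"
  by (metis cinner_adj cinner_commute)

lemma adj_unique: "(\<And>u v. cinner (app S u) v = cinner u (app T v)) \<Longrightarrow> adj T = S"
  by (rule bop_eqI, rule cinner_eqI) (metis cinner_adj cinner_commute)

lemma adj_adj [simp]: "adj (adj T) = T"
  by (rule adj_unique) (simp add: cinner_adj_right)

lemma adj_mult: "adj (S * T) = adj T * adj S"
  by (rule adj_unique) (simp add: app_times cinner_adj)

lemma adj_add: "adj (S + T) = adj S + adj T"
  by (rule adj_unique) (simp add: app_add cinner_adj cinner_add_left cinner_add_right)

lemma adj_diff: "adj (S - T) = adj S - adj T"
  by (rule adj_unique) (simp add: app_diff cinner_adj cinner_diff_left cinner_diff_right)

lemma adj_one [simp]: "adj 1 = 1"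
  by (rule adj_unique) (simp add: app_one)

lemma adj_scaleR: "adj (r *\<^sub>R T) = r *\<^sub>R adj T"
  by (rule adj_unique) (simp add: app_scaleR cinner_adj cinner_scaleR_right flip: cscale_of_real add: cinner_cscale_left cinner_cscale_right)

lemma norm_adj_le: "norm (adj T) \<le> norm T"
proof (rule norm_bop_le)
  fix u
  have "(norm (app (adj T) u))\<^sup>2 = cmod (cinner (app (adj T) u) (app (adj T) u))"
    by (simp only: cinner_self norm_of_real) simp
  also have "\<dots> = cmod (cinner u (app T (app (adj T) u)))" by (simp add: cinner_adj)
  also have "\<dots> \<le> norm u * norm (app T (app (adj T) u))" by (rule cmod_cinner_le)
  also have "\<dots> \<le> norm u * (norm T * norm (app (adj T) u))" by (intro mult_left_mono norm_app) simp
  finally have "norm (app (adj T) u) * norm (app (adj T) u) \<le> (norm T * norm u) * norm (app (adj T) u)"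
    by (simp add: power2_eq_square mult_ac)
  then show "norm (app (adj T) u) \<le> norm T * norm u" by (cases "app (adj T) u = 0") auto
qed simp

lemma norm_adj [simp]: "norm (adj T) = norm T"
  using norm_adj_le[of T] norm_adj_le[of "adj T"] by simp

section \<open>The polarisation\<close>

text \<open>A diagonal operator with coefficients of modulus one; its values are defined by their
  Fourier coefficients.\<close>

lemma pol_exists:
  obtains E :: "'n::finite bop" where "\<And>v k. app E (wave v k) = (if k \<ge> 0 then wave v k else - wave v k)"
proof -
  define s :: "int \<times> 'n \<Rightarrow> complex" where "s b = (if fst b \<ge> 0 then 1 else - 1)" for b
  have s: "cmod (s b) = 1" for b by (simp add: s_def)
  have "\<exists>w. (\<forall>b. cinner (basis_wave b) w = s b * cinner (basis_wave b) u) \<and> (norm w)\<^sup>2 \<le> (norm u)\<^sup>2" for u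
    using l2_of_coeffs[of "\<lambda>b. s b * cinner (basis_wave b) u" "(norm u)\<^sup>2"] bessel[OF _ orthofamily_basis_wave]
    by (metis (no_types, lifting) norm_mult s mult_1_left sum.cong)
  then obtain f where f: "\<And>u b. cinner (basis_wave b) (f u) = s b * cinner (basis_wave b) u"
    "\<And>u. (norm (f u))\<^sup>2 \<le> (norm u)\<^sup>2" by metis
  have eqI: "u = w" if "\<And>b. cinner (basis_wave b) u = cinner (basis_wave b) w" for u w :: "'n l2"
    using basis_wave_total[of "u - w"] that by (simp add: cinner_diff_right)
  have "f (u + v) = f u + f v" for u v
    by (rule eqI) (simp add: cinner_add_right f distrib_left)
  moreover have "f (cscale c u) = cscale c (f u)" for c u
    by (rule eqI) (simp add: cinner_cscale_right f mult.left_commute)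
  moreover have "norm (f u) \<le> 1 * norm u" for u
    using f(2)[of u] by (simp add: power2_le_iff_abs_le)
  ultimately obtain E where E: "\<And>u. app E u = f u" using bop_exists[of f 1] by metis
  have "app E (wave v k) = (if k \<ge> 0 then wave v k else - wave v k)" for v k
  proof (rule eqI)
    fix b :: "int \<times> 'n"
    have "cinner (basis_wave b) (app E (wave v k)) = s b * cinner (basis_wave b) (wave v k)"
      by (simp add: E f)
    also have "\<dots> = cinner (basis_wave b) (if k \<ge> 0 then wave v k else - wave v k)"
      by (cases b) (auto simp: s_def basis_wave_def cinner_wave cinner_minus_right)
    finally show "cinner (basis_wave b) (app E (wave v k)) = cinner (basis_wave b) (if k \<ge> 0 then wave v k else - wave v k)" .
  qed
  then show thesis by (rule that)
qed

lemma app_pol_wave: "app pol (wave v k) = (if k \<ge> 0 then wave v k else - wave v k)"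
proof -
  obtain E :: "'a bop" where E: "\<And>v k. app E (wave v k) = (if k \<ge> 0 then wave v k else - wave v k)"
    using pol_exists by blast
  have "\<forall>v k. app (pol :: 'a bop) (wave v k) = (if k \<ge> 0 then wave v k else - wave v k)"
    unfolding pol_def
  proof (rule theI[where a=E])
    show "\<forall>v k. app E (wave v k) = (if 0 \<le> k then wave v k else - wave v k)" using E by blast
    fix E' :: "'a bop" assume E': "\<forall>v k. app E' (wave v k) = (if 0 \<le> k then wave v k else - wave v k)"
    show "E' = E" by (rule bop_eq_on_basis) (auto simp: basis_wave_def E E')
  qed
  then show ?thesis by blast
qed

lemma app_pol_basis: "app pol (basis_wave b) = (if fst b \<ge> 0 then basis_wave b else - basis_wave b)"
  by (cases b) (simp add: basis_wave_def app_pol_wave)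

lemma pol_pol [simp]: "pol * pol = 1"
  by (rule bop_eq_on_basis) (simp add: app_times app_pol_basis app_one flip: cscale_minus_one add: app_cscale cscale_cscale cscale_one)

lemma cinner_pol: "cinner (basis_wave b) (app pol u) = (if fst b \<ge> 0 then 1 else -1) * cinner (basis_wave b) u"
proof (rule LIMSEQ_unique)
  let ?s = "\<lambda>n. \<Sum>i<n. cscale (cinner (basis_wave (enum_basis i)) u) (basis_wave (enum_basis i))"
  have s: "?s \<longlonglongrightarrow> u" using basis_expansion_sums[of u] by (simp add: sums_def)
  show "(\<lambda>n. cinner (basis_wave b) (app pol (?s n))) \<longlonglongrightarrow> cinner (basis_wave b) (app pol u)"
    using s by (intro tendsto_intros)
  have *: "cinner (basis_wave b) (app pol (basis_wave c)) = (if fst b \<ge> 0 then 1 else -1) * cinner (basis_wave b) (basis_wave c)" for c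
    by (auto simp: app_pol_basis cinner_minus_right cinner_basis_wave)
  have "cinner (basis_wave b) (app pol (?s n)) = (if fst b \<ge> 0 then 1 else -1) * cinner (basis_wave b) (?s n)" for n
    by (simp add: app_sum_right app_cscale cinner_sum_right cinner_cscale_right * sum_distrib_left sum_negf mult.left_commute del: cinner_basis_wave)
  moreover have "(\<lambda>n. (if fst b \<ge> 0 then 1 else -1) * cinner (basis_wave b) (?s n)) \<longlonglongrightarrow> (if fst b \<ge> 0 then 1 else -1) * cinner (basis_wave b) u"
    using s by (intro tendsto_intros)
  ultimately show "(\<lambda>n. cinner (basis_wave b) (app pol (?s n))) \<longlonglongrightarrow> (if fst b \<ge> 0 then 1 else -1) * cinner (basis_wave b) u" by simp
qed

section \<open>Continuous functional calculus for positive operators\<close>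

definition positive_op :: "'n::finite bop \<Rightarrow> bool" where
  "positive_op A \<longleftrightarrow> adj A = A \<and> (\<forall>u. 0 \<le> Re (cinner u (app A u)))"

lemma cinner_self_adjoint: "adj A = A \<Longrightarrow> cinner (app A u) v = cinner u (app A v)"
  by (metis cinner_adj)

lemma positive_op_one: "positive_op 1"
  by (simp add: positive_op_def app_one Re_cinner)

lemma positive_op_add: "positive_op A \<Longrightarrow> positive_op B \<Longrightarrow> positive_op (A + B)"
  by (simp add: positive_op_def adj_add app_add cinner_add_right)

lemma positive_op_zero: "positive_op 0"
  using adj_scaleR[of 0 0] by (simp add: positive_op_def)

lemma positive_op_scaleR: "0 \<le> c \<Longrightarrow> positive_op A \<Longrightarrow> positive_op (c *\<^sub>R A)"
  by (simp add: positive_op_def adj_scaleR app_scaleR cinner_scaleR_right)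

lemma positive_op_sum: "(\<And>i. i \<in> I \<Longrightarrow> positive_op (f i)) \<Longrightarrow> positive_op (\<Sum>i\<in>I. f i)"
  by (induction I rule: infinite_finite_induct) (simp_all add: positive_op_zero positive_op_add)

lemma positive_op_conj: "adj S = S \<Longrightarrow> positive_op A \<Longrightarrow> positive_op (S * A * S)"
  by (simp add: positive_op_def adj_mult app_times mult.assoc flip: cinner_self_adjoint[of S])

lemma positive_op_adj_mult: "positive_op (adj T * T)"
  by (simp add: positive_op_def adj_mult app_times cinner_adj_right Re_cinner)

lemma adj_power: "adj (A ^ n) = adj A ^ n"
  by (induction n) (simp_all add: adj_mult power_commutes)

lemma tendsto_positive_op:
  assumes "X \<longlonglongrightarrow> A" "\<And>n. positive_op (X n)"
  shows "positive_op A"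
proof -
  have "cinner (app A u) v = cinner u (app A v)" for u v
  proof (rule LIMSEQ_unique)
    show "(\<lambda>n. cinner (app (X n) u) v) \<longlonglongrightarrow> cinner (app A u) v"
      by (intro tendsto_intros assms)
    have "cinner (app (X n) u) v = cinner u (app (X n) v)" for n
      using assms(2)[of n] by (simp add: positive_op_def cinner_self_adjoint)
    moreover have "(\<lambda>n. cinner u (app (X n) v)) \<longlonglongrightarrow> cinner u (app A v)"
      by (intro tendsto_intros assms)
    ultimately show "(\<lambda>n. cinner (app (X n) u) v) \<longlonglongrightarrow> cinner u (app A v)" by simp
  qed
  then have "adj A = A" by (intro adj_unique)
  moreover have "0 \<le> Re (cinner u (app A u))" for u
  proof (rule LIMSEQ_le_const)
    show "(\<lambda>n. Re (cinner u (app (X n) u))) \<longlonglongrightarrow> Re (cinner u (app A u))"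
      by (intro tendsto_intros assms)
    show "\<exists>N. \<forall>n\<ge>N. 0 \<le> Re (cinner u (app (X n) u))"
      using assms(2) by (simp add: positive_op_def)
  qed
  ultimately show ?thesis by (simp add: positive_op_def)
qed

lemma poly_op_altdef: "degree P \<le> n \<Longrightarrow> poly_op P A = (\<Sum>i\<le>n. coeff P i *\<^sub>R A ^ i)"
  unfolding poly_op_def by (rule sum.mono_neutral_left) (auto simp: coeff_eq_0)

lemma poly_op_add: "poly_op (P + Q) A = poly_op P A + poly_op Q A"
proof -
  let ?n = "max (degree P) (degree Q)"
  show ?thesis
    using poly_op_altdef[of P ?n A] poly_op_altdef[of Q ?n A] poly_op_altdef[of "P + Q" ?n A] degree_add_le_max[of P Q]
    by (simp add: scaleR_left_distrib sum.distrib)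
qed

lemma poly_op_smult: "poly_op (smult c P) A = c *\<^sub>R poly_op P A"
  using poly_op_altdef[of "smult c P" "degree P" A] degree_smult_le[of c P]
  by (simp add: poly_op_def scaleR_sum_right)

lemma poly_op_diff: "poly_op (P - Q) A = poly_op P A - poly_op Q A"
  using poly_op_add[of "P - Q" Q A] by simp

lemma poly_op_zero [simp]: "poly_op 0 A = 0"
  by (simp add: poly_op_def)

lemma poly_op_pCons: "poly_op (pCons a P) A = a *\<^sub>R 1 + A * poly_op P A"
proof -
  have "poly_op (pCons a P) A = (\<Sum>i\<le>Suc (degree P). coeff (pCons a P) i *\<^sub>R A ^ i)"
    by (rule poly_op_altdef) (simp add: degree_pCons_le)
  also have "\<dots> = a *\<^sub>R 1 + A * poly_op P A"
    by (simp add: sum.atMost_Suc_shift poly_op_def sum_distrib_left del: sum.atMost_Suc)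
  finally show ?thesis .
qed

lemma poly_op_mult: "poly_op (P * Q) A = poly_op P A * poly_op Q A"
  by (induction P) (simp_all add: poly_op_add poly_op_smult poly_op_pCons distrib_right mult.assoc)

lemma poly_op_one [simp]: "poly_op 1 A = 1"
  by (simp add: poly_op_pCons one_pCons)

lemma poly_op_power: "poly_op (P ^ n) A = poly_op P A ^ n"
  by (induction n) (simp_all add: poly_op_mult)

lemma poly_op_sum: "poly_op (\<Sum>i\<in>I. f i) A = (\<Sum>i\<in>I. poly_op (f i) A)"
  by (induction I rule: infinite_finite_induct) (simp_all add: poly_op_add)

lemma poly_op_monom: "poly_op (monom c n) A = c *\<^sub>R A ^ n"
  by (induction n arbitrary: c) (simp_all add: monom_Suc poly_op_pCons monom_0)

lemma adj_poly_op: "adj A = A \<Longrightarrow> adj (poly_op P A) = poly_op P A"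
proof (induction P)
  case 0
  then show ?case using adj_scaleR[of 0 0] by simp
next
  case (pCons a P)
  have "poly_op P A * A = A * poly_op P A"
    using poly_op_mult[of P "[:0,1:]" A] poly_op_mult[of "[:0,1:]" P A] by (simp add: poly_op_pCons mult.commute)
  then show ?case using pCons by (simp add: poly_op_pCons adj_add adj_mult adj_scaleR)
qed

section \<open>Bernstein operators and positivity of polynomials of a positive operator\<close>

text \<open>The terms of the Bernstein approximants on the interval \<open>[0, M]\<close>.\<close>

definition bernstein_op :: "real \<Rightarrow> 'n::finite bop \<Rightarrow> nat \<Rightarrow> nat \<Rightarrow> 'n bop" where
  "bernstein_op M A n k = (real (n choose k) / M ^ n) *\<^sub>R (A ^ k * (M *\<^sub>R 1 - A) ^ (n - k))"

text \<open>The binomial theorem is stated for commutative rings, so it is applied to the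
  polynomials x and M - x and then transported by \<open>poly_op\<close>.\<close>

lemma sum_bernstein_op:
  assumes "M > 0" shows "(\<Sum>k\<le>n. bernstein_op M A n k) = 1"
proof -
  have "(\<Sum>k\<le>n. bernstein_op M A n k)
      = poly_op (smult (1 / M ^ n) (\<Sum>k\<le>n. of_nat (n choose k) * [:0,1:] ^ k * [:M,-1:] ^ (n - k))) A"
    by (simp add: poly_op_smult poly_op_sum poly_op_mult poly_op_power poly_op_pCons scaleR_sum_right
        bernstein_op_def of_nat_poly scaleR_right_diff_distrib)
  also have "(\<Sum>k\<le>n. of_nat (n choose k) * [:0,1:] ^ k * [:M,-1:] ^ (n - k)) = [:M:] ^ n"
    by (subst binomial_ring[symmetric]) simp
  also have "poly_op (smult (1 / M ^ n) ([:M:] ^ n)) A = 1"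
    using assms by (simp add: poly_op_smult poly_op_power poly_op_pCons scaleR_power)
  finally show ?thesis .
qed

text \<open>The absorption identity (k + 1) binom(n + 1, k + 1) = (n + 1) binom(n, k) trades one
  factor of the node for a factor A and lowers the degree; g is the part of the function that
  remains.\<close>

lemma bernstein_shift:
  assumes "M > 0"
  shows "(\<Sum>k\<le>Suc n. (g (real k * M / real (Suc n)) * (real k * M / real (Suc n))) *\<^sub>R bernstein_op M A (Suc n) k)
    = A * (\<Sum>k\<le>n. g ((real n * (real k * M / real n) + M) / real (Suc n)) *\<^sub>R bernstein_op M A n k)"
proof -
  have "(\<Sum>k\<le>Suc n. (g (real k * M / real (Suc n)) * (real k * M / real (Suc n))) *\<^sub>R bernstein_op M A (Suc n) k)
      = (\<Sum>k\<le>n. (g (real (Suc k) * M / real (Suc n)) * (real (Suc k) * M / real (Suc n))) *\<^sub>R bernstein_op M A (Suc n) (Suc k))"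
    by (subst sum.atMost_Suc_shift) simp
  also have "\<dots> = (\<Sum>k\<le>n. A * (g ((real n * (real k * M / real n) + M) / real (Suc n)) *\<^sub>R bernstein_op M A n k))"
  proof (rule sum.cong[OF refl])
    fix k assume k: "k \<in> {..n}"
    \<comment> \<open>For n = 0 only k = 0 occurs, and the quotient by zero is 0.\<close>
    have node: "real n * (real k * M / real n) + M = real (Suc k) * M"
      using k by (cases "n = 0") (auto simp: algebra_simps)
    have "real (Suc k) * real (Suc n choose Suc k) = real (Suc n) * real (n choose k)"
      using Suc_times_binomial_eq[of n k] by (metis of_nat_mult mult.commute)
    then have "(real (Suc k) * M / real (Suc n)) * (real (Suc n choose Suc k) / M ^ Suc n) = real (n choose k) / M ^ n"
      using assms by (simp add: divide_simps del: of_nat_Suc binomial_Suc_Suc)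
    then have "(g (real (Suc k) * M / real (Suc n)) * (real (Suc k) * M / real (Suc n))) *\<^sub>R bernstein_op M A (Suc n) (Suc k)
        = (g (real (Suc k) * M / real (Suc n)) * (real (n choose k) / M ^ n)) *\<^sub>R (A ^ Suc k * (M *\<^sub>R 1 - A) ^ (n - k))"
      unfolding bernstein_op_def scaleR_scaleR by (simp only: mult.assoc diff_Suc_Suc)
    then show "(g (real (Suc k) * M / real (Suc n)) * (real (Suc k) * M / real (Suc n))) *\<^sub>R bernstein_op M A (Suc n) (Suc k)
        = A * (g ((real n * (real k * M / real n) + M) / real (Suc n)) *\<^sub>R bernstein_op M A n k)"
      unfolding node by (simp add: bernstein_op_def mult.assoc del: of_nat_Suc)
  qed
  finally show ?thesis by (simp add: sum_distrib_left)
qed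

text \<open>Induction on d. The shift lemma extracts A and leaves the power d - 1 of (n x + M)/(n +
  1); in its binomial expansion only the top coefficient survives in the limit.\<close>

lemma bernstein_power_tendsto:
  assumes "M > 0"
  shows "(\<lambda>n. \<Sum>k\<le>n. ((real k * M / real n) ^ d) *\<^sub>R bernstein_op M A n k) \<longlonglongrightarrow> A ^ d"
proof (induction d rule: less_induct)
  case (less d)
  show ?case
  proof (cases d)
    case 0
    then show ?thesis by (simp add: sum_bernstein_op[OF assms])
  next
    case (Suc e)
    let ?L = "\<lambda>n i. \<Sum>k\<le>n. ((real k * M / real n) ^ i) *\<^sub>R bernstein_op M A n k"
    define w where "w n i = real (e choose i) * (real n / real (Suc n)) ^ i * (M / real (Suc n)) ^ (e - i)" for n i
    have L: "?L (Suc n) d = A * (\<Sum>i\<le>e. w n i *\<^sub>R ?L n i)" for n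
    proof -
      have "((real n * x + M) / real (Suc n)) ^ e = (\<Sum>i\<le>e. w n i * x ^ i)" for x
      proof -
        have "((real n * x + M) / real (Suc n)) ^ e = (real n / real (Suc n) * x + M / real (Suc n)) ^ e"
          by (simp add: add_divide_distrib)
        also have "\<dots> = (\<Sum>i\<le>e. w n i * x ^ i)"
          unfolding binomial_ring w_def power_mult_distrib by (simp add: mult_ac)
        finally show ?thesis .
      qed
      then have "?L (Suc n) d = A * (\<Sum>k\<le>n. (\<Sum>i\<le>e. w n i * (real k * M / real n) ^ i) *\<^sub>R bernstein_op M A n k)"
        using bernstein_shift[OF assms, of "\<lambda>x. x ^ e" n A] unfolding Suc power_Suc2 by presburger
      also have "(\<Sum>k\<le>n. (\<Sum>i\<le>e. w n i * (real k * M / real n) ^ i) *\<^sub>R bernstein_op M A n k)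
          = (\<Sum>i\<le>e. w n i *\<^sub>R ?L n i)"
        unfolding scaleR_sum_left scaleR_sum_right by (subst sum.swap) simp
      finally show ?thesis .
    qed
    have "(\<lambda>n. A * (\<Sum>i\<le>e. w n i *\<^sub>R ?L n i)) \<longlonglongrightarrow> A * (\<Sum>i\<le>e. (real (e choose i) * 1 ^ i * 0 ^ (e - i)) *\<^sub>R A ^ i)"
      unfolding w_def
    proof (intro tendsto_intros)
      show "(\<lambda>n. real n / real (Suc n)) \<longlonglongrightarrow> 1"
        by (rule LIMSEQ_n_over_Suc_n)
      show "(\<lambda>n. M / real (Suc n)) \<longlonglongrightarrow> 0"
        using LIMSEQ_Suc[OF lim_const_over_n[of M]] by simp
      show "(\<lambda>n. ?L n i) \<longlonglongrightarrow> A ^ i" if "i \<in> {..e}" for i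
        using less.IH[of i] that Suc by simp
    qed
    moreover have "(\<Sum>i\<le>e. (real (e choose i) * 1 ^ i * 0 ^ (e - i)) *\<^sub>R A ^ i)
        = (\<Sum>i\<in>{e}. (real (e choose i) * 1 ^ i * 0 ^ (e - i)) *\<^sub>R A ^ i)"
      by (rule sum.mono_neutral_right) (auto simp: power_0_left)
    ultimately have "(\<lambda>n. ?L (Suc n) d) \<longlonglongrightarrow> A ^ d"
      unfolding L by (simp add: Suc)
    then show ?thesis by (rule LIMSEQ_imp_Suc)
  qed
qed

text \<open>Even powers are distributed to both sides, so that the product is a congruence S C S
  with C = 1, A, D or A D according to the parities of k and j.\<close>

lemma positive_op_commuting_powers:
  assumes A: "positive_op A" and D: "positive_op D" and c: "A * D = D * A" and AD: "positive_op (A * D)"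
  shows "positive_op (A ^ k * D ^ j)"
proof -
  have cp: "A ^ a * D ^ b = D ^ b * A ^ a" for a b
    by (metis c power_commuting_commutes)
  have sq: "positive_op (A ^ (a + a) * C * D ^ (b + b))"
    if C: "positive_op C" "A * C = C * A" "D * C = C * D" for a b C
  proof -
    have ca: "A ^ a * C = C * A ^ a" and cd: "D ^ b * C = C * D ^ b"
      using C by (auto intro: power_commuting_commutes)
    have "A ^ (a + a) * C * D ^ (b + b) = (A ^ a * D ^ b) * C * (A ^ a * D ^ b)"
    proof -
      have "(A ^ a * D ^ b) * C * (A ^ a * D ^ b) = A ^ a * (D ^ b * C) * A ^ a * D ^ b"
        by (simp add: mult.assoc)
      also have "\<dots> = A ^ a * C * (D ^ b * A ^ a) * D ^ b"
        by (simp add: cd mult.assoc)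
      also have "\<dots> = A ^ a * (C * A ^ a) * D ^ b * D ^ b"
        by (simp add: cp[symmetric] mult.assoc)
      also have "\<dots> = A ^ a * A ^ a * C * D ^ b * D ^ b"
        by (simp add: ca[symmetric] mult.assoc)
      finally show ?thesis by (simp add: power_add mult.assoc)
    qed
    moreover have "adj (A ^ a * D ^ b) = A ^ a * D ^ b"
      using A D by (simp add: positive_op_def adj_mult adj_power cp)
    ultimately show ?thesis using positive_op_conj C(1) by metis
  qed
  consider (ee) a b where "k = a + a" "j = b + b" | (oe) a b where "k = a + a + 1" "j = b + b"
    | (eo) a b where "k = a + a" "j = 1 + (b + b)" | (oo) a b where "k = a + a + 1" "j = 1 + (b + b)"
    by (metis add.commute even_iff_mod_2_eq_zero mult_2 oddE evenE)
  then show ?thesis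
  proof cases
    case ee then show ?thesis using sq[OF positive_op_one, of a b] by simp
  next
    case oe then show ?thesis using sq[OF A refl c[symmetric], of a b] oe
      by (simp only: power_Suc2 Suc_eq_plus1[symmetric])
  next
    case eo then show ?thesis using sq[OF D, of a b] c by (simp add: power_add mult.assoc)
  next
    case oo
    have "A * (A * D) = A * D * A" "D * (A * D) = A * D * D" by (metis c mult.assoc)+
    moreover have "A ^ k = A ^ (a + a) * A"
      by (simp only: oo Suc_eq_plus1[symmetric] power_Suc2)
    moreover have "D ^ j = D * D ^ (b + b)"
      by (simp add: oo)
    ultimately show ?thesis using sq[OF AD, of a b] by (simp only: mult.assoc)
  qed
qed

lemma positive_op_norm_minus:
  assumes A: "positive_op A"
  shows "positive_op (norm A *\<^sub>R 1 - A)"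
proof -
  have "Re (cinner u (app A u)) \<le> norm A * (norm u * norm u)" for u
  proof -
    have "Re (cinner u (app A u)) \<le> cmod (cinner u (app A u))" by (rule complex_Re_le_cmod)
    also have "\<dots> \<le> norm u * norm (app A u)" by (rule cmod_cinner_le)
    also have "\<dots> \<le> norm u * (norm A * norm u)" by (intro mult_left_mono norm_app) simp
    finally show ?thesis by (simp add: mult_ac)
  qed
  then show ?thesis
    using A by (simp add: positive_op_def adj_diff adj_scaleR app_diff app_scaleR app_one
        cinner_diff_right cinner_scaleR_right cinner_self power2_eq_square)
qed

lemma positive_bernstein_op:
  assumes A: "positive_op A" and M: "norm A > 0"
  shows "positive_op (bernstein_op (norm A) A n k)"
proof -
  let ?M = "norm A" let ?D = "?M *\<^sub>R 1 - A"
  have D: "positive_op ?D" by (rule positive_op_norm_minus[OF A])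
  have c: "A * ?D = ?D * A" by (simp add: algebra_simps)
  \<comment> \<open>As A + D = M, the product A D is a positive multiple of a sum of two congruences
    of positive operators. This avoids square roots, which are obtained only later from the
    functional calculus.\<close>
  have "A * ?D * A + ?D * A * ?D = ?M *\<^sub>R (A * ?D)"
    by (simp add: algebra_simps)
  moreover have "positive_op (A * ?D * A + ?D * A * ?D)"
    using A D by (intro positive_op_add positive_op_conj) (auto simp: positive_op_def)
  ultimately have "positive_op (?M *\<^sub>R (A * ?D))" by (simp only:)
  then have "positive_op ((1 / ?M) *\<^sub>R (?M *\<^sub>R (A * ?D)))"
    by (rule positive_op_scaleR[rotated]) simp
  then have "positive_op (((1 / ?M) * ?M) *\<^sub>R (A * ?D))" by (simp only: scaleR_scaleR)
  moreover have "(1 / ?M) * ?M = 1" using M by simp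
  ultimately have "positive_op (A * ?D)" by (simp only: scaleR_one)
  then show ?thesis
    unfolding bernstein_op_def
    by (intro positive_op_scaleR positive_op_commuting_powers A D c) auto
qed

text \<open>The values of P at the nodes are nonnegative coefficients of positive Bernstein
  operators, and these combinations converge to P(A). This takes the place of the spectral
  theorem.\<close>

lemma positive_poly_op:
  assumes A: "positive_op A" and P: "\<And>x. 0 \<le> x \<Longrightarrow> x \<le> norm A \<Longrightarrow> 0 \<le> poly P x"
  shows "positive_op (poly_op P A)"
proof (cases "norm A > 0")
  case True
  let ?M = "norm A"
  show ?thesis
  proof (rule tendsto_positive_op)
    have "(\<lambda>n. \<Sum>i\<le>degree P. coeff P i *\<^sub>R (\<Sum>k\<le>n. ((real k * ?M / real n) ^ i) *\<^sub>R bernstein_op ?M A n k))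
        \<longlonglongrightarrow> poly_op P A"
      unfolding poly_op_def by (intro tendsto_intros bernstein_power_tendsto True)
    also have "(\<lambda>n. \<Sum>i\<le>degree P. coeff P i *\<^sub>R (\<Sum>k\<le>n. ((real k * ?M / real n) ^ i) *\<^sub>R bernstein_op ?M A n k))
        = (\<lambda>n. \<Sum>k\<le>n. poly P (real k * ?M / real n) *\<^sub>R bernstein_op ?M A n k)"
      unfolding scaleR_sum_right poly_altdef scaleR_sum_left by (subst sum.swap) simp
    finally show "(\<lambda>n. \<Sum>k\<le>n. poly P (real k * ?M / real n) *\<^sub>R bernstein_op ?M A n k) \<longlonglongrightarrow> poly_op P A" .
    fix n
    show "positive_op (\<Sum>k\<le>n. poly P (real k * ?M / real n) *\<^sub>R bernstein_op ?M A n k)"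
    proof (intro positive_op_sum positive_op_scaleR positive_bernstein_op A True P)
      fix k assume "k \<in> {..n}"
      then show "real k * ?M / real n \<le> ?M"
        by (cases "n = 0") (auto simp: divide_simps mult.commute[of _ ?M] mult_left_mono)
    qed simp_all
  qed
next
  case False
  then have "A = 0" by simp
  moreover have "0 \<le> coeff P 0" using P[of 0] by (simp add: poly_0_coeff_0)
  moreover have "poly_op P 0 = coeff P 0 *\<^sub>R (1 :: 'a bop)"
    by (cases P) (simp add: poly_op_pCons)
  ultimately show ?thesis by (simp add: positive_op_scaleR positive_op_one)
qed

text \<open>Positivity of s^2 - P^2 on the interval says that |P(A) u|^2 is at most s^2
  |u|^2.\<close>

lemma norm_poly_op_le:
  assumes A: "positive_op A" and P: "\<And>x. 0 \<le> x \<Longrightarrow> x \<le> norm A \<Longrightarrow> \<bar>poly P x\<bar> \<le> s"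
  shows "norm (poly_op P A) \<le> s"
proof (rule norm_bop_le)
  show s: "0 \<le> s" using P[of 0] by force
  fix u
  have "positive_op (poly_op ([:s\<^sup>2:] - P * P) A)"
    using P s by (intro positive_poly_op A) (simp add: power2_eq_square[symmetric] abs_le_square_iff[symmetric])
  then have "0 \<le> Re (cinner u (app (poly_op ([:s\<^sup>2:] - P * P) A) u))"
    by (simp add: positive_op_def)
  also have "\<dots> = s\<^sup>2 * (norm u)\<^sup>2 - Re (cinner (app (poly_op P A) u) (app (poly_op P A) u))"
    using A by (simp add: poly_op_diff poly_op_mult poly_op_pCons app_diff app_scaleR app_one app_times
        cinner_diff_right cinner_scaleR_right cinner_self_adjoint[OF adj_poly_op] positive_op_def Re_cinner power2_norm_eq_inner)
  finally have "(norm (app (poly_op P A) u))\<^sup>2 \<le> (s * norm u)\<^sup>2"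
    by (simp add: Re_cinner power2_norm_eq_inner[symmetric] power_mult_distrib)
  then show "norm (app (poly_op P A) u) \<le> s * norm u"
    using s by (rule_tac power2_le_imp_le) auto
qed

lemma poly_approximation:
  fixes f :: "real \<Rightarrow> real"
  assumes "continuous_on {0..M} f"
  obtains P where "uniform_limit {0..M} (\<lambda>n. poly (P n)) f sequentially"
proof -
  have "\<exists>P. \<forall>x\<in>{0..M}. \<bar>f x - poly P x\<bar> < e" if e: "e > 0" for e
  proof -
    obtain g where g: "real_polynomial_function g" "\<And>x. x \<in> {0..M} \<Longrightarrow> \<bar>f x - g x\<bar> < e"
      by (rule Stone_Weierstrass_real_polynomial_function[of "{0..M}" f e]) (use assms e in auto)
    obtain a n where "g = (\<lambda>x. \<Sum>i\<le>n. a i * x ^ i)"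
      using g(1) real_polynomial_function_imp_sum by blast
    then have "g = poly (\<Sum>i\<le>n. monom (a i) i)"
      by (auto simp: poly_sum poly_monom)
    with g show ?thesis by blast
  qed
  then have "\<exists>P. \<forall>x\<in>{0..M}. \<bar>f x - poly P x\<bar> < inverse (real (Suc n))" for n by simp
  then obtain P where P: "\<And>n x. x \<in> {0..M} \<Longrightarrow> \<bar>f x - poly (P n) x\<bar> < inverse (real (Suc n))"
    by metis
  have "uniform_limit {0..M} (\<lambda>n. poly (P n)) f sequentially"
  proof (rule uniform_limitI)
    fix e :: real assume "0 < e"
    with LIMSEQ_inverse_real_of_nat have "\<forall>\<^sub>F n in sequentially. inverse (real (Suc n)) < e"
      by (rule order_tendstoD)
    then show "\<forall>\<^sub>F n in sequentially. \<forall>x\<in>{0..M}. dist (poly (P n) x) (f x) < e"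
    proof eventually_elim
      case (elim n)
      show ?case
      proof
        fix x assume "x \<in> {0..M}"
        then show "dist (poly (P n) x) (f x) < e"
          using P[of x n] elim by (simp add: dist_real_def abs_minus_commute)
      qed
    qed
  qed
  then show thesis by (rule that)
qed

lemma poly_op_same_limit:
  assumes A: "positive_op A"
    and P: "uniform_limit {0..norm A} (\<lambda>n. poly (P n)) f sequentially"
    and Q: "uniform_limit {0..norm A} (\<lambda>n. poly (Q n)) f sequentially"
  shows "(\<lambda>n. poly_op (P n) A - poly_op (Q n) A) \<longlonglongrightarrow> 0"
proof (rule metric_LIMSEQ_I)
  fix e :: real assume e: "e > 0"
  have "\<forall>\<^sub>F n in sequentially. (\<forall>x\<in>{0..norm A}. dist (poly (P n) x) (f x) < e/4) \<and> (\<forall>x\<in>{0..norm A}. dist (poly (Q n) x) (f x) < e/4)"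
    using uniform_limitD[OF P, of "e/4"] uniform_limitD[OF Q, of "e/4"] e by (intro eventually_conj) auto
  then obtain N where N: "\<And>n x. n \<ge> N \<Longrightarrow> x \<in> {0..norm A} \<Longrightarrow> dist (poly (P n) x) (f x) < e/4 \<and> dist (poly (Q n) x) (f x) < e/4"
    unfolding eventually_sequentially by blast
  have *: "norm (poly_op (P n - Q n) A) \<le> e/2" if "n \<ge> N" for n
  proof (rule norm_poly_op_le[OF A])
    fix x assume "0 \<le> x" "x \<le> norm A"
    then have "x \<in> {0..norm A}" by simp
    then show "\<bar>poly (P n - Q n) x\<bar> \<le> e/2"
      using N[OF that, of x] unfolding dist_real_def poly_diff by linarith
  qed
  have "norm (poly_op (P n - Q n) A) < e" if "n \<ge> N" for n
    using *[OF that] e by linarith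
  then show "\<exists>N. \<forall>n\<ge>N. dist (poly_op (P n) A - poly_op (Q n) A) 0 < e"
    by (auto simp: poly_op_diff)
qed

lemma poly_op_Cauchy:
  assumes A: "positive_op A" and P: "uniform_limit {0..norm A} (\<lambda>n. poly (P n)) f sequentially"
  shows "convergent (\<lambda>n. poly_op (P n) A)"
proof -
  have "Cauchy (\<lambda>n. poly_op (P n) A)"
  proof (rule metric_CauchyI)
    fix e :: real assume e: "e > 0"
    have "\<forall>\<^sub>F n in sequentially. \<forall>x\<in>{0..norm A}. dist (poly (P n) x) (f x) < e/4"
      by (rule uniform_limitD[OF P]) (use e in simp)
    then obtain N where N: "\<And>n x. n \<ge> N \<Longrightarrow> x \<in> {0..norm A} \<Longrightarrow> dist (poly (P n) x) (f x) < e/4"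
      unfolding eventually_sequentially by blast
    have *: "norm (poly_op (P m - P n) A) \<le> e/2" if "m \<ge> N" "n \<ge> N" for m n
    proof (rule norm_poly_op_le[OF A])
      fix x assume "0 \<le> x" "x \<le> norm A"
      then have "x \<in> {0..norm A}" by simp
      then show "\<bar>poly (P m - P n) x\<bar> \<le> e/2"
        using N[OF that(1), of x] N[OF that(2), of x] unfolding dist_real_def poly_diff by linarith
    qed
    have "norm (poly_op (P m - P n) A) < e" if "m \<ge> N" "n \<ge> N" for m n
      using *[OF that] e by linarith
    then show "\<exists>N. \<forall>m\<ge>N. \<forall>n\<ge>N. dist (poly_op (P m) A) (poly_op (P n) A) < e"
      by (auto simp: poly_op_diff dist_norm)
  qed
  then show ?thesis by (rule Cauchy_convergent)
qed

text \<open>\<open>fun_calc\<close> is a definite description; by \<open>poly_op_same_limit\<close>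
  all approximating sequences share one limit, so any of them computes it.\<close>

lemma fun_calc_tendsto:
  assumes A: "positive_op A" and P: "uniform_limit {0..norm A} (\<lambda>n. poly (P n)) f sequentially"
  shows "(\<lambda>n. poly_op (P n) A) \<longlonglongrightarrow> fun_calc f A"
proof -
  obtain C where C: "(\<lambda>n. poly_op (P n) A) \<longlonglongrightarrow> C"
    using poly_op_Cauchy[OF A P] convergentD by blast
  have "fun_calc f A = C"
    unfolding fun_calc_def
  proof (rule the_equality)
    show "\<exists>P. uniform_limit {0..norm A} (\<lambda>n. poly (P n)) f sequentially \<and> (\<lambda>n. poly_op (P n) A) \<longlonglongrightarrow> C"
      using P C by blast
    fix C' assume "\<exists>P. uniform_limit {0..norm A} (\<lambda>n. poly (P n)) f sequentially \<and> (\<lambda>n. poly_op (P n) A) \<longlonglongrightarrow> C'"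
    then obtain Q where Q: "uniform_limit {0..norm A} (\<lambda>n. poly (Q n)) f sequentially" "(\<lambda>n. poly_op (Q n) A) \<longlonglongrightarrow> C'" by blast
    have "(\<lambda>n. poly_op (Q n) A - poly_op (P n) A) \<longlonglongrightarrow> C' - C"
      by (intro tendsto_diff Q C)
    with poly_op_same_limit[OF A Q(1) P] have "C' - C = 0" by (rule LIMSEQ_unique[rotated])
    then show "C' = C" by simp
  qed
  with C show ?thesis by simp
qed

text \<open>The squares of the polynomials that approximate the root converge uniformly to x, so
  their values at C converge to C.\<close>

lemma positive_op_sqrt:
  assumes C: "positive_op C"
  obtains S where "adj S = S" "S * S = C"
proof -
  have "continuous_on {0..norm C} sqrt" by (intro continuous_intros)
  then obtain P where P: "uniform_limit {0..norm C} (\<lambda>n. poly (P n)) sqrt sequentially"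
    using poly_approximation by blast
  define S where "S = fun_calc sqrt C"
  have S: "(\<lambda>n. poly_op (P n) C) \<longlonglongrightarrow> S"
    unfolding S_def by (rule fun_calc_tendsto[OF C P])
  have bdd: "bounded (sqrt ` {0..norm C})"
    by (intro compact_imp_bounded compact_continuous_image continuous_intros) simp
  have "uniform_limit {0..norm C} (\<lambda>n x. poly (P n) x * poly (P n) x) (\<lambda>x. sqrt x * sqrt x) sequentially"
    by (rule uniform_lim_mult[OF P P bdd bdd])
  moreover have "uniform_limit {0..norm C} (\<lambda>n x. poly (P n) x * poly (P n) x) (\<lambda>x. sqrt x * sqrt x) sequentially
      \<longleftrightarrow> uniform_limit {0..norm C} (\<lambda>n. poly (P n * P n)) (poly [:0,1:]) sequentially"
    by (rule uniform_limit_cong') auto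
  ultimately have "uniform_limit {0..norm C} (\<lambda>n. poly (P n * P n)) (poly [:0,1:]) sequentially"
    by blast
  from poly_op_same_limit[OF C this, of "\<lambda>_. [:0,1:]"]
  have "(\<lambda>n. poly_op (P n) C * poly_op (P n) C - C) \<longlonglongrightarrow> 0"
    by (simp add: poly_op_mult poly_op_pCons uniform_limit_const)
  moreover have "(\<lambda>n. poly_op (P n) C * poly_op (P n) C - C) \<longlonglongrightarrow> S * S - C"
    by (intro tendsto_intros S)
  ultimately have "S * S - C = 0" using LIMSEQ_unique by blast
  then have SS: "S * S = C" by simp
  have "cinner (app S u) v = cinner u (app S v)" for u v
  proof (rule LIMSEQ_unique)
    show "(\<lambda>n. cinner (app (poly_op (P n) C) u) v) \<longlonglongrightarrow> cinner (app S u) v"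
      by (intro tendsto_intros S)
    have "cinner (app (poly_op (P n) C) u) v = cinner u (app (poly_op (P n) C) v)" for n
      using C by (simp add: positive_op_def cinner_self_adjoint adj_poly_op)
    moreover have "(\<lambda>n. cinner u (app (poly_op (P n) C) v)) \<longlonglongrightarrow> cinner u (app S v)"
      by (intro tendsto_intros S)
    ultimately show "(\<lambda>n. cinner (app (poly_op (P n) C) u) v) \<longlonglongrightarrow> cinner u (app S v)" by simp
  qed
  then have "adj S = S" by (intro adj_unique)
  with SS show thesis using that by blast
qed

text \<open>Convexity on the half line by induction: multiplying the bound for n by x exceeds the
  next tangent by (n + 1) s^n (x - s)^2.\<close>

lemma power_tangent_le:
  fixes x s :: real
  assumes "0 \<le> x" "0 \<le> s"
  shows "s ^ Suc n + real (Suc n) * s ^ n * (x - s) \<le> x ^ Suc n"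
proof (induction n)
  case (Suc n)
  have "s ^ Suc (Suc n) + real (Suc (Suc n)) * s ^ Suc n * (x - s)
      = x * (s ^ Suc n + real (Suc n) * s ^ n * (x - s)) - real (Suc n) * s ^ n * (x - s)\<^sup>2"
    by (simp add: power2_eq_square algebra_simps)
  also have "\<dots> \<le> x * (s ^ Suc n + real (Suc n) * s ^ n * (x - s))"
    using assms by simp
  also have "\<dots> \<le> x * x ^ Suc n"
    using Suc assms by (intro mult_left_mono)
  finally show ?case by simp
qed simp

text \<open>Jensen's inequality, by integrating the tangent of \<open>x \<mapsto> x\<^sup>p\<close> against the spectral measure of \<open>u\<close>.\<close>

lemma power_cinner_le:
  assumes A: "positive_op A" and u: "norm u = 1" and p: "p \<ge> 1"
  shows "(Re (cinner u (app A u))) ^ p \<le> Re (cinner u (app (A ^ p) u))"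
proof -
  obtain n where n: "p = Suc n" using p by (cases p) auto
  define s where "s = Re (cinner u (app A u))"
  have s: "s \<ge> 0" using A by (simp add: s_def positive_op_def)
  define P where "P = monom 1 p - [:s ^ p - real p * s ^ n * s, real p * s ^ n:]"
  have "positive_op (poly_op P A)"
  proof (rule positive_poly_op[OF A])
    fix x :: real assume "0 \<le> x"
    then show "0 \<le> poly P x"
      using power_tangent_le[of x s n] s unfolding P_def n
      by (simp add: poly_monom algebra_simps)
  qed
  then have "0 \<le> Re (cinner u (app (poly_op P A) u))" by (simp add: positive_op_def)
  also have "\<dots> = Re (cinner u (app (A ^ p) u)) - s ^ p"
    using u by (simp add: P_def poly_op_diff poly_op_monom poly_op_pCons app_diff app_add app_scaleR app_one
        cinner_diff_right cinner_add_right cinner_scaleR_right cinner_self s_def algebra_simps)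
  finally show ?thesis by (simp add: s_def)
qed

section \<open>Membership in the Schatten ideals\<close>

text \<open>For even exponents the functional calculus is a polynomial: x powr p agrees with x^p on
  the half line, at 0 because p >= 1. This makes the ideals accessible to algebra.\<close>

lemma abs_powr_even:
  assumes "p \<ge> 1"
  shows "abs_powr T (2 * real p) = (adj T * T) ^ p"
proof -
  have "uniform_limit {0..norm (adj T * T)} (\<lambda>n. poly (monom 1 p)) (\<lambda>x. x powr (2 * real p / 2)) sequentially
     \<longleftrightarrow> uniform_limit {0..norm (adj T * T)} (\<lambda>n. poly (monom 1 p)) (poly (monom 1 p)) sequentially"
    by (rule uniform_limit_cong') (use assms in \<open>auto simp: poly_monom powr_realpow' power_0_left\<close>)
  then have "uniform_limit {0..norm (adj T * T)} (\<lambda>n. poly (monom 1 p)) (\<lambda>x. x powr (2 * real p / 2)) sequentially"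
    by (simp add: uniform_limit_const)
  from fun_calc_tendsto[OF positive_op_adj_mult this] show ?thesis
    by (simp add: abs_powr_def poly_op_monom LIMSEQ_const_iff)
qed

lemma positive_op_power:
  assumes "positive_op A" shows "positive_op (A ^ p)"
  using positive_poly_op[OF assms, of "monom 1 p"] by (simp add: poly_op_monom poly_monom)

lemma diag_entry_eq: "diag_entry T b = cinner (basis_wave b) (app T (basis_wave b))"
  by (cases b) (simp add: diag_entry_def basis_wave_def)

lemma self_adjoint_cinner_real:
  assumes "adj A = A" shows "cinner u (app A u) = of_real (Re (cinner u (app A u)))"
proof -
  have "cinner u (app A u) = cnj (cinner u (app A u))"
    using cinner_commute[of u "app A u"] cinner_self_adjoint[OF assms, of u u] by simp
  then show ?thesis by (simp add: complex_eq_iff)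
qed

lemma diag_entry_real:
  assumes "positive_op A"
  shows "diag_entry A b = of_real (Re (diag_entry A b))" "0 \<le> Re (diag_entry A b)"
  using assms self_adjoint_cinner_real[of A "basis_wave b"] by (simp_all add: positive_op_def diag_entry_eq)

text \<open>Write C = S^2 with S self-adjoint. Each quadratic form is a Parseval sum over the
  Fourier basis; after exchanging the sums, Bessel's inequality for the family bounds each term by a
  diagonal entry of C.\<close>

lemma sum_cinner_le_trace:
  assumes C: "positive_op C" and s: "diag_entry C summable_on UNIV" and I: "finite I" "orthofamily f I"
  shows "(\<Sum>i\<in>I. Re (cinner (f i) (app C (f i)))) \<le> Re (trace_op C)"
proof -
  obtain S where S: "adj S = S" "S * S = C" using positive_op_sqrt[OF C] by blast
  have q: "Re (cinner u (app C u)) = (norm (app S u))\<^sup>2" for u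
    unfolding S(2)[symmetric] app_times
    using cinner_self_adjoint[OF S(1), of u "app S u"] by (metis Re_cinner power2_norm_eq_inner)
  have fin: "((\<lambda>b. \<Sum>i\<in>I. g i b) has_sum (\<Sum>i\<in>I. h i)) UNIV"
    if "\<And>i. (g i has_sum h i) UNIV" for g :: "'b \<Rightarrow> int \<times> 'a \<Rightarrow> real" and h
    using I(1) by induction (simp_all add: has_sum_add that)
  have hs: "((\<lambda>b. \<Sum>i\<in>I. (cmod (cinner (basis_wave b) (app S (f i))))\<^sup>2) has_sum (\<Sum>i\<in>I. Re (cinner (f i) (app C (f i))))) UNIV"
    unfolding q by (intro fin parseval)
  have tr: "((\<lambda>b. Re (diag_entry C b)) has_sum Re (trace_op C)) UNIV"
    unfolding trace_op_def by (intro has_sum_Re has_sum_infsum s)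
  show ?thesis
  proof (rule has_sum_mono[OF hs tr])
    fix b
    have "(\<Sum>i\<in>I. (cmod (cinner (basis_wave b) (app S (f i))))\<^sup>2) = (\<Sum>i\<in>I. (cmod (cinner (f i) (app S (basis_wave b))))\<^sup>2)"
      by (metis (no_types, lifting) S(1) cinner_commute cinner_self_adjoint complex_mod_cnj)
    also have "\<dots> \<le> (norm (app S (basis_wave b)))\<^sup>2" by (rule bessel[OF I])
    finally show "(\<Sum>i\<in>I. (cmod (cinner (basis_wave b) (app S (f i))))\<^sup>2) \<le> Re (diag_entry C b)"
      by (simp add: diag_entry_eq q)
  qed
qed

section \<open>Finite rank operators and approximation numbers\<close>

text \<open>Rank is witnessed by a sum of n rank-one operators without any independence, so that
  padding, sums and products are immediate.\<close>

definition rank_le :: "nat \<Rightarrow> 'n::finite bop \<Rightarrow> bool" where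
  "rank_le n F \<longleftrightarrow> (\<exists>u v. \<forall>x. app F x = (\<Sum>i<n. cscale (cinner (v i) x) (u i)))"

lemma rank_leI: "(\<And>x. app F x = (\<Sum>i<n. cscale (cinner (v i) x) (u i))) \<Longrightarrow> rank_le n F"
  unfolding rank_le_def by blast

lemma rank_le_0: "rank_le 0 F \<longleftrightarrow> F = 0"
  by (auto simp: rank_le_def intro: bop_eqI)

lemma cscale_zero_left [simp]: "cscale 0 u = 0"
  using cscale_of_real[of 0 u] by simp

lemma rank_le_mono:
  assumes "rank_le m F" "m \<le> n" shows "rank_le n F"
proof -
  obtain u v where uv: "\<And>x. app F x = (\<Sum>i<m. cscale (cinner (v i) x) (u i))"
    using assms(1) unfolding rank_le_def by blast
  have "app F x = (\<Sum>i<n. cscale (cinner (v i) x) (if i < m then u i else 0))" for x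
    unfolding uv using assms(2) by (intro sum.mono_neutral_cong_left) (auto simp: cscale_zero)
  then show ?thesis by (rule rank_leI)
qed

lemma rank_le_zero [simp]: "rank_le n 0"
  using rank_le_mono[of 0 0 n] by (simp add: rank_le_0)

lemma sum_lessThan_add: "(\<Sum>i<m + n. f i) = (\<Sum>i<m. f i) + (\<Sum>i<n. f (m + i))"
  for f :: "nat \<Rightarrow> 'b::comm_monoid_add"
  by (induction n) (simp_all add: add.assoc)

lemma rank_le_add:
  assumes "rank_le m F" "rank_le n G" shows "rank_le (m + n) (F + G)"
proof -
  obtain u v where uv: "\<And>x. app F x = (\<Sum>i<m. cscale (cinner (v i) x) (u i))"
    using assms(1) unfolding rank_le_def by blast
  obtain u' v' where uv': "\<And>x. app G x = (\<Sum>i<n. cscale (cinner (v' i) x) (u' i))"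
    using assms(2) unfolding rank_le_def by blast
  let ?u = "\<lambda>i. if i < m then u i else u' (i - m)" and ?v = "\<lambda>i. if i < m then v i else v' (i - m)"
  have "app (F + G) x = (\<Sum>i<m + n. cscale (cinner (?v i) x) (?u i))" for x
    by (simp add: sum_lessThan_add app_add uv uv')
  then show ?thesis by (rule rank_leI)
qed

lemma rank_le_mult_left:
  assumes "rank_le n F" shows "rank_le n (S * F)"
proof -
  obtain u v where uv: "\<And>x. app F x = (\<Sum>i<n. cscale (cinner (v i) x) (u i))"
    using assms(1) unfolding rank_le_def by blast
  have "app (S * F) x = (\<Sum>i<n. cscale (cinner (v i) x) (app S (u i)))" for x
    by (simp add: app_times uv app_sum_right app_cscale)
  then show ?thesis by (rule rank_leI)
qed

lemma rank_le_mult_right: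
  assumes "rank_le n F" shows "rank_le n (F * S)"
proof -
  obtain u v where uv: "\<And>x. app F x = (\<Sum>i<n. cscale (cinner (v i) x) (u i))"
    using assms(1) unfolding rank_le_def by blast
  have "app (F * S) x = (\<Sum>i<n. cscale (cinner (app (adj S) (v i)) x) (u i))" for x
    by (simp add: app_times uv cinner_adj)
  then show ?thesis by (rule rank_leI)
qed

lemma rank_le_scaleR: "rank_le n F \<Longrightarrow> rank_le n (c *\<^sub>R F)"
  using rank_le_mult_left[of n F "c *\<^sub>R 1"] by simp

lemma rank_le_uminus: "rank_le n F \<Longrightarrow> rank_le n (- F)"
  using rank_le_scaleR[of n F "-1"] by simp

lemma rank_le_diff: "rank_le m F \<Longrightarrow> rank_le n G \<Longrightarrow> rank_le (m + n) (F - G)"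
  using rank_le_add[of m F n "- G"] by (simp add: rank_le_uminus)

lemma rank_le_adj:
  assumes "rank_le n F" shows "rank_le n (adj F)"
proof -
  obtain u v where uv: "\<And>x. app F x = (\<Sum>i<n. cscale (cinner (v i) x) (u i))"
    using assms(1) unfolding rank_le_def by blast
  have "app (adj F) y = (\<Sum>i<n. cscale (cinner (u i) y) (v i))" for y
  proof (rule cinner_eqI)
    fix w
    have "cinner w (app (adj F) y) = (\<Sum>i<n. cnj (cinner (v i) w) * cinner (u i) y)"
      by (simp add: cinner_adj_right uv cinner_sum_left cinner_cscale_left)
    also have "\<dots> = cinner w (\<Sum>i<n. cscale (cinner (u i) y) (v i))"
      by (simp add: cinner_sum_right cinner_cscale_right cinner_commute[symmetric] mult.commute)
    finally show "cinner w (app (adj F) y) = cinner w (\<Sum>i<n. cscale (cinner (u i) y) (v i))" .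
  qed
  then show ?thesis by (rule rank_leI)
qed

text \<open>Gram-Schmidt, with a zero vector in the place of every vector that depends on its
  predecessors.\<close>

lemma orthonormalize:
  fixes u :: "nat \<Rightarrow> 'n::finite l2"
  shows "\<exists>w. orthofamily w {..<n} \<and> (\<forall>i<n. (\<Sum>j<n. cscale (cinner (w j) (u i)) (w j)) = u i)"
proof (induction n)
  case 0
  show ?case by (simp add: orthofamily_def)
next
  case (Suc n)
  then obtain w where w: "orthofamily w {..<n}" "\<And>i. i < n \<Longrightarrow> (\<Sum>j<n. cscale (cinner (w j) (u i)) (w j)) = u i"
    by blast
  define s where "s = (\<Sum>j<n. cscale (cinner (w j) (u n)) (w j))"
  define r where "r = u n - s"
  \<comment> \<open>If \<open>u n\<close> lies in the span already built, then r = 0 and the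
    quotient is 0 by convention, so that e = 0.\<close>
  define e where "e = (1 / norm r) *\<^sub>R r"
  define w' where "w' = w(n := e)"
  have wr: "cinner (w j) r = 0" if "j < n" for j
  proof -
    have "cinner (w j) s = (if w j = 0 then 0 else cinner (w j) (u n))"
      unfolding s_def using that by (intro orthofamily_cinner_sum w) auto
    then show ?thesis by (simp add: r_def cinner_diff_right)
  qed
  then have we: "cinner (w j) e = 0" "cinner e (w j) = 0" if "j < n" for j
    using that cinner_commute[of e "w j"] by (auto simp: e_def cinner_scaleR_right)
  have ne: "norm e = 0 \<or> norm e = 1" by (simp add: e_def)
  have of: "orthofamily w' {..<Suc n}"
    using w(1) ne we unfolding orthofamily_def w'_def by (auto simp: less_Suc_eq)
  have es: "cinner e (\<Sum>j<n. cscale (c j) (w j)) = 0" for c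
    by (simp add: cinner_sum_right cinner_cscale_right we)
  have sum': "(\<Sum>j<Suc n. cscale (cinner (w' j) x) (w' j)) = (\<Sum>j<n. cscale (cinner (w j) x) (w j)) + cscale (cinner e x) e" for x
    by (simp add: w'_def)
  have "(\<Sum>j<Suc n. cscale (cinner (w' j) (u i)) (w' j)) = u i" if "i < Suc n" for i
  proof (cases "i = n")
    case True
    have "cinner e (u n) = cinner e r"
      unfolding r_def cinner_diff_right s_def es by simp
    also have "\<dots> = of_real (norm r)"
    proof -
      have "cinner r r = of_real (norm r * norm r)" by (simp add: cinner_self power2_eq_square)
      then have "cinner r e = of_real (norm r)" by (simp add: e_def cinner_scaleR_right)
      then show ?thesis using cinner_commute[of e r] by simp
    qed
    finally have "cscale (cinner e (u n)) e = r"
      by (simp add: cscale_of_real e_def)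
    then show ?thesis unfolding sum' True s_def[symmetric] r_def by simp
  next
    case False
    then have i: "i < n" using that by simp
    have "cinner e (u i) = 0" using es[of "\<lambda>j. cinner (w j) (u i)"] w(2)[OF i] by simp
    then show ?thesis unfolding sum' w(2)[OF i] by simp
  qed
  with of show ?case by blast
qed

lemma rank_le_orthofamily:
  assumes "rank_le n F"
  obtains w where "orthofamily w {..<n}" "\<And>x. app F x = (\<Sum>j<n. cscale (cinner (app (adj F) (w j)) x) (w j))"
proof -
  obtain u v where uv: "\<And>x. app F x = (\<Sum>i<n. cscale (cinner (v i) x) (u i))"
    using assms(1) unfolding rank_le_def by blast
  obtain w where w: "orthofamily w {..<n}" "\<And>i. i < n \<Longrightarrow> (\<Sum>j<n. cscale (cinner (w j) (u i)) (w j)) = u i"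
    using orthonormalize[of n u] by blast
  have "app F x = (\<Sum>j<n. cscale (cinner (app (adj F) (w j)) x) (w j))" for x
  proof -
    have "app F x = (\<Sum>i<n. cscale (cinner (v i) x) (\<Sum>j<n. cscale (cinner (w j) (u i)) (w j)))"
      unfolding uv using w(2) by (intro sum.cong) auto
    also have "\<dots> = (\<Sum>i<n. \<Sum>j<n. cscale (cinner (v i) x * cinner (w j) (u i)) (w j))"
      by (simp add: cscale_sum cscale_cscale)
    also have "\<dots> = (\<Sum>j<n. \<Sum>i<n. cscale (cinner (v i) x * cinner (w j) (u i)) (w j))"
      by (rule sum.swap)
    also have "\<dots> = (\<Sum>j<n. cscale (cinner (w j) (app F x)) (w j))"
    proof (rule sum.cong[OF refl])
      fix j
      have "(\<Sum>i\<in>I. cscale (c i) (w j)) = cscale (\<Sum>i\<in>I. c i) (w j)" for c :: "nat \<Rightarrow> complex" and I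
        by (induction I rule: infinite_finite_induct) (simp_all add: cscale_add_left)
      then show "(\<Sum>i<n. cscale (cinner (v i) x * cinner (w j) (u i)) (w j)) = cscale (cinner (w j) (app F x)) (w j)"
        by (simp add: uv cinner_sum_right cinner_cscale_right)
    qed
    finally show ?thesis by (simp add: cinner_adj)
  qed
  with w(1) show thesis by (rule that)
qed

text \<open>Approximation numbers, counted from 0 so that \<open>appr 0 T\<close> is the norm and
  ranks add in \<open>appr_add\<close> and \<open>appr_mult\<close>. They serve in place of singular
  values.\<close>

definition appr :: "nat \<Rightarrow> 'n::finite bop \<Rightarrow> real" where
  "appr n T = (INF F\<in>{F. rank_le n F}. norm (T - F))"

lemma bdd_below_appr: "bdd_below ((\<lambda>F. norm (T - F)) ` {F. rank_le n F})"
  by (rule bdd_belowI2[where m=0]) simp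

lemma appr_le: "rank_le n F \<Longrightarrow> appr n T \<le> norm (T - F)"
  unfolding appr_def by (rule cINF_lower[OF bdd_below_appr]) simp

lemma appr_approx:
  assumes "e > 0" obtains F where "rank_le n F" "norm (T - F) < appr n T + e"
proof -
  have "appr n T < appr n T + e" using assms by simp
  then show thesis
    using that unfolding appr_def
    by (subst (asm) cINF_less_iff[OF _ bdd_below_appr]) (auto intro: exI[of _ 0])
qed

lemma appr_ge:
  assumes "\<And>F. rank_le n F \<Longrightarrow> c \<le> norm (T - F)" shows "c \<le> appr n T"
  unfolding appr_def using assms by (intro cINF_greatest) (auto intro: exI[of _ 0])

lemma appr_ge_mult:
  assumes k: "0 \<le> k" and F: "\<And>F. rank_le n F \<Longrightarrow> c \<le> k * norm (T - F)"
  shows "c \<le> k * appr n T"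
proof (cases "k = 0")
  case True
  then show ?thesis using F[of 0] by simp
next
  case False
  then have "c / k \<le> appr n T"
    using k F by (intro appr_ge) (simp add: divide_le_eq mult.commute)
  then show ?thesis using k False by (simp add: divide_le_eq mult.commute)
qed

lemma appr_nonneg [simp]: "0 \<le> appr n T"
  by (rule appr_ge) simp

lemma appr_le_norm: "appr n T \<le> norm T"
  using appr_le[of n 0 T] by simp

lemma appr_0: "appr 0 T = norm T"
  by (rule antisym[OF appr_le_norm]) (rule appr_ge, simp add: rank_le_0)

lemma appr_antimono: "m \<le> n \<Longrightarrow> appr n T \<le> appr m T"
  by (rule appr_ge) (blast intro: appr_le rank_le_mono)

lemma appr_add: "appr (m + n) (S + T) \<le> appr m S + appr n T"
proof -
  have "appr (m + n) (S + T) - appr m S \<le> appr n T"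
  proof (rule appr_ge)
    fix G :: "'a bop" assume G: "rank_le n G"
    have "appr (m + n) (S + T) - norm (T - G) \<le> appr m S"
    proof (rule appr_ge)
      fix F :: "'a bop" assume F: "rank_le m F"
      have "appr (m + n) (S + T) \<le> norm ((S + T) - (F + G))"
        by (rule appr_le[OF rank_le_add[OF F G]])
      also have "\<dots> = norm ((S - F) + (T - G))" by (simp add: algebra_simps)
      also have "\<dots> \<le> norm (S - F) + norm (T - G)" by (rule norm_triangle_ineq)
      finally show "appr (m + n) (S + T) - norm (T - G) \<le> norm (S - F)" by simp
    qed
    then show "appr (m + n) (S + T) - appr m S \<le> norm (T - G)" by simp
  qed
  then show ?thesis by simp
qed

text \<open>If F and G approximate S and T, then F T + (S - F) G has rank at most m + n and misses S
  T by (S - F)(T - G).\<close>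

lemma appr_mult: "appr (m + n) (S * T) \<le> appr m S * appr n T"
proof (rule appr_ge_mult)
  fix G :: "'a bop" assume G: "rank_le n G"
  have "appr (m + n) (S * T) \<le> norm (T - G) * appr m S"
  proof (rule appr_ge_mult)
    fix F :: "'a bop" assume F: "rank_le m F"
    have "rank_le (m + n) (F * T + (S - F) * G)"
      by (intro rank_le_add rank_le_mult_left rank_le_mult_right F G)
    then have "appr (m + n) (S * T) \<le> norm (S * T - (F * T + (S - F) * G))" by (rule appr_le)
    also have "S * T - (F * T + (S - F) * G) = (S - F) * (T - G)" by (simp add: algebra_simps)
    also have "norm \<dots> \<le> norm (S - F) * norm (T - G)" by (rule norm_mult_ineq)
    finally show "appr (m + n) (S * T) \<le> norm (T - G) * norm (S - F)" by (simp add: mult.commute)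
  qed simp
  then show "appr (m + n) (S * T) \<le> appr m S * norm (T - G)" by (simp add: mult.commute)
qed simp

lemma appr_lipschitz: "appr n S \<le> appr n T + norm (S - T)"
  using appr_add[of n 0 T "S - T"] by (simp add: appr_0)

lemma appr_adj: "appr n (adj T) = appr n T"
proof -
  have *: "appr n (adj T) \<le> appr n T" for T :: "'a bop"
  proof (rule appr_ge)
    fix F :: "'a bop" assume "rank_le n F"
    then have "appr n (adj T) \<le> norm (adj T - adj F)" by (intro appr_le rank_le_adj)
    then show "appr n (adj T) \<le> norm (T - F)" by (simp flip: adj_diff)
  qed
  show ?thesis using *[of T] *[of "adj T"] by simp
qed

section \<open>Nuclear operators and the trace\<close>

text \<open>T as an absolutely convergent sum of rank-one operators, expressed through matrix
  elements. The double index anticipates the construction below: dyadic block and position in the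
  block.\<close>

definition nuclear_rep :: "(nat \<times> nat \<Rightarrow> 'n::finite l2) \<Rightarrow> (nat \<times> nat \<Rightarrow> 'n l2) \<Rightarrow> 'n bop \<Rightarrow> bool" where
  "nuclear_rep u v T \<longleftrightarrow> (\<lambda>i. norm (u i) * norm (v i)) summable_on UNIV \<and>
     (\<forall>x y. ((\<lambda>i. cinner y (u i) * cinner (v i) x) has_sum cinner y (app T x)) UNIV)"

text \<open>Expanding each pairing in the Fourier basis gives a double series that converges
  absolutely by Parseval and Cauchy-Schwarz, so the two summations may be exchanged.\<close>

lemma nuclear_rep_trace:
  assumes T: "nuclear_rep u v T"
  shows "diag_entry T summable_on UNIV"
    and "trace_op T = (\<Sum>\<^sub>\<infinity>i. cinner (v i) (u i))"
    and "cmod (trace_op T) \<le> (\<Sum>\<^sub>\<infinity>i. norm (u i) * norm (v i))"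
proof -
  let ?h = "\<lambda>i b. cnj (cinner (basis_wave b) (v i)) * cinner (basis_wave b) (u i)"
  have s: "(\<lambda>i. norm (u i) * norm (v i)) summable_on UNIV"
    and T': "\<And>x y. ((\<lambda>i. cinner y (u i) * cinner (v i) x) has_sum cinner y (app T x)) UNIV"
    using T by (auto simp: nuclear_rep_def)
  have "(\<lambda>i. \<Sum>\<^sub>\<infinity>b. cmod (?h i b)) summable_on UNIV"
    by (rule summable_on_comparison_test[OF s])
      (use parseval_cinner_abs(2) in \<open>auto intro!: infsum_nonneg simp: mult.commute[of "norm (u _)"]\<close>)
  then have "(\<lambda>x. norm (case x of (i, b) \<Rightarrow> ?h i b)) summable_on UNIV \<times> UNIV"
    by (intro iffD2[OF Infinite_Sum.abs_summable_on_Sigma_iff] conjI ballI; unfold prod.case)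
      (rule parseval_cinner_abs(1), simp add: infsum_nonneg)
  then have hs: "(\<lambda>(i, b). ?h i b) summable_on UNIV \<times> UNIV"
    by (rule abs_summable_summable)
  then have "((\<lambda>(i, b). ?h i b) \<circ> prod.swap) summable_on UNIV \<times> UNIV"
    by (subst summable_on_reindex[symmetric]) (simp_all add: product_swap)
  then have hs': "(\<lambda>(b, i). ?h i b) summable_on UNIV \<times> UNIV"
    by (simp add: o_def case_prod_unfold)
  have d: "diag_entry T b = (\<Sum>\<^sub>\<infinity>i. ?h i b)" for b
    using infsumI[OF T'[of "basis_wave b" "basis_wave b"]]
    by (simp add: diag_entry_eq cinner_commute[symmetric] mult.commute)
  show "diag_entry T summable_on UNIV"
    unfolding d[abs_def] using summable_on_Sigma_banach[OF hs'] by simp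
  have "trace_op T = (\<Sum>\<^sub>\<infinity>i. \<Sum>\<^sub>\<infinity>b. ?h i b)"
    unfolding trace_op_def d[abs_def] by (rule infsum_swap_banach[OF hs'])
  also have "\<dots> = (\<Sum>\<^sub>\<infinity>i. cinner (v i) (u i))"
    by (intro infsum_cong infsumI parseval_cinner)
  finally show tr: "trace_op T = (\<Sum>\<^sub>\<infinity>i. cinner (v i) (u i))" .
  have le: "cmod (cinner (v i) (u i)) \<le> norm (u i) * norm (v i)" for i
    using cmod_cinner_le[of "v i" "u i"] by (simp add: mult.commute)
  have as: "(\<lambda>i. cmod (cinner (v i) (u i))) summable_on UNIV"
    by (rule summable_on_comparison_test[OF s]) (use le in auto)
  have "cmod (trace_op T) \<le> (\<Sum>\<^sub>\<infinity>i. cmod (cinner (v i) (u i)))"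
    unfolding tr by (rule norm_infsum_bound[OF as])
  also have "\<dots> \<le> (\<Sum>\<^sub>\<infinity>i. norm (u i) * norm (v i))"
    by (rule infsum_mono[OF as s]) (use le in auto)
  finally show "cmod (trace_op T) \<le> (\<Sum>\<^sub>\<infinity>i. norm (u i) * norm (v i))" .
qed

lemma nuclear_rep_mult_left:
  assumes "nuclear_rep u v T" shows "nuclear_rep (\<lambda>i. app S (u i)) v (S * T)"
  unfolding nuclear_rep_def
proof (intro conjI allI)
  have s: "(\<lambda>i. norm (u i) * norm (v i)) summable_on UNIV"
    using assms by (simp add: nuclear_rep_def)
  show "(\<lambda>i. norm (app S (u i)) * norm (v i)) summable_on UNIV"
  proof (rule summable_on_comparison_test)
    show "(\<lambda>i. norm S * (norm (u i) * norm (v i))) summable_on UNIV"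
      by (rule summable_on_cmult_right[OF s])
    show "norm (app S (u i)) * norm (v i) \<le> norm S * (norm (u i) * norm (v i))" for i
      using mult_right_mono[OF norm_app[of S "u i"], of "norm (v i)"] by (simp add: mult_ac)
  qed simp
  fix x y
  show "((\<lambda>i. cinner y (app S (u i)) * cinner (v i) x) has_sum cinner y (app (S * T) x)) UNIV"
    using assms unfolding nuclear_rep_def by (simp add: app_times flip: cinner_adj)
qed

lemma nuclear_rep_mult_right:
  assumes "nuclear_rep u v T" shows "nuclear_rep u (\<lambda>i. app (adj S) (v i)) (T * S)"
  unfolding nuclear_rep_def
proof (intro conjI allI)
  have s: "(\<lambda>i. norm (u i) * norm (v i)) summable_on UNIV"
    using assms by (simp add: nuclear_rep_def)
  show "(\<lambda>i. norm (u i) * norm (app (adj S) (v i))) summable_on UNIV"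
  proof (rule summable_on_comparison_test)
    show "(\<lambda>i. norm S * (norm (u i) * norm (v i))) summable_on UNIV"
      by (rule summable_on_cmult_right[OF s])
    show "norm (u i) * norm (app (adj S) (v i)) \<le> norm S * (norm (u i) * norm (v i))" for i
      using mult_left_mono[OF norm_app[of "adj S" "v i"], of "norm (u i)"] by (simp add: mult_ac)
  qed simp
  fix x y
  show "((\<lambda>i. cinner y (u i) * cinner (app (adj S) (v i)) x) has_sum cinner y (app (T * S) x)) UNIV"
    using assms unfolding nuclear_rep_def by (simp add: app_times cinner_adj)
qed

text \<open>Both traces are the sum of the inner products of \<open>v i\<close> with
  \<open>app S (u i)\<close>.\<close>

lemma nuclear_rep_trace_commute:
  assumes "nuclear_rep u v T" shows "trace_op (S * T) = trace_op (T * S)"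
  unfolding nuclear_rep_trace(2)[OF nuclear_rep_mult_left[OF assms]]
    nuclear_rep_trace(2)[OF nuclear_rep_mult_right[OF assms]]
  by (simp add: cinner_adj)

text \<open>One half of Cauchy's condensation test; the samples at 2^j - 1 match the ranks used in
  \<open>nuclear_rep_exists\<close>.\<close>

lemma sum_dyadic_le:
  fixes a :: "nat \<Rightarrow> real"
  assumes "\<And>m n. m \<le> n \<Longrightarrow> a n \<le> a m" "\<And>n. 0 \<le> a n"
  shows "(\<Sum>j\<le>J. 2 ^ j * a (2 ^ j - 1)) \<le> 2 * (\<Sum>n<2 ^ J. a n)"
proof (induction J)
  case 0
  then show ?case using assms(2)[of 0] by simp
next
  case (Suc J)
  have "(\<Sum>n<2 ^ Suc J. a n) = (\<Sum>n<2 ^ J. a n) + (\<Sum>n<2 ^ J. a (2 ^ J + n))"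
    using sum_lessThan_add[of a "2 ^ J" "2 ^ J"] by (simp add: mult_2)
  moreover have "(\<Sum>n<(2::nat) ^ J. a (2 ^ Suc J - 1)) \<le> (\<Sum>n<2 ^ J. a (2 ^ J + n))"
    by (intro sum_mono assms) auto
  ultimately show ?case using Suc by simp
qed

text \<open>T is the telescoping sum of differences of near-optimal approximants of rank 2^j - 1. A
  difference of rank r and norm c splits into rank-one terms of total size at most r c, so
  condensation bounds everything by the sum of the approximation numbers.\<close>

lemma nuclear_rep_exists:
  fixes T :: "'n::finite bop"
  assumes s: "summable (\<lambda>n. appr n T)" and d: "d > 0"
  obtains u v where "nuclear_rep u v T" "(\<Sum>\<^sub>\<infinity>i. norm (u i) * norm (v i)) \<le> 16 * ((\<Sum>n. appr n T) + d)"
proof -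
  \<comment> \<open>The slack d / 4^j makes room for near-minimisers; weighted with 8 * 2^j it sums
    to at most 16 d.\<close>
  define a where "a j = appr (2 ^ j - 1) T + d / 4 ^ j" for j :: nat
  have "\<exists>F. rank_le (2 ^ j - 1) F \<and> norm (T - F) < a j" for j
    using appr_approx[of "d / 4 ^ j" "2 ^ j - 1" T] d unfolding a_def by (metis divide_pos_pos zero_less_numeral zero_less_power)
  then obtain F where F: "\<And>j. rank_le (2 ^ j - 1) (F j)" "\<And>j. norm (T - F j) < a j" by metis
  \<comment> \<open>The first rank is 2^0 - 1 = 0, so the telescoping sum starts at zero.\<close>
  have F0: "F 0 = 0" using F(1)[of 0] by (simp add: rank_le_0)
  define G where "G j = F (Suc j) - F j" for j
  \<comment> \<open>The ranks 2^(j+1) - 1 and 2^j - 1 add up to less than 4 * 2^j. With norm at most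
    2 a j, a block contributes at most 8 * 2^j * a j.\<close>
  define N :: "nat \<Rightarrow> nat" where "N j = 4 * 2 ^ j" for j
  have "rank_le (N j) (G j)" for j
  proof -
    have "rank_le ((2 ^ Suc j - 1) + (2 ^ j - 1)) (G j)"
      unfolding G_def by (rule rank_le_diff[OF F(1) F(1)])
    then show ?thesis by (rule rank_le_mono) (simp add: N_def)
  qed
  then have "\<exists>w. orthofamily w {..<N j} \<and> (\<forall>x. app (G j) x = (\<Sum>i<N j. cscale (cinner (app (adj (G j)) (w i)) x) (w i)))" for j
    using rank_le_orthofamily by metis
  then obtain w where w: "\<And>j. orthofamily (w j) {..<N j}"
    "\<And>j x. app (G j) x = (\<Sum>i<N j. cscale (cinner (app (adj (G j)) (w j i)) x) (w j i))" by metis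
  have a_mono: "a (Suc j) \<le> a j" for j
    unfolding a_def using d by (intro add_mono appr_antimono diff_le_mono power_increasing divide_left_mono) auto
  have nG: "norm (G j) \<le> 2 * a j" for j
  proof -
    have "norm (G j) = norm ((T - F j) - (T - F (Suc j)))" by (simp add: G_def)
    also have "\<dots> \<le> norm (T - F j) + norm (T - F (Suc j))" by (rule norm_triangle_ineq4)
    finally show ?thesis using F(2)[of j] F(2)[of "Suc j"] a_mono[of j] by linarith
  qed
  have a0: "0 \<le> a j" for j using d by (simp add: a_def)
  have bd: "(\<Sum>j<J. 8 * 2 ^ j * a j) \<le> 16 * ((\<Sum>n. appr n T) + d)" for J
  proof -
    have "(\<Sum>j<J. 8 * 2 ^ j * a j) \<le> (\<Sum>j\<le>J. 8 * 2 ^ j * a j)"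
      using a0 by (intro sum_mono2) auto
    also have "\<dots> = 8 * (\<Sum>j\<le>J. 2 ^ j * appr (2 ^ j - 1) T) + 8 * d * (\<Sum>j\<le>J. (1/2) ^ j)"
    proof -
      have "8 * 2 ^ j * a j = 8 * (2 ^ j * appr (2 ^ j - 1) T) + 8 * d * (1/2) ^ j" for j :: nat
      proof -
        have "(2::real) ^ j / 4 ^ j = (1/2) ^ j" by (simp flip: power_divide)
        moreover have "8 * 2 ^ j * a j = 8 * (2 ^ j * appr (2 ^ j - 1) T) + 8 * d * (2 ^ j / 4 ^ j)"
          by (simp add: a_def algebra_simps)
        ultimately show ?thesis by simp
      qed
      then show ?thesis by (simp add: sum.distrib sum_distrib_left)
    qed
    also have "(\<Sum>j\<le>J. 2 ^ j * appr (2 ^ j - 1) T) \<le> 2 * (\<Sum>n<2 ^ J. appr n T)"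
      by (rule sum_dyadic_le) (auto intro: appr_antimono)
    also have "(\<Sum>n<2 ^ J. appr n T) \<le> (\<Sum>n. appr n T)"
      by (rule sum_le_suminf[OF s]) auto
    also have "(\<Sum>j\<le>J. (1/2::real) ^ j) \<le> 2"
    proof -
      have "(\<Sum>j\<le>J. (1/2::real) ^ j) = (\<Sum>j<Suc J. (1/2) ^ j)" by (simp add: lessThan_Suc_atMost)
      also have "\<dots> \<le> 2" by (simp only: geometric_sum) simp
      finally show ?thesis .
    qed
    finally show ?thesis using d by simp
  qed
  have sa: "summable (\<lambda>j. 8 * 2 ^ j * a j)"
    by (rule summableI_nonneg_bounded[OF _ bd]) (simp add: a0)
  have sa_le: "(\<Sum>j. 8 * 2 ^ j * a j) \<le> 16 * ((\<Sum>n. appr n T) + d)"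
    by (rule suminf_le_const[OF sa bd])
  define u where "u = (\<lambda>(j, i). if i < N j then w j i else 0)"
  define v where "v = (\<lambda>(j, i). app (adj (G j)) (w j i))"
  have norm_w: "norm (w j i) \<le> 1" if "i < N j" for i j
    using w(1)[of j] that unfolding orthofamily_def by (metis lessThan_iff order_refl zero_le_one)
  have uv_le: "norm (u (j, i)) * norm (v (j, i)) \<le> (if i < N j then 2 * a j else 0)" for j i
  proof (cases "i < N j")
    case True
    have "norm (u (j, i)) * norm (v (j, i)) \<le> 1 * (norm (G j) * 1)"
      using True norm_w[OF True] norm_app[of "adj (G j)" "w j i"]
        mult_left_mono[OF norm_w[OF True], of "norm (G j)"]
      by (intro mult_mono) (auto simp: u_def v_def)
    then show ?thesis using nG[of j] True by simp
  qed (simp add: u_def)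
  have fs: "(\<lambda>i. f i) summable_on UNIV" "(\<Sum>\<^sub>\<infinity>i. f i) = (\<Sum>i<N j. f i)"
    if "\<And>i. i \<ge> N j \<Longrightarrow> f i = 0" for f :: "nat \<Rightarrow> 'c::{banach}" and j
  proof -
    have "(f has_sum (\<Sum>i<N j. f i)) UNIV"
      by (rule has_sum_finite_neutralI[of "{..<N j}"]) (use that in auto)
    then show "(\<lambda>i. f i) summable_on UNIV" "(\<Sum>\<^sub>\<infinity>i. f i) = (\<Sum>i<N j. f i)"
      by (auto simp: summable_on_def intro: infsumI)
  qed
  have inner_le: "(\<Sum>\<^sub>\<infinity>i. norm (u (j, i)) * norm (v (j, i))) \<le> 8 * 2 ^ j * a j" for j
  proof -
    have "(\<Sum>\<^sub>\<infinity>i. norm (u (j, i)) * norm (v (j, i))) = (\<Sum>i<N j. norm (u (j, i)) * norm (v (j, i)))"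
      by (rule fs[of j]) (simp add: u_def)
    also have "\<dots> \<le> (\<Sum>i<N j. 2 * a j)"
      using uv_le by (intro sum_mono) (metis lessThan_iff)
    finally show ?thesis by (simp add: N_def)
  qed
  have inner_s: "(\<lambda>i. norm (u (j, i)) * norm (v (j, i))) summable_on UNIV" for j
    by (rule fs[of j]) (simp add: u_def)
  have sa': "(\<lambda>j. 8 * 2 ^ j * a j) summable_on UNIV"
    by (rule norm_summable_imp_summable_on) (use sa a0 in simp)
  have sum_outer: "(\<lambda>j. \<Sum>\<^sub>\<infinity>i. norm (u (j, i)) * norm (v (j, i))) summable_on UNIV"
    by (rule summable_on_comparison_test[OF sa']) (use inner_le in \<open>auto intro!: infsum_nonneg\<close>)
  have abs_uv: "(\<lambda>i. norm (u i) * norm (v i)) summable_on UNIV \<times> UNIV"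
  proof -
    have "(\<lambda>i. norm (norm (u i) * norm (v i))) summable_on UNIV \<times> UNIV"
      using Infinite_Sum.abs_summable_on_Sigma_iff[of "\<lambda>i. norm (u i) * norm (v i)" UNIV "\<lambda>_. UNIV"]
        inner_s sum_outer by (simp add: infsum_nonneg)
    then show ?thesis by simp
  qed
  have "(\<Sum>\<^sub>\<infinity>i. norm (u i) * norm (v i)) = (\<Sum>\<^sub>\<infinity>j. \<Sum>\<^sub>\<infinity>i. norm (u (j, i)) * norm (v (j, i)))"
    using infsum_Sigma_banach[OF abs_uv] by simp
  also have "\<dots> \<le> (\<Sum>\<^sub>\<infinity>j. 8 * 2 ^ j * a j)"
    by (rule infsum_mono[OF sum_outer sa']) (use inner_le in auto)
  also have "\<dots> = (\<Sum>j. 8 * 2 ^ j * a j)"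
    by (rule infsumI, rule norm_summable_imp_has_sum) (use sa a0 in \<open>auto simp: summable_sums\<close>)
  finally have bound: "(\<Sum>\<^sub>\<infinity>i. norm (u i) * norm (v i)) \<le> 16 * ((\<Sum>n. appr n T) + d)"
    using sa_le by linarith
  have a_lim: "a \<longlonglongrightarrow> 0"
  proof -
    have "(\<lambda>j. 2 ^ j * a j) \<longlonglongrightarrow> 0"
      using summable_LIMSEQ_zero[OF summable_mult[OF sa, of "1/8"]] by simp
    then show ?thesis
    proof (rule Lim_null_comparison[rotated], intro always_eventually allI)
      fix j
      have "1 * a j \<le> 2 ^ j * a j" by (intro mult_right_mono a0) simp
      then show "norm (a j) \<le> 2 ^ j * a j" using a0[of j] by simp
    qed
  qed
  have F_lim: "F \<longlonglongrightarrow> T"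
  proof -
    have "(\<lambda>j. F j - T) \<longlonglongrightarrow> 0"
      by (rule Lim_null_comparison[OF _ a_lim])
        (use F(2) in \<open>auto intro!: always_eventually simp: norm_minus_commute less_imp_le\<close>)
    then show ?thesis by (rule LIM_zero_cancel)
  qed
  have "((\<lambda>i. cinner y (u i) * cinner (v i) x) has_sum cinner y (app T x)) UNIV" for x y
  proof -
    let ?h = "\<lambda>i. cinner y (u i) * cinner (v i) x"
    have "(\<lambda>i. norm (?h i)) summable_on UNIV"
    proof (rule summable_on_comparison_test)
      show "(\<lambda>i. norm y * norm x * (norm (u i) * norm (v i))) summable_on UNIV"
        by (rule summable_on_cmult_right) (use abs_uv in simp)
      show "norm (?h i) \<le> norm y * norm x * (norm (u i) * norm (v i))" for i
        using mult_mono[OF cmod_cinner_le[of y "u i"] cmod_cinner_le[of "v i" x]]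
        by (simp add: norm_mult mult_ac)
    qed simp
    then have hs: "?h summable_on UNIV \<times> UNIV"
      using abs_summable_summable by simp
    have "infsum ?h (UNIV \<times> UNIV) = (\<Sum>\<^sub>\<infinity>j. \<Sum>\<^sub>\<infinity>i. ?h (j, i))"
      using infsum_Sigma_banach[OF hs] by simp
    also have "(\<lambda>j. \<Sum>\<^sub>\<infinity>i. ?h (j, i)) = (\<lambda>j. cinner y (app (G j) x))"
    proof
      fix j
      have "(\<Sum>\<^sub>\<infinity>i. ?h (j, i)) = (\<Sum>i<N j. ?h (j, i))"
        by (rule fs[of j]) (simp add: u_def)
      also have "\<dots> = cinner y (app (G j) x)"
        by (subst w(2)) (simp add: cinner_sum_right cinner_cscale_right u_def v_def mult.commute)
      finally show "(\<Sum>\<^sub>\<infinity>i. ?h (j, i)) = cinner y (app (G j) x)" .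
    qed
    also have "(\<Sum>\<^sub>\<infinity>j. cinner y (app (G j) x)) = cinner y (app T x)"
    proof (rule infsumI, rule norm_summable_imp_has_sum)
      show "summable (\<lambda>j. norm (cinner y (app (G j) x)))"
      proof (rule summable_comparison_test')
        show "summable (\<lambda>j. norm y * norm x * (8 * 2 ^ j * a j))"
          by (rule summable_mult[OF sa])
        fix j
        have "norm (cinner y (app (G j) x)) \<le> norm y * (norm (G j) * norm x)"
          by (rule order_trans[OF cmod_cinner_le]) (intro mult_left_mono norm_app norm_ge_zero)
        also have "\<dots> \<le> norm y * ((8 * 2 ^ j * a j) * norm x)"
        proof (intro mult_left_mono mult_right_mono norm_ge_zero)
          have "(1::real) \<le> 2 ^ j" by simp
          then have "2 \<le> 8 * (2::real) ^ j" by linarith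
          then have "2 * a j \<le> 8 * 2 ^ j * a j" by (intro mult_right_mono a0)
          with nG[of j] show "norm (G j) \<le> 8 * 2 ^ j * a j" by linarith
        qed
        finally show "norm (norm (cinner y (app (G j) x))) \<le> norm y * norm x * (8 * 2 ^ j * a j)"
          by (simp add: mult_ac)
      qed
      have ps: "(\<Sum>j<n. G j) = F n" for n
        unfolding G_def by (subst sum_lessThan_telescope) (simp add: F0)
      have "(\<Sum>j<n. cinner y (app (G j) x)) = cinner y (app (F n) x)" for n
        by (simp add: cinner_sum_right app_sum flip: ps)
      then show "(\<lambda>j. cinner y (app (G j) x)) sums cinner y (app T x)"
        unfolding sums_def by (simp, intro tendsto_intros F_lim)
    qed
    finally show ?thesis using has_sum_infsum[OF hs] by simp
  qed
  then have "nuclear_rep u v T"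
    using abs_uv by (simp add: nuclear_rep_def)
  then show thesis using bound by (rule that)
qed

text \<open>Summable approximation numbers are chosen instead of summable diagonal entries because
  they survive sums and products and yield \<open>trace_class_bound\<close>.\<close>

definition trace_class :: "'n::finite bop \<Rightarrow> bool" where
  "trace_class T \<longleftrightarrow> summable (\<lambda>n. appr n T)"

lemma trace_class_nuclear: "trace_class T \<Longrightarrow> \<exists>u v. nuclear_rep u v T"
  unfolding trace_class_def by (rule nuclear_rep_exists[of T 1]) auto

lemma trace_class_summable: "trace_class T \<Longrightarrow> diag_entry T summable_on UNIV"
  using trace_class_nuclear nuclear_rep_trace(1) by blast

lemma trace_class_bound: "trace_class T \<Longrightarrow> cmod (trace_op T) \<le> 16 * (\<Sum>n. appr n T)"
proof (rule field_le_epsilon)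
  fix e :: real assume T: "trace_class T" and "e > 0"
  then have e: "e / 16 > 0" by simp
  show "cmod (trace_op T) \<le> 16 * (\<Sum>n. appr n T) + e"
  proof (rule nuclear_rep_exists[OF T[unfolded trace_class_def] e])
    fix u v assume "nuclear_rep u v T" "(\<Sum>\<^sub>\<infinity>i. norm (u i) * norm (v i)) \<le> 16 * ((\<Sum>n. appr n T) + e / 16)"
    then show ?thesis using nuclear_rep_trace(3)[of u v T] by simp
  qed
qed

lemma trace_commute: "trace_class T \<Longrightarrow> trace_op (S * T) = trace_op (T * S)"
  using trace_class_nuclear nuclear_rep_trace_commute by blast

lemma sum_block_le:
  fixes a :: "nat \<Rightarrow> real"
  assumes "\<And>m n. m \<le> n \<Longrightarrow> a n \<le> a m"
  shows "(\<Sum>n<N * k. a n) \<le> real k * (\<Sum>n<N. a (k * n))"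
proof (induction N)
  case (Suc N)
  have "(\<Sum>n<Suc N * k. a n) = (\<Sum>n<N * k. a n) + (\<Sum>i<k. a (N * k + i))"
    using sum_lessThan_add[of a "N * k" k] by (simp add: add.commute)
  also have "(\<Sum>i<k. a (N * k + i)) \<le> (\<Sum>i<k. a (k * N))"
    by (intro sum_mono assms) (simp add: mult.commute)
  finally show ?case using Suc by (simp add: algebra_simps)
qed simp

text \<open>A block of length k is bounded by k times its first term. This converts bounds along
  multiples of k, the form in which sums and products of operators are estimated, into
  summability.\<close>

lemma summable_block:
  fixes a :: "nat \<Rightarrow> real"
  assumes mono: "\<And>m n. m \<le> n \<Longrightarrow> a n \<le> a m" and nn: "\<And>n. 0 \<le> a n" and k: "k \<ge> 1"
    and bd: "\<And>N. (\<Sum>n<N. a (k * n)) \<le> M"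
  shows "summable a" "suminf a \<le> real k * M"
proof -
  have *: "(\<Sum>n<N. a n) \<le> real k * M" for N
  proof -
    have "(\<Sum>n<N. a n) \<le> (\<Sum>n<N * k. a n)"
      using k nn by (intro sum_mono2) auto
    also have "\<dots> \<le> real k * (\<Sum>n<N. a (k * n))" by (rule sum_block_le[OF mono])
    also have "\<dots> \<le> real k * M" by (intro mult_left_mono bd) simp
    finally show ?thesis .
  qed
  show s: "summable a" by (rule summableI_nonneg_bounded[OF nn *])
  show "suminf a \<le> real k * M" by (rule suminf_le_const[OF s *])
qed

lemma trace_class_add:
  assumes "trace_class S" "trace_class T" shows "trace_class (S + T)"
  unfolding trace_class_def
proof (rule summable_block(1)[where k=2])
  fix N
  have "(\<Sum>n<N. appr (2 * n) (S + T)) \<le> (\<Sum>n<N. appr n S + appr n T)"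
    by (intro sum_mono) (metis appr_add mult_2)
  also have "\<dots> = (\<Sum>n<N. appr n S) + (\<Sum>n<N. appr n T)" by (rule sum.distrib)
  also have "\<dots> \<le> (\<Sum>n. appr n S) + (\<Sum>n. appr n T)"
    using assms unfolding trace_class_def by (intro add_mono sum_le_suminf) auto
  finally show "(\<Sum>n<N. appr (2 * n) (S + T)) \<le> (\<Sum>n. appr n S) + (\<Sum>n. appr n T)" .
qed (auto intro: appr_antimono)

lemma trace_class_mult_left: "trace_class T \<Longrightarrow> trace_class (S * T)"
  unfolding trace_class_def
  by (rule summable_comparison_test'[OF summable_mult[of _ "norm S"]])
    (use appr_mult[of 0 _ S T] in \<open>auto simp: appr_0\<close>)

lemma trace_class_mult_right: "trace_class T \<Longrightarrow> trace_class (T * S)"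
  unfolding trace_class_def
  by (rule summable_comparison_test'[OF summable_mult2[of _ "norm S"]])
    (use appr_mult[of _ 0 T S] in \<open>auto simp: appr_0\<close>)

lemma trace_class_scaleR: "trace_class T \<Longrightarrow> trace_class (c *\<^sub>R T)"
  using trace_class_mult_left[of T "c *\<^sub>R 1"] by simp

lemma trace_class_uminus: "trace_class T \<Longrightarrow> trace_class (- T)"
  using trace_class_scaleR[of T "-1"] by simp

lemma trace_class_diff: "trace_class S \<Longrightarrow> trace_class T \<Longrightarrow> trace_class (S - T)"
  using trace_class_add[of S "- T"] by (simp add: trace_class_uminus)

lemma trace_class_zero: "trace_class 0"
proof -
  have "appr n (0 :: 'a bop) = 0" for n
    using appr_le_norm[of n "0 :: 'a bop"] appr_nonneg[of n "0 :: 'a bop"] by simp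
  then show ?thesis by (simp add: trace_class_def)
qed

lemma trace_class_sum: "(\<And>i. i \<in> I \<Longrightarrow> trace_class (f i)) \<Longrightarrow> trace_class (\<Sum>i\<in>I. f i)"
  by (induction I rule: infinite_finite_induct) (simp_all add: trace_class_zero trace_class_add)

lemma trace_add:
  assumes "trace_class S" "trace_class T" shows "trace_op (S + T) = trace_op S + trace_op T"
proof -
  have "diag_entry (S + T) = (\<lambda>b. diag_entry S b + diag_entry T b)"
    by (simp add: fun_eq_iff diag_entry_eq app_add cinner_add_right)
  then show ?thesis
    unfolding trace_op_def using assms by (simp add: infsum_add trace_class_summable)
qed

lemma trace_cscale_op: "trace_op (cscale_op c T) = c * trace_op T"
proof -
  have "diag_entry (cscale_op c T) = (\<lambda>b. c * diag_entry T b)"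
    by (simp add: fun_eq_iff diag_entry_eq app_cscale_op cinner_cscale_right)
  then show ?thesis
    unfolding trace_op_def by (simp add: infsum_cmult_right')
qed

lemma cscale_op_of_real: "cscale_op (of_real r) T = r *\<^sub>R T"
  by (rule bop_eqI) (simp add: app_cscale_op app_scaleR cscale_of_real)

lemma trace_scaleR: "trace_op (c *\<^sub>R T) = of_real c * trace_op T"
  using trace_cscale_op[of "of_real c" T] by (simp add: cscale_op_of_real)

lemma trace_uminus: "trace_op (- T) = - trace_op T"
  using trace_scaleR[of "-1" T] by simp

lemma trace_zero [simp]: "trace_op 0 = 0"
  using trace_scaleR[of 0 0] by simp

lemma trace_diff:
  assumes "trace_class S" "trace_class T" shows "trace_op (S - T) = trace_op S - trace_op T"
  using trace_add[OF assms(1) trace_class_uminus[OF assms(2)]] by (simp add: trace_uminus)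

lemma trace_sum:
  "(\<And>i. i \<in> I \<Longrightarrow> trace_class (f i)) \<Longrightarrow> trace_op (\<Sum>i\<in>I. f i) = (\<Sum>i\<in>I. trace_op (f i))"
  by (induction I rule: infinite_finite_induct) (simp_all add: trace_add trace_class_sum)

text \<open>Conjugation by the involution \<open>pol\<close> preserves the trace of a trace class
  operator, so the two halves agree.\<close>

lemma cond_trace_eq:
  assumes "trace_class T" shows "cond_trace T = trace_op T"
proof -
  have "trace_op (pol * T * pol) = trace_op T"
    using trace_commute[OF trace_class_mult_right[OF assms, of pol], of pol] by (simp add: mult.assoc)
  then show ?thesis
    using assms by (simp add: cond_trace_def trace_add trace_class_mult_left trace_class_mult_right)
qed

section \<open>Approximation numbers and Schatten norms\<close>

text \<open>A dual description of the approximation numbers. Restricting T to the complement of n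
  vectors changes it by an operator of rank n, so the restriction has norm at least
  \<open>appr n T\<close>, and some unit vector of the complement reaches half of its norm.\<close>

lemma greedy_orthofamily:
  "\<exists>f :: nat \<Rightarrow> 'n::finite l2. orthofamily f UNIV \<and> (\<forall>n. appr n T \<le> 2 * norm (app T (f n)))"
proof -
  define P :: "(nat \<Rightarrow> 'n l2) \<Rightarrow> nat \<Rightarrow> 'n l2 \<Rightarrow> bool" where
    "P f n r \<longleftrightarrow> (norm r = 0 \<or> norm r = 1) \<and> (\<forall>i<n. cinner (f i) r = 0) \<and> appr n T \<le> 2 * norm (app T r)" for f n r
  have "\<exists>f. \<forall>n. P f n (f n)"
  proof (rule dependent_wellorder_choice)
    show "P f n r = P g n r" if "\<And>m. m < n \<Longrightarrow> f m = g m" for r f g n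
      using that by (simp add: P_def)
    fix n f assume P: "\<And>m. m < n \<Longrightarrow> P f m (f m)"
    have of: "orthofamily f {..<n}"
      unfolding orthofamily_def
    proof (intro conjI ballI impI)
      fix i assume "i \<in> {..<n}"
      then show "norm (f i) = 0 \<or> norm (f i) = 1" using P by (simp add: P_def)
      fix j assume "j \<in> {..<n}" "i \<noteq> j"
      then show "cinner (f i) (f j) = 0"
        using P[of i] P[of j] \<open>i \<in> {..<n}\<close> cinner_commute[of "f i" "f j"]
        by (cases "i < j") (auto simp: P_def)
    qed
    \<comment> \<open>The projection onto the complement of the vectors chosen so far.\<close>
    define q where "q x = x - (\<Sum>i<n. cscale (cinner (f i) x) (f i))" for x
    have nq: "norm (q x) \<le> norm x" for x
      unfolding q_def by (rule bessel_remainder_norm_le[OF _ of]) simp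
    have qa: "q (x + y) = q x + q y" for x y
      by (simp add: q_def cinner_add_right cscale_add_left sum.distrib)
    have qs: "q (cscale c x) = cscale c (q x)" for c x
      by (simp add: q_def cscale_diff cscale_sum cscale_cscale cinner_cscale_right)
    have "\<exists>Q. \<forall>x. app Q x = q x"
      by (rule bop_exists[of q 1, OF qa qs]) (use nq in auto)
    then obtain Q where Q: "\<And>x. app Q x = q x" by blast
    have "rank_le n (1 - Q)"
      unfolding rank_le_def by (intro exI[of _ f] allI) (simp add: app_diff app_one Q q_def)
    then have "appr n T \<le> norm (T - T * (1 - Q))"
      by (intro appr_le rank_le_mult_left)
    then have aQ: "appr n T \<le> norm (T * Q)" by (simp add: algebra_simps)
    show "\<exists>r. P f n r"
    proof (cases "norm (T * Q) = 0")
      \<comment> \<open>Where T vanishes on the complement, the zero vector is an admissible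
        choice.\<close>
      case True
      then have "P f n 0" using aQ by (simp add: P_def)
      then show ?thesis by blast
    next
      case False
      have "\<exists>x. norm (app (T * Q) x) > norm (T * Q) / 2 * norm x"
      proof (rule ccontr)
        assume "\<not> ?thesis"
        then have "norm (T * Q) \<le> norm (T * Q) / 2"
          by (intro norm_bop_le) (auto simp: not_less)
        then show False using False by simp
      qed
      then obtain x where x: "norm (app T (q x)) > norm (T * Q) / 2 * norm x"
        by (auto simp: app_times Q)
      have qx: "norm (q x) > 0"
      proof (rule ccontr)
        assume "\<not> norm (q x) > 0"
        then have "q x = 0" by simp
        then have "norm (T * Q) / 2 * norm x < norm (app T 0)" using x by metis
        moreover have "0 \<le> norm (T * Q) / 2 * norm x" by simp
        ultimately show False by (metis app_zero_right norm_zero not_less)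
      qed
      define r where "r = (1 / norm (q x)) *\<^sub>R q x"
      have "norm r = 1" using qx by (simp add: r_def)
      moreover have "cinner (f i) r = 0" if "i < n" for i
        using orthofamily_cinner_sum[OF _ of, of i "\<lambda>i. cinner (f i) x"] that
        by (simp add: r_def q_def cinner_scaleR_right cinner_diff_right)
      moreover have "norm (T * Q) \<le> 2 * norm (app T r)"
      proof -
        have "norm (T * Q) / 2 * norm (q x) \<le> norm (T * Q) / 2 * norm x"
          by (intro mult_left_mono nq) simp
        also have "\<dots> < norm (app T (q x))" by (rule x)
        finally have "norm (T * Q) / 2 < norm (app T (q x)) / norm (q x)"
          using qx by (simp add: less_divide_eq)
        then show ?thesis using qx by (simp add: r_def app_scaleR_right mult.commute)
      qed
      ultimately have "P f n r" using aQ by (simp add: P_def)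
      then show ?thesis by blast
    qed
  qed
  then obtain f where f: "\<And>n. P f n (f n)" by blast
  have "orthofamily f UNIV"
    unfolding orthofamily_def
  proof (intro conjI ballI impI)
    fix i j :: nat
    show "norm (f i) = 0 \<or> norm (f i) = 1" using f[of i] by (simp add: P_def)
    assume "i \<noteq> j"
    then show "cinner (f i) (f j) = 0"
      using f[of i] f[of j] cinner_commute[of "f i" "f j"] by (cases "i < j") (auto simp: P_def)
  qed
  then show ?thesis using f by (auto simp: P_def)
qed

lemma trace_op_nonneg: "positive_op C \<Longrightarrow> 0 \<le> Re (trace_op C)"
proof (cases "diag_entry C summable_on UNIV")
  case True
  assume "positive_op C"
  then show ?thesis
    unfolding trace_op_def infsum_Re[OF True, symmetric]
    by (intro infsum_nonneg diag_entry_real)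
qed (simp add: trace_op_def infsum_not_exists)

lemma schatten_norm_power:
  assumes "p \<ge> 1"
  shows "schatten_norm (2 * real p) T ^ (2 * p) = Re (trace_op ((adj T * T) ^ p))"
proof -
  have nn: "0 \<le> Re (trace_op ((adj T * T) ^ p))"
    by (intro trace_op_nonneg positive_op_power positive_op_adj_mult)
  have "(x powr (1 / (2 * real p))) ^ (2 * p) = x" if "0 \<le> x" for x
  proof (cases "x = 0")
    case False
    then have "(x powr (1 / (2 * real p))) ^ (2 * p) = x powr (1 / (2 * real p) * real (2 * p))"
      using that by (simp add: powr_realpow[symmetric] powr_powr)
    also have "1 / (2 * real p) * real (2 * p) = 1" using assms by simp
    finally show ?thesis using that False by simp
  qed (use assms in \<open>simp add: power_0_left\<close>)
  from this[OF nn] show ?thesis by (simp add: schatten_norm_def abs_powr_even[OF assms])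
qed

text \<open>Along the greedy family \<open>appr n T\<close> is at most twice |T (f n)|. Jensen's
  inequality bounds the power 2p of |T (f n)| by the quadratic form of (T^* T)^p, and the trace
  bounds the sum of these forms.\<close>

lemma sum_appr_le_schatten:
  fixes T :: "'n::finite bop"
  assumes T: "T \<in> schatten (2 * real p)" and p: "p \<ge> 1"
  shows "(\<Sum>n<N. appr n T ^ (2 * p)) \<le> (2 * schatten_norm (2 * real p) T) ^ (2 * p)"
proof -
  obtain f :: "nat \<Rightarrow> 'n l2" where f: "orthofamily f UNIV" "\<And>n. appr n T \<le> 2 * norm (app T (f n))"
    using greedy_orthofamily[of T] by blast
  define A where "A = adj T * T"
  have A: "positive_op A" unfolding A_def by (rule positive_op_adj_mult)
  have q: "Re (cinner u (app A u)) = (norm (app T u))\<^sup>2" for u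
    by (simp add: A_def app_times cinner_adj_right Re_cinner power2_norm_eq_inner)
  have "appr n T ^ (2 * p) \<le> 4 ^ p * Re (cinner (f n) (app (A ^ p) (f n)))" for n
  proof -
    have "appr n T ^ (2 * p) \<le> (2 * norm (app T (f n))) ^ (2 * p)"
      by (intro power_mono f) simp
    also have "\<dots> = 4 ^ p * ((norm (app T (f n)))\<^sup>2) ^ p"
      by (simp add: power_mult power_mult_distrib)
    also have "((norm (app T (f n)))\<^sup>2) ^ p \<le> Re (cinner (f n) (app (A ^ p) (f n)))"
    proof (cases "norm (f n) = 1")
      case True
      then show ?thesis using power_cinner_le[OF A True p] by (simp add: q)
    next
      case False
      then have "f n = 0" using f(1) unfolding orthofamily_def by auto
      then show ?thesis using p by (simp add: power_0_left)
    qed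
    finally show ?thesis by simp
  qed
  then have "(\<Sum>n<N. appr n T ^ (2 * p)) \<le> (\<Sum>n<N. 4 ^ p * Re (cinner (f n) (app (A ^ p) (f n))))"
    by (intro sum_mono)
  also have "\<dots> = 4 ^ p * (\<Sum>n<N. Re (cinner (f n) (app (A ^ p) (f n))))"
    by (simp add: sum_distrib_left)
  also have "\<dots> \<le> 4 ^ p * Re (trace_op (A ^ p))"
    using T f(1) unfolding schatten_def abs_powr_even[OF p]
    by (intro mult_left_mono sum_cinner_le_trace positive_op_power A)
      (auto simp: A_def intro: orthofamily_subset)
  also have "\<dots> = (2 * schatten_norm (2 * real p) T) ^ (2 * p)"
    unfolding power_mult_distrib schatten_norm_power[OF p] A_def by (simp add: power_mult)
  finally show ?thesis .
qed

section \<open>Graded ideals\<close>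

text \<open>\<open>schatten_bound r k M T\<close> says that \<open>T\<close> lies in the Schatten ideal of exponent \<open>r / k\<close>, with a norm
  controlled by \<open>M\<close>: its approximation numbers are dominated by \<open>M s\<^sub>n\<^sup>k\<close> where the \<open>r\<close>-norm of \<open>s\<close> is at most one.
  For \<open>k = 0\<close> this is the operator norm. Sampling at multiples of \<open>k\<close> makes Hoelder's inequality trivial.\<close>

definition schatten_bound :: "nat \<Rightarrow> nat \<Rightarrow> real \<Rightarrow> 'n::finite bop \<Rightarrow> bool" where
  "schatten_bound r k M T \<longleftrightarrow> 0 \<le> M \<and> (\<exists>s. (\<forall>n. 0 \<le> s n) \<and> (\<forall>N. (\<Sum>n<N. s n ^ r) \<le> 1) \<and>
     (\<forall>n. appr (k * n) T \<le> M * s n ^ k))"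

lemma schatten_bound_nonneg: "schatten_bound r k M T \<Longrightarrow> 0 \<le> M"
  by (simp add: schatten_bound_def)

lemma schatten_bound_mono:
  assumes "schatten_bound r k M T" "M \<le> M'" shows "schatten_bound r k M' T"
proof -
  obtain s where s: "0 \<le> M" "\<forall>n. 0 \<le> s n" "\<forall>N. (\<Sum>n<N. s n ^ r) \<le> 1" "\<forall>n. appr (k * n) T \<le> M * s n ^ k"
    using assms(1) unfolding schatten_bound_def by blast
  have "appr (k * n) T \<le> M' * s n ^ k" for n
    using s assms(2) by (meson mult_right_mono order_trans zero_le_power)
  then show ?thesis unfolding schatten_bound_def using s assms(2) by (auto intro!: exI[of _ s])
qed

lemma schatten_bound_0:
  assumes "r \<ge> 1" shows "schatten_bound r 0 M T \<longleftrightarrow> norm T \<le> M"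
proof
  assume "norm T \<le> M"
  moreover from this have "0 \<le> M" using norm_ge_zero order_trans by blast
  ultimately show "schatten_bound r 0 M T"
    using assms by (auto simp: schatten_bound_def appr_0 power_0_left intro!: exI[of _ "\<lambda>_. 0"])
qed (auto simp: schatten_bound_def appr_0)

lemma schatten_bound_zero: "r \<ge> 1 \<Longrightarrow> 0 \<le> M \<Longrightarrow> schatten_bound r k M 0"
proof -
  assume "r \<ge> 1" "0 \<le> M"
  moreover have "appr n (0 :: 'a bop) = 0" for n
    using appr_le_norm[of n "0 :: 'a bop"] appr_nonneg[of n "0 :: 'a bop"] by simp
  ultimately show "schatten_bound r k M (0 :: 'a bop)"
    by (auto simp: schatten_bound_def power_0_left intro!: exI[of _ "\<lambda>_. 0"])
qed

text \<open>Both sequences are replaced by half their maximum, whose r-th powers still sum to at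
  most one as 2^r >= 2. The factor 2^(j+k) undoes the halving.\<close>

lemma schatten_bound_mult:
  assumes r: "r \<ge> 1" and S: "schatten_bound r j M S" and T: "schatten_bound r k M' T"
  shows "schatten_bound r (j + k) (M * M' * 2 ^ (j + k)) (S * T)"
proof -
  obtain s where s: "0 \<le> M" "\<And>n. 0 \<le> s n" "\<And>N. (\<Sum>n<N. s n ^ r) \<le> 1" "\<And>n. appr (j * n) S \<le> M * s n ^ j"
    using S unfolding schatten_bound_def by blast
  obtain s' where s': "0 \<le> M'" "\<And>n. 0 \<le> s' n" "\<And>N. (\<Sum>n<N. s' n ^ r) \<le> 1" "\<And>n. appr (k * n) T \<le> M' * s' n ^ k"
    using T unfolding schatten_bound_def by blast
  define m where "m n = max (s n) (s' n)" for n
  have m0: "0 \<le> m n" for n by (simp add: m_def s le_max_iff_disj)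
  have mr: "m n ^ r \<le> s n ^ r + s' n ^ r" for n
    using s(2)[of n] s'(2)[of n] by (auto simp: m_def max_def)
  have two: "(2::real) \<le> 2 ^ r" using r self_le_power[of "2::real" r] by simp
  have "(\<Sum>n<N. (m n / 2) ^ r) \<le> 1" for N
  proof -
    have "(\<Sum>n<N. (m n / 2) ^ r) \<le> (\<Sum>n<N. (s n ^ r + s' n ^ r) / 2)"
      unfolding power_divide using two mr m0 s(2) s'(2)
      by (intro sum_mono frac_le) auto
    also have "\<dots> = ((\<Sum>n<N. s n ^ r) + (\<Sum>n<N. s' n ^ r)) / 2"
      by (simp add: sum.distrib flip: sum_divide_distrib)
    also have "\<dots> \<le> 1" using s(3)[of N] s'(3)[of N] by simp
    finally show ?thesis .
  qed
  moreover have "appr ((j + k) * n) (S * T) \<le> M * M' * 2 ^ (j + k) * (m n / 2) ^ (j + k)" for n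
  proof -
    have "appr ((j + k) * n) (S * T) \<le> appr (j * n) S * appr (k * n) T"
      using appr_mult[of "j * n" "k * n" S T] by (simp add: distrib_right)
    also have "\<dots> \<le> (M * s n ^ j) * (M' * s' n ^ k)"
      by (intro mult_mono s s') (auto intro!: mult_nonneg_nonneg zero_le_power s)
    also have "\<dots> \<le> (M * m n ^ j) * (M' * m n ^ k)"
      using s s' by (intro mult_mono mult_left_mono power_mono) (auto simp: m_def le_max_iff_disj intro!: mult_nonneg_nonneg zero_le_power)
    also have "\<dots> = M * M' * 2 ^ (j + k) * (m n / 2) ^ (j + k)"
      by (simp add: power_add power_divide)
    finally show ?thesis .
  qed
  ultimately show ?thesis
    unfolding schatten_bound_def using s(1) s'(1) m0
    by (intro conjI exI[of _ "\<lambda>n. m n / 2"]) auto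
qed

lemma schatten_bound_mult_left:
  assumes "schatten_bound r k M T" shows "schatten_bound r k (norm A * M) (A * T)"
proof -
  obtain s where s: "0 \<le> M" "\<forall>n. 0 \<le> s n" "\<forall>N. (\<Sum>n<N. s n ^ r) \<le> 1" "\<forall>n. appr (k * n) T \<le> M * s n ^ k"
    using assms(1) unfolding schatten_bound_def by blast
  have "appr (k * n) (A * T) \<le> norm A * M * s n ^ k" for n
  proof -
    have "appr (k * n) (A * T) \<le> norm A * appr (k * n) T" using appr_mult[of 0 "k * n" A T] by (simp add: appr_0)
    also have "\<dots> \<le> norm A * (M * s n ^ k)" using s by (intro mult_left_mono) auto
    finally show ?thesis by (simp add: mult.assoc)
  qed
  then show ?thesis unfolding schatten_bound_def using s by (auto intro!: exI[of _ s])
qed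

lemma schatten_bound_mult_right:
  assumes "schatten_bound r k M T" shows "schatten_bound r k (M * norm A) (T * A)"
proof -
  obtain s where s: "0 \<le> M" "\<forall>n. 0 \<le> s n" "\<forall>N. (\<Sum>n<N. s n ^ r) \<le> 1" "\<forall>n. appr (k * n) T \<le> M * s n ^ k"
    using assms(1) unfolding schatten_bound_def by blast
  have "appr (k * n) (T * A) \<le> M * norm A * s n ^ k" for n
  proof -
    have "appr (k * n) (T * A) \<le> appr (k * n) T * norm A" using appr_mult[of "k * n" 0 T A] by (simp add: appr_0)
    also have "\<dots> \<le> (M * s n ^ k) * norm A" using s by (intro mult_right_mono) auto
    finally show ?thesis by (simp add: mult_ac)
  qed
  then show ?thesis unfolding schatten_bound_def using s by (auto intro!: exI[of _ s])
qed

lemma schatten_bound_scaleR: "schatten_bound r k M T \<Longrightarrow> schatten_bound r k (\<bar>c\<bar> * M) (c *\<^sub>R T)"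
  using schatten_bound_mult_left[of r k M T "c *\<^sub>R 1"] by simp

lemma schatten_bound_uminus: "schatten_bound r k M T \<Longrightarrow> schatten_bound r k M (- T)"
  using schatten_bound_scaleR[of r k M T "-1"] by simp

text \<open>Ranks add, so the sample at n has to use both sequences at n div 2. Every value then
  occurs twice and the maximum may double the sum again; division by 4 compensates, at the price of
  the constant 4^k.\<close>

lemma schatten_bound_add:
  assumes r: "r \<ge> 1" and S: "schatten_bound r k M S" and T: "schatten_bound r k M' T"
  shows "schatten_bound r k ((M + M') * 4 ^ k) (S + T)"
proof -
  obtain s where s: "0 \<le> M" "\<And>n. 0 \<le> s n" "\<And>N. (\<Sum>n<N. s n ^ r) \<le> 1" "\<And>n. appr (k * n) S \<le> M * s n ^ k"
    using S unfolding schatten_bound_def by blast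
  obtain s' where s': "0 \<le> M'" "\<And>n. 0 \<le> s' n" "\<And>N. (\<Sum>n<N. s' n ^ r) \<le> 1" "\<And>n. appr (k * n) T \<le> M' * s' n ^ k"
    using T unfolding schatten_bound_def by blast
  define m where "m n = max (s n) (s' n)" for n
  have m0: "0 \<le> m n" for n by (simp add: m_def s le_max_iff_disj)
  have mr: "m n ^ r \<le> s n ^ r + s' n ^ r" for n
    using s(2)[of n] s'(2)[of n] by (auto simp: m_def max_def)
  have four: "(4::real) \<le> 4 ^ r" using r self_le_power[of "4::real" r] by simp
  have "(\<Sum>n<N. (m (n div 2) / 4) ^ r) \<le> 1" for N
  proof -
    have db: "(\<Sum>n<2 * N. g (n div 2)) = 2 * (\<Sum>n<N. g n)" for g :: "nat \<Rightarrow> real"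
      by (induction N) simp_all
    have "(\<Sum>n<N. (m (n div 2) / 4) ^ r) \<le> (\<Sum>n<2 * N. (m (n div 2) / 4) ^ r)"
      using m0 by (intro sum_mono2) auto
    also have "\<dots> = 2 * (\<Sum>n<N. (m n / 4) ^ r)" by (rule db)
    also have "\<dots> \<le> 2 * (\<Sum>n<N. (s n ^ r + s' n ^ r) / 4)"
      unfolding power_divide using four mr m0 s(2) s'(2)
      by (intro mult_left_mono sum_mono frac_le) auto
    also have "\<dots> = ((\<Sum>n<N. s n ^ r) + (\<Sum>n<N. s' n ^ r)) / 2"
      by (simp add: sum.distrib flip: sum_divide_distrib)
    also have "\<dots> \<le> 1" using s(3)[of N] s'(3)[of N] by simp
    finally show ?thesis .
  qed
  moreover have "appr (k * n) (S + T) \<le> (M + M') * 4 ^ k * (m (n div 2) / 4) ^ k" for n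
  proof -
    let ?h = "n div 2"
    have "k * ?h + k * ?h = k * (2 * ?h)" by simp
    also have "\<dots> \<le> k * n" by (intro mult_left_mono) auto
    finally have "appr (k * n) (S + T) \<le> appr (k * ?h + k * ?h) (S + T)" by (rule appr_antimono)
    also have "\<dots> \<le> appr (k * ?h) S + appr (k * ?h) T" by (rule appr_add)
    also have "\<dots> \<le> M * s ?h ^ k + M' * s' ?h ^ k" by (intro add_mono s s')
    also have "\<dots> \<le> M * m ?h ^ k + M' * m ?h ^ k"
      using s s' by (intro add_mono mult_left_mono power_mono) (auto simp: m_def)
    also have "\<dots> = (M + M') * 4 ^ k * (m ?h / 4) ^ k"
      by (simp add: power_divide algebra_simps)
    finally show ?thesis .
  qed
  ultimately show ?thesis
    unfolding schatten_bound_def using s(1) s'(1) m0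
    by (intro conjI exI[of _ "\<lambda>n. m (n div 2) / 4"]) auto
qed

lemma schatten_bound_diff:
  assumes r: "r \<ge> 1" and S: "schatten_bound r k M S" and T: "schatten_bound r k M' T"
  shows "schatten_bound r k ((M + M') * 4 ^ k) (S - T)"
  using schatten_bound_add[OF r S schatten_bound_uminus[OF T]] by simp

text \<open>The sequence is bounded by 1, so its k-th powers lie below its r-th powers once k >= r.
  The constant collects k from the sampling and 16 from the nuclear representation.\<close>

lemma schatten_bound_trace:
  assumes T: "schatten_bound r k M T" and k: "r \<le> k" "k \<ge> 1" and r: "r \<ge> 1"
  shows "trace_class T" "cmod (trace_op T) \<le> 16 * real k * M"
proof -
  obtain s where s: "0 \<le> M" "\<And>n. 0 \<le> s n" "\<And>N. (\<Sum>n<N. s n ^ r) \<le> 1" "\<And>n. appr (k * n) T \<le> M * s n ^ k"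
    using T unfolding schatten_bound_def by blast
  have s1: "s n \<le> 1" for n
  proof -
    have "s n ^ r \<le> (\<Sum>i<Suc n. s i ^ r)"
      using s(2) by (intro member_le_sum) auto
    then have "s n ^ r \<le> 1 ^ r" using s(3)[of "Suc n"] by simp
    then show ?thesis using power_mono_iff[of "s n" 1 r] s(2)[of n] r by simp
  qed
  have bd: "(\<Sum>n<N. appr (k * n) T) \<le> M" for N
  proof -
    have "(\<Sum>n<N. appr (k * n) T) \<le> (\<Sum>n<N. M * s n ^ r)"
      using s s1 k by (intro sum_mono order_trans[OF s(4)] mult_left_mono power_decreasing) auto
    also have "\<dots> = M * (\<Sum>n<N. s n ^ r)" by (simp add: sum_distrib_left)
    also have "\<dots> \<le> M * 1" using s by (intro mult_left_mono) auto
    finally show ?thesis by simp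
  qed
  have "summable (\<lambda>n. appr n T)" and le: "(\<Sum>n. appr n T) \<le> real k * M"
    using summable_block[of "\<lambda>n. appr n T", OF appr_antimono appr_nonneg k(2) bd] by auto
  then show tc: "trace_class T" by (simp add: trace_class_def)
  show "cmod (trace_op T) \<le> 16 * real k * M"
    using trace_class_bound[OF tc] le by simp
qed

text \<open>The canonical sequence is \<open>appr n T / M\<close>; for M = 0 it is zero by
  convention, and then all approximation numbers of T vanish.\<close>

lemma schatten_bound_1_iff:
  assumes r: "r \<ge> 1"
  shows "schatten_bound r 1 M T \<longleftrightarrow> 0 \<le> M \<and> (\<forall>N. (\<Sum>n<N. appr n T ^ r) \<le> M ^ r)"
proof
  assume "schatten_bound r 1 M T"
  then obtain s where s: "0 \<le> M" "\<And>n. 0 \<le> s n" "\<And>N. (\<Sum>n<N. s n ^ r) \<le> 1" "\<And>n. appr n T \<le> M * s n"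
    unfolding schatten_bound_def by auto
  have "(\<Sum>n<N. appr n T ^ r) \<le> M ^ r" for N
  proof -
    have "(\<Sum>n<N. appr n T ^ r) \<le> (\<Sum>n<N. (M * s n) ^ r)"
      by (intro sum_mono power_mono s) simp
    also have "\<dots> = M ^ r * (\<Sum>n<N. s n ^ r)" by (simp add: power_mult_distrib sum_distrib_left)
    also have "\<dots> \<le> M ^ r * 1" using s by (intro mult_left_mono) auto
    finally show ?thesis by simp
  qed
  with s show "0 \<le> M \<and> (\<forall>N. (\<Sum>n<N. appr n T ^ r) \<le> M ^ r)" by blast
next
  assume *: "0 \<le> M \<and> (\<forall>N. (\<Sum>n<N. appr n T ^ r) \<le> M ^ r)"
  have "(\<Sum>n<N. (appr n T / M) ^ r) \<le> 1" for N
  proof (cases "M = 0")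
    case False
    have "(\<Sum>n<N. (appr n T / M) ^ r) = (\<Sum>n<N. appr n T ^ r) / M ^ r"
      by (simp add: power_divide sum_divide_distrib)
    then show ?thesis using * False by (simp add: divide_le_eq)
  qed (use r in \<open>simp add: power_0_left\<close>)
  moreover have "appr n T \<le> M * (appr n T / M)" for n
  proof (cases "M = 0")
    case True
    have "appr n T ^ r \<le> (\<Sum>i<Suc n. appr i T ^ r)"
      by (intro member_le_sum) auto
    also have "\<dots> \<le> 0" using * True r by (auto simp: power_0_left dest: spec[of _ "Suc n"])
    finally have "appr n T ^ r \<le> 0" .
    then have "appr n T = 0" using r by (metis appr_nonneg order_antisym power_eq_0_iff zero_le_power)
    then show ?thesis by simp
  qed simp
  ultimately show "schatten_bound r 1 M T"
    using * by (auto simp: schatten_bound_def intro!: exI[of _ "\<lambda>n. appr n T / M"])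
qed

lemma schatten_bound_adj: "r \<ge> 1 \<Longrightarrow> schatten_bound r 1 M T \<Longrightarrow> schatten_bound r 1 M (adj T)"
  unfolding schatten_bound_1_iff by (simp add: appr_adj)

text \<open>Approximation numbers are Lipschitz in the operator norm, so finite sums of their powers
  pass to the limit. A bound in the ideal thus survives convergence that is known only in operator
  norm.\<close>

lemma schatten_bound_limit:
  assumes r: "r \<ge> 1" and X: "X \<longlonglongrightarrow> T" and b: "\<And>n. schatten_bound r 1 M (X n)"
  shows "schatten_bound r 1 M T"
  unfolding schatten_bound_1_iff[OF r]
proof (intro conjI allI)
  show "0 \<le> M" using b[of 0] by (rule schatten_bound_nonneg)
  fix N
  have ap: "(\<lambda>n. appr i (X n)) \<longlonglongrightarrow> appr i T" for i
  proof -
    have n0: "(\<lambda>n. norm (X n - T)) \<longlonglongrightarrow> 0"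
      using X by (simp add: LIM_zero tendsto_norm_zero)
    have "norm (appr i (X n) - appr i T) \<le> norm (X n - T)" for n
      using appr_lipschitz[of i "X n" T] appr_lipschitz[of i T "X n"] by (simp add: norm_minus_commute abs_le_iff)
    then have "(\<lambda>n. appr i (X n) - appr i T) \<longlonglongrightarrow> 0"
      by (intro Lim_null_comparison[OF _ n0] always_eventually allI)
    then show ?thesis by (rule LIM_zero_cancel)
  qed
  show "(\<Sum>n<N. appr n T ^ r) \<le> M ^ r"
  proof (rule LIMSEQ_le_const2)
    show "(\<lambda>k. \<Sum>n<N. appr n (X k) ^ r) \<longlonglongrightarrow> (\<Sum>n<N. appr n T ^ r)"
      by (intro tendsto_intros ap)
    show "\<exists>K. \<forall>k\<ge>K. (\<Sum>n<N. appr n (X k) ^ r) \<le> M ^ r"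
      using b unfolding schatten_bound_1_iff[OF r] by blast
  qed
qed

text \<open>Peeling off the first summand subjects each later term to the quasi-triangle inequality
  once more, hence the weights 4^(k+1).\<close>

lemma schatten_bound_sum:
  assumes r: "r \<ge> 1" and b: "\<And>k. k < K \<Longrightarrow> schatten_bound r 1 (M k) (T k)"
  shows "schatten_bound r 1 (\<Sum>k<K. 4 ^ Suc k * M k) (\<Sum>k<K. T k)"
  using b
proof (induction K arbitrary: M T)
  case 0
  then show ?case by (simp add: schatten_bound_zero[OF r])
next
  case (Suc K)
  have "schatten_bound r 1 (\<Sum>k<K. 4 ^ Suc k * M (Suc k)) (\<Sum>k<K. T (Suc k))"
    by (rule Suc.IH) (use Suc.prems in auto)
  from schatten_bound_add[OF r Suc.prems[of 0] this]
  have "schatten_bound r 1 ((M 0 + (\<Sum>k<K. 4 ^ Suc k * M (Suc k))) * 4 ^ 1) (T 0 + (\<Sum>k<K. T (Suc k)))" by simp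
  then show ?case
    by (simp add: sum.lessThan_Suc_shift algebra_simps sum_distrib_left del: sum.lessThan_Suc)
qed

lemma schatten_bound_power:
  assumes r: "r \<ge> 1" and T: "schatten_bound r j M T"
  shows "\<exists>M'. schatten_bound r (j * n) M' (T ^ n)"
proof (induction n)
  case 0
  then show ?case using schatten_bound_0[OF r, of 1 "1 :: 'a bop"] by auto
next
  case (Suc n)
  then obtain M' where "schatten_bound r (j * n) M' (T ^ n)" by blast
  from schatten_bound_mult[OF r T this] show ?case by auto
qed

lemma schatten_imp_bound:
  assumes "T \<in> schatten (2 * real p)" "p \<ge> 1"
  shows "schatten_bound (2 * p) 1 (2 * schatten_norm (2 * real p) T) T"
  using sum_appr_le_schatten[OF assms] assms(2)
  by (subst schatten_bound_1_iff) (auto simp: schatten_norm_def)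

text \<open>The operator \<open>(adj T * T) ^ p\<close> is a product of 2p elements of degree one,
  hence trace class, and its diagonal entries are summable.\<close>

lemma schatten_bound_imp_schatten:
  fixes T :: "'n::finite bop"
  assumes "schatten_bound (2 * p) 1 M T" "p \<ge> 1"
  shows "T \<in> schatten (2 * real p)"
proof -
  have r: "2 * p \<ge> 1" using assms(2) by simp
  have "schatten_bound (2 * p) (1 + 1) (M * M * 2 ^ (1 + 1)) (adj T * T)"
    by (intro schatten_bound_mult schatten_bound_adj r assms)
  then obtain M' where "schatten_bound (2 * p) ((1 + 1) * p) M' ((adj T * T) ^ p)"
    using schatten_bound_power[OF r] by blast
  moreover have "(1 + 1) * p = 2 * p" by simp
  ultimately have "schatten_bound (2 * p) (2 * p) M' ((adj T * T) ^ p)" by (simp only:)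
  then have "trace_class ((adj T * T) ^ p)"
    by (rule schatten_bound_trace(1)) (use r in auto)
  then show ?thesis
    by (simp add: schatten_def abs_powr_even[OF assms(2)] trace_class_summable)
qed

section \<open>Differentiable trace functions\<close>

lemma cscale_op_mult_left: "cscale_op c S * T = cscale_op c (S * T)"
  by (rule bop_eqI) (simp add: app_times app_cscale_op)

lemma cscale_op_mult_right: "S * cscale_op c T = cscale_op c (S * T)"
  by (rule bop_eqI) (simp add: app_times app_cscale_op app_cscale)

lemma cscale_op_add: "cscale_op c (S + T) = cscale_op c S + cscale_op c T"
  by (simp add: cscale_op_def distrib_left)

lemma cscale_op_diff: "cscale_op c (S - T) = cscale_op c S - cscale_op c T"
  by (simp add: cscale_op_def right_diff_distrib)

lemma cscale_op_zero [simp]: "cscale_op c 0 = 0"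
  by (simp add: cscale_op_def)

text \<open>A first-order Taylor expansion with values in degree k, uniform on quasi-balls of radius
  m. The remainder is quadratic, rather than merely o(h), because this is preserved by products with
  explicit constants; h is any bound for H, which spares the choice of an optimal one.\<close>

definition expands :: "nat \<Rightarrow> nat \<Rightarrow> ('n::finite bop \<Rightarrow> 'n bop) \<Rightarrow> ('n bop \<Rightarrow> 'n bop \<Rightarrow> 'n bop) \<Rightarrow> bool" where
  "expands r k f f' \<longleftrightarrow> (\<forall>B H H'. f' B (H + H') = f' B H + f' B H') \<and>
     (\<forall>B c H. f' B (cscale_op c H) = cscale_op c (f' B H)) \<and>
     (\<forall>m. \<exists>K\<ge>0. \<forall>B. schatten_bound r 1 m B \<longrightarrow> schatten_bound r k K (f B) \<and>
        (\<forall>H h. schatten_bound r 1 h H \<longrightarrow> schatten_bound r k (K * h) (f' B H) \<and>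
           (h \<le> 1 \<longrightarrow> schatten_bound r k (K * h\<^sup>2) (f (B + H) - f B - f' B H))))"

lemma expandsD:
  assumes "expands r k f f'"
  obtains K where "K \<ge> 0" "\<And>B. schatten_bound r 1 m B \<Longrightarrow> schatten_bound r k K (f B)"
    "\<And>B H h. schatten_bound r 1 m B \<Longrightarrow> schatten_bound r 1 h H \<Longrightarrow> schatten_bound r k (K * h) (f' B H)"
    "\<And>B H h. schatten_bound r 1 m B \<Longrightarrow> schatten_bound r 1 h H \<Longrightarrow> h \<le> 1 \<Longrightarrow>
       schatten_bound r k (K * h\<^sup>2) (f (B + H) - f B - f' B H)"
  using assms unfolding expands_def by metis

lemma expandsI:
  assumes "\<And>B H H'. f' B (H + H') = f' B H + f' B H'" "\<And>B c H. f' B (cscale_op c H) = cscale_op c (f' B H)"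
    and "\<And>m. \<exists>K\<ge>0. \<forall>B. schatten_bound r 1 m B \<longrightarrow> schatten_bound r k K (f B) \<and>
        (\<forall>H h. schatten_bound r 1 h H \<longrightarrow> schatten_bound r k (K * h) (f' B H) \<and>
           (h \<le> 1 \<longrightarrow> schatten_bound r k (K * h\<^sup>2) (f (B + H) - f B - f' B H)))"
  shows "expands r k f f'"
  using assms unfolding expands_def by blast

lemma expands_add_right: "expands r k f f' \<Longrightarrow> f' B (H + H') = f' B H + f' B H'"
  and expands_cscale_right: "expands r k f f' \<Longrightarrow> f' B (cscale_op c H) = cscale_op c (f' B H)"
  unfolding expands_def by blast+

lemma expands_const_graded:
  assumes r: "r \<ge> 1" and C: "schatten_bound r k M C"
  shows "expands r k (\<lambda>_. C) (\<lambda>_ _. 0)"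
proof (rule expandsI)
  show "\<exists>K\<ge>0. \<forall>B. schatten_bound r 1 m B \<longrightarrow> schatten_bound r k K C \<and>
        (\<forall>H h. schatten_bound r 1 h H \<longrightarrow> schatten_bound r k (K * h) 0 \<and>
           (h \<le> 1 \<longrightarrow> schatten_bound r k (K * h\<^sup>2) (C - C - 0)))" for m
    using C schatten_bound_nonneg[OF C]
    by (intro exI[of _ M]) (auto intro!: schatten_bound_zero r mult_nonneg_nonneg dest: schatten_bound_nonneg)
qed simp_all

lemma expands_const: "r \<ge> 1 \<Longrightarrow> expands r 0 (\<lambda>_. C) (\<lambda>_ _. 0)"
  by (rule expands_const_graded[where M="norm C"]) (simp_all add: schatten_bound_0)

lemma expands_id:
  assumes r: "r \<ge> 1" shows "expands r 1 (\<lambda>B :: 'n::finite bop. B) (\<lambda>_ H. H)"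
proof (rule expandsI)
  fix m
  show "\<exists>K\<ge>0. \<forall>B. schatten_bound r 1 m B \<longrightarrow> schatten_bound r 1 K (B :: 'n bop) \<and>
        (\<forall>H h. schatten_bound r 1 h H \<longrightarrow> schatten_bound r 1 (K * h) H \<and>
           (h \<le> 1 \<longrightarrow> schatten_bound r 1 (K * h\<^sup>2) (B + H - B - H)))"
  proof (intro exI[of _ "max m 1"] conjI allI impI)
    fix B :: "'n bop" assume B: "schatten_bound r 1 m B"
    show "schatten_bound r 1 (max m 1) B"
      using B by (rule schatten_bound_mono) simp
    fix H :: "'n bop" and h
    assume H: "schatten_bound r 1 h H"
    have h: "0 \<le> h" using H by (rule schatten_bound_nonneg)
    have "1 * h \<le> max m 1 * h" by (intro mult_right_mono h) simp
    with H show "schatten_bound r 1 (max m 1 * h) H"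
      by (rule_tac schatten_bound_mono) simp_all
    show "schatten_bound r 1 (max m 1 * h\<^sup>2) (B + H - B - H)"
      by (simp add: schatten_bound_zero[OF r])
  qed simp
qed simp_all

text \<open>The remainder of the product splits into f' g', the remainder of f times g at B + H, and
  f + f' times the remainder of g; each of them is quadratic in h.\<close>

lemma expands_mult:
  fixes f g :: "'n::finite bop \<Rightarrow> 'n bop"
  assumes r: "r \<ge> 1" and f: "expands r j f f'" and g: "expands r k g g'"
  shows "expands r (j + k) (\<lambda>B. f B * g B) (\<lambda>B H. f' B H * g B + f B * g' B H)"
proof (rule expandsI)
  fix m
  obtain K1 where K1: "K1 \<ge> 0" "\<And>B. schatten_bound r 1 m B \<Longrightarrow> schatten_bound r j K1 (f B)"
    "\<And>B H h. schatten_bound r 1 m B \<Longrightarrow> schatten_bound r 1 h H \<Longrightarrow> schatten_bound r j (K1 * h) (f' B H)"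
    "\<And>B H h. schatten_bound r 1 m B \<Longrightarrow> schatten_bound r 1 h H \<Longrightarrow> h \<le> 1 \<Longrightarrow>
       schatten_bound r j (K1 * h\<^sup>2) (f (B + H) - f B - f' B H)"
    using expandsD[OF f, of m] by metis
  obtain K2 where K2: "K2 \<ge> 0" "\<And>B. schatten_bound r 1 m B \<Longrightarrow> schatten_bound r k K2 (g B)"
    "\<And>B H h. schatten_bound r 1 m B \<Longrightarrow> schatten_bound r 1 h H \<Longrightarrow> schatten_bound r k (K2 * h) (g' B H)"
    "\<And>B H h. schatten_bound r 1 m B \<Longrightarrow> schatten_bound r 1 h H \<Longrightarrow> h \<le> 1 \<Longrightarrow>
       schatten_bound r k (K2 * h\<^sup>2) (g (B + H) - g B - g' B H)"
    using expandsD[OF g, of m] by metis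
  \<comment> \<open>The remainder involves g at B + H, whose bound is at most (m + 1) * 4 for h <=
    1, on account of the quasi-triangle inequality.\<close>
  obtain K3 where K3: "K3 \<ge> 0" "\<And>B. schatten_bound r 1 ((m + 1) * 4 ^ 1) B \<Longrightarrow> schatten_bound r k K3 (g B)"
    using expandsD[OF g, of "(m + 1) * 4 ^ 1"] by metis
  define c D where "c = (2::real) ^ (j + k)" and "D = (4::real) ^ (j + k)"
  have cD: "c \<ge> 0" "D \<ge> 0" by (simp_all add: c_def D_def)
  define A1 A2 A3 where "A1 = K1 * K2 * c" and "A2 = (A1 + A1) * D"
    and "A3 = ((A1 + K1 * K3 * c) * D + (K1 + K1) * 4 ^ j * K2 * c) * D"
  have A: "A1 \<ge> 0" "A2 \<ge> 0" "A3 \<ge> 0"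
    using K1(1) K2(1) K3(1) cD by (auto simp: A1_def A2_def A3_def)
  show "\<exists>K\<ge>0. \<forall>B. schatten_bound r 1 m B \<longrightarrow> schatten_bound r (j + k) K (f B * g B) \<and>
        (\<forall>H h. schatten_bound r 1 h H \<longrightarrow> schatten_bound r (j + k) (K * h) (f' B H * g B + f B * g' B H) \<and>
           (h \<le> 1 \<longrightarrow> schatten_bound r (j + k) (K * h\<^sup>2)
              (f (B + H) * g (B + H) - f B * g B - (f' B H * g B + f B * g' B H))))"
  proof (intro exI[of _ "A1 + A2 + A3"] conjI allI impI)
    show "0 \<le> A1 + A2 + A3" using A by simp
    fix B :: "'n bop" assume B: "schatten_bound r 1 m B"
    have "schatten_bound r (j + k) (K1 * K2 * 2 ^ (j + k)) (f B * g B)"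
      by (rule schatten_bound_mult[OF r K1(2)[OF B] K2(2)[OF B]])
    then show "schatten_bound r (j + k) (A1 + A2 + A3) (f B * g B)"
      by (rule schatten_bound_mono) (use A in \<open>simp add: A1_def c_def\<close>)
    fix H :: "'n bop" and h assume H: "schatten_bound r 1 h H"
    have h: "0 \<le> h" using H by (rule schatten_bound_nonneg)
    have "schatten_bound r (j + k) ((K1 * h * K2 * 2 ^ (j + k) + K1 * (K2 * h) * 2 ^ (j + k)) * 4 ^ (j + k)) (f' B H * g B + f B * g' B H)"
      by (intro schatten_bound_add schatten_bound_mult r K1 K2 B H)
    moreover have "(K1 * h * K2 * 2 ^ (j + k) + K1 * (K2 * h) * 2 ^ (j + k)) * 4 ^ (j + k) = A2 * h"
      by (simp add: A2_def A1_def c_def D_def algebra_simps)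
    moreover have "A2 * h \<le> (A1 + A2 + A3) * h" using A h by (intro mult_right_mono) auto
    ultimately show "schatten_bound r (j + k) ((A1 + A2 + A3) * h) (f' B H * g B + f B * g' B H)"
      by (metis schatten_bound_mono)
    assume h1: "h \<le> 1"
    have BH: "schatten_bound r k K3 (g (B + H))"
      by (rule K3(2), rule schatten_bound_mono[OF schatten_bound_add[OF r B H]]) (use h1 in simp)
    have ff: "schatten_bound r j ((K1 + K1 * h) * 4 ^ j) (f B + f' B H)"
      by (intro schatten_bound_add r K1 B H)
    have ff': "schatten_bound r j ((K1 + K1) * 4 ^ j) (f B + f' B H)"
      by (rule schatten_bound_mono[OF ff]) (use K1(1) h h1 in \<open>simp add: mult_left_le\<close>)
    have "schatten_bound r (j + k)
       (((K1 * h * (K2 * h) * 2 ^ (j + k) + K1 * h\<^sup>2 * K3 * 2 ^ (j + k)) * 4 ^ (j + k) + (K1 + K1) * 4 ^ j * (K2 * h\<^sup>2) * 2 ^ (j + k)) * 4 ^ (j + k))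
       (f' B H * g' B H + (f (B + H) - f B - f' B H) * g (B + H) + (f B + f' B H) * (g (B + H) - g B - g' B H))"
      by (intro schatten_bound_add schatten_bound_mult r K1 K2 B H BH ff' h1)
    moreover have "((K1 * h * (K2 * h) * 2 ^ (j + k) + K1 * h\<^sup>2 * K3 * 2 ^ (j + k)) * 4 ^ (j + k) + (K1 + K1) * 4 ^ j * (K2 * h\<^sup>2) * 2 ^ (j + k)) * 4 ^ (j + k) = A3 * h\<^sup>2"
      by (simp add: A3_def A1_def c_def D_def algebra_simps power2_eq_square)
    moreover have "A3 * h\<^sup>2 \<le> (A1 + A2 + A3) * h\<^sup>2" using A by (intro mult_right_mono) auto
    moreover have "f' B H * g' B H + (f (B + H) - f B - f' B H) * g (B + H) + (f B + f' B H) * (g (B + H) - g B - g' B H)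
       = f (B + H) * g (B + H) - f B * g B - (f' B H * g B + f B * g' B H)"
      by (simp add: algebra_simps)
    ultimately show "schatten_bound r (j + k) ((A1 + A2 + A3) * h\<^sup>2) (f (B + H) * g (B + H) - f B * g B - (f' B H * g B + f B * g' B H))"
      by (metis schatten_bound_mono)
  qed
qed (use f g in \<open>simp_all add: expands_add_right expands_cscale_right distrib_left distrib_right
      cscale_op_mult_left cscale_op_mult_right cscale_op_add\<close>)

lemma expands_add:
  fixes f g :: "'n::finite bop \<Rightarrow> 'n bop"
  assumes r: "r \<ge> 1" and f: "expands r k f f'" and g: "expands r k g g'"
  shows "expands r k (\<lambda>B. f B + g B) (\<lambda>B H. f' B H + g' B H)"
proof (rule expandsI)
  fix m
  obtain K1 where K1: "K1 \<ge> 0" "\<And>B. schatten_bound r 1 m B \<Longrightarrow> schatten_bound r k K1 (f B)"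
    "\<And>B H h. schatten_bound r 1 m B \<Longrightarrow> schatten_bound r 1 h H \<Longrightarrow> schatten_bound r k (K1 * h) (f' B H)"
    "\<And>B H h. schatten_bound r 1 m B \<Longrightarrow> schatten_bound r 1 h H \<Longrightarrow> h \<le> 1 \<Longrightarrow>
       schatten_bound r k (K1 * h\<^sup>2) (f (B + H) - f B - f' B H)"
    using expandsD[OF f, of m] by metis
  obtain K2 where K2: "K2 \<ge> 0" "\<And>B. schatten_bound r 1 m B \<Longrightarrow> schatten_bound r k K2 (g B)"
    "\<And>B H h. schatten_bound r 1 m B \<Longrightarrow> schatten_bound r 1 h H \<Longrightarrow> schatten_bound r k (K2 * h) (g' B H)"
    "\<And>B H h. schatten_bound r 1 m B \<Longrightarrow> schatten_bound r 1 h H \<Longrightarrow> h \<le> 1 \<Longrightarrow>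
       schatten_bound r k (K2 * h\<^sup>2) (g (B + H) - g B - g' B H)"
    using expandsD[OF g, of m] by metis
  show "\<exists>K\<ge>0. \<forall>B. schatten_bound r 1 m B \<longrightarrow> schatten_bound r k K (f B + g B) \<and>
        (\<forall>H h. schatten_bound r 1 h H \<longrightarrow> schatten_bound r k (K * h) (f' B H + g' B H) \<and>
           (h \<le> 1 \<longrightarrow> schatten_bound r k (K * h\<^sup>2) (f (B + H) + g (B + H) - (f B + g B) - (f' B H + g' B H))))"
  proof (intro exI[of _ "(K1 + K2) * 4 ^ k"] conjI allI impI)
    show "0 \<le> (K1 + K2) * 4 ^ k" using K1(1) K2(1) by simp
    fix B :: "'n bop" assume B: "schatten_bound r 1 m B"
    show "schatten_bound r k ((K1 + K2) * 4 ^ k) (f B + g B)"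
      by (intro schatten_bound_add r K1 K2 B)
    fix H :: "'n bop" and h assume H: "schatten_bound r 1 h H"
    show "schatten_bound r k ((K1 + K2) * 4 ^ k * h) (f' B H + g' B H)"
      using schatten_bound_add[OF r K1(3)[OF B H] K2(3)[OF B H]] by (simp add: algebra_simps)
    assume h1: "h \<le> 1"
    have "f (B + H) + g (B + H) - (f B + g B) - (f' B H + g' B H)
      = (f (B + H) - f B - f' B H) + (g (B + H) - g B - g' B H)" by simp
    then show "schatten_bound r k ((K1 + K2) * 4 ^ k * h\<^sup>2) (f (B + H) + g (B + H) - (f B + g B) - (f' B H + g' B H))"
      using schatten_bound_add[OF r K1(4)[OF B H h1] K2(4)[OF B H h1]] by (simp add: algebra_simps)
  qed
qed (use f g in \<open>simp_all add: expands_add_right expands_cscale_right cscale_op_add\<close>)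

lemma expands_mult_left:
  assumes "r \<ge> 1" "expands r k g g'" shows "expands r k (\<lambda>B. C * g B) (\<lambda>B H. C * g' B H)"
  using expands_mult[OF assms(1) expands_const[OF assms(1)] assms(2)] by simp

lemma expands_mult_right:
  assumes "r \<ge> 1" "expands r k g g'" shows "expands r k (\<lambda>B. g B * C) (\<lambda>B H. g' B H * C)"
  using expands_mult[OF assms(1) assms(2) expands_const[OF assms(1)]] by simp

lemma expands_diff:
  assumes r: "r \<ge> 1" and f: "expands r k f f'" and g: "expands r k g g'"
  shows "expands r k (\<lambda>B. f B - g B) (\<lambda>B H. f' B H - g' B H)"
  using expands_add[OF r f expands_mult_left[OF r g, of "-1"]] by simp

text \<open>Additivity is asked for within the ideal, where the operators under the trace are trace
  class. Homogeneity holds for all operators because \<open>infsum\<close> commutes with scalars in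
  every case.\<close>

definition sdiff :: "nat \<Rightarrow> ('n::finite bop \<Rightarrow> complex) \<Rightarrow> ('n bop \<Rightarrow> 'n bop \<Rightarrow> complex) \<Rightarrow> bool" where
  "sdiff r \<phi> \<phi>' \<longleftrightarrow>
     (\<forall>B H H' m h h'. schatten_bound r 1 m B \<longrightarrow> schatten_bound r 1 h H \<longrightarrow> schatten_bound r 1 h' H' \<longrightarrow>
        \<phi>' B (H + H') = \<phi>' B H + \<phi>' B H') \<and>
     (\<forall>B c H. \<phi>' B (cscale_op c H) = c * \<phi>' B H) \<and>
     (\<forall>m. \<exists>K\<ge>0. \<forall>B. schatten_bound r 1 m B \<longrightarrow>
        (\<forall>H h. schatten_bound r 1 h H \<longrightarrow> cmod (\<phi>' B H) \<le> K * h \<and>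
           (h \<le> 1 \<longrightarrow> cmod (\<phi> (B + H) - \<phi> B - \<phi>' B H) \<le> K * h\<^sup>2)))"

lemma sdiff_add_right:
  "sdiff r \<phi> \<phi>' \<Longrightarrow> schatten_bound r 1 m B \<Longrightarrow> schatten_bound r 1 h H \<Longrightarrow> schatten_bound r 1 h' H' \<Longrightarrow>
   \<phi>' B (H + H') = \<phi>' B H + \<phi>' B H'"
  unfolding sdiff_def by blast

lemma sdiff_cscale_right: "sdiff r \<phi> \<phi>' \<Longrightarrow> \<phi>' B (cscale_op c H) = c * \<phi>' B H"
  unfolding sdiff_def by blast

text \<open>On degree k >= r the trace is bounded by 16 k times the quasi-norm, so it turns an
  operator expansion into a scalar one.\<close>

lemma sdiff_trace:
  fixes f :: "'n::finite bop \<Rightarrow> 'n bop"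
  assumes r: "r \<ge> 1" "r \<le> k" and f: "expands r k f f'"
  shows "sdiff r (\<lambda>B. trace_op (f B)) (\<lambda>B H. trace_op (f' B H))"
  unfolding sdiff_def
proof (intro conjI allI impI)
  have k: "k \<ge> 1" using r by simp
  note tr = schatten_bound_trace[OF _ r(2) k r(1)]
  {
    fix B H H' :: "'n bop" and m h h'
    assume B: "schatten_bound r 1 m B" and H: "schatten_bound r 1 h H" "schatten_bound r 1 h' H'"
    obtain K where "\<And>H h. schatten_bound r 1 h H \<Longrightarrow> schatten_bound r k (K * h) (f' B H)"
      using expandsD[OF f, of m] B by metis
    then have "trace_class (f' B H)" "trace_class (f' B H')" using tr(1) H by blast+
    then show "trace_op (f' B (H + H')) = trace_op (f' B H) + trace_op (f' B H')"
      unfolding expands_add_right[OF f] by (rule trace_add)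
  }
  show "trace_op (f' B (cscale_op c H)) = c * trace_op (f' B H)" for B c H
    unfolding expands_cscale_right[OF f] by (rule trace_cscale_op)
  fix m
  obtain K where K: "K \<ge> 0" "\<And>B. schatten_bound r 1 m B \<Longrightarrow> schatten_bound r k K (f B)"
    "\<And>B H h. schatten_bound r 1 m B \<Longrightarrow> schatten_bound r 1 h H \<Longrightarrow> schatten_bound r k (K * h) (f' B H)"
    "\<And>B H h. schatten_bound r 1 m B \<Longrightarrow> schatten_bound r 1 h H \<Longrightarrow> h \<le> 1 \<Longrightarrow>
       schatten_bound r k (K * h\<^sup>2) (f (B + H) - f B - f' B H)"
    using expandsD[OF f, of m] by metis
  obtain K' where K': "\<And>B. schatten_bound r 1 ((m + 1) * 4 ^ 1) B \<Longrightarrow> schatten_bound r k K' (f B)"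
    using expandsD[OF f, of "(m + 1) * 4 ^ 1"] by metis
  show "\<exists>K\<ge>0. \<forall>B. schatten_bound r 1 m B \<longrightarrow>
        (\<forall>H h. schatten_bound r 1 h H \<longrightarrow> cmod (trace_op (f' B H)) \<le> K * h \<and>
           (h \<le> 1 \<longrightarrow> cmod (trace_op (f (B + H)) - trace_op (f B) - trace_op (f' B H)) \<le> K * h\<^sup>2))"
  proof (intro exI[of _ "16 * real k * K"] conjI allI impI)
    show "0 \<le> 16 * real k * K" using K(1) by simp
    fix B H :: "'n bop" and h assume B: "schatten_bound r 1 m B" and H: "schatten_bound r 1 h H"
    show "cmod (trace_op (f' B H)) \<le> 16 * real k * K * h"
      using tr(2)[OF K(3)[OF B H]] by (simp add: mult.assoc)
    assume h1: "h \<le> 1"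
    have "schatten_bound r k K' (f (B + H))"
      by (rule K', rule schatten_bound_mono[OF schatten_bound_add[OF r(1) B H]]) (use h1 in simp)
    then have tc: "trace_class (f (B + H))" "trace_class (f B)" "trace_class (f' B H)"
      using tr(1) K(2)[OF B] K(3)[OF B H] by blast+
    have "trace_op (f (B + H)) - trace_op (f B) - trace_op (f' B H) = trace_op (f (B + H) - f B - f' B H)"
      by (simp add: trace_diff tc trace_class_diff)
    then show "cmod (trace_op (f (B + H)) - trace_op (f B) - trace_op (f' B H)) \<le> 16 * real k * K * h\<^sup>2"
      using tr(2)[OF K(4)[OF B H h1]] by (simp add: mult.assoc)
  qed
qed

lemma sdiff_add:
  assumes f: "sdiff r \<phi> \<phi>'" and g: "sdiff r \<psi> \<psi>'"
  shows "sdiff r (\<lambda>B. \<phi> B + \<psi> B) (\<lambda>B H. \<phi>' B H + \<psi>' B H)"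
  unfolding sdiff_def
proof (intro conjI allI impI)
  fix B H H' :: "'a bop" and m h h'
  assume "schatten_bound r 1 m B" "schatten_bound r 1 h H" "schatten_bound r 1 h' H'"
  then have "\<phi>' B (H + H') = \<phi>' B H + \<phi>' B H'" "\<psi>' B (H + H') = \<psi>' B H + \<psi>' B H'"
    using sdiff_add_right[OF f] sdiff_add_right[OF g] by auto
  then show "\<phi>' B (H + H') + \<psi>' B (H + H') = \<phi>' B H + \<psi>' B H + (\<phi>' B H' + \<psi>' B H')" by simp
next
  fix B H :: "'a bop" and c
  have "\<phi>' B (cscale_op c H) = c * \<phi>' B H" "\<psi>' B (cscale_op c H) = c * \<psi>' B H"
    using sdiff_cscale_right[OF f] sdiff_cscale_right[OF g] by auto
  then show "\<phi>' B (cscale_op c H) + \<psi>' B (cscale_op c H) = c * (\<phi>' B H + \<psi>' B H)"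
    by (simp add: distrib_left)
next
  fix m
  obtain K1 where K1: "K1 \<ge> 0" "\<And>B H h. schatten_bound r 1 m B \<Longrightarrow> schatten_bound r 1 h H \<Longrightarrow> cmod (\<phi>' B H) \<le> K1 * h"
    "\<And>B H h. schatten_bound r 1 m B \<Longrightarrow> schatten_bound r 1 h H \<Longrightarrow> h \<le> 1 \<Longrightarrow> cmod (\<phi> (B + H) - \<phi> B - \<phi>' B H) \<le> K1 * h\<^sup>2"
    using f unfolding sdiff_def by metis
  obtain K2 where K2: "K2 \<ge> 0" "\<And>B H h. schatten_bound r 1 m B \<Longrightarrow> schatten_bound r 1 h H \<Longrightarrow> cmod (\<psi>' B H) \<le> K2 * h"
    "\<And>B H h. schatten_bound r 1 m B \<Longrightarrow> schatten_bound r 1 h H \<Longrightarrow> h \<le> 1 \<Longrightarrow> cmod (\<psi> (B + H) - \<psi> B - \<psi>' B H) \<le> K2 * h\<^sup>2"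
    using g unfolding sdiff_def by metis
  show "\<exists>K\<ge>0. \<forall>B. schatten_bound r 1 m B \<longrightarrow>
        (\<forall>H h. schatten_bound r 1 h H \<longrightarrow> cmod (\<phi>' B H + \<psi>' B H) \<le> K * h \<and>
           (h \<le> 1 \<longrightarrow> cmod (\<phi> (B + H) + \<psi> (B + H) - (\<phi> B + \<psi> B) - (\<phi>' B H + \<psi>' B H)) \<le> K * h\<^sup>2))"
  proof (intro exI[of _ "K1 + K2"] conjI allI impI)
    show "0 \<le> K1 + K2" using K1 K2 by simp
    fix B H :: "'a bop" and h assume B: "schatten_bound r 1 m B" and H: "schatten_bound r 1 h H"
    show "cmod (\<phi>' B H + \<psi>' B H) \<le> (K1 + K2) * h"
      using norm_triangle_ineq[of "\<phi>' B H" "\<psi>' B H"] K1(2)[OF B H] K2(2)[OF B H] by (simp add: distrib_right)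
    assume h1: "h \<le> 1"
    have eq: "\<phi> (B + H) + \<psi> (B + H) - (\<phi> B + \<psi> B) - (\<phi>' B H + \<psi>' B H)
      = (\<phi> (B + H) - \<phi> B - \<phi>' B H) + (\<psi> (B + H) - \<psi> B - \<psi>' B H)" by simp
    show "cmod (\<phi> (B + H) + \<psi> (B + H) - (\<phi> B + \<psi> B) - (\<phi>' B H + \<psi>' B H)) \<le> (K1 + K2) * h\<^sup>2"
      unfolding eq using norm_triangle_ineq[of "\<phi> (B + H) - \<phi> B - \<phi>' B H" "\<psi> (B + H) - \<psi> B - \<psi>' B H"]
        K1(3)[OF B H h1] K2(3)[OF B H h1] by (simp add: distrib_right)
  qed
qed

lemma sdiff_cmult:
  assumes f: "sdiff r \<phi> \<phi>'"
  shows "sdiff r (\<lambda>B. a * \<phi> B) (\<lambda>B H. a * \<phi>' B H)"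
  unfolding sdiff_def
proof (intro conjI allI impI)
  fix B H H' :: "'a bop" and m h h'
  assume "schatten_bound r 1 m B" "schatten_bound r 1 h H" "schatten_bound r 1 h' H'"
  then have "\<phi>' B (H + H') = \<phi>' B H + \<phi>' B H'"
    using f unfolding sdiff_def by blast
  then show "a * \<phi>' B (H + H') = a * \<phi>' B H + a * \<phi>' B H'" by (simp add: distrib_left)
next
  fix B H :: "'a bop" and c
  have "\<phi>' B (cscale_op c H) = c * \<phi>' B H"
    using f unfolding sdiff_def by blast
  then show "a * \<phi>' B (cscale_op c H) = c * (a * \<phi>' B H)" by simp
next
  fix m
  obtain K1 where K1: "K1 \<ge> 0" "\<And>B H h. schatten_bound r 1 m B \<Longrightarrow> schatten_bound r 1 h H \<Longrightarrow> cmod (\<phi>' B H) \<le> K1 * h"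
    "\<And>B H h. schatten_bound r 1 m B \<Longrightarrow> schatten_bound r 1 h H \<Longrightarrow> h \<le> 1 \<Longrightarrow> cmod (\<phi> (B + H) - \<phi> B - \<phi>' B H) \<le> K1 * h\<^sup>2"
    using f unfolding sdiff_def by metis
  show "\<exists>K\<ge>0. \<forall>B. schatten_bound r 1 m B \<longrightarrow>
        (\<forall>H h. schatten_bound r 1 h H \<longrightarrow> cmod (a * \<phi>' B H) \<le> K * h \<and>
           (h \<le> 1 \<longrightarrow> cmod (a * \<phi> (B + H) - a * \<phi> B - a * \<phi>' B H) \<le> K * h\<^sup>2))"
  proof (intro exI[of _ "cmod a * K1"] conjI allI impI)
    show "0 \<le> cmod a * K1" using K1 by simp
    fix B H :: "'a bop" and h assume B: "schatten_bound r 1 m B" and H: "schatten_bound r 1 h H"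
    show "cmod (a * \<phi>' B H) \<le> cmod a * K1 * h"
      using mult_left_mono[OF K1(2)[OF B H], of "cmod a"] by (simp add: norm_mult mult.assoc)
    assume h1: "h \<le> 1"
    show "cmod (a * \<phi> (B + H) - a * \<phi> B - a * \<phi>' B H) \<le> cmod a * K1 * h\<^sup>2"
      using mult_left_mono[OF K1(3)[OF B H h1], of "cmod a"]
      by (simp add: norm_mult mult.assoc flip: right_diff_distrib)
  qed
qed

lemma sdiff_zero: "sdiff r (\<lambda>_. 0) (\<lambda>_ _. 0)"
proof -
  have "schatten_bound r 1 h H \<Longrightarrow> 0 \<le> h" for h and H :: "'a bop" by (rule schatten_bound_nonneg)
  then show ?thesis by (auto simp: sdiff_def intro: exI[of _ 0])
qed

lemma sdiff_sum:
  assumes "\<And>i. i \<in> I \<Longrightarrow> sdiff r (\<phi> i) (\<phi>' i)"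
  shows "sdiff r (\<lambda>B. \<Sum>i\<in>I. \<phi> i B) (\<lambda>B H. \<Sum>i\<in>I. \<phi>' i B H)"
  using assms by (induction I rule: infinite_finite_induct) (simp_all add: sdiff_zero sdiff_add)

section \<open>Schatten ideals, flat connections and Frechet differentiability\<close>

definition schatten_ideal :: "nat \<Rightarrow> 'n::finite bop set" where
  "schatten_ideal r = {T. \<exists>M. schatten_bound r 1 M T}"

lemma schatten_eq_ideal: "p \<ge> 1 \<Longrightarrow> schatten (2 * real p) = schatten_ideal (2 * p)"
  using schatten_imp_bound schatten_bound_imp_schatten unfolding schatten_ideal_def by blast

lemma schatten_ideal_mult_left: "T \<in> schatten_ideal r \<Longrightarrow> A * T \<in> schatten_ideal r"
  unfolding schatten_ideal_def using schatten_bound_mult_left by blast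

lemma schatten_ideal_mult_right: "T \<in> schatten_ideal r \<Longrightarrow> T * A \<in> schatten_ideal r"
  unfolding schatten_ideal_def using schatten_bound_mult_right by blast

lemma schatten_ideal_add: "r \<ge> 1 \<Longrightarrow> S \<in> schatten_ideal r \<Longrightarrow> T \<in> schatten_ideal r \<Longrightarrow> S + T \<in> schatten_ideal r"
  unfolding schatten_ideal_def using schatten_bound_add by blast

lemma schatten_ideal_diff: "r \<ge> 1 \<Longrightarrow> S \<in> schatten_ideal r \<Longrightarrow> T \<in> schatten_ideal r \<Longrightarrow> S - T \<in> schatten_ideal r"
  unfolding schatten_ideal_def using schatten_bound_diff by blast

lemma gl_res_eq: "p \<ge> 1 \<Longrightarrow> X \<in> gl_res (real p) \<longleftrightarrow> commutator pol X \<in> schatten_ideal (2 * p)"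
  by (simp add: gl_res_def schatten_eq_ideal)

lemma flat_conn_ideal:
  assumes "B \<in> flat_conn (real p)" "p \<ge> 1" shows "B \<in> schatten_ideal (2 * p)"
  using assms by (auto simp: flat_conn_def GL_res_def schatten_eq_ideal intro: schatten_ideal_mult_left)

text \<open>\<open>pol + B\<close> is the conjugate g^(-1) pol g of an involution.\<close>

lemma flat_conn_square:
  assumes "B \<in> flat_conn p" shows "(pol + B) * (pol + B) = 1"
proof -
  obtain g g' where g: "B = g' * commutator pol g" "g' * g = 1" "g * g' = 1"
    using assms unfolding flat_conn_def by blast
  have "pol + B = g' * pol * g"
    using g(2) by (simp add: g(1) commutator_def algebra_simps) (simp flip: mult.assoc)
  then have "(pol + B) * (pol + B) = g' * pol * (g * g') * pol * g" by (simp add: mult.assoc)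
  also have "\<dots> = g' * (pol * pol) * g" by (simp add: g(3) mult.assoc)
  finally show ?thesis by (simp add: g(2))
qed

lemma sdiff_bound:
  assumes "sdiff r \<phi> \<phi>'" "B \<in> schatten_ideal r"
  obtains K where "K \<ge> 0" "\<And>H h. schatten_bound r 1 h H \<Longrightarrow> cmod (\<phi>' B H) \<le> K * h"
    "\<And>H h. schatten_bound r 1 h H \<Longrightarrow> h \<le> 1 \<Longrightarrow> cmod (\<phi> (B + H) - \<phi> B - \<phi>' B H) \<le> K * h\<^sup>2"
proof -
  obtain m where m: "schatten_bound r 1 m B" using assms(2) by (auto simp: schatten_ideal_def)
  have "\<exists>K\<ge>0. \<forall>B. schatten_bound r 1 m B \<longrightarrow>
        (\<forall>H h. schatten_bound r 1 h H \<longrightarrow> cmod (\<phi>' B H) \<le> K * h \<and>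
           (h \<le> 1 \<longrightarrow> cmod (\<phi> (B + H) - \<phi> B - \<phi>' B H) \<le> K * h\<^sup>2))"
    using assms(1) unfolding sdiff_def by blast
  then show thesis using m that by blast
qed

lemma sdiff_imp_differentiable_flat:
  fixes \<phi> :: "'n::finite bop \<Rightarrow> complex"
  assumes p: "p \<ge> 1" and \<phi>: "sdiff (2 * p) \<phi> \<phi>'" and eq: "\<And>B. B \<in> flat_conn (real p) \<Longrightarrow> \<psi> B = \<phi> B"
  shows "differentiable_flat (real p) \<psi>"
  unfolding differentiable_flat_def
proof
  fix B :: "'n bop" assume B: "B \<in> flat_conn (real p)"
  then have BI: "B \<in> schatten_ideal (2 * p)" using p by (rule flat_conn_ideal)
  let ?n = "schatten_norm (2 * real p)"
  obtain K where K: "K \<ge> 0" "\<And>H h. schatten_bound (2 * p) 1 h H \<Longrightarrow> cmod (\<phi>' B H) \<le> K * h"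
    "\<And>H h. schatten_bound (2 * p) 1 h H \<Longrightarrow> h \<le> 1 \<Longrightarrow> cmod (\<phi> (B + H) - \<phi> B - \<phi>' B H) \<le> K * h\<^sup>2"
    using sdiff_bound[OF \<phi> BI] by metis
  have "schatten_functional (2 * real p) (\<phi>' B)"
    unfolding schatten_functional_def
  proof (intro conjI ballI allI)
    fix S T :: "'n bop" assume "S \<in> schatten (2 * real p)" "T \<in> schatten (2 * real p)"
    then show "\<phi>' B (S + T) = \<phi>' B S + \<phi>' B T"
      using sdiff_add_right[OF \<phi>] BI p unfolding schatten_eq_ideal[OF p] schatten_ideal_def by blast
  next
    show "\<phi>' B (cscale_op c T) = c * \<phi>' B T" for c T by (rule sdiff_cscale_right[OF \<phi>])
    show "\<exists>K. \<forall>T\<in>schatten (2 * real p). cmod (\<phi>' B T) \<le> K * ?n T"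
      using K(2)[OF schatten_imp_bound[OF _ p]] by (auto intro!: exI[of _ "K * 2"] simp: mult.assoc)
  qed
  moreover have "\<exists>d>0. \<forall>B'\<in>flat_conn (real p). ?n (B' - B) < d \<longrightarrow>
      cmod (\<psi> B' - \<psi> B - \<phi>' B (B' - B)) \<le> e * ?n (B' - B)" if e: "e > 0" for e
  \<comment> \<open>\<open>schatten_imp_bound\<close> costs a factor 2: a Schatten norm below 1/2
    gives the bound h <= 1 required by the expansion, and the remainder is at most 4 K times the
    squared norm, which the second entry of the minimum controls.\<close>
  proof (intro exI[of _ "min (1/2) (e / (4 * K + 1))"] conjI ballI impI)
    show "0 < min (1/2) (e / (4 * K + 1))" using e K(1) by simp
    fix B' :: "'n bop" assume B': "B' \<in> flat_conn (real p)" and small: "?n (B' - B) < min (1/2) (e / (4 * K + 1))"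
    have n0: "0 \<le> ?n (B' - B)" by (simp add: schatten_norm_def)
    have "B' - B \<in> schatten (2 * real p)"
      unfolding schatten_eq_ideal[OF p]
      by (intro schatten_ideal_diff flat_conn_ideal[OF B' p] BI) (use p in simp)
    from K(3)[OF schatten_imp_bound[OF this p]] small
    have "cmod (\<phi> (B + (B' - B)) - \<phi> B - \<phi>' B (B' - B)) \<le> K * (2 * ?n (B' - B))\<^sup>2" by simp
    also have "\<dots> = (4 * K * ?n (B' - B)) * ?n (B' - B)" by (simp add: power2_eq_square)
    also have "\<dots> \<le> e * ?n (B' - B)"
    proof (rule mult_right_mono[OF _ n0])
      have "4 * K * ?n (B' - B) \<le> (4 * K + 1) * ?n (B' - B)" using n0 by (intro mult_right_mono) auto
      also have "\<dots> \<le> (4 * K + 1) * (e / (4 * K + 1))" using small K(1) by (intro mult_left_mono) auto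
      also have "\<dots> = e" using K(1) by simp
      finally show "4 * K * ?n (B' - B) \<le> e" .
    qed
    finally show "cmod (\<psi> B' - \<psi> B - \<phi>' B (B' - B)) \<le> e * ?n (B' - B)"
      using eq[OF B] eq[OF B'] by simp
  qed
  ultimately show "\<exists>D. schatten_functional (2 * real p) D \<and>
    (\<forall>e>0. \<exists>d>0. \<forall>B'\<in>flat_conn (real p). ?n (B' - B) < d \<longrightarrow> cmod (\<psi> B' - \<psi> B - D (B' - B)) \<le> e * ?n (B' - B))"
    by blast
qed

section \<open>The Lie derivative\<close>

text \<open>The Leibniz rule, one factor X at a time. Each step costs the quasi-triangle constant 4,
  so the growth stays geometric in k.\<close>

lemma schatten_bound_commutator_power:
  assumes r: "r \<ge> 1" and d: "schatten_bound r 1 d (commutator F X)"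
  shows "schatten_bound r 1 (d * (8 * (norm X + 1)) ^ k) (commutator F (X ^ k))"
proof (induction k)
  case 0
  have "commutator F (X ^ 0) = 0" by (simp add: commutator_def)
  then show ?case using schatten_bound_zero[OF r] schatten_bound_nonneg[OF d] by simp
next
  case (Suc k)
  let ?x = "norm X" let ?c = "8 * (?x + 1)"
  have d0: "0 \<le> d" using d by (rule schatten_bound_nonneg)
  have "commutator F (X ^ Suc k) = commutator F (X ^ k) * X + X ^ k * commutator F X"
    by (simp only: commutator_def power_Suc2 algebra_simps mult.assoc)
  moreover have "schatten_bound r 1 ((d * ?c ^ k * ?x + norm (X ^ k) * d) * 4 ^ 1) (commutator F (X ^ k) * X + X ^ k * commutator F X)"
    by (intro schatten_bound_add r schatten_bound_mult_left schatten_bound_mult_right Suc d)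
  moreover have "(d * ?c ^ k * ?x + norm (X ^ k) * d) * 4 ^ 1 \<le> d * ?c ^ Suc k"
  proof -
    have "norm (X ^ k) \<le> ?x ^ k" by (rule norm_power_ineq)
    also have "\<dots> \<le> ?c ^ k" by (intro power_mono) auto
    finally have "(d * ?c ^ k * ?x + norm (X ^ k) * d) * 4 ^ 1 \<le> (d * ?c ^ k * ?x + ?c ^ k * d) * 4 ^ 1"
      using d0 by (intro mult_right_mono add_left_mono) auto
    also have "\<dots> = d * ?c ^ k * (4 * (?x + 1))" by (simp add: algebra_simps)
    also have "\<dots> \<le> d * ?c ^ k * ?c"
      using d0 by (intro mult_left_mono mult_nonneg_nonneg) auto
    finally show ?thesis by (simp only: power_Suc mult_ac)
  qed
  ultimately show ?case by (metis schatten_bound_mono)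
qed

lemma commutator_sum: "commutator F (\<Sum>k\<in>A. f k) = (\<Sum>k\<in>A. commutator F (f k))"
  for F :: "'n::finite bop"
  by (simp add: commutator_def sum_distrib_left sum_distrib_right sum_subtractf)

lemma commutator_scaleR: "commutator F (c *\<^sub>R X) = c *\<^sub>R commutator F X"
  for F :: "'n::finite bop"
  by (simp add: commutator_def scaleR_right_diff_distrib)

lemma sum_split_two: "(\<Sum>k<K + 2. f k) = f 0 + f 1 + (\<Sum>k<K. f (k + 2))"
  for f :: "nat \<Rightarrow> 'b::comm_monoid_add"
  by (induction K) (simp_all add: numeral_2_eq_2 add.assoc)

text \<open>The exponential series may be summed in the quasi-norm because \<open>k!\<close> beats the powers of the quasi-triangle constant.\<close>

lemma schatten_bound_commutator_exp:
  fixes F X :: "'n::finite bop"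
  assumes r: "r \<ge> 1" and d: "schatten_bound r 1 d (commutator F X)"
  obtains C where "C \<ge> 0" "\<And>t. \<bar>t\<bar> \<le> 1 \<Longrightarrow>
    schatten_bound r 1 (C * t\<^sup>2) (commutator F (exp (t *\<^sub>R X)) - t *\<^sub>R commutator F X)"
proof -
  define c where "c = 8 * (norm X + 1)"
  have c0: "c \<ge> 0" by (simp add: c_def)
  have d0: "0 \<le> d" using d by (rule schatten_bound_nonneg)
  \<comment> \<open>The weights 4^(k+1) of the quasi-norm turn c^(k+2)/(k+2)! into at most
    (4c)^(k+2)/(k+2)!, which sums to less than exp(4c).\<close>
  define C where "C = d * exp (4 * c)"
  have "schatten_bound r 1 (C * t\<^sup>2) (commutator F (exp (t *\<^sub>R X)) - t *\<^sub>R commutator F X)" if t: "\<bar>t\<bar> \<le> 1" for t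
  proof (rule schatten_bound_limit[OF r])
    define T where "T k = (t ^ (k + 2) / fact (k + 2)) *\<^sub>R commutator F (X ^ (k + 2))" for k
    define M where "M k = \<bar>t ^ (k + 2) / fact (k + 2)\<bar> * (d * c ^ (k + 2))" for k
    show "(\<lambda>K. \<Sum>k<K. T k) \<longlonglongrightarrow> commutator F (exp (t *\<^sub>R X)) - t *\<^sub>R commutator F X"
    proof -
      let ?e = "\<lambda>k. (t *\<^sub>R X) ^ k /\<^sub>R fact k"
      have "?e sums exp (t *\<^sub>R X)" by (rule exp_converges)
      then have "(\<lambda>K. \<Sum>k<K + 2. ?e k) \<longlonglongrightarrow> exp (t *\<^sub>R X)"
        unfolding sums_def by (rule LIMSEQ_ignore_initial_segment)
      then have lim: "(\<lambda>K. commutator F (\<Sum>k<K + 2. ?e k)) \<longlonglongrightarrow> commutator F (exp (t *\<^sub>R X))"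
        unfolding commutator_def by (intro tendsto_intros)
      have "commutator F (\<Sum>k<K + 2. ?e k) = (\<Sum>k<K. T k) + t *\<^sub>R commutator F X" for K
      proof -
        have "(\<Sum>k<K + 2. ?e k) = ?e 0 + ?e 1 + (\<Sum>k<K. ?e (k + 2))" by (rule sum_split_two)
        also have "?e 0 + ?e 1 = 1 + t *\<^sub>R X" by simp
        finally have A: "(\<Sum>k<K + 2. ?e k) = 1 + t *\<^sub>R X + (\<Sum>k<K. ?e (k + 2))" .
        have Bc: "commutator F (?e k) = (t ^ k / fact k) *\<^sub>R commutator F (X ^ k)" for k
          by (simp add: scaleR_power commutator_scaleR divide_inverse mult.commute)
        have Cc: "commutator F (1 + t *\<^sub>R X + S) = t *\<^sub>R commutator F X + commutator F S" for S
          by (simp add: commutator_def algebra_simps)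
        show ?thesis unfolding A Cc commutator_sum Bc T_def by (rule add.commute)
      qed
      with lim have "(\<lambda>K. (\<Sum>k<K. T k) + t *\<^sub>R commutator F X) \<longlonglongrightarrow> commutator F (exp (t *\<^sub>R X))" by simp
      from tendsto_diff[OF this tendsto_const[of "t *\<^sub>R commutator F X"]] show ?thesis by simp
    qed
    fix K
    have "schatten_bound r 1 (\<Sum>k<K. 4 ^ Suc k * M k) (\<Sum>k<K. T k)"
      unfolding T_def M_def c_def
      by (intro schatten_bound_sum r schatten_bound_scaleR schatten_bound_commutator_power d)
    moreover have "(\<Sum>k<K. 4 ^ Suc k * M k) \<le> C * t\<^sup>2"
    proof -
      have "(\<Sum>k<K. 4 ^ Suc k * M k) \<le> (\<Sum>k<K. d * t\<^sup>2 * ((4 * c) ^ (k + 2) / fact (k + 2)))"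
      proof (rule sum_mono)
        fix k
        have "\<bar>t ^ (k + 2)\<bar> = \<bar>t\<bar> ^ k * t\<^sup>2" by (simp only: abs_mult power_abs power_add power2_abs)
        also have "\<dots> \<le> 1 * t\<^sup>2" using t by (intro mult_right_mono power_le_one) auto
        finally have tk: "\<bar>t ^ (k + 2)\<bar> \<le> t\<^sup>2" by simp
        have "4 ^ Suc k * M k = (4 ^ Suc k * (d * c ^ (k + 2) / fact (k + 2))) * \<bar>t ^ (k + 2)\<bar>"
          by (simp add: M_def abs_divide)
        also have "\<dots> \<le> (4 ^ Suc k * (d * c ^ (k + 2) / fact (k + 2))) * t\<^sup>2"
          using d0 c0 by (intro mult_left_mono tk) auto
        also have "\<dots> \<le> (4 ^ (k + 2) * (d * c ^ (k + 2) / fact (k + 2))) * t\<^sup>2"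
          using d0 c0 by (intro mult_right_mono) auto
        also have "\<dots> = d * t\<^sup>2 * ((4 * c) ^ (k + 2) / fact (k + 2))"
          by (simp only: power_mult_distrib) simp
        finally show "4 ^ Suc k * M k \<le> d * t\<^sup>2 * ((4 * c) ^ (k + 2) / fact (k + 2))" .
      qed
      also have "\<dots> = d * t\<^sup>2 * (\<Sum>k<K. (4 * c) ^ (k + 2) / fact (k + 2))"
        by (simp add: sum_distrib_left)
      also have "\<dots> \<le> d * t\<^sup>2 * exp (4 * c)"
      proof (intro mult_left_mono mult_nonneg_nonneg d0 zero_le_power2)
        have "(\<Sum>k<K. (4 * c) ^ (k + 2) / fact (k + 2)) \<le> (\<Sum>k<K + 2. (4 * c) ^ k / fact k)"
          unfolding sum_split_two using c0 by simp
        also have "\<dots> \<le> exp (4 * c)"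
          using sum_le_suminf[OF summable_exp[of "4 * c"], of "{..<K + 2}"] c0
          by (simp add: exp_def divide_inverse mult.commute)
        finally show "(\<Sum>k<K. (4 * c) ^ (k + 2) / fact (k + 2)) \<le> exp (4 * c)" .
      qed
      finally show ?thesis by (simp only: C_def mult_ac)
    qed
    ultimately show "schatten_bound r 1 (C * t\<^sup>2) (\<Sum>k<K. T k)" by (rule schatten_bound_mono)
  qed
  moreover have "C \<ge> 0" using d0 by (simp add: C_def)
  ultimately show thesis using that by blast
qed

lemma norm_exp_minus_one_le: "norm (exp (Y :: 'n::finite bop) - 1) \<le> norm Y * exp (norm Y)"
proof -
  have s: "summable (\<lambda>k. norm (Y ^ Suc k /\<^sub>R fact (Suc k)))"
    using summable_norm_exp[of Y] by (subst summable_Suc_iff)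
  have "exp Y - 1 = (\<Sum>k. Y ^ Suc k /\<^sub>R fact (Suc k))"
    using suminf_split_head[OF summable_exp_generic[of Y]] by (simp add: exp_def)
  also have "norm \<dots> \<le> (\<Sum>k. norm (Y ^ Suc k /\<^sub>R fact (Suc k)))" by (rule summable_norm[OF s])
  also have "\<dots> \<le> (\<Sum>k. norm Y * (norm Y ^ k /\<^sub>R fact k))"
  proof (rule suminf_le[OF _ s])
    show "summable (\<lambda>k. norm Y * (norm Y ^ k /\<^sub>R fact k))"
      by (intro summable_mult summable_exp_generic)
    fix k
    have "norm (Y ^ Suc k /\<^sub>R fact (Suc k)) \<le> norm Y ^ Suc k / fact (Suc k)"
      using norm_power_ineq[of Y "Suc k"] by (simp add: divide_inverse mult.commute mult_left_mono del: fact_Suc power_Suc)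
    also have "\<dots> \<le> norm Y ^ Suc k / fact k"
      by (intro divide_left_mono fact_mono_nat) (auto simp: fact_mono)
    also have "\<dots> = norm Y * (norm Y ^ k /\<^sub>R fact k)" by (simp add: divide_inverse)
    finally show "norm (Y ^ Suc k /\<^sub>R fact (Suc k)) \<le> norm Y * (norm Y ^ k /\<^sub>R fact k)" .
  qed
  also have "\<dots> = norm Y * exp (norm Y)"
    unfolding exp_def by (rule suminf_mult[OF summable_exp_generic])
  finally show ?thesis .
qed

text \<open>The conjugate of F differs from F by exp(-tX) [F, exp(tX)]. Replacing the left factor by
  1 and the commutator by its linear part costs order t^2 in the ideal.\<close>

lemma schatten_bound_flow:
  fixes F X :: "'n::finite bop"
  assumes r: "r \<ge> 1" and FX: "commutator F X \<in> schatten_ideal r"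
  obtains C where "C \<ge> 0" "\<And>t. \<bar>t\<bar> \<le> 1 \<Longrightarrow>
    schatten_bound r 1 (C * t\<^sup>2) (exp (- (t *\<^sub>R X)) * F * exp (t *\<^sub>R X) - F - t *\<^sub>R commutator F X)"
proof -
  obtain d where d: "schatten_bound r 1 d (commutator F X)" using FX by (auto simp: schatten_ideal_def)
  have d0: "0 \<le> d" using d by (rule schatten_bound_nonneg)
  obtain C where C: "C \<ge> 0" "\<And>t. \<bar>t\<bar> \<le> 1 \<Longrightarrow>
    schatten_bound r 1 (C * t\<^sup>2) (commutator F (exp (t *\<^sub>R X)) - t *\<^sub>R commutator F X)"
    using schatten_bound_commutator_exp[OF r d] by metis
  let ?x = "norm X"
  have "schatten_bound r 1 ((exp ?x * C + ?x * exp ?x * d) * 4 * t\<^sup>2)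
     (exp (- (t *\<^sub>R X)) * F * exp (t *\<^sub>R X) - F - t *\<^sub>R commutator F X)" if t: "\<bar>t\<bar> \<le> 1" for t
  proof -
    let ?E = "exp (- (t *\<^sub>R X))"
    have nt: "norm (- (t *\<^sub>R X)) = \<bar>t\<bar> * ?x" by simp
    have tx: "\<bar>t\<bar> * ?x \<le> ?x" using t by (simp add: mult_left_le_one_le)
    have nE: "norm ?E \<le> exp ?x"
    proof -
      have "norm ?E \<le> exp (\<bar>t\<bar> * ?x)" using norm_exp[of "- (t *\<^sub>R X)"] unfolding nt .
      also have "\<dots> \<le> exp ?x" using tx by (simp only: exp_le_cancel_iff)
      finally show ?thesis .
    qed
    have nE1: "norm (?E - 1) \<le> \<bar>t\<bar> * (?x * exp ?x)"
    proof -
      have "norm (?E - 1) \<le> \<bar>t\<bar> * ?x * exp (\<bar>t\<bar> * ?x)"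
        using norm_exp_minus_one_le[of "- (t *\<^sub>R X)"] by simp
      also have "\<dots> \<le> \<bar>t\<bar> * ?x * exp ?x" using tx by (intro mult_left_mono) auto
      finally show ?thesis by (simp add: mult.assoc)
    qed
    have inv: "?E * exp (t *\<^sub>R X) = 1"
      using exp_minus_inverse[of "- (t *\<^sub>R X)"] by simp
    have eq: "?E * F * exp (t *\<^sub>R X) - F - t *\<^sub>R commutator F X
      = ?E * (commutator F (exp (t *\<^sub>R X)) - t *\<^sub>R commutator F X) + t *\<^sub>R ((?E - 1) * commutator F X)"
    proof -
      have "?E * commutator F (exp (t *\<^sub>R X)) = ?E * F * exp (t *\<^sub>R X) - (?E * exp (t *\<^sub>R X)) * F"
        by (simp add: commutator_def right_diff_distrib mult.assoc)
      then have "?E * commutator F (exp (t *\<^sub>R X)) = ?E * F * exp (t *\<^sub>R X) - F" by (simp add: inv)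
      then show ?thesis by (simp add: right_diff_distrib left_diff_distrib scaleR_right_diff_distrib)
    qed
    have b1: "schatten_bound r 1 (exp ?x * C * t\<^sup>2) (?E * (commutator F (exp (t *\<^sub>R X)) - t *\<^sub>R commutator F X))"
    proof (rule schatten_bound_mono[OF schatten_bound_mult_left[OF C(2)[OF t]]])
      show "norm ?E * (C * t\<^sup>2) \<le> exp ?x * C * t\<^sup>2"
        unfolding mult.assoc using nE C(1) by (intro mult_right_mono) auto
    qed
    have b2: "schatten_bound r 1 (?x * exp ?x * d * t\<^sup>2) (t *\<^sub>R ((?E - 1) * commutator F X))"
    proof (rule schatten_bound_mono[OF schatten_bound_scaleR[OF schatten_bound_mult_left[OF d]]])
      have "\<bar>t\<bar> * (norm (?E - 1) * d) \<le> \<bar>t\<bar> * (\<bar>t\<bar> * (?x * exp ?x) * d)"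
        using nE1 d0 by (intro mult_left_mono mult_right_mono) auto
      also have "\<dots> = ?x * exp ?x * d * t\<^sup>2"
      proof -
        have "t\<^sup>2 = \<bar>t\<bar> * \<bar>t\<bar>" by (simp add: power2_eq_square)
        then show ?thesis by (simp only: mult_ac)
      qed
      finally show "\<bar>t\<bar> * (norm (?E - 1) * d) \<le> ?x * exp ?x * d * t\<^sup>2" .
    qed
    show ?thesis
      unfolding eq using schatten_bound_add[OF r b1 b2] by (simp add: algebra_simps)
  qed
  moreover have "(exp ?x * C + ?x * exp ?x * d) * 4 \<ge> 0" using C(1) d0 by simp
  ultimately show thesis using that by blast
qed

text \<open>The flow displaces B by t D + R(t) with D = [F, X] in the ideal and R(t) of order t^2
  there, so the derivative at 0 is the first-order term in the direction D. The curve stays in the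
  ideal, hence \<psi> and \<phi> may be compared there.\<close>

lemma lie_deriv_eq:
  fixes \<phi> :: "'n::finite bop \<Rightarrow> complex"
  assumes r: "r \<ge> 1" and \<phi>: "sdiff r \<phi> \<phi>'" and B: "B \<in> schatten_ideal r"
    and X: "commutator pol X \<in> schatten_ideal r"
    and eq: "\<And>B. B \<in> schatten_ideal r \<Longrightarrow> \<psi> B = \<phi> B"
  shows "lie_deriv X \<psi> B = \<phi>' B (commutator (pol + B) X)"
proof -
  let ?F = "pol + B" let ?D = "commutator ?F X"
  have "?D = commutator pol X + (B * X - X * B)" by (simp add: commutator_def algebra_simps)
  then have D: "?D \<in> schatten_ideal r"
    using r X B by (simp add: schatten_ideal_add schatten_ideal_diff schatten_ideal_mult_left schatten_ideal_mult_right)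
  then obtain d where d: "schatten_bound r 1 d ?D" by (auto simp: schatten_ideal_def)
  have d0: "0 \<le> d" using d by (rule schatten_bound_nonneg)
  obtain C where C: "C \<ge> 0" "\<And>t. \<bar>t\<bar> \<le> 1 \<Longrightarrow>
    schatten_bound r 1 (C * t\<^sup>2) (exp (- (t *\<^sub>R X)) * ?F * exp (t *\<^sub>R X) - ?F - t *\<^sub>R ?D)"
    using schatten_bound_flow[OF r D] by metis
  obtain K where K: "K \<ge> 0" "\<And>H h. schatten_bound r 1 h H \<Longrightarrow> cmod (\<phi>' B H) \<le> K * h"
    "\<And>H h. schatten_bound r 1 h H \<Longrightarrow> h \<le> 1 \<Longrightarrow> cmod (\<phi> (B + H) - \<phi> B - \<phi>' B H) \<le> K * h\<^sup>2"
    using sdiff_bound[OF \<phi> B] by metis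
  obtain m where m: "schatten_bound r 1 m B" using B by (auto simp: schatten_ideal_def)
  define R where "R t = exp (- (t *\<^sub>R X)) * ?F * exp (t *\<^sub>R X) - ?F - t *\<^sub>R ?D" for t
  define g where "g t = \<psi> (exp (- (t *\<^sub>R X)) * ?F * exp (t *\<^sub>R X) - pol)" for t
  have R: "schatten_bound r 1 (C * t\<^sup>2) (R t)" if "\<bar>t\<bar> \<le> 1" for t
    unfolding R_def by (rule C(2)[OF that])
  have tD: "schatten_bound r 1 (\<bar>t\<bar> * d) (t *\<^sub>R ?D)" for t
    by (rule schatten_bound_scaleR[OF d])
  define L where "L = (d + C) * 4"
  have L0: "L \<ge> 0" using d0 C(1) by (simp add: L_def)
  have H: "schatten_bound r 1 (L * \<bar>t\<bar>) (t *\<^sub>R ?D + R t)" if t: "\<bar>t\<bar> \<le> 1" for t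
  proof (rule schatten_bound_mono[OF schatten_bound_add[OF r tD R[OF t]]])
    have "t\<^sup>2 \<le> \<bar>t\<bar>" using t by (metis abs_ge_zero mult_left_le power2_abs power2_eq_square)
    then have "C * t\<^sup>2 \<le> C * \<bar>t\<bar>" using C(1) by (rule mult_left_mono)
    then show "(\<bar>t\<bar> * d + C * t\<^sup>2) * 4 ^ 1 \<le> L * \<bar>t\<bar>" by (simp add: L_def algebra_simps)
  qed
  have g0: "g t = \<phi> (B + (t *\<^sub>R ?D + R t))" if "\<bar>t\<bar> \<le> 1" for t
  proof -
    have "B + (t *\<^sub>R ?D + R t) \<in> schatten_ideal r"
      by (rule schatten_ideal_add[OF r B]) (use H[OF that] in \<open>auto simp: schatten_ideal_def\<close>)
    moreover have "exp (- (t *\<^sub>R X)) * ?F * exp (t *\<^sub>R X) - pol = B + (t *\<^sub>R ?D + R t)"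
      by (simp add: R_def)
    ultimately show ?thesis unfolding g_def using eq by metis
  qed
  have g00: "g 0 = \<phi> B" using g0[of 0] by (simp add: R_def)
  have est: "norm (g t - g 0 - t *\<^sub>R \<phi>' B ?D) \<le> (K * L\<^sup>2 + K * C) * t\<^sup>2" if t: "\<bar>t\<bar> \<le> 1" "L * \<bar>t\<bar> \<le> 1" for t
  proof -
    have "\<phi>' B (t *\<^sub>R ?D + R t) = \<phi>' B (t *\<^sub>R ?D) + \<phi>' B (R t)"
      by (rule sdiff_add_right[OF \<phi> m tD R[OF t(1)]])
    also have "\<phi>' B (t *\<^sub>R ?D) = of_real t * \<phi>' B ?D"
      using sdiff_cscale_right[OF \<phi>, of B "of_real t" ?D] by (simp add: cscale_op_of_real)
    finally have eq': "g t - g 0 - t *\<^sub>R \<phi>' B ?D = (\<phi> (B + (t *\<^sub>R ?D + R t)) - \<phi> B - \<phi>' B (t *\<^sub>R ?D + R t)) + \<phi>' B (R t)"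
      unfolding g0[OF t(1)] g00 by (simp add: scaleR_conv_of_real)
    have "norm (g t - g 0 - t *\<^sub>R \<phi>' B ?D) \<le> K * (L * \<bar>t\<bar>)\<^sup>2 + K * (C * t\<^sup>2)"
      unfolding eq' using norm_triangle_ineq[of "\<phi> (B + (t *\<^sub>R ?D + R t)) - \<phi> B - \<phi>' B (t *\<^sub>R ?D + R t)" "\<phi>' B (R t)"]
        K(3)[OF H[OF t(1)] t(2)] K(2)[OF R[OF t(1)]]
      by linarith
    then show ?thesis by (simp add: power_mult_distrib algebra_simps)
  qed
  have "(g has_vector_derivative \<phi>' B ?D) (at 0)"
    unfolding has_vector_derivative_def has_derivative_at
  proof (intro conjI)
    show "bounded_linear (\<lambda>t. t *\<^sub>R \<phi>' B ?D)" by (rule bounded_linear_scaleR_left)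
    define Q where "Q = K * L\<^sup>2 + K * C"
    have "((\<lambda>t. Q * \<bar>t\<bar>) \<longlongrightarrow> Q * \<bar>0\<bar>) (at (0::real))" by (intro tendsto_intros)
    then have lim: "((\<lambda>t. Q * \<bar>t\<bar>) \<longlongrightarrow> 0) (at (0::real))" by simp
    show "(\<lambda>t. norm (g (0 + t) - g 0 - t *\<^sub>R \<phi>' B ?D) / norm t) \<midarrow>0\<rightarrow> 0"
    proof (rule Lim_null_comparison[OF _ lim])
      have "\<forall>\<^sub>F t in at (0::real). \<bar>t\<bar> < 1 / (L + 1)"
        using L0 by (auto simp: eventually_at dist_real_def intro!: exI[of _ "1 / (L + 1)"])
      then show "\<forall>\<^sub>F t in at 0. norm (norm (g (0 + t) - g 0 - t *\<^sub>R \<phi>' B ?D) / norm t) \<le> Q * \<bar>t\<bar>"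
      proof eventually_elim
        case (elim t)
        have Lt: "(L + 1) * \<bar>t\<bar> \<le> 1" using elim L0 by (simp add: field_simps)
        have "1 * \<bar>t\<bar> \<le> (L + 1) * \<bar>t\<bar>" "L * \<bar>t\<bar> \<le> (L + 1) * \<bar>t\<bar>" using L0 by (intro mult_right_mono; simp)+
        then have "norm (g t - g 0 - t *\<^sub>R \<phi>' B ?D) \<le> Q * t\<^sup>2"
          unfolding Q_def using Lt by (intro est) auto
        then show ?case
          by (cases "t = 0") (auto simp: divide_le_eq power2_eq_square abs_mult_self_eq mult.assoc)
      qed
    qed
  qed
  then show ?thesis
    unfolding lie_deriv_def g_def by (rule vector_derivative_at)
qed

section \<open>Cyclicity of the trace on products of Schatten operators\<close>

lemma rank_le_trace_class: "rank_le N F \<Longrightarrow> trace_class F"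
proof -
  assume F: "rank_le N F"
  have "appr n F = 0" if "n \<ge> N" for n
    using appr_le[OF rank_le_mono[OF F that], of F] appr_nonneg[of n F] by simp
  then have "\<forall>\<^sub>F n in sequentially. appr n F = 0"
    by (auto simp: eventually_sequentially)
  then have "summable (\<lambda>n. appr n F) = summable (\<lambda>n. 0 :: real)"
    by (rule summable_cong)
  then show ?thesis by (simp add: trace_class_def)
qed

lemma summable_half_power: "summable (\<lambda>n. (1/2 :: real) ^ (n div 2))"
proof (rule summable_block(1)[where k=2 and M=2])
  fix N
  have "(\<Sum>n<N. (1/2 :: real) ^ (2 * n div 2)) = (\<Sum>n<N. (1/2) ^ n)" by simp
  also have "\<dots> \<le> 2" by (simp only: geometric_sum) simp
  finally show "(\<Sum>n<N. (1/2 :: real) ^ (2 * n div 2)) \<le> 2" .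
qed (auto intro!: power_decreasing div_le_mono)

lemma schatten_bound_tendsto_zero:
  assumes r: "r \<ge> 1" and j: "j \<ge> 1" and U: "schatten_bound r j M U"
  shows "(\<lambda>n. appr (j * n) U) \<longlonglongrightarrow> 0"
proof -
  obtain s where s: "0 \<le> M" "\<And>n. 0 \<le> s n" "\<And>N. (\<Sum>n<N. s n ^ r) \<le> 1" "\<And>n. appr (j * n) U \<le> M * s n ^ j"
    using U unfolding schatten_bound_def by blast
  have "summable (\<lambda>n. s n ^ r)"
    by (rule summableI_nonneg_bounded[OF _ s(3)]) (simp add: s)
  then have "(\<lambda>n. s n ^ r) \<longlonglongrightarrow> 0" by (rule summable_LIMSEQ_zero)
  then have "(\<lambda>n. root r (s n ^ r)) \<longlonglongrightarrow> root r 0" by (rule tendsto_real_root)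
  then have "s \<longlonglongrightarrow> 0" using r s(2) by (simp add: real_root_power_cancel)
  then have "(\<lambda>n. M * s n ^ j) \<longlonglongrightarrow> M * 0 ^ j" by (intro tendsto_intros)
  then have "(\<lambda>n. M * s n ^ j) \<longlonglongrightarrow> 0" using j by (simp add: power_0_left)
  then show ?thesis
    by (rule Lim_null_comparison[rotated]) (use s(4) in \<open>auto intro!: always_eventually\<close>)
qed

text \<open>One factor is approximated by finite rank operators. Those of rank \<open>j N\<close> with almost optimal error leave
  a remainder whose approximation numbers are dominated uniformly in \<open>N\<close>.\<close>

lemma trace_commute_graded:
  fixes U V :: "'n::finite bop"
  assumes r: "r \<ge> 1" and j: "j \<ge> 1" and jk: "r \<le> j + k"
    and U: "schatten_bound r j M U" and V: "schatten_bound r k M' V"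
  shows "trace_op (U * V) = trace_op (V * U)"
proof -
  obtain s where s: "0 \<le> M" "\<And>n. 0 \<le> s n" "\<And>N. (\<Sum>n<N. s n ^ r) \<le> 1" "\<And>n. appr (j * n) U \<le> M * s n ^ j"
    using U unfolding schatten_bound_def by blast
  obtain s' where s': "0 \<le> M'" "\<And>n. 0 \<le> s' n" "\<And>N. (\<Sum>n<N. s' n ^ r) \<le> 1" "\<And>n. appr (k * n) V \<le> M' * s' n ^ k"
    using V unfolding schatten_bound_def by blast
  have le1: "x \<le> 1" if "0 \<le> x" "x ^ r \<le> 1" for x :: real
    using power_mono_iff[of x 1 r] that r by simp
  have s1: "s n \<le> 1" "s' n \<le> 1" for n
  proof -
    have "s n ^ r \<le> (\<Sum>i<Suc n. s i ^ r)" "s' n ^ r \<le> (\<Sum>i<Suc n. s' i ^ r)"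
      using s(2) s'(2) by (intro member_le_sum; simp)+
    then have "s n ^ r \<le> 1" "s' n ^ r \<le> 1"
      using s(3)[of "Suc n"] s'(3)[of "Suc n"] by linarith+
    then show "s n \<le> 1" "s' n \<le> 1"
      using le1[OF s(2)] le1[OF s'(2)] by blast+
  qed
  define u v where "u n = appr (j * n) U" and "v n = appr (k * n) V" for n
  have uv0: "0 \<le> u n" "0 \<le> v n" for n by (simp_all add: u_def v_def)
  have "\<exists>F. rank_le (j * N) F \<and> norm (U - F) < u N + (1/2) ^ N" for N
    using appr_approx[of "(1/2) ^ N" "j * N" U] unfolding u_def by (metis half_gt_zero zero_less_one zero_less_power)
  then obtain F where F: "\<And>N. rank_le (j * N) (F N)" "\<And>N. norm (U - F N) < u N + (1/2) ^ N" by metis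
  \<comment> \<open>A dominating sequence independent of N: halving the index absorbs the rank of
    the approximant, as \<open>uF\<close> shows.\<close>
  define g where "g n = (u (n div 2) + (1/2) ^ (n div 2)) * v n" for n
  have uF: "appr (j * n) (U - F N) \<le> u (n div 2) + (1/2) ^ (n div 2)" for n N
  \<comment> \<open>Below 2 N the norm of the remainder suffices, since n div 2 <= N; from 2 N on,
    removing the rank j N of \<open>F N\<close> still leaves n - N >= n div 2.\<close>
  proof (cases "n < 2 * N")
    case True
    have "appr (j * n) (U - F N) \<le> u N + (1/2) ^ N"
      using appr_le_norm[of "j * n" "U - F N"] F(2)[of N] by linarith
    also have "\<dots> \<le> u (n div 2) + (1/2) ^ (n div 2)"
      unfolding u_def using True by (intro add_mono appr_antimono mult_left_mono power_decreasing) auto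
    finally show ?thesis .
  next
    case False
    have "appr (j * n) (U - F N) \<le> appr (j * (n - N) + j * N) (U + - F N)"
      using False by (intro eq_refl arg_cong2[where f=appr]) (simp_all flip: distrib_left)
    also have "\<dots> \<le> appr (j * (n - N)) U + appr (j * N) (- F N)" by (rule appr_add)
    also have "appr (j * N) (- F N) = 0"
      using appr_le[OF rank_le_uminus[OF F(1)[of N]], of "- F N"] appr_nonneg[of "j * N" "- F N"] by simp
    also have "appr (j * (n - N)) U \<le> u (n div 2)"
      unfolding u_def using False by (intro appr_antimono mult_left_mono) auto
    finally show ?thesis by (simp add: add_increasing2)
  qed
  have sg: "summable g"
  proof -
    have "(\<Sum>n<N. s (n div 2) ^ r) \<le> 2" for N
    proof -
      have db: "(\<Sum>n<2 * N. f (n div 2)) = 2 * (\<Sum>n<N. f n)" for f :: "nat \<Rightarrow> real"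
        by (induction N) simp_all
      have "(\<Sum>n<N. s (n div 2) ^ r) \<le> (\<Sum>n<2 * N. s (n div 2) ^ r)"
        using s(2) by (intro sum_mono2) auto
      also have "\<dots> \<le> 2" unfolding db[of "\<lambda>n. s n ^ r"] using s(3)[of N] by simp
      finally show ?thesis .
    qed
    then have "summable (\<lambda>n. s (n div 2) ^ r)"
      by (intro summableI_nonneg_bounded) (auto simp: s)
    moreover have "summable (\<lambda>n. s' n ^ r)"
      by (rule summableI_nonneg_bounded[OF _ s'(3)]) (simp add: s')
    ultimately have sm: "summable (\<lambda>n. M * M' * (s (n div 2) ^ r + s' n ^ r) + M' * (1/2) ^ (n div 2))"
      by (intro summable_add summable_mult summable_half_power)
    show ?thesis
    proof (rule summable_comparison_test'[OF sm])
      fix n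
      let ?m = "max (s (n div 2)) (s' n)"
      have m: "0 \<le> ?m" "?m \<le> 1" using s(2)[of "n div 2"] s1 by (auto simp: max_def)
      have "u (n div 2) * v n \<le> (M * s (n div 2) ^ j) * (M' * s' n ^ k)"
        unfolding u_def v_def by (intro mult_mono s s') (auto intro!: mult_nonneg_nonneg zero_le_power s)
      also have "\<dots> \<le> (M * ?m ^ j) * (M' * ?m ^ k)"
        using s s' m by (intro mult_mono mult_left_mono power_mono) (auto intro!: mult_nonneg_nonneg zero_le_power)
      also have "\<dots> = M * M' * ?m ^ (j + k)" by (simp add: power_add)
      also have "\<dots> \<le> M * M' * ?m ^ r"
        using s(1) s'(1) m jk by (intro mult_left_mono power_decreasing) auto
      also have "\<dots> \<le> M * M' * (s (n div 2) ^ r + s' n ^ r)"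
        using s(1,2) s'(1,2) by (intro mult_left_mono) (auto simp: max_def)
      finally have 1: "u (n div 2) * v n \<le> M * M' * (s (n div 2) ^ r + s' n ^ r)" .
      have "s' n ^ k \<le> 1" using s'(2) s1 by (intro power_le_one) auto
      then have "M' * s' n ^ k \<le> M'" using s'(1) by (simp add: mult_left_le)
      then have "v n \<le> M'" unfolding v_def using s'(4)[of n] by linarith
      then have 2: "(1/2) ^ (n div 2) * v n \<le> M' * (1/2) ^ (n div 2)" by (subst mult.commute) (intro mult_right_mono, auto)
      have "norm (g n) = u (n div 2) * v n + (1/2) ^ (n div 2) * v n"
        using uv0 by (simp add: g_def distrib_right)
      then show "norm (g n) \<le> M * M' * (s (n div 2) ^ r + s' n ^ r) + M' * (1/2) ^ (n div 2)"
        using 1 2 by linarith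
    qed
  qed
  have Flim: "(\<lambda>N. norm (U - F N)) \<longlonglongrightarrow> 0"
  proof (rule Lim_null_comparison)
    have "(\<lambda>N. u N + (1/2) ^ N) \<longlonglongrightarrow> 0 + 0"
      unfolding u_def by (intro tendsto_add schatten_bound_tendsto_zero[OF r j U] LIMSEQ_power_zero) simp
    then show "(\<lambda>N. u N + (1/2) ^ N) \<longlonglongrightarrow> 0" by simp
    show "\<forall>\<^sub>F N in sequentially. norm (norm (U - F N)) \<le> u N + (1/2) ^ N"
      using F(2) by (auto intro!: always_eventually less_imp_le)
  qed
  define h where "h n N = appr (j * n) (U - F N) * v n" for n N
  \<comment> \<open>Dominated convergence for series: every term tends to 0 as N grows, and g
    dominates.\<close>
  have lim: "(\<lambda>N. \<Sum>n. h n N) \<longlonglongrightarrow> (\<Sum>n. 0 :: real)"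
  proof (rule tannerys_theorem[THEN conjunct2, THEN conjunct2])
    show "(h n \<longlongrightarrow> 0) sequentially" for n
    proof (rule Lim_null_comparison)
      have "(\<lambda>N. norm (U - F N) * v n) \<longlonglongrightarrow> 0 * v n" by (intro tendsto_intros Flim)
      then show "(\<lambda>N. norm (U - F N) * v n) \<longlonglongrightarrow> 0" by simp
      show "\<forall>\<^sub>F N in sequentially. norm (h n N) \<le> norm (U - F N) * v n"
        using uv0 by (auto intro!: always_eventually mult_right_mono appr_le_norm simp: h_def)
    qed
    show "\<forall>\<^sub>F (n, N) in at_top \<times>\<^sub>F sequentially. norm (h n N) \<le> g n"
      using uv0 uF by (auto intro!: always_eventually mult_right_mono simp: h_def g_def)
  qed (use sg in auto)
  let ?L = "j + k"
  have L: "?L \<ge> 1" using j by simp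
  have bound: "trace_class T \<and> cmod (trace_op T) \<le> 16 * (real ?L * (\<Sum>n. h n N))"
    if T: "\<And>n. appr (?L * n) T \<le> h n N" for T :: "'n bop" and N
  proof -
    have hs: "summable (\<lambda>n. h n N)"
      by (rule summable_comparison_test'[OF sg]) (use uv0 uF in \<open>auto intro!: mult_right_mono simp: h_def g_def\<close>)
    have bd: "(\<Sum>n<K. appr (?L * n) T) \<le> (\<Sum>n. h n N)" for K
      using T by (intro order_trans[OF sum_mono sum_le_suminf[OF hs]]) (auto simp: h_def uv0)
    from summable_block[of "\<lambda>n. appr n T", OF appr_antimono appr_nonneg L bd]
    have "trace_class T" "(\<Sum>n. appr n T) \<le> real ?L * (\<Sum>n. h n N)" by (auto simp: trace_class_def)
    then show ?thesis using trace_class_bound[of T] by (auto intro: order_trans)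
  qed
  have b1: "appr (?L * n) ((U - F N) * V) \<le> h n N" for n N
    using appr_mult[of "j * n" "k * n" "U - F N" V] by (simp add: h_def v_def distrib_right)
  have b2: "appr (?L * n) (V * (U - F N)) \<le> h n N" for n N
  proof -
    have e: "?L * n = k * n + j * n" by (simp add: distrib_right)
    show ?thesis
      unfolding e h_def v_def mult.commute[of "appr (j * n) (U - F N)"] by (rule appr_mult)
  qed
  \<comment> \<open>The finite rank part \<open>F N\<close> is trace class and commutes with V under
    the trace; only the remainder \<open>U - F N\<close> contributes.\<close>
  have est: "cmod (trace_op (U * V) - trace_op (V * U)) \<le> 32 * real ?L * (\<Sum>n. h n N)" for N
  proof -
    have F': "trace_class (F N)" by (rule rank_le_trace_class[OF F(1)])
    have "U * V = (U - F N) * V + F N * V" "V * U = V * (U - F N) + V * F N"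
      by (simp_all add: algebra_simps)
    then have "trace_op (U * V) = trace_op ((U - F N) * V) + trace_op (F N * V)"
      "trace_op (V * U) = trace_op (V * (U - F N)) + trace_op (V * F N)"
      using bound[OF b1] bound[OF b2] F' by (metis trace_add trace_class_mult_left trace_class_mult_right)+
    then have "trace_op (U * V) - trace_op (V * U) = trace_op ((U - F N) * V) - trace_op (V * (U - F N))"
      using trace_commute[OF F', of V] by simp
    also have "cmod \<dots> \<le> cmod (trace_op ((U - F N) * V)) + cmod (trace_op (V * (U - F N)))"
      by (rule norm_triangle_ineq4)
    also have "\<dots> \<le> 16 * (real ?L * (\<Sum>n. h n N)) + 16 * (real ?L * (\<Sum>n. h n N))"
      using bound[OF b1, of N] bound[OF b2, of N] by (intro add_mono) auto
    also have "\<dots> = 32 * real ?L * (\<Sum>n. h n N)" by (simp only: mult.assoc)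
    finally show ?thesis .
  qed
  have "(\<lambda>N. 32 * real ?L * (\<Sum>n. h n N)) \<longlonglongrightarrow> 32 * real ?L * (\<Sum>n. 0 :: real)"
    by (intro tendsto_intros lim)
  then have "(\<lambda>N. 32 * real ?L * (\<Sum>n. h n N)) \<longlonglongrightarrow> 0" by simp
  then have "cmod (trace_op (U * V) - trace_op (V * U)) \<le> 0"
    by (rule LIMSEQ_le_const) (use est in auto)
  then show ?thesis by simp
qed

section \<open>Derivatives of powers\<close>

primrec dpow :: "nat \<Rightarrow> 'a::ring_1 \<Rightarrow> 'a \<Rightarrow> 'a" where
  "dpow 0 B H = 0"
| "dpow (Suc n) B H = H * B ^ n + B * dpow n B H"

text \<open>The polarised second derivative of the power.\<close>

primrec d2pow :: "nat \<Rightarrow> 'a::ring_1 \<Rightarrow> 'a \<Rightarrow> 'a \<Rightarrow> 'a" where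
  "d2pow 0 B H G = 0"
| "d2pow (Suc n) B H G = G * dpow n B H + H * dpow n B G + B * d2pow n B H G"

lemma dpow_add: "dpow n B (G + H) = dpow n B G + dpow n B H"
  by (induction n) (simp_all add: algebra_simps)

lemma dpow_diff: "dpow n B (G - H) = dpow n B G - dpow n B H"
  using dpow_add[of n B "G - H" H] by simp

lemma d2pow_commute: "d2pow n B H G = d2pow n B G H"
  by (induction n) (simp_all add: algebra_simps)

text \<open>The commutator with X is a derivation with value [B, X] at B, so both sides obey the
  same Leibniz recursion in n.\<close>

lemma dpow_commutator: "dpow n B (commutator B X) = commutator (B ^ n) X"
proof (induction n)
  case (Suc n)
  have "dpow (Suc n) B (commutator B X) = commutator B X * B ^ n + B * commutator (B ^ n) X"
    by (simp add: Suc)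
  then show ?case by (simp add: commutator_def algebra_simps)
qed (simp add: commutator_def)

lemma dpow_eq_sum: "dpow n B H = (\<Sum>i<n. B ^ i * H * B ^ (n - Suc i))"
proof (induction n)
  case (Suc n)
  have "B * (\<Sum>i<n. B ^ i * H * B ^ (n - Suc i)) = (\<Sum>i<n. B ^ Suc i * H * B ^ (n - Suc i))"
    by (simp add: sum_distrib_left mult.assoc)
  then show ?case
    using Suc by (simp add: sum.lessThan_Suc_shift del: sum.lessThan_Suc)
qed simp

lemma expands_zero: "r \<ge> 1 \<Longrightarrow> expands r k (\<lambda>_. 0) (\<lambda>_ _. 0)"
  by (rule expands_const_graded[where M=0]) (simp_all add: schatten_bound_zero)

lemma expands_power:
  assumes r: "r \<ge> 1" shows "expands r n (\<lambda>B. B ^ n) (\<lambda>B H. dpow n B H)"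
proof (induction n)
  case 0
  show ?case using expands_const[OF r, of 1] by simp
next
  case (Suc n)
  from expands_mult[OF r expands_id[OF r] Suc] show ?case by simp
qed

lemma expands_dpow:
  assumes r: "r \<ge> 1" and g: "expands r 1 g g'"
  shows "expands r n (\<lambda>B. dpow n B (g B)) (\<lambda>B H. d2pow n B H (g B) + dpow n B (g' B H))"
proof (induction n)
  case 0
  show ?case using expands_zero[OF r, of 0] by simp
next
  case (Suc n)
  have "expands r (1 + n) (\<lambda>B. g B * B ^ n + B * dpow n B (g B))
     (\<lambda>B H. (g' B H * B ^ n + g B * dpow n B H) + (H * dpow n B (g B) + B * (d2pow n B H (g B) + dpow n B (g' B H))))"
    by (intro expands_add r expands_mult g expands_power expands_id Suc)
  moreover have "(\<lambda>B H. (g' B H * B ^ n + g B * dpow n B H) + (H * dpow n B (g B) + B * (d2pow n B H (g B) + dpow n B (g' B H))))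
     = (\<lambda>B H. d2pow (Suc n) B H (g B) + dpow (Suc n) B (g' B H))"
    by (simp add: fun_eq_iff algebra_simps)
  ultimately show ?case by simp
qed

text \<open>The value lies in degree 1 because [pol, X] does; this constant part is split off, since
  \<open>pol\<close> itself has degree 0 only.\<close>

lemma expands_commutator:
  assumes r: "r \<ge> 1" and X: "commutator pol X \<in> schatten_ideal r"
  shows "expands r 1 (\<lambda>B. commutator (pol + B) X) (\<lambda>B H. commutator H X)"
proof -
  obtain M where M: "schatten_bound r 1 M (commutator pol X)" using X by (auto simp: schatten_ideal_def)
  have "expands r 1 (\<lambda>B. commutator pol X + (B * X - X * B)) (\<lambda>B H. 0 + (H * X - X * H))"
    by (intro expands_add r expands_const_graded[OF r M] expands_diff expands_mult_left expands_mult_right expands_id)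
  moreover have "(\<lambda>B. commutator pol X + (B * X - X * B)) = (\<lambda>B. commutator (pol + B) X)"
    by (simp add: fun_eq_iff commutator_def algebra_simps)
  ultimately show ?thesis by (simp add: commutator_def)
qed

definition graded :: "nat \<Rightarrow> nat \<Rightarrow> 'n::finite bop \<Rightarrow> bool" where
  "graded r k T \<longleftrightarrow> (\<exists>M. schatten_bound r k M T)"

lemma graded_any: "r \<ge> 1 \<Longrightarrow> graded r 0 A"
  unfolding graded_def using schatten_bound_0 by blast

lemma graded_zero: "r \<ge> 1 \<Longrightarrow> graded r k 0"
  unfolding graded_def using schatten_bound_zero by blast

lemma graded_mult: "r \<ge> 1 \<Longrightarrow> graded r j S \<Longrightarrow> graded r k T \<Longrightarrow> graded r (j + k) (S * T)"
  unfolding graded_def using schatten_bound_mult by blast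

lemma graded_mult_left: "graded r k T \<Longrightarrow> graded r k (A * T)"
  unfolding graded_def using schatten_bound_mult_left by blast

lemma graded_mult_right: "graded r k T \<Longrightarrow> graded r k (T * A)"
  unfolding graded_def using schatten_bound_mult_right by blast

lemma graded_add: "r \<ge> 1 \<Longrightarrow> graded r k S \<Longrightarrow> graded r k T \<Longrightarrow> graded r k (S + T)"
  unfolding graded_def using schatten_bound_add by blast

lemma graded_power: "r \<ge> 1 \<Longrightarrow> B \<in> schatten_ideal r \<Longrightarrow> graded r n (B ^ n)"
  unfolding graded_def schatten_ideal_def using schatten_bound_power[of r 1 _ B n] by auto

lemma graded_trace_class: "graded r k T \<Longrightarrow> r \<le> k \<Longrightarrow> r \<ge> 1 \<Longrightarrow> trace_class T"
  unfolding graded_def using schatten_bound_trace(1) le_trans by blast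

lemma graded_trace_commute:
  assumes "r \<ge> 1" "r \<le> j + k" "graded r j U" "graded r k V"
  shows "trace_op (U * V) = trace_op (V * U)"
proof (cases "j \<ge> 1")
  case True
  then show ?thesis using assms trace_commute_graded unfolding graded_def by blast
next
  case False
  then have "k \<ge> 1" using assms by linarith
  moreover have "r \<le> k + j" using assms by simp
  ultimately show ?thesis using assms trace_commute_graded unfolding graded_def by metis
qed

text \<open>The direction G counts as merely bounded, so a derivative loses one degree. Truncated
  subtraction makes the cases n = 0 and n = 1 harmless.\<close>

lemma graded_dpow:
  assumes r: "r \<ge> 1" and B: "B \<in> schatten_ideal r" shows "graded r (n - 1) (dpow n B G)"
proof (induction n)
  case (Suc n)
  have "graded r n (B * dpow n B G)"
  proof (cases n)
    case (Suc m)
    have "graded r (1 + (n - 1)) (B * dpow n B G)"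
      using graded_mult[OF r _ Suc.IH, of 1 B] graded_power[OF r B, of 1] by simp
    then show ?thesis using Suc by simp
  qed (use graded_zero[OF r] in simp)
  then show ?case using graded_add[OF r graded_mult_left[OF graded_power[OF r B, of n], of G]] by simp
qed (use graded_zero[OF r] in simp)

lemma graded_d2pow:
  assumes r: "r \<ge> 1" and B: "B \<in> schatten_ideal r" shows "graded r (n - 2) (d2pow n B H G)"
proof (induction n)
  case (Suc n)
  have "graded r (n - 1) (B * d2pow n B H G)"
  proof (cases "n \<ge> 2")
    case True
    have "graded r (1 + (n - 2)) (B * d2pow n B H G)"
      using graded_mult[OF r _ Suc.IH, of 1 B] graded_power[OF r B, of 1] by simp
    then show ?thesis using True by (simp add: numeral_2_eq_2 Suc_diff_Suc)
  next
    case False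
    then have "n - 1 = 0" by simp
    then show ?thesis using graded_any[OF r] by simp
  qed
  then have "graded r (n - 1) (d2pow (Suc n) B H G)"
    unfolding d2pow.simps
    by (rule graded_add[OF r graded_add[OF r graded_mult_left[OF graded_dpow[OF r B]]
      graded_mult_left[OF graded_dpow[OF r B]]]])
  moreover have "Suc n - 2 = n - 1" by simp
  ultimately show ?case by (simp only:)
qed (use graded_zero[OF r] in simp)

section \<open>The cocycles\<close>

text \<open>Up to the factor \<open>4\<^sup>p\<close>, this is the cocycle \<open>c_tilde\<close>.\<close>

definition alt_form :: "nat \<Rightarrow> 'n::finite bop \<Rightarrow> 'n bop \<Rightarrow> 'n bop \<Rightarrow> complex" where
  "alt_form p X Y B = (\<Sum>k\<le>2 * p + 1. (-1) ^ k * trace_op (B ^ (2 * p + 1 - k) * X * B ^ k * Y))"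

text \<open>The trace of this operator is the coboundary of X -> Tr(pol B^(2p+2) X): the Lie
  derivative along X differentiates the power in the direction [F, X].\<close>

definition exact_op :: "nat \<Rightarrow> 'n::finite bop \<Rightarrow> 'n bop \<Rightarrow> 'n bop \<Rightarrow> 'n bop" where
  "exact_op p X Y B = pol * (dpow (2 * p + 2) B (commutator (pol + B) X) * Y
     - dpow (2 * p + 2) B (commutator (pol + B) Y) * X - B ^ (2 * p + 2) * commutator X Y)"

text \<open>The second summand is the coboundary of \<open>2\<^bsup>2p-1\<^esup> Tr (\<epsilon> B\<^bsup>2p+2\<^esup> X)\<close>.\<close>

definition modified_cocycle :: "nat \<Rightarrow> 'n::finite bop \<Rightarrow> 'n bop \<Rightarrow> 'n bop \<Rightarrow> complex" where
  "modified_cocycle p X Y B = 4 ^ p * alt_form p X Y B + 4 ^ p / 2 * trace_op (exact_op p X Y B)"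

section \<open>Index sums and the algebra at a fixed flat connection\<close>

definition triples :: "nat \<Rightarrow> (nat \<times> nat \<times> nat) set" where
  "triples n = {(a, b, c). a + b + c = n}"

lemma finite_triples [simp]: "finite (triples n)"
  by (rule finite_subset[of _ "{..n} \<times> {..n} \<times> {..n}"]) (auto simp: triples_def)

lemma sum_triples_rotate:
  "(\<Sum>(a, b, c)\<in>triples n. g a b c) = (\<Sum>(a, b, c)\<in>triples n. g b c a)" for g :: "nat \<Rightarrow> nat \<Rightarrow> nat \<Rightarrow> 'b::comm_monoid_add"
  by (rule sum.reindex_bij_witness[where i="\<lambda>(a, b, c). (b, c, a)" and j="\<lambda>(a, b, c). (c, a, b)"])
    (auto simp: triples_def)

text \<open>The summand for k = n + 1 has an empty inner sum; it is present because
  \<open>alt_form\<close> sums up to 2p + 1 while the words of its derivative have degree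
  2p.\<close>

lemma sum_triples_nested:
  "(\<Sum>k\<le>Suc n. \<Sum>i<Suc n - k. g i (n - k - i) k) = (\<Sum>(a, b, c)\<in>triples n. g a b c)"
  for g :: "nat \<Rightarrow> nat \<Rightarrow> nat \<Rightarrow> 'b::comm_monoid_add"
  unfolding sum.Sigma[OF finite_atMost ballI[OF finite_lessThan]]
  by (rule sum.reindex_bij_witness[where i="\<lambda>(a, b, c). (c, a)" and j="\<lambda>(k, i). (i, n - k - i, k)"])
    (auto simp: triples_def)

lemma sum_atMost_rev: "(\<Sum>k\<le>n. f (n - k)) = (\<Sum>k\<le>n. f k)"
  for f :: "nat \<Rightarrow> 'b::comm_monoid_add"
  by (rule sum.reindex_bij_witness[where i="\<lambda>k. n - k" and j="\<lambda>k. n - k"]) auto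

lemma minus_one_power_diff: "k \<le> n \<Longrightarrow> odd n \<Longrightarrow> (-1) ^ (n - k) = - ((-1) ^ k :: 'b::ring_1)"
  by (cases "even k") auto

text \<open>Fixing one connection makes the rest algebraic: membership in the ideal makes words with
  at least 2p factors B trace class and allows their rotation, while F^2 = 1 gives the commutation
  rules with \<open>pol\<close>.\<close>

locale flat_point =
  fixes p :: nat and B :: "'n::finite bop"
  assumes p: "p \<ge> 1" and B_ideal: "B \<in> schatten_ideal (2 * p)" and F_square: "(pol + B) * (pol + B) = 1"
begin

lemma exponent_ge_1: "2 * p \<ge> 1" using p by simp

declare power_Suc [simp del] dpow.simps [simp del] d2pow.simps [simp del]

lemma trace_class_two_factors:
  assumes "2 * p \<le> a + b" shows "trace_class (A * B ^ a * X * B ^ b * Y)"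
proof -
  have 1: "graded (2 * p) a (A * B ^ a * X)" and 2: "graded (2 * p) b (B ^ b * Y)"
    by (intro graded_mult_left graded_mult_right graded_power[OF exponent_ge_1 B_ideal])+
  have "graded (2 * p) (a + b) (A * B ^ a * X * B ^ b * Y)"
    using graded_mult[OF exponent_ge_1 1 2] by (simp only: mult.assoc)
  then show ?thesis by (rule graded_trace_class[OF _ assms exponent_ge_1])
qed

lemma trace_class_three_factors:
  assumes "2 * p \<le> a + b + c" shows "trace_class (A * B ^ a * X * B ^ b * Y * B ^ c * Z)"
proof -
  have 1: "graded (2 * p) a (A * B ^ a * X)" and 2: "graded (2 * p) b (B ^ b * Y)"
    and 3: "graded (2 * p) c (B ^ c * Z)"
    by (intro graded_mult_left graded_mult_right graded_power[OF exponent_ge_1 B_ideal])+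
  have "graded (2 * p) (a + b + c) (A * B ^ a * X * B ^ b * Y * B ^ c * Z)"
    using graded_mult[OF exponent_ge_1 graded_mult[OF exponent_ge_1 1 2] 3] by (simp only: mult.assoc)
  then show ?thesis by (rule graded_trace_class[OF _ assms exponent_ge_1])
qed

lemma trace_class_two_powers: "2 * p \<le> a + b \<Longrightarrow> trace_class (B ^ a * X * B ^ b * Y)"
  using trace_class_two_factors[of a b 1] by simp

lemma trace_class_three_powers: "2 * p \<le> a + b + c \<Longrightarrow> trace_class (B ^ a * X * B ^ b * Y * B ^ c * Z)"
  using trace_class_three_factors[of a b c 1] by simp

lemma trace_class_dpow: "2 * p + 1 \<le> n \<Longrightarrow> trace_class (A * dpow n B G * Y)"
  by (intro trace_class_mult_left trace_class_mult_right graded_trace_class[OF graded_dpow[OF exponent_ge_1 B_ideal] _ exponent_ge_1]) simp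

text \<open>The two factors may fail to be trace class individually; the sum of their degrees
  justifies the exchange.\<close>

lemma trace_rotate_two:
  assumes "2 * p \<le> a + b"
  shows "trace_op (A * B ^ a * X * (B ^ b * Y)) = trace_op (B ^ b * Y * (A * B ^ a * X))"
  by (rule graded_trace_commute[OF exponent_ge_1 assms])
    (intro graded_mult_left graded_mult_right graded_power[OF exponent_ge_1 B_ideal])+

lemma pol_B_pol: "B * pol = - (pol * B) - B * B"
proof -
  have "pol * pol + pol * B + B * pol + B * B = 1"
    using F_square by (simp add: algebra_simps)
  then have "B * pol + (pol * B + B * B) = 0" by (simp add: algebra_simps)
  then have "B * pol = - (pol * B + B * B)" by (rule eq_neg_iff_add_eq_0[THEN iffD2])
  also have "\<dots> = - (pol * B) - B * B" by simp
  finally show ?thesis .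
qed

lemma power_pol:
  "B ^ a * pol = (if even a then pol * B ^ a else - (pol * B ^ a) - B ^ Suc a)"
proof (induction a)
  case (Suc a)
  have "B ^ Suc a * pol = B * (B ^ a * pol)" by (simp add: power_Suc mult.assoc)
  also have "\<dots> = (if even a then (B * pol) * B ^ a else - ((B * pol) * B ^ a) - B * B ^ Suc a)"
    unfolding Suc by (simp add: power_Suc mult.assoc right_diff_distrib)
  also have "\<dots> = (if even (Suc a) then pol * B ^ Suc a else - (pol * B ^ Suc a) - B ^ Suc (Suc a))"
    unfolding pol_B_pol by (simp add: power_Suc mult.assoc left_diff_distrib)
  finally show ?case .
qed simp

lemma pol_power:
  "pol * B ^ a = (if even a then B ^ a * pol else - (B ^ a * pol) - B ^ Suc a)"
  using power_pol[of a] by (auto simp: algebra_simps)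

text \<open>This and \<open>F_power_pol\<close> evaluate the words in which F stands next to a power
  of B; only even exponents leave a term with \<open>pol\<close>.\<close>

lemma pol_power_F: "pol * B ^ i * (pol + B) = (-1) ^ i * B ^ i + (if even i then pol * B ^ Suc i else 0)"
proof -
  have "pol * B ^ i * (pol + B) = pol * (B ^ i * pol) + pol * (B ^ i * B)" by (simp add: algebra_simps)
  also have "B ^ i * B = B ^ Suc i" by (simp only: power_Suc2)
  also have "pol * (B ^ i * pol) + pol * B ^ Suc i = (-1) ^ i * B ^ i + (if even i then pol * B ^ Suc i else 0)"
  proof -
    have pp: "pol * (pol * T) = T" for T :: "'n bop" by (simp flip: mult.assoc)
    show ?thesis unfolding power_pol by (auto simp: right_diff_distrib pp simp del: power_Suc)
  qed
  finally show ?thesis .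
qed

lemma F_power_pol: "(pol + B) * B ^ j * pol = (-1) ^ j * B ^ j + (if even j then B ^ Suc j * pol else 0)"
proof -
  have "(pol + B) * B ^ j * pol = (pol * B ^ j) * pol + B ^ Suc j * pol" by (simp add: power_Suc algebra_simps)
  also have "\<dots> = (-1) ^ j * B ^ j + (if even j then B ^ Suc j * pol else 0)"
    unfolding pol_power by (auto simp: left_diff_distrib mult.assoc simp del: power_Suc)
  finally show ?thesis .
qed

abbreviation "C X Y \<equiv> alt_form p X Y B"
abbreviation "N \<equiv> 2 * p + 1"

lemma trace_rotate_complement:
  assumes "k \<le> N"
  shows "trace_op (B ^ (N - k) * Y * B ^ k * X) = trace_op (B ^ k * X * B ^ (N - k) * Y)"
proof -
  have "2 * p \<le> (N - k) + k" using assms by linarith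
  from trace_rotate_two[OF this, of 1 Y X] show ?thesis by (simp only: mult_1_left mult.assoc)
qed

lemma C_eq: "C X Y = (\<Sum>k\<le>N. (-1) ^ k * trace_op (B ^ (N - k) * X * B ^ k * Y))"
  by (simp only: alt_form_def)

text \<open>N is odd, so reversing the index changes the sign; together with a rotation this gives
  antisymmetry.\<close>

lemma C_rev: "C X Y = (\<Sum>k\<le>N. - ((-1) ^ k * trace_op (B ^ k * X * B ^ (N - k) * Y)))"
proof -
  have "C X Y = (\<Sum>k\<le>N. (-1) ^ (N - k) * trace_op (B ^ (N - (N - k)) * X * B ^ (N - k) * Y))"
    unfolding C_eq by (rule sum_atMost_rev[symmetric])
  also have "\<dots> = (\<Sum>k\<le>N. - ((-1) ^ k * trace_op (B ^ k * X * B ^ (N - k) * Y)))"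
    by (intro sum.cong refl) (simp add: minus_one_power_diff del: One_nat_def)
  finally show ?thesis .
qed

lemma C_antisym: "C Y X = - C X Y"
proof -
  have "trace_op (B ^ (N - k) * Y * B ^ k * X) = trace_op (B ^ k * X * B ^ (N - k) * Y)" if "k \<le> N" for k
    by (rule trace_rotate_complement[OF that])
  then show ?thesis
    unfolding C_rev[of X Y] unfolding C_eq[of Y X] by (simp add: sum_negf)
qed

lemma C_add_right: "C X (Y + Y') = C X Y + C X Y'"
  unfolding C_eq by (simp add: distrib_left trace_add trace_class_two_powers sum.distrib)

lemma C_diff_right: "C X (Y - Y') = C X Y - C X Y'"
  unfolding C_eq by (simp add: right_diff_distrib trace_diff trace_class_two_powers sum_subtractf)

lemma C_diff_left: "C (X - X') Y = C X Y - C X' Y"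
  by (metis C_antisym C_diff_right minus_diff_eq minus_diff_commute diff_minus_eq_add uminus_add_conv_diff)

text \<open>By rotation the subtracted term with index k is the term of \<open>alt_form\<close> with
  index N - k, and the signs agree because N is odd. The p + 1 differences thus unfold into all 2p +
  2 terms.\<close>

lemma c_tilde_eq: "c_tilde p X Y B = 4 ^ p * C X Y"
proof -
  define q where "q k = trace_op (B ^ (N - k) * X * B ^ k * Y)" for k
  have sgn: "(-1) ^ k * T = ((-1 :: real) ^ k) *\<^sub>R T" for k and T :: "'n bop"
    by (cases "even k") simp_all
  have tc: "trace_class ((-1) ^ k * (B ^ (N - k) * X * B ^ k * Y - B ^ (N - k) * Y * B ^ k * X))" if "k \<le> p" for k
    unfolding sgn by (intro trace_class_scaleR trace_class_diff trace_class_two_powers) (use that in simp_all)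
  have swap: "trace_op (B ^ (N - k) * Y * B ^ k * X) = q (N - k)" if "k \<le> p" for k
  proof -
    have "k \<le> N" "N - (N - k) = k" using that by simp_all
    then show ?thesis using trace_rotate_complement[OF \<open>k \<le> N\<close>, of Y X] by (simp only: q_def)
  qed
  have "cond_trace (\<Sum>k\<le>p. (-1) ^ k * (B ^ (N - k) * X * B ^ k * Y - B ^ (N - k) * Y * B ^ k * X))
      = (\<Sum>k\<le>p. (-1) ^ k * (q k - q (N - k)))"
  proof -
    have "cond_trace (\<Sum>k\<le>p. (-1) ^ k * (B ^ (N - k) * X * B ^ k * Y - B ^ (N - k) * Y * B ^ k * X))
       = (\<Sum>k\<le>p. trace_op ((-1) ^ k * (B ^ (N - k) * X * B ^ k * Y - B ^ (N - k) * Y * B ^ k * X)))"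
      using tc by (subst cond_trace_eq) (auto intro!: trace_class_sum trace_sum)
    also have "\<dots> = (\<Sum>k\<le>p. (-1) ^ k * (q k - q (N - k)))"
    proof (rule sum.cong[OF refl])
      fix k assume "k \<in> {..p}"
      then have k: "k \<le> p" by simp
      have "trace_op (B ^ (N - k) * X * B ^ k * Y - B ^ (N - k) * Y * B ^ k * X)
          = trace_op (B ^ (N - k) * X * B ^ k * Y) - trace_op (B ^ (N - k) * Y * B ^ k * X)"
        by (intro trace_diff trace_class_two_powers) (use k in simp_all)
      also have "\<dots> = q k - q (N - k)"
        unfolding swap[OF k] q_def ..
      finally have "trace_op (B ^ (N - k) * X * B ^ k * Y - B ^ (N - k) * Y * B ^ k * X) = q k - q (N - k)" .
      then show "trace_op ((-1) ^ k * (B ^ (N - k) * X * B ^ k * Y - B ^ (N - k) * Y * B ^ k * X)) = (-1) ^ k * (q k - q (N - k))"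
        unfolding sgn trace_scaleR by simp
    qed
    finally show ?thesis .
  qed
  also have "\<dots> = (\<Sum>k<Suc p. (-1) ^ k * q k) + (\<Sum>k<Suc p. - ((-1) ^ k * q (N - k)))"
    by (simp add: lessThan_Suc_atMost right_diff_distrib sum_subtractf sum_negf del: sum.lessThan_Suc)
  also have "(\<Sum>k<Suc p. - ((-1) ^ k * q (N - k))) = (\<Sum>k<Suc p. (-1) ^ (Suc p + k) * q (Suc p + k))"
  proof (rule sum.reindex_bij_witness[where i="\<lambda>k. p - k" and j="\<lambda>k. p - k"])
    fix k assume "k \<in> {..<Suc p}"
    then have k: "k \<le> p" by simp
    then have "Suc p + (p - k) = N - k" by simp
    then show "(-1) ^ (Suc p + (p - k)) * q (Suc p + (p - k)) = - ((-1) ^ k * q (N - k))"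
      using k by (simp only:) (simp add: minus_one_power_diff del: One_nat_def)
  qed auto
  also have "(\<Sum>k<Suc p. (-1) ^ k * q k) + \<dots> = (\<Sum>k<Suc p + Suc p. (-1) ^ k * q k)"
    by (rule sum_lessThan_add[symmetric])
  also have "Suc p + Suc p = Suc N" by simp
  finally have "cond_trace (\<Sum>k\<le>p. (-1) ^ k * (B ^ (N - k) * X * B ^ k * Y - B ^ (N - k) * Y * B ^ k * X))
      = (\<Sum>k<Suc N. (-1) ^ k * q k)" .
  moreover have "(2 :: complex) ^ (2 * p) = 4 ^ p" by (simp add: power_mult)
  ultimately show ?thesis
    by (simp only: c_tilde_def C_eq q_def lessThan_Suc_atMost)
qed

lemma trace_class_exact_terms:
  "trace_class (pol * (dpow (2 * p + 2) B G * Y))" "trace_class (pol * (B ^ (2 * p + 2) * Y))"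
  using trace_class_dpow[of "2 * p + 2" pol G Y] trace_class_two_factors[of "2 * p + 2" 0 pol 1 Y] by (simp_all add: mult.assoc)

text \<open>Here the exponent 2p + 2 is exhausted: two derivatives leave degree 2p, the threshold
  for the trace.\<close>

lemma trace_class_d2pow: "trace_class (pol * (d2pow (2 * p + 2) B G H * Y))"
proof -
  have "trace_class (d2pow (2 * p + 2) B G H)"
    by (rule graded_trace_class[OF graded_d2pow[OF exponent_ge_1 B_ideal] _ exponent_ge_1]) simp
  then show ?thesis by (intro trace_class_mult_left trace_class_mult_right)
qed

lemma trace_exact:
  "trace_op (exact_op p X Y B) = trace_op (pol * (dpow (2 * p + 2) B (commutator (pol + B) X) * Y))
    - trace_op (pol * (dpow (2 * p + 2) B (commutator (pol + B) Y) * X))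
    - trace_op (pol * (B ^ (2 * p + 2) * commutator X Y))"
  unfolding exact_op_def right_diff_distrib by (simp only: trace_diff trace_class_diff trace_class_exact_terms)

lemma exact_antisym: "trace_op (exact_op p Y X B) = - trace_op (exact_op p X Y B)"
proof -
  have "exact_op p Y X B = - exact_op p X Y B"
    by (simp add: exact_op_def commutator_def algebra_simps)
  then show ?thesis by (simp add: trace_uminus)
qed

lemma trace_class_exact: "trace_class (exact_op p X Y B)"
  unfolding exact_op_def right_diff_distrib by (intro trace_class_diff trace_class_exact_terms)

lemma exact_add_right: "trace_op (exact_op p X (Y + Y') B) = trace_op (exact_op p X Y B) + trace_op (exact_op p X Y' B)"
proof -
  have "commutator (pol + B) (Y + Y') = commutator (pol + B) Y + commutator (pol + B) Y'"
    "commutator X (Y + Y') = commutator X Y + commutator X Y'"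
    by (simp_all add: commutator_def algebra_simps)
  then have "exact_op p X (Y + Y') B = exact_op p X Y B + exact_op p X Y' B"
    unfolding exact_op_def by (simp only: dpow_add) (simp add: algebra_simps)
  then show ?thesis by (simp add: trace_add trace_class_exact)
qed

lemma modified_antisym: "modified_cocycle p Y X B = - modified_cocycle p X Y B"
  by (simp add: modified_cocycle_def C_antisym[of X Y] exact_antisym[of X Y])

lemma modified_add_right: "modified_cocycle p X (Y + Y') B = modified_cocycle p X Y B + modified_cocycle p X Y' B"
  by (simp add: modified_cocycle_def C_add_right exact_add_right algebra_simps)

text \<open>Rotation brings X to the right end of every word, so that the factors around Y can be
  simplified by \<open>pol_power_F\<close> and \<open>F_power_pol\<close>.\<close>

lemma trace_dpow_commutator:
  "trace_op (pol * (dpow (2 * p + 2) B (commutator (pol + B) X) * Y))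
    = trace_op ((\<Sum>i\<le>N. B ^ (N - i) * Y * (pol * B ^ i * (pol + B)) - (pol + B) * B ^ (N - i) * Y * (pol * B ^ i)) * X)"
proof -
  have split: "pol * (dpow (2 * p + 2) B (commutator (pol + B) X) * Y)
     = (\<Sum>i\<le>N. pol * B ^ i * ((pol + B) * X) * (B ^ (N - i) * Y) - pol * B ^ i * X * ((pol + B) * B ^ (N - i) * Y))"
  proof -
    have "2 * p + 2 = Suc N" by simp
    then have "dpow (2 * p + 2) B (commutator (pol + B) X) = (\<Sum>i\<le>N. B ^ i * commutator (pol + B) X * B ^ (N - i))"
      by (simp only: dpow_eq_sum lessThan_Suc_atMost diff_Suc_Suc)
    then have "pol * (dpow (2 * p + 2) B (commutator (pol + B) X) * Y)
       = (\<Sum>i\<le>N. pol * (B ^ i * commutator (pol + B) X * B ^ (N - i) * Y))"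
      by (simp only: sum_distrib_left sum_distrib_right)
    also have "\<dots> = (\<Sum>i\<le>N. pol * B ^ i * ((pol + B) * X) * (B ^ (N - i) * Y) - pol * B ^ i * X * ((pol + B) * B ^ (N - i) * Y))"
      by (intro sum.cong refl) (simp only: commutator_def left_diff_distrib right_diff_distrib mult.assoc)
    finally show ?thesis .
  qed
  have t1: "trace_class (pol * B ^ i * ((pol + B) * X) * (B ^ (N - i) * Y))" (is ?A)
    and t2: "trace_class (pol * B ^ i * X * ((pol + B) * B ^ (N - i) * Y))" (is ?B)
    and t3: "trace_class (B ^ (N - i) * Y * (pol * B ^ i * (pol + B)) * X)" (is ?C)
    and t4: "trace_class ((pol + B) * B ^ (N - i) * Y * (pol * B ^ i) * X)" (is ?D) if "i \<le> N" for i
  proof -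
    show ?A using trace_class_two_factors[of i "N - i" pol "(pol + B) * X" Y] that by (simp add: mult.assoc)
    show ?B using trace_class_two_factors[of i "N - i" pol "X * (pol + B)" Y] that by (simp add: mult.assoc)
    show ?C using trace_class_two_powers[of "N - i" i "Y * pol" "(pol + B) * X"] that by (simp add: mult.assoc)
    show ?D using trace_class_two_factors[of "N - i" i "pol + B" "Y * pol" X] that by (simp add: mult.assoc)
  qed
  have r1': "trace_op (pol * B ^ i * ((pol + B) * X) * (B ^ (N - i) * Y)) = trace_op (B ^ (N - i) * Y * (pol * B ^ i * (pol + B)) * X)"
    if "i \<le> N" for i
    using trace_rotate_two[of i "N - i" pol "(pol + B) * X" Y] that by (simp add: mult.assoc)
  have r2: "trace_op (pol * B ^ i * X * ((pol + B) * B ^ (N - i) * Y)) = trace_op ((pol + B) * B ^ (N - i) * Y * (pol * B ^ i) * X)"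
    if "i \<le> N" for i
    using trace_rotate_two[of "N - i" i "pol + B" "Y * pol" X] trace_rotate_two[of i "N - i" pol "X * (pol + B)" Y] that
      graded_trace_commute[OF exponent_ge_1, of i "N - i" "pol * B ^ i * X" "(pol + B) * B ^ (N - i) * Y"]
    by (simp add: mult.assoc graded_mult_left graded_mult_right graded_power[OF exponent_ge_1 B_ideal])
  have "trace_op (pol * (dpow (2 * p + 2) B (commutator (pol + B) X) * Y))
     = (\<Sum>i\<le>N. trace_op (B ^ (N - i) * Y * (pol * B ^ i * (pol + B)) * X) - trace_op ((pol + B) * B ^ (N - i) * Y * (pol * B ^ i) * X))"
    unfolding split using t1 t2 r1' r2 by (subst trace_sum) (auto intro!: trace_class_diff sum.cong simp: trace_diff)
  also have "\<dots> = trace_op (\<Sum>i\<le>N. B ^ (N - i) * Y * (pol * B ^ i * (pol + B)) * X - (pol + B) * B ^ (N - i) * Y * (pol * B ^ i) * X)"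
    using t3 t4 by (subst trace_sum) (auto intro!: trace_class_diff sum.cong simp: trace_diff)
  finally show ?thesis by (simp only: sum_distrib_right left_diff_distrib)
qed

lemma sum_even_odd:
  "(\<Sum>i<2 * m. if even i then g i else 0) = (\<Sum>l<m. g (2 * l))"
  "(\<Sum>i<2 * m. if odd i then g i else 0) = (\<Sum>l<m. g (Suc (2 * l)))"
  for g :: "nat \<Rightarrow> 'b::comm_monoid_add"
  by (induction m) simp_all

text \<open>Both parts reduce to the single operator S: \<open>CS\<close> gives -Tr(S X),
  \<open>E1\<close> gives 2 Tr(S X), and by \<open>E2\<close> the other two terms of the exact part
  cancel each other.\<close>

lemma modified_even:
  assumes Y: "pol * Y = Y * pol"
  shows "modified_cocycle p X Y B = 0"
proof -
  define S where "S = (\<Sum>k\<le>N. (-1) ^ k * (B ^ (N - k) * Y * B ^ k))"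
  have sgn: "(-1) ^ k * T = ((-1 :: real) ^ k) *\<^sub>R T" for k and T :: "'n bop"
    by (cases "even k") simp_all
  have CS: "C X Y = - trace_op (S * X)"
  proof -
    have "S * X = (\<Sum>k\<le>N. ((-1 :: real) ^ k) *\<^sub>R (B ^ (N - k) * Y * B ^ k * X))"
      by (simp only: S_def sgn sum_distrib_right mult_scaleR_left)
    then have "trace_op (S * X) = (\<Sum>k\<le>N. of_real ((-1 :: real) ^ k) * trace_op (B ^ (N - k) * Y * B ^ k * X))"
      by (simp only:) (subst trace_sum, auto intro!: trace_class_scaleR trace_class_two_powers simp: trace_scaleR)
    then have "trace_op (S * X) = C Y X" by (simp add: C_eq)
    then show ?thesis by (simp add: C_antisym[of X Y])
  qed
  have "(\<Sum>i\<le>N. B ^ (N - i) * Y * (pol * B ^ i * (pol + B)) - (pol + B) * B ^ (N - i) * Y * (pol * B ^ i)) = S + S"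
  proof -
    \<comment> \<open>As Y commutes with \<open>pol\<close>, the \<open>pol\<close> behind Y can be
      moved in front of it. The exponents i and N - i have opposite parity, so the same signed word
      appears twice and exactly one word with \<open>pol\<close> is left over.\<close>
    have summand: "B ^ (N - i) * Y * (pol * B ^ i * (pol + B)) - (pol + B) * B ^ (N - i) * Y * (pol * B ^ i)
      = (-1) ^ i * (B ^ (N - i) * Y * B ^ i) + (-1) ^ i * (B ^ (N - i) * Y * B ^ i)
        + ((if even i then B ^ (N - i) * Y * pol * B ^ Suc i else 0) - (if odd i then B ^ Suc (N - i) * Y * pol * B ^ i else 0))"
      if i: "i \<le> N" for i
    proof -
      have "(pol + B) * B ^ (N - i) * Y * (pol * B ^ i) = ((pol + B) * B ^ (N - i) * pol) * Y * B ^ i"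
        by (simp add: mult.assoc) (simp add: Y flip: mult.assoc)
      also have "\<dots> = - ((-1) ^ i * (B ^ (N - i) * Y * B ^ i)) + (if odd i then B ^ Suc (N - i) * Y * pol * B ^ i else 0)"
      proof -
        have e: "even (N - i) = odd i" using i by auto
        have s: "(-1) ^ (N - i) = - ((-1) ^ i :: 'n bop)" using i by (intro minus_one_power_diff) auto
        have yp: "pol * (Y * T) = Y * (pol * T)" for T :: "'n bop" by (simp flip: mult.assoc add: Y)
        show ?thesis unfolding F_power_pol e s
          by (cases "even i") (auto simp: distrib_right yp mult.assoc simp del: power_Suc)
      qed
      finally have 2: "(pol + B) * B ^ (N - i) * Y * (pol * B ^ i)
         = - ((-1) ^ i * (B ^ (N - i) * Y * B ^ i)) + (if odd i then B ^ Suc (N - i) * Y * pol * B ^ i else 0)" .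
      have 1: "B ^ (N - i) * Y * (pol * B ^ i * (pol + B))
         = (-1) ^ i * (B ^ (N - i) * Y * B ^ i) + (if even i then B ^ (N - i) * Y * pol * B ^ Suc i else 0)"
        unfolding pol_power_F by (cases "even i") (auto simp: distrib_left mult.assoc simp del: power_Suc)
      show ?thesis unfolding 1 2 by simp
    qed
    \<comment> \<open>The leftover for an even i cancels the one for i + 1.\<close>
    have zero: "(\<Sum>i\<le>N. (if even i then B ^ (N - i) * Y * pol * B ^ Suc i else 0) - (if odd i then B ^ Suc (N - i) * Y * pol * B ^ i else 0)) = 0"
    proof -
      have N2: "{..N} = {..<2 * Suc p}" by auto
      have "(\<Sum>l<Suc p. B ^ (N - 2 * l) * Y * pol * B ^ Suc (2 * l)) = (\<Sum>l<Suc p. B ^ Suc (N - Suc (2 * l)) * Y * pol * B ^ Suc (2 * l))"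
      proof (rule sum.cong[OF refl])
        fix l assume "l \<in> {..<Suc p}"
        then have "N - 2 * l = Suc (N - Suc (2 * l))" by simp
        then show "B ^ (N - 2 * l) * Y * pol * B ^ Suc (2 * l) = B ^ Suc (N - Suc (2 * l)) * Y * pol * B ^ Suc (2 * l)" by (simp only:)
      qed
      then show ?thesis
        unfolding sum_subtractf N2 sum_even_odd(1)[of "\<lambda>i. B ^ (N - i) * Y * pol * B ^ Suc i"]
          sum_even_odd(2)[of "\<lambda>i. B ^ Suc (N - i) * Y * pol * B ^ i"] by (simp only: diff_self)
    qed
    have "(\<Sum>i\<le>N. B ^ (N - i) * Y * (pol * B ^ i * (pol + B)) - (pol + B) * B ^ (N - i) * Y * (pol * B ^ i))
      = (\<Sum>i\<le>N. (-1) ^ i * (B ^ (N - i) * Y * B ^ i) + (-1) ^ i * (B ^ (N - i) * Y * B ^ i)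
        + ((if even i then B ^ (N - i) * Y * pol * B ^ Suc i else 0) - (if odd i then B ^ Suc (N - i) * Y * pol * B ^ i else 0)))"
      by (intro sum.cong refl summand) simp
    also have "\<dots> = S + S + 0"
      unfolding sum.distrib zero S_def ..
    finally show ?thesis by simp
  qed
  then have E1: "trace_op (pol * (dpow (2 * p + 2) B (commutator (pol + B) X) * Y)) = 2 * trace_op (S * X)"
  proof -
    have "trace_class (S * X)"
      unfolding S_def sgn sum_distrib_right scaleR_left_diff_distrib mult_scaleR_left
      by (intro trace_class_sum trace_class_scaleR trace_class_two_powers) simp
    with \<open>_ = S + S\<close> show ?thesis
      unfolding trace_dpow_commutator by (simp add: distrib_right trace_add)
  qed
  \<comment> \<open>Since [F, Y] = [B, Y], the power differentiates to [B^(2p+2), Y], and rotating Y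
    past \<open>pol\<close> cancels the rest.\<close>
  have E2: "trace_op (pol * (dpow (2 * p + 2) B (commutator (pol + B) Y) * X)) + trace_op (pol * (B ^ (2 * p + 2) * commutator X Y)) = 0"
  proof -
    let ?P = "B ^ (2 * p + 2)"
    have "commutator (pol + B) Y = commutator B Y" using Y by (simp add: commutator_def algebra_simps)
    then have d: "dpow (2 * p + 2) B (commutator (pol + B) Y) = ?P * Y - Y * ?P"
      by (simp only: dpow_commutator) (simp add: commutator_def)
    have t: "trace_class (pol * (?P * T))" "trace_class (pol * (Y * (?P * T)))" for T
      using trace_class_exact_terms(2) trace_class_two_factors[of 0 "2 * p + 2" pol Y T] by (simp_all add: mult.assoc)
    have "trace_op (pol * (?P * (X * Y))) = trace_op (Y * (pol * (?P * X)))"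
      using trace_commute[OF trace_class_exact_terms(2)[of X], of Y] by (simp add: mult.assoc)
    also have "Y * (pol * (?P * X)) = pol * (Y * (?P * X))"
      by (simp flip: mult.assoc add: Y)
    finally have c: "trace_op (pol * (?P * (X * Y))) = trace_op (pol * (Y * (?P * X)))" .
    have "pol * ((?P * Y - Y * ?P) * X) = pol * (?P * (Y * X)) - pol * (Y * (?P * X))"
      "pol * (?P * commutator X Y) = pol * (?P * (X * Y)) - pol * (?P * (Y * X))"
      by (simp_all add: commutator_def right_diff_distrib left_diff_distrib mult.assoc)
    then show ?thesis unfolding d by (simp only: trace_diff[OF t(1) t(2)] trace_diff[OF t(1) t(1)] c) simp
  qed
  have "trace_op (exact_op p X Y B) = 2 * trace_op (S * X)"
    using E1 E2 unfolding trace_exact by (simp add: algebra_simps eq_neg_iff_add_eq_0)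
  then show ?thesis by (simp add: modified_cocycle_def CS)
qed

text \<open>The exponents in a word have the odd sum N, so one of the two gaps between X and Y
  carries an even power of B and the word vanishes, after a rotation if it is the gap in
  front.\<close>

lemma modified_odd:
  assumes X: "pol * X = - (X * pol)" and Y: "pol * Y = - (Y * pol)"
    and XY: "\<And>b. X * B ^ (2 * b) * Y = 0" and YX: "\<And>b. Y * B ^ (2 * b) * X = 0"
  shows "modified_cocycle p X Y B = 0"
proof -
  have z: "trace_op (A * B ^ a * X * (B ^ b * Y)) = 0" if "odd (a + b)" "2 * p \<le> a + b" "A = 1" for A a b
  proof (cases "even b")
    case True
    then obtain m where "b = 2 * m" by (elim evenE)
    then have "X * (B ^ b * Y) = 0" using XY[of m] by (simp add: mult.assoc)
    then show ?thesis by (simp add: mult.assoc)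
  next
    case False
    then have "even a" using that by simp
    then obtain m where "a = 2 * m" by (elim evenE)
    then have "Y * (B ^ a * X) = 0" using YX[of m] by (simp add: mult.assoc)
    then show ?thesis using trace_rotate_two[OF that(2), of A X Y] that(3) by (simp add: mult.assoc)
  qed
  have z': "trace_op (A * B ^ a * Y * (B ^ b * X)) = 0" if "odd (a + b)" "2 * p \<le> a + b" "A = 1" for A a b
    using z[of b a 1] trace_rotate_two[OF that(2), of 1 Y X] that by (simp add: mult.assoc add.commute)
  have C0: "C X Y = 0"
    unfolding C_eq
  proof (intro sum.neutral ballI)
    fix k assume "k \<in> {..N}"
    then show "(-1) ^ k * trace_op (B ^ (N - k) * X * B ^ k * Y) = 0"
      using z[of "N - k" k 1] by (simp add: mult.assoc)
  qed
  have dp: "trace_op (pol * (dpow (2 * p + 2) B (commutator (pol + B) X) * Y)) = 0"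
    if X: "pol * X = - (X * pol)" and XY: "\<And>b. X * B ^ (2 * b) * Y = 0"
      and z: "\<And>a b. odd (a + b) \<Longrightarrow> 2 * p \<le> a + b \<Longrightarrow> trace_op (B ^ a * X * (B ^ b * Y)) = 0" for X Y
  proof -
    let ?P = "B ^ (2 * p + 2)"
    \<comment> \<open>For odd X the commutator with \<open>pol\<close> is 2 pol X. The part [B, X]
      differentiates the power to [B^(2p+2), X], whose product with Y vanishes by
      \<open>XY\<close>.\<close>
    have "commutator (pol + B) X = commutator B X + (pol * X + pol * X)"
      using X by (simp add: commutator_def algebra_simps)
    then have "dpow (2 * p + 2) B (commutator (pol + B) X)
       = (?P * X - X * ?P) + (\<Sum>i\<le>N. B ^ i * (pol * X + pol * X) * B ^ (N - i))"
    proof -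
      have "2 * p + 2 = Suc N" by simp
      then have "dpow (2 * p + 2) B (pol * X + pol * X) = (\<Sum>i\<le>N. B ^ i * (pol * X + pol * X) * B ^ (N - i))"
        by (simp only: dpow_eq_sum lessThan_Suc_atMost diff_Suc_Suc)
      with \<open>commutator (pol + B) X = _\<close> show ?thesis
        by (simp only: dpow_add dpow_commutator) (simp add: commutator_def)
    qed
    moreover have "X * Y = 0" "X * (?P * Y) = 0"
      using XY[of 0] XY[of "Suc p"] by (simp_all add: mult.assoc)
    ultimately have "pol * (dpow (2 * p + 2) B (commutator (pol + B) X) * Y)
       = (\<Sum>i\<le>N. pol * (B ^ i * pol) * X * (B ^ (N - i) * Y) + pol * (B ^ i * pol) * X * (B ^ (N - i) * Y))"
      by (simp add: distrib_right left_diff_distrib mult.assoc sum_distrib_left sum_distrib_right distrib_left)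
    also have "\<dots> = (\<Sum>i\<le>N. if even i then B ^ i * X * (B ^ (N - i) * Y) + B ^ i * X * (B ^ (N - i) * Y) else 0)"
    proof (rule sum.cong[OF refl])
      fix i assume "i \<in> {..N}"
      then have i: "i \<le> N" by simp
      show "pol * (B ^ i * pol) * X * (B ^ (N - i) * Y) + pol * (B ^ i * pol) * X * (B ^ (N - i) * Y)
          = (if even i then B ^ i * X * (B ^ (N - i) * Y) + B ^ i * X * (B ^ (N - i) * Y) else 0)"
      proof (cases "even i")
        case True
        have "pol * (B ^ i * pol) = B ^ i"
          unfolding power_pol using True by (simp flip: mult.assoc)
        then show ?thesis using True by simp
      next
        case False
        then have "even (N - i)" using i by simp
        then obtain m where "N - i = 2 * m" by (elim evenE)
        then have "X * (B ^ (N - i) * Y) = 0" using XY[of m] by (simp add: mult.assoc)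
        then show ?thesis using False by (simp add: mult.assoc)
      qed
    qed
    finally have eq: "pol * (dpow (2 * p + 2) B (commutator (pol + B) X) * Y)
      = (\<Sum>i\<le>N. if even i then B ^ i * X * (B ^ (N - i) * Y) + B ^ i * X * (B ^ (N - i) * Y) else 0)" .
    have t: "trace_class (B ^ i * X * (B ^ (N - i) * Y))" if "i \<le> N" for i
      using trace_class_two_powers[of i "N - i" X Y] that by (simp add: mult.assoc)
    show ?thesis
      unfolding eq using t z by (subst trace_sum) (auto intro!: trace_class_add trace_class_zero sum.neutral simp: trace_add)
  qed
  have "X * Y = 0" "Y * X = 0" using XY[of 0] YX[of 0] by simp_all
  then have "trace_op (exact_op p X Y B) = 0"
    unfolding trace_exact using dp[OF X XY z[of _ _ 1, simplified]] dp[OF Y YX z'[of _ _ 1, simplified]]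
    by (simp add: commutator_def)
  then show ?thesis by (simp add: modified_cocycle_def C0)
qed

text \<open>Bilinearity and antisymmetry remove the even part of each argument by
  \<open>modified_even\<close> and leave the odd parts, which are half of X - pol X pol and half of
  Y - pol Y pol.\<close>

lemma modified_triangular:
  assumes XY: "\<And>b. (X - pol * X * pol) * B ^ (2 * b) * (Y - pol * Y * pol) = 0"
    and YX: "\<And>b. (Y - pol * Y * pol) * B ^ (2 * b) * (X - pol * X * pol) = 0"
  shows "modified_cocycle p X Y B = 0"
proof -
  define e o' where "e X = (1/2) *\<^sub>R (X + pol * X * pol)" and "o' X = (1/2) *\<^sub>R (X - pol * X * pol)" for X :: "'n bop"
  have pp: "pol * (pol * T) = T" "T * pol * pol = T" for T :: "'n bop"
    by (simp flip: mult.assoc) (simp add: mult.assoc)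
  have sp: "X = e X + o' X" for X
    by (simp add: e_def o'_def scaleR_add_right[symmetric] flip: scaleR_2) 
  have ev: "pol * e X = e X * pol" for X
    by (simp add: e_def distrib_left distrib_right pp mult.assoc)
  have od: "pol * o' X = - (o' X * pol)" for X
    by (simp add: o'_def right_diff_distrib left_diff_distrib pp mult.assoc flip: scaleR_minus_right)
  have "modified_cocycle p X Y B = modified_cocycle p X (o' Y) B"
    by (subst sp[of Y]) (simp add: modified_add_right modified_even[OF ev])
  also have "\<dots> = - modified_cocycle p (o' Y) (e X + o' X) B"
    by (subst modified_antisym) (simp flip: sp)
  also have "\<dots> = - modified_cocycle p (o' Y) (o' X) B"
    by (simp add: modified_add_right modified_even[OF ev])
  also have "modified_cocycle p (o' Y) (o' X) B = 0"
    by (rule modified_odd[OF od od]) (simp_all add: o'_def XY YX)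
  finally show ?thesis by simp
qed

end

section \<open>Derivatives along the connection and the cocycle identity\<close>

definition alt_form_deriv :: "nat \<Rightarrow> 'n::finite bop \<Rightarrow> 'n bop \<Rightarrow> 'n bop \<Rightarrow> 'n bop \<Rightarrow> complex" where
  "alt_form_deriv p X Y B H = (\<Sum>k\<le>2 * p + 1. (-1) ^ k *
     trace_op ((dpow (2 * p + 1 - k) B H * X * B ^ k + B ^ (2 * p + 1 - k) * X * dpow k B H) * Y))"

definition exact_op_deriv :: "nat \<Rightarrow> 'n::finite bop \<Rightarrow> 'n bop \<Rightarrow> 'n bop \<Rightarrow> 'n bop \<Rightarrow> 'n bop" where
  "exact_op_deriv p X Y B H = pol *
     ((d2pow (2 * p + 2) B H (commutator (pol + B) X) + dpow (2 * p + 2) B (commutator H X)) * Y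
     - (d2pow (2 * p + 2) B H (commutator (pol + B) Y) + dpow (2 * p + 2) B (commutator H Y)) * X
     - dpow (2 * p + 2) B H * commutator X Y)"

lemma sdiff_alt_form:
  assumes p: "p \<ge> 1"
  shows "sdiff (2 * p) (alt_form p X Y) (alt_form_deriv p X Y)"
proof -
  have r: "2 * p \<ge> 1" using p by simp
  have "sdiff (2 * p) (\<lambda>B. (-1) ^ k * trace_op (B ^ (2 * p + 1 - k) * X * B ^ k * Y))
     (\<lambda>B H. (-1) ^ k * trace_op ((dpow (2 * p + 1 - k) B H * X * B ^ k + B ^ (2 * p + 1 - k) * X * dpow k B H) * Y))"
    if k: "k \<le> 2 * p + 1" for k
  proof (intro sdiff_cmult sdiff_trace[OF r, where k="2 * p + 1 - k + k"])
    show "2 * p \<le> 2 * p + 1 - k + k" using k by simp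
    show "expands (2 * p) (2 * p + 1 - k + k) (\<lambda>B. B ^ (2 * p + 1 - k) * X * B ^ k * Y)
      (\<lambda>B H. (dpow (2 * p + 1 - k) B H * X * B ^ k + B ^ (2 * p + 1 - k) * X * dpow k B H) * Y)"
      by (intro expands_mult_right expands_mult expands_power r)
  qed
  then show ?thesis
    unfolding alt_form_def[abs_def] alt_form_deriv_def[abs_def] by (intro sdiff_sum) auto
qed

lemma sdiff_exact:
  assumes p: "p \<ge> 1" and X: "commutator pol X \<in> schatten_ideal (2 * p)" and Y: "commutator pol Y \<in> schatten_ideal (2 * p)"
  shows "sdiff (2 * p) (\<lambda>B. trace_op (exact_op p X Y B)) (\<lambda>B H. trace_op (exact_op_deriv p X Y B H))"
proof -
  have r: "2 * p \<ge> 1" using p by simp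
  have "expands (2 * p) (2 * p + 2) (exact_op p X Y) (exact_op_deriv p X Y)"
    unfolding exact_op_def[abs_def] exact_op_deriv_def[abs_def]
    by (intro expands_mult_left expands_diff expands_mult_right expands_dpow expands_commutator expands_power r X Y)
  from sdiff_trace[OF r _ this] show ?thesis by simp
qed

lemma sdiff_modified:
  assumes "p \<ge> 1" "commutator pol X \<in> schatten_ideal (2 * p)" "commutator pol Y \<in> schatten_ideal (2 * p)"
  shows "sdiff (2 * p) (modified_cocycle p X Y)
    (\<lambda>B H. 4 ^ p * alt_form_deriv p X Y B H + 4 ^ p / 2 * trace_op (exact_op_deriv p X Y B H))"
  unfolding modified_cocycle_def[abs_def]
  by (intro sdiff_add sdiff_cmult sdiff_alt_form sdiff_exact assms)

lemma sum_triples_Suc: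
  "(\<Sum>(a, b, c)\<in>triples (Suc n). f a b c) = (\<Sum>c\<le>Suc n. f 0 (Suc n - c) c) + (\<Sum>(a, b, c)\<in>triples n. f (Suc a) b c)"
  for f :: "nat \<Rightarrow> nat \<Rightarrow> nat \<Rightarrow> 'b::comm_monoid_add"
proof -
  let ?A = "(\<lambda>c. (0 :: nat, Suc n - c, c)) ` {..Suc n}" and ?B = "(\<lambda>(a, b, c). (Suc a, b, c)) ` triples n"
  have "triples (Suc n) = ?A \<union> ?B"
  proof (intro equalityI subsetI)
    fix x assume "x \<in> triples (Suc n)"
    then obtain a b c where x: "x = (a, b, c)" "a + b + c = Suc n" by (auto simp: triples_def)
    show "x \<in> ?A \<union> ?B"
    proof (cases a)
      case 0
      then have "x = (0, Suc n - c, c)" "c \<le> Suc n" using x by auto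
      then show ?thesis by blast
    next
      case (Suc a')
      then have "x = (case (a', b, c) of (a, b, c) \<Rightarrow> (Suc a, b, c))" "(a', b, c) \<in> triples n"
        using x by (auto simp: triples_def)
      then show ?thesis by blast
    qed
  qed (auto simp: triples_def)
  moreover have "?A \<inter> ?B = {}" by auto
  ultimately have "(\<Sum>(a, b, c)\<in>triples (Suc n). f a b c) = (\<Sum>(a, b, c)\<in>?A. f a b c) + (\<Sum>(a, b, c)\<in>?B. f a b c)"
    by (simp add: sum.union_disjoint)
  moreover have "(\<Sum>(a, b, c)\<in>?A. f a b c) = (\<Sum>c\<le>Suc n. f 0 (Suc n - c) c)"
    by (subst sum.reindex) (auto simp: inj_on_def simp del: sum.atMost_Suc)
  moreover have "(\<Sum>(a, b, c)\<in>?B. f a b c) = (\<Sum>(a, b, c)\<in>triples n. f (Suc a) b c)"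
    by (subst sum.reindex) (auto simp: inj_on_def intro!: sum.cong)
  ultimately show ?thesis by (simp only:)
qed

context flat_point
begin

text \<open>Cyclic words in three arguments: Q without \<open>pol\<close>, P with \<open>pol\<close>
  in front, R with [pol, Z] as one argument. W collects the words that [pol, Z] produces when
  \<open>alt_form\<close> is differentiated along Z, see \<open>alt_form_lie\<close>.\<close>

definition "Q a b c X Y Z = trace_op (B ^ a * X * B ^ b * Y * B ^ c * Z)"
definition "P a b c X Y Z = trace_op (pol * B ^ a * X * B ^ b * Y * B ^ c * Z)"
definition "R a b c Z X Y = trace_op (B ^ a * commutator pol Z * B ^ b * X * B ^ c * Y)"
definition "W Z X Y = (\<Sum>(a, b, c)\<in>triples (2 * p). (-1) ^ c * R a b c Z X Y)"

lemma trace_rotate_three: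
  assumes "2 * p \<le> a + b + c"
  shows "trace_op (A * B ^ a * X * (A' * B ^ b * Y * B ^ c * Z)) = trace_op (A' * B ^ b * Y * B ^ c * Z * (A * B ^ a * X))"
proof -
  have 1: "graded (2 * p) a (A * B ^ a * X)" and 2: "graded (2 * p) b (A' * B ^ b * Y)"
    and 3: "graded (2 * p) c (B ^ c * Z)"
    by (intro graded_mult_left graded_mult_right graded_power[OF exponent_ge_1 B_ideal])+
  have "graded (2 * p) (b + c) (A' * B ^ b * Y * B ^ c * Z)"
    using graded_mult[OF exponent_ge_1 2 3] by (simp only: mult.assoc)
  with 1 show ?thesis
    by (intro graded_trace_commute[OF exponent_ge_1, of a "b + c"]) (use assms in auto)
qed

lemma Q_rotate: "2 * p \<le> a + b + c \<Longrightarrow> Q a b c X Y Z = Q b c a Y Z X"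
  using trace_rotate_three[of a b c 1 X 1 Y Z] by (simp add: Q_def mult.assoc)

text \<open>In [pol, Z] the \<open>pol\<close> before Z is moved to the left through B^a and the one
  after Z is rotated to the front; an odd a leaves an extra word without \<open>pol\<close>.\<close>

lemma R_eq:
  assumes abc: "a + b + c = 2 * p"
  shows "R a b c Z X Y = (-1) ^ a * P a b c Z X Y - (if odd a then Q (Suc a) b c Z X Y else 0) - P b c a X Y Z"
proof -
  have t: "trace_class (B ^ a * pol * Z * B ^ b * X * B ^ c * Y)" "trace_class (B ^ a * Z * pol * B ^ b * X * B ^ c * Y)"
    using trace_class_three_powers[of a b c "pol * Z" X Y] trace_class_three_powers[of a b c "Z * pol" X Y] abc by (simp_all add: mult.assoc)
  have "B ^ a * commutator pol Z * B ^ b * X * B ^ c * Y = B ^ a * pol * Z * B ^ b * X * B ^ c * Y - B ^ a * Z * pol * B ^ b * X * B ^ c * Y"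
    by (simp add: commutator_def algebra_simps)
  then have "R a b c Z X Y = trace_op (B ^ a * pol * Z * B ^ b * X * B ^ c * Y) - trace_op (B ^ a * Z * pol * B ^ b * X * B ^ c * Y)"
    unfolding R_def by (simp only: trace_diff t)
  also have "trace_op (B ^ a * Z * pol * B ^ b * X * B ^ c * Y) = P b c a X Y Z"
    using trace_rotate_three[of a b c 1 Z pol X Y] abc by (simp add: P_def mult.assoc)
  also have "trace_op (B ^ a * pol * Z * B ^ b * X * B ^ c * Y)
      = (-1) ^ a * P a b c Z X Y - (if odd a then Q (Suc a) b c Z X Y else 0)"
  proof (cases "even a")
    case True
    then show ?thesis unfolding power_pol by (simp add: P_def)
  next
    case False
    have t': "trace_class (pol * B ^ a * Z * B ^ b * X * B ^ c * Y)" "trace_class (B ^ Suc a * Z * B ^ b * X * B ^ c * Y)"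
      using trace_class_three_factors[of a b c pol Z X Y] trace_class_three_powers[of "Suc a" b c Z X Y] abc by simp_all
    have "B ^ a * pol * Z * B ^ b * X * B ^ c * Y = - (pol * B ^ a * Z * B ^ b * X * B ^ c * Y) - B ^ Suc a * Z * B ^ b * X * B ^ c * Y"
      unfolding power_pol using False by (simp add: algebra_simps)
    then show ?thesis using False
      by (simp only: trace_diff trace_uminus trace_class_uminus t') (simp add: P_def Q_def)
  qed
  finally show ?thesis .
qed

text \<open>The two sums of words P have the same shape with shifted arguments, so they cancel in a
  cyclic sum and only the words Q survive.\<close>

lemma W_eq:
  "W Z X Y = (\<Sum>(a, b, c)\<in>triples (2 * p). (-1) ^ b * P a b c Z X Y) - (\<Sum>(a, b, c)\<in>triples (2 * p). (-1) ^ b * P a b c X Y Z)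
    - (\<Sum>(a, b, c)\<in>triples (2 * p). if odd a then (-1) ^ c * Q (Suc a) b c Z X Y else 0)"
proof -
  have "W Z X Y = (\<Sum>(a, b, c)\<in>triples (2 * p). (-1) ^ b * P a b c Z X Y - (-1) ^ c * P b c a X Y Z
     - (if odd a then (-1) ^ c * Q (Suc a) b c Z X Y else 0))"
    unfolding W_def
  proof (intro sum.cong refl, clarify)
    fix a b c assume "(a, b, c) \<in> triples (2 * p)"
    then have abc: "a + b + c = 2 * p" by (simp add: triples_def)
    have "even (a + b + c)" unfolding abc by simp
    then have "(-1 :: complex) ^ c * (-1) ^ a = (-1) ^ b"
      by (cases "even a"; cases "even b") auto
    then show "(-1) ^ c * R a b c Z X Y = (-1) ^ b * P a b c Z X Y - (-1) ^ c * P b c a X Y Z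
       - (if odd a then (-1) ^ c * Q (Suc a) b c Z X Y else 0)"
      unfolding R_eq[OF abc] by (simp add: right_diff_distrib flip: mult.assoc)
  qed
  also have "\<dots> = (\<Sum>(a, b, c)\<in>triples (2 * p). (-1) ^ b * P a b c Z X Y) - (\<Sum>(a, b, c)\<in>triples (2 * p). (-1) ^ c * P b c a X Y Z)
    - (\<Sum>(a, b, c)\<in>triples (2 * p). if odd a then (-1) ^ c * Q (Suc a) b c Z X Y else 0)"
    by (simp only: case_prod_unfold sum_subtractf)
  also have "(\<Sum>(a, b, c)\<in>triples (2 * p). (-1) ^ c * P b c a X Y Z) = (\<Sum>(a, b, c)\<in>triples (2 * p). (-1) ^ b * P a b c X Y Z)"
    using sum_triples_rotate[of "\<lambda>a b c. (-1) ^ b * P a b c X Y Z" "2 * p"] by simp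
  finally show ?thesis .
qed

definition "Q_even Z X Y = (\<Sum>(a, b, c)\<in>triples N. (if even a then (-1) ^ c else 0) * Q a b c Z X Y)"

text \<open>The exponent a = 0 gives the form C with Y Z merged into one argument; positive even
  exponents give the words left over in \<open>W_eq\<close>.\<close>

lemma Q_even_eq:
  "Q_even Z X Y = C X (Y * Z) + (\<Sum>(a, b, c)\<in>triples (2 * p). if odd a then (-1) ^ c * Q (Suc a) b c Z X Y else 0)"
proof -
  have "Q_even Z X Y = (\<Sum>(a, b, c)\<in>triples (Suc (2 * p)). (if even a then (-1) ^ c else 0) * Q a b c Z X Y)"
    unfolding Q_even_def by simp
  also have "\<dots> = (\<Sum>c\<le>Suc (2 * p). (if even (0::nat) then (-1) ^ c else 0) * Q 0 (Suc (2 * p) - c) c Z X Y)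
    + (\<Sum>(a, b, c)\<in>triples (2 * p). (if even (Suc a) then (-1) ^ c else 0) * Q (Suc a) b c Z X Y)"
    by (rule sum_triples_Suc)
  also have "(\<Sum>c\<le>Suc (2 * p). (if even (0::nat) then (-1) ^ c else 0) * Q 0 (Suc (2 * p) - c) c Z X Y) = C X (Y * Z)"
  proof -
    have "Q 0 (N - c) c Z X Y = trace_op (B ^ (N - c) * X * B ^ c * (Y * Z))" if "c \<le> N" for c
    proof -
      have "trace_class (B ^ (N - c) * X * B ^ c * Y)" by (rule trace_class_two_powers) (use that in simp)
      from trace_commute[OF this, of Z] show ?thesis by (simp add: Q_def mult.assoc)
    qed
    then show ?thesis unfolding C_eq by (intro sum.cong) auto
  qed
  also have "(\<Sum>(a, b, c)\<in>triples (2 * p). (if even (Suc a) then (-1) ^ c else 0) * Q (Suc a) b c Z X Y)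
     = (\<Sum>(a, b, c)\<in>triples (2 * p). if odd a then (-1) ^ c * Q (Suc a) b c Z X Y else 0)"
    by (intro sum.cong) auto
  finally show ?thesis .
qed

text \<open>After rotation the coefficient of a word is a sum over the cyclic shifts of an exponent
  triple with odd sum. Either all exponents are odd and every contribution is 0, or exactly one is
  odd and the two nonzero contributions are opposite.\<close>

lemma Q_even_cyclic: "Q_even Z X Y + Q_even X Y Z + Q_even Y Z X = 0"
proof -
  define t :: "nat \<Rightarrow> nat \<Rightarrow> nat \<Rightarrow> complex" where "t a b c = (if even a then (-1) ^ c else 0)" for a b c
  have 2: "Q_even X Y Z = (\<Sum>(a, b, c)\<in>triples N. t b c a * Q a b c Z X Y)"
  proof -
    have "Q_even X Y Z = (\<Sum>(a, b, c)\<in>triples N. t a b c * Q c a b Z X Y)"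
      unfolding Q_even_def t_def
    proof (intro sum.cong refl, clarify)
      fix a b c assume "(a, b, c) \<in> triples N"
      then have "Q a b c X Y Z = Q c a b Z X Y"
        using Q_rotate[of a b c X Y Z] Q_rotate[of b c a Y Z X] by (simp add: triples_def)
      then show "(if even a then (-1) ^ c else 0) * Q a b c X Y Z = (if even a then (-1) ^ c else 0) * Q c a b Z X Y"
        by simp
    qed
    also have "\<dots> = (\<Sum>(a, b, c)\<in>triples N. t b c a * Q a b c Z X Y)"
      using sum_triples_rotate[of "\<lambda>a b c. t b c a * Q a b c Z X Y" N]
        sum_triples_rotate[of "\<lambda>a b c. t c a b * Q b c a Z X Y" N] by simp
    finally show ?thesis .
  qed
  have 3: "Q_even Y Z X = (\<Sum>(a, b, c)\<in>triples N. t c a b * Q a b c Z X Y)"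
  proof -
    have "Q_even Y Z X = (\<Sum>(a, b, c)\<in>triples N. t a b c * Q b c a Z X Y)"
      unfolding Q_even_def t_def
    proof (intro sum.cong refl, clarify)
      fix a b c assume "(a, b, c) \<in> triples N"
      then have "Q a b c Y Z X = Q b c a Z X Y"
        using Q_rotate[of a b c Y Z X] by (simp add: triples_def)
      then show "(if even a then (-1) ^ c else 0) * Q a b c Y Z X = (if even a then (-1) ^ c else 0) * Q b c a Z X Y"
        by simp
    qed
    also have "\<dots> = (\<Sum>(a, b, c)\<in>triples N. t c a b * Q a b c Z X Y)"
      using sum_triples_rotate[of "\<lambda>a b c. t c a b * Q a b c Z X Y" N] by simp
    finally show ?thesis .
  qed
  have "Q_even Z X Y + Q_even X Y Z + Q_even Y Z X
     = (\<Sum>(a, b, c)\<in>triples N. (t a b c + t b c a + t c a b) * Q a b c Z X Y)"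
    unfolding 2 3 unfolding Q_even_def t_def
    by (simp only: sum.distrib[symmetric] case_prod_unfold distrib_right)
  also have "\<dots> = 0"
  proof (intro sum.neutral ballI, clarify)
    fix a b c assume "(a, b, c) \<in> triples N"
    then have "odd (a + b + c)" by (simp add: triples_def)
    then have "t a b c + t b c a + t c a b = 0"
      unfolding t_def by (cases "even a"; cases "even b") auto
    then show "(t a b c + t b c a + t c a b) * Q a b c Z X Y = 0" by simp
  qed
  finally show ?thesis .
qed

lemma W_cyclic: "W Z X Y + W X Y Z + W Y Z X = C X (Y * Z) + C Y (Z * X) + C Z (X * Y)"
proof -
  define p' where "p' X Y Z = (\<Sum>(a, b, c)\<in>triples (2 * p). (-1) ^ b * P a b c X Y Z)" for X Y Z
  define q where "q Z X Y = (\<Sum>(a, b, c)\<in>triples (2 * p). if odd a then (-1) ^ c * Q (Suc a) b c Z X Y else 0)" for X Y Z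
  have W: "W Z X Y = p' Z X Y - p' X Y Z - q Z X Y" for X Y Z
    unfolding p'_def q_def by (rule W_eq)
  have "C X (Y * Z) + q Z X Y + (C Y (Z * X) + q X Y Z) + (C Z (X * Y) + q Y Z X) = 0"
    using Q_even_cyclic[of Z X Y] unfolding Q_even_eq q_def .
  then show ?thesis unfolding W by algebra
qed

text \<open>[F, Z] = [B, Z] + [pol, Z]. The first part acts as a derivation on the powers of B and
  is shifted onto X and Y by cyclicity; the second gives the words of W.\<close>

lemma alt_form_lie:
  "alt_form_deriv p X Y B (commutator (pol + B) Z)
    = C (commutator Z X) Y + C X (commutator Z Y) + W Z X Y - W Z Y X"
proof -
  let ?th = "commutator pol Z"
  have dG: "dpow n B (commutator (pol + B) Z) = commutator (B ^ n) Z + dpow n B ?th" for n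
  proof -
    have "commutator (pol + B) Z = commutator B Z + ?th" by (simp add: commutator_def algebra_simps)
    then show ?thesis by (simp only: dpow_add dpow_commutator)
  qed
  have D1: "dpow (N - k) B ?th * X * B ^ k * Y = (\<Sum>i<N - k. B ^ i * ?th * B ^ (2 * p - k - i) * X * B ^ k * Y)" for k X Y
    unfolding dpow_eq_sum sum_distrib_right by (intro sum.cong) simp_all
  have D2: "B ^ (N - k) * X * dpow k B ?th * Y = (\<Sum>i<k. B ^ (N - k) * X * B ^ i * ?th * B ^ (k - Suc i) * Y)" for k
    by (simp add: dpow_eq_sum sum_distrib_right sum_distrib_left mult.assoc)
  have t1: "trace_class (B ^ i * ?th * B ^ (2 * p - k - i) * X * B ^ k * Y)" if "i < N - k" for i k X Y
    by (rule trace_class_three_powers) (use that in simp)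
  have t2: "trace_class (B ^ (N - k) * X * B ^ i * ?th * B ^ (k - Suc i) * Y)" if "i < k" "k \<le> N" for i k
    by (rule trace_class_three_powers) (use that in simp)
  have r2: "trace_op (B ^ (N - k) * X * B ^ i * ?th * B ^ (k - Suc i) * Y) = R i (k - Suc i) (N - k) Z Y X"
    if "i < k" "k \<le> N" for i k
  proof -
    have "2 * p \<le> N - k + i + (k - Suc i)" using that by simp
    from trace_rotate_three[OF this, of 1 X 1 ?th Y] show ?thesis by (simp only: R_def mult_1_left mult.assoc)
  qed
  have each: "trace_op ((dpow (N - k) B (commutator (pol + B) Z) * X * B ^ k + B ^ (N - k) * X * dpow k B (commutator (pol + B) Z)) * Y)
    = trace_op (B ^ (N - k) * commutator Z X * B ^ k * Y) + trace_op (B ^ (N - k) * X * B ^ k * commutator Z Y)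
      + (\<Sum>i<N - k. R i (2 * p - k - i) k Z X Y) + (\<Sum>i<k. R i (k - Suc i) (N - k) Z Y X)"
    if k: "k \<le> N" for k
  proof -
    let ?A1 = "B ^ (N - k) * commutator Z X * B ^ k * Y" and ?A2 = "B ^ (N - k) * X * B ^ k * (Z * Y)"
    let ?A3 = "Z * (B ^ (N - k) * X * B ^ k * Y)"
    let ?E1 = "dpow (N - k) B ?th * X * B ^ k * Y" and ?E2 = "B ^ (N - k) * X * dpow k B ?th * Y"
    have kk: "2 * p \<le> N - k + k" using k by simp
    have tA: "trace_class ?A1" "trace_class ?A2" "trace_class ?A3" "trace_class (B ^ (N - k) * X * B ^ k * (Y * Z))"
      by (intro trace_class_two_powers trace_class_mult_left kk)+
    have tE: "trace_class ?E1" "trace_class ?E2"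
      unfolding D1 D2 by (intro trace_class_sum t1 t2; use k in simp)+
    have "(dpow (N - k) B (commutator (pol + B) Z) * X * B ^ k + B ^ (N - k) * X * dpow k B (commutator (pol + B) Z)) * Y
       = ?A1 + ?A2 - ?A3 + ?E1 + ?E2"
      unfolding dG by (simp add: commutator_def algebra_simps)
    then have "trace_op ((dpow (N - k) B (commutator (pol + B) Z) * X * B ^ k + B ^ (N - k) * X * dpow k B (commutator (pol + B) Z)) * Y)
       = trace_op ?A1 + trace_op ?A2 - trace_op ?A3 + trace_op ?E1 + trace_op ?E2"
      by (simp only: trace_add trace_diff trace_class_add trace_class_diff tA tE)
    also have "trace_op ?A3 = trace_op (B ^ (N - k) * X * B ^ k * (Y * Z))"
      using trace_commute[OF trace_class_two_powers[OF kk], of Z X Y] by (simp only: mult.assoc)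
    also have "trace_op ?A1 + trace_op ?A2 - trace_op (B ^ (N - k) * X * B ^ k * (Y * Z))
       = trace_op ?A1 + trace_op (B ^ (N - k) * X * B ^ k * commutator Z Y)"
      unfolding commutator_def[of Z Y] right_diff_distrib[of "B ^ (N - k) * X * B ^ k"]
      by (simp only: trace_diff tA) simp
    also have "trace_op ?E1 = (\<Sum>i<N - k. R i (2 * p - k - i) k Z X Y)"
      unfolding D1 R_def using t1 by (intro trace_sum) auto
    also have "trace_op ?E2 = (\<Sum>i<k. R i (k - Suc i) (N - k) Z Y X)"
      unfolding D2 using t2[OF _ k] r2[OF _ k] by (subst trace_sum) auto
    finally show ?thesis .
  qed
  have "alt_form_deriv p X Y B (commutator (pol + B) Z)
     = (\<Sum>k\<le>N. (-1) ^ k * (trace_op (B ^ (N - k) * commutator Z X * B ^ k * Y) + trace_op (B ^ (N - k) * X * B ^ k * commutator Z Y)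
      + (\<Sum>i<N - k. R i (2 * p - k - i) k Z X Y) + (\<Sum>i<k. R i (k - Suc i) (N - k) Z Y X)))"
    unfolding alt_form_deriv_def using each by (intro sum.cong refl) (simp only: atMost_iff)
  also have "\<dots> = C (commutator Z X) Y + C X (commutator Z Y)
      + (\<Sum>k\<le>N. (-1) ^ k * (\<Sum>i<N - k. R i (2 * p - k - i) k Z X Y))
      + (\<Sum>k\<le>N. (-1) ^ k * (\<Sum>i<k. R i (k - Suc i) (N - k) Z Y X))"
    unfolding C_eq by (simp only: distrib_left sum.distrib)
  also have W1: "(\<Sum>k\<le>N. (-1) ^ k * (\<Sum>i<N - k. R i (2 * p - k - i) k Z X Y)) = W Z X Y" for X Y
    using sum_triples_nested[of "\<lambda>a b c. (-1) ^ c * R a b c Z X Y" "2 * p"]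
    by (simp only: W_def sum_distrib_left Suc_eq_plus1)
  \<comment> \<open>The derivatives of the second power take the shape of W once k is reversed; the
    sign comes from N being odd.\<close>
  also have "(\<Sum>k\<le>N. (-1) ^ k * (\<Sum>i<k. R i (k - Suc i) (N - k) Z Y X)) = - W Z Y X"
  proof -
    have "(\<Sum>k\<le>N. (-1) ^ k * (\<Sum>i<k. R i (k - Suc i) (N - k) Z Y X))
       = (\<Sum>k\<le>N. (-1) ^ (N - k) * (\<Sum>i<N - k. R i (N - k - Suc i) (N - (N - k)) Z Y X))"
      by (rule sum_atMost_rev[symmetric])
    also have "\<dots> = (\<Sum>k\<le>N. - ((-1) ^ k * (\<Sum>i<N - k. R i (2 * p - k - i) k Z Y X)))"
    proof (intro sum.cong refl)
      fix k assume "k \<in> {..N}"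
      then have k: "k \<le> N" "N - (N - k) = k" by simp_all
      have "(-1 :: complex) ^ (N - k) = - ((-1) ^ k)" using k by (intro minus_one_power_diff) auto
      moreover have "(\<Sum>i<N - k. R i (N - k - Suc i) k Z Y X) = (\<Sum>i<N - k. R i (2 * p - k - i) k Z Y X)"
        by (intro sum.cong refl arg_cong2[where f="\<lambda>b Z. R _ b k Z Y X"]) auto
      ultimately show "(-1) ^ (N - k) * (\<Sum>i<N - k. R i (N - k - Suc i) (N - (N - k)) Z Y X)
          = - ((-1) ^ k * (\<Sum>i<N - k. R i (2 * p - k - i) k Z Y X))"
        unfolding k(2) by simp
    qed
    also have "\<dots> = - W Z Y X" unfolding sum_negf W1 ..
    finally show ?thesis .
  qed
  finally show ?thesis by simp
qed

text \<open>The terms W form two cyclic sums, one for each orientation of X, Y, Z.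
  \<open>W_cyclic\<close> turns them into forms C of products, which combine to commutators and
  cancel against the rest.\<close>

lemma alt_form_closed:
  "alt_form_deriv p Y Z B (commutator (pol + B) X) - alt_form_deriv p X Z B (commutator (pol + B) Y)
     + alt_form_deriv p X Y B (commutator (pol + B) Z)
     - C (commutator X Y) Z + C (commutator X Z) Y - C (commutator Y Z) X = 0"
proof -
  have "W X Y Z + W Y Z X + W Z X Y = C X (Y * Z) + C Y (Z * X) + C Z (X * Y)"
    "W X Z Y + W Y X Z + W Z Y X = C X (Z * Y) + C Y (X * Z) + C Z (Y * X)"
    using W_cyclic[of Z X Y] W_cyclic[of Z Y X] by (simp_all only: ac_simps)
  moreover have "C X (Y * Z) - C X (Z * Y) = C X (commutator Y Z)" "C Y (X * Z) - C Y (Z * X) = C Y (commutator X Z)"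
    "C Z (X * Y) - C Z (Y * X) = C Z (commutator X Y)"
    by (simp_all only: commutator_def C_diff_right)
  moreover have "C U (commutator V V') = - C U (commutator V' V)" for U V V'
    by (simp add: commutator_def C_diff_right)
  note this[of X Z Y]
  moreover have neg: "C (commutator U V) V' = - C V' (commutator U V)" "C (commutator V U) V' = - C (commutator U V) V'" for U V V'
    by (simp_all add: C_antisym[of V'] commutator_def C_diff_left)
  note neg(1)[of X Y Z] neg(1)[of X Z Y] neg(1)[of Y Z X] neg(2)[of X Y Z] neg(2)[of X Z Y]
  ultimately show ?thesis
    unfolding alt_form_lie by algebra
qed

text \<open>Formally \<delta>\<delta> = 0, checked on operators before the trace is taken: second
  derivatives cancel by symmetry, first derivatives and double commutators by the Jacobi
  identity.\<close>

lemma exact_closed: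
  "trace_op (exact_op_deriv p Y Z B (commutator (pol + B) X)) - trace_op (exact_op_deriv p X Z B (commutator (pol + B) Y))
     + trace_op (exact_op_deriv p X Y B (commutator (pol + B) Z))
     - trace_op (exact_op p (commutator X Y) Z B) + trace_op (exact_op p (commutator X Z) Y B)
     - trace_op (exact_op p (commutator Y Z) X B) = 0"
proof -
  have td: "trace_class (exact_op_deriv p X Y B H)" for X Y H
    unfolding exact_op_deriv_def right_diff_distrib distrib_right distrib_left
    by (intro trace_class_diff trace_class_add trace_class_exact_terms trace_class_d2pow)
  define a where "a = 2 * p + 2"
  define g where "g U = commutator (pol + B) U" for U
  define d s where "d U V = dpow a B (commutator (g U) V)" and "s U V = d2pow a B (g U) (g V)" for U V
  have s: "s U V = s V U" for U V unfolding s_def by (rule d2pow_commute)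
  have jac: "dpow a B (g (commutator U V)) = d U V - d V U" for U V
  proof -
    have "g (commutator U V) = commutator (g U) V - commutator (g V) U"
      by (simp add: g_def commutator_def algebra_simps)
    then show ?thesis by (simp only: d_def dpow_diff)
  qed
  have "exact_op_deriv p Y Z B (g X) - exact_op_deriv p X Z B (g Y) + exact_op_deriv p X Y B (g Z)
     - exact_op p (commutator X Y) Z B + exact_op p (commutator X Z) Y B - exact_op p (commutator Y Z) X B
    = pol * (((s X Y + d X Y) * Z - (s X Z + d X Z) * Y - dpow a B (g X) * commutator Y Z)
      - ((s Y X + d Y X) * Z - (s Y Z + d Y Z) * X - dpow a B (g Y) * commutator X Z)
      + ((s Z X + d Z X) * Y - (s Z Y + d Z Y) * X - dpow a B (g Z) * commutator X Y)
      - ((d X Y - d Y X) * Z - dpow a B (g Z) * commutator X Y - B ^ a * commutator (commutator X Y) Z)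
      + ((d X Z - d Z X) * Y - dpow a B (g Y) * commutator X Z - B ^ a * commutator (commutator X Z) Y)
      - ((d Y Z - d Z Y) * X - dpow a B (g X) * commutator Y Z - B ^ a * commutator (commutator Y Z) X))"
    unfolding jac[symmetric] unfolding exact_op_def exact_op_deriv_def d_def s_def g_def a_def
    by (simp only: right_diff_distrib distrib_left)
  also have "\<dots> = pol * (B ^ a * (commutator (commutator X Y) Z - commutator (commutator X Z) Y + commutator (commutator Y Z) X))"
    unfolding s[of Y X] s[of Z X] s[of Z Y] by (simp add: algebra_simps)
  also have "commutator (commutator X Y) Z - commutator (commutator X Z) Y + commutator (commutator Y Z) X = 0"
    by (simp add: commutator_def algebra_simps)
  finally have "trace_op (exact_op_deriv p Y Z B (g X) - exact_op_deriv p X Z B (g Y) + exact_op_deriv p X Y B (g Z)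
     - exact_op p (commutator X Y) Z B + exact_op p (commutator X Z) Y B - exact_op p (commutator Y Z) X B) = 0"
    by simp
  then show ?thesis
    unfolding g_def by (simp only: trace_add trace_diff trace_class_add trace_class_diff td trace_class_exact)
qed

lemma modified_cscale_right: "modified_cocycle p X (cscale_op c Y) B = c * modified_cocycle p X Y B"
proof -
  have dc: "dpow n B (cscale_op c G) = cscale_op c (dpow n B G)" for n G
    by (induction n) (simp_all add: dpow.simps cscale_op_mult_left cscale_op_mult_right cscale_op_add)
  have com: "commutator U (cscale_op c Y) = cscale_op c (commutator U Y)" for U
    by (simp add: commutator_def cscale_op_mult_left cscale_op_mult_right cscale_op_diff)
  have "exact_op p X (cscale_op c Y) B = cscale_op c (exact_op p X Y B)"
    unfolding exact_op_def by (simp only: dc com cscale_op_mult_left cscale_op_mult_right cscale_op_diff[symmetric])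
  moreover have "C X (cscale_op c Y) = c * C X Y"
    unfolding C_eq sum_distrib_left by (intro sum.cong) (simp_all add: cscale_op_mult_right trace_cscale_op)
  ultimately show ?thesis by (simp add: modified_cocycle_def trace_cscale_op algebra_simps)
qed

text \<open>The odd part of such an X is a multiple of (1 - pol) X (1 + pol). Even powers of B
  commute with \<open>pol\<close>, so the product of two odd parts contains (1 + pol)(1 - pol) =
  0.\<close>

lemma modified_lower:
  assumes "(1 + pol) * X * (1 - pol) = 0" "(1 + pol) * Y * (1 - pol) = 0"
  shows "modified_cocycle p X Y B = 0"
proof -
  have D: "X - pol * X * pol = (1/2) *\<^sub>R ((1 - pol) * X * (1 + pol))" if "(1 + pol) * X * (1 - pol) = 0" for X
  proof -
    have "(X - pol * X * pol) + (X - pol * X * pol) = (1 - pol) * X * (1 + pol) + (1 + pol) * X * (1 - pol)"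
      by (simp add: algebra_simps)
    then have "2 *\<^sub>R (X - pol * X * pol) = (1 - pol) * X * (1 + pol)" by (simp add: that scaleR_2)
    then have "(1/2) *\<^sub>R (2 *\<^sub>R (X - pol * X * pol)) = (1/2) *\<^sub>R ((1 - pol) * X * (1 + pol))" by (simp only:)
    then show ?thesis by simp
  qed
  have com: "pol * B ^ (2 * b) = B ^ (2 * b) * pol" for b
    using power_pol[of "2 * b"] by simp
  have "(1 + pol) * B ^ (2 * b) * (1 - pol) = B ^ (2 * b) * ((1 + pol) * (1 - pol))" for b
    by (simp only: distrib_left distrib_right left_diff_distrib right_diff_distrib mult.assoc[symmetric] com mult_1_left mult_1_right)
  moreover have "(1 + pol :: 'n bop) * (1 - pol) = 0" by (simp add: algebra_simps)
  ultimately have z: "(1 + pol) * B ^ (2 * b) * (1 - pol) = 0" for b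
    by simp
  have "U * ((1 + pol) * (B ^ (2 * b) * ((1 - pol) * V))) = U * ((1 + pol) * B ^ (2 * b) * (1 - pol)) * V" for U V b
    by (simp only: mult.assoc)
  then have z': "U * ((1 + pol) * (B ^ (2 * b) * ((1 - pol) * V))) = 0" for U V b
    by (simp only: z mult_zero_left mult_zero_right)
  show ?thesis
    by (intro modified_triangular)
      (unfold D[OF assms(1)] D[OF assms(2)], simp_all add: mult.assoc z')
qed

lemma modified_upper:
  assumes "(1 - pol) * X * (1 + pol) = 0" "(1 - pol) * Y * (1 + pol) = 0"
  shows "modified_cocycle p X Y B = 0"
proof -
  have D: "X - pol * X * pol = (1/2) *\<^sub>R ((1 + pol) * X * (1 - pol))" if "(1 - pol) * X * (1 + pol) = 0" for X
  proof -
    have "(X - pol * X * pol) + (X - pol * X * pol) = (1 + pol) * X * (1 - pol) + (1 - pol) * X * (1 + pol)"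
      by (simp add: algebra_simps)
    then have "2 *\<^sub>R (X - pol * X * pol) = (1 + pol) * X * (1 - pol)" by (simp add: that scaleR_2)
    then have "(1/2) *\<^sub>R (2 *\<^sub>R (X - pol * X * pol)) = (1/2) *\<^sub>R ((1 + pol) * X * (1 - pol))" by (simp only:)
    then show ?thesis by simp
  qed
  have com: "pol * B ^ (2 * b) = B ^ (2 * b) * pol" for b
    using power_pol[of "2 * b"] by simp
  have "(1 - pol) * B ^ (2 * b) * (1 + pol) = B ^ (2 * b) * ((1 - pol) * (1 + pol))" for b
    by (simp only: distrib_left distrib_right left_diff_distrib right_diff_distrib mult.assoc[symmetric] com mult_1_left mult_1_right)
  moreover have "(1 - pol :: 'n bop) * (1 + pol) = 0" by (simp add: algebra_simps)
  ultimately have z: "(1 - pol) * B ^ (2 * b) * (1 + pol) = 0" for b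
    by simp
  have "U * ((1 - pol) * (B ^ (2 * b) * ((1 + pol) * V))) = U * ((1 - pol) * B ^ (2 * b) * (1 + pol)) * V" for U V b
    by (simp only: mult.assoc)
  then have z': "U * ((1 - pol) * (B ^ (2 * b) * ((1 + pol) * V))) = 0" for U V b
    by (simp only: z mult_zero_left mult_zero_right)
  show ?thesis
    by (intro modified_triangular)
      (unfold D[OF assms(1)] D[OF assms(2)], simp_all add: mult.assoc z')
qed

end

lemma flat_point_flat_conn: "p \<ge> 1 \<Longrightarrow> B \<in> flat_conn (real p) \<Longrightarrow> flat_point p B"
  by (simp add: flat_point_def flat_conn_ideal flat_conn_square)

definition primitive :: "nat \<Rightarrow> 'n::finite bop \<Rightarrow> 'n bop \<Rightarrow> complex" where
  "primitive p X B = 4 ^ p / 2 * trace_op (pol * B ^ (2 * p + 2) * X)"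

lemma sdiff_primitive:
  assumes p: "p \<ge> 1"
  shows "sdiff (2 * p) (primitive p X) (\<lambda>B H. 4 ^ p / 2 * trace_op (pol * dpow (2 * p + 2) B H * X))"
proof -
  have r: "2 * p \<ge> 1" using p by simp
  have "expands (2 * p) (2 * p + 2) (\<lambda>B. pol * B ^ (2 * p + 2) * X) (\<lambda>B H. pol * dpow (2 * p + 2) B H * X)"
    by (intro expands_mult_right expands_mult_left expands_power r)
  from sdiff_cmult[OF sdiff_trace[OF r _ this], of "4 ^ p / 2"] show ?thesis
    by (simp add: primitive_def[abs_def])
qed

text \<open>\<open>modified_cocycle\<close> is written with formal derivatives so that it can itself
  be differentiated; at flat connections they are the true Lie derivatives of
  \<open>primitive\<close>.\<close>

lemma modified_eq_coboundary:
  assumes p: "p \<ge> 1" and X: "X \<in> gl_res (real p)" and Y: "Y \<in> gl_res (real p)" and B: "B \<in> flat_conn (real p)"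
  shows "modified_cocycle p X Y B = c_tilde p X Y B + coboundary1 (primitive p) X Y B"
proof -
  interpret flat_point p B by (rule flat_point_flat_conn[OF p B])
  have L: "lie_deriv U (primitive p V) B = 4 ^ p / 2 * trace_op (pol * (dpow (2 * p + 2) B (commutator (pol + B) U) * V))"
    if "U \<in> gl_res (real p)" for U V
    using lie_deriv_eq[OF exponent_ge_1 sdiff_primitive[OF p] B_ideal, of U "primitive p V" V] that
    by (simp only: gl_res_eq[OF p] mult.assoc)
  show ?thesis
    unfolding modified_cocycle_def c_tilde_eq coboundary1_def L[OF X] L[OF Y] primitive_def trace_exact
    by (simp add: algebra_simps)
qed

lemma cocycle2_modified:
  assumes p: "p \<ge> 1"
  shows "cocycle2 (real p) (modified_cocycle p :: 'n::finite bop \<Rightarrow> _)"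
  unfolding cocycle2_def cochain2_def
proof (intro conjI ballI)
  fix X Y :: "'n bop" assume X: "X \<in> gl_res (real p)" and Y: "Y \<in> gl_res (real p)"
  show "differentiable_flat (real p) (modified_cocycle p X Y)"
    by (rule sdiff_imp_differentiable_flat[OF p sdiff_modified[OF p]]) (use X Y gl_res_eq[OF p] in auto)
next
  fix B Z :: "'n bop" assume B: "B \<in> flat_conn (real p)"
  interpret flat_point p B by (rule flat_point_flat_conn[OF p B])
  show "gl_linear (real p) (\<lambda>X. modified_cocycle p Z X B)"
    by (simp add: gl_linear_def modified_add_right modified_cscale_right)
  then show "gl_linear (real p) (\<lambda>X. modified_cocycle p X Z B)"
    unfolding modified_antisym[of _ Z] by (simp add: gl_linear_def)
next
  fix B X :: "'n bop" assume B: "B \<in> flat_conn (real p)"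
  interpret flat_point p B by (rule flat_point_flat_conn[OF p B])
  show "modified_cocycle p X X B = 0"
    using modified_antisym[of X X] by simp
next
  fix X Y Z B :: "'n bop"
  assume gl: "X \<in> gl_res (real p)" "Y \<in> gl_res (real p)" "Z \<in> gl_res (real p)" and B: "B \<in> flat_conn (real p)"
  interpret flat_point p B by (rule flat_point_flat_conn[OF p B])
  have L: "lie_deriv U (modified_cocycle p V V') B = 4 ^ p * alt_form_deriv p V V' B (commutator (pol + B) U)
      + 4 ^ p / 2 * trace_op (exact_op_deriv p V V' B (commutator (pol + B) U))"
    if "U \<in> gl_res (real p)" "V \<in> gl_res (real p)" "V' \<in> gl_res (real p)" for U V V'
    by (rule lie_deriv_eq[OF exponent_ge_1 sdiff_modified[OF p] B_ideal]) (use that gl_res_eq[OF p] in auto)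
  define A E where "A = alt_form_deriv p Y Z B (commutator (pol + B) X) - alt_form_deriv p X Z B (commutator (pol + B) Y)
     + alt_form_deriv p X Y B (commutator (pol + B) Z)
     - C (commutator X Y) Z + C (commutator X Z) Y - C (commutator Y Z) X"
    and "E = trace_op (exact_op_deriv p Y Z B (commutator (pol + B) X)) - trace_op (exact_op_deriv p X Z B (commutator (pol + B) Y))
     + trace_op (exact_op_deriv p X Y B (commutator (pol + B) Z))
     - trace_op (exact_op p (commutator X Y) Z B) + trace_op (exact_op p (commutator X Z) Y B)
     - trace_op (exact_op p (commutator Y Z) X B)"
  have "coboundary2 (modified_cocycle p) X Y Z B = 4 ^ p * A + 4 ^ p / 2 * E"
    unfolding coboundary2_def L[OF gl] L[OF gl(2,1,3)] L[OF gl(3,1,2)] modified_cocycle_def A_def E_def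
    by (simp add: algebra_simps)
  also have "A = 0" unfolding A_def by (rule alt_form_closed)
  also have "E = 0" unfolding E_def by (rule exact_closed)
  finally show "coboundary2 (modified_cocycle p) X Y Z B = 0" by simp
qed

lemma cohomologous2_modified:
  assumes p: "p \<ge> 1"
  shows "cohomologous2 (real p) (c_tilde p) (modified_cocycle p :: 'n::finite bop \<Rightarrow> _)"
  unfolding cohomologous2_def
proof (intro exI[of _ "primitive p"] conjI ballI)
  show "cochain1 (real p) (primitive p :: 'n bop \<Rightarrow> _)"
    unfolding cochain1_def
  proof (intro conjI ballI)
    fix X :: "'n bop"
    show "differentiable_flat (real p) (primitive p X)"
      by (rule sdiff_imp_differentiable_flat[OF p sdiff_primitive[OF p]]) simp
  next
    fix B :: "'n bop" assume B: "B \<in> flat_conn (real p)"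
    interpret flat_point p B by (rule flat_point_flat_conn[OF p B])
    have t: "trace_class (pol * B ^ (2 * p + 2) * X)" for X
      using trace_class_exact_terms(2)[of X] by (simp only: mult.assoc)
    show "gl_linear (real p) (\<lambda>X. primitive p X B)"
      unfolding gl_linear_def primitive_def distrib_left[of "pol * B ^ (2 * p + 2)"] cscale_op_mult_right trace_cscale_op
      by (simp only: trace_add[OF t t]) (simp add: algebra_simps)
  qed
qed (rule modified_eq_coboundary[OF p])

section \<open>Multiplication by loops\<close>

text \<open>\<open>bdd_symbol\<close> asks for boundedness on the whole line; periodicity reduces
  this to one compact period.\<close>

lemma periodic_bdd_symbol:
  fixes X :: "real \<Rightarrow> complex^'n^'n"
  assumes c: "continuous_on UNIV X" and per: "\<And>x. X (x + 2 * pi) = X x"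
  shows "bdd_symbol X"
proof -
  have n: "X (x + real n * (2 * pi)) = X x" for x n
  proof (induction n)
    case (Suc n)
    have "x + real (Suc n) * (2 * pi) = (x + real n * (2 * pi)) + 2 * pi" by (simp add: algebra_simps)
    then show ?case using Suc per by metis
  qed simp
  have i: "X (x + real_of_int k * (2 * pi)) = X x" for x k
  proof (cases "k \<ge> 0")
    case True
    then show ?thesis using n[of x "nat k"] by simp
  next
    case False
    then show ?thesis using n[of "x + real_of_int k * (2 * pi)" "nat (- k)"] by simp
  qed
  have "range X \<subseteq> X ` {0..2*pi}"
  proof clarify
    fix x
    define y where "y = x + real_of_int (- \<lfloor>x / (2 * pi)\<rfloor>) * (2 * pi)"
    have two_pi: "2 * pi > 0" by simp
    have "real_of_int \<lfloor>x / (2 * pi)\<rfloor> \<le> x / (2 * pi)" "x / (2 * pi) < real_of_int \<lfloor>x / (2 * pi)\<rfloor> + 1" by linarith+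
    then have "real_of_int \<lfloor>x / (2 * pi)\<rfloor> * (2 * pi) \<le> x" "x < (real_of_int \<lfloor>x / (2 * pi)\<rfloor> + 1) * (2 * pi)"
      by (simp_all only: pos_le_divide_eq pos_divide_less_eq two_pi)
    then have "0 \<le> y" "y \<le> 2 * pi" by (simp_all add: y_def distrib_right)
    moreover have "X x = X y" unfolding y_def by (rule i[symmetric])
    ultimately show "X x \<in> X ` {0..2*pi}" by simp
  qed
  moreover have "bounded (X ` {0..2*pi})"
    by (intro compact_imp_bounded compact_continuous_image continuous_on_subset[OF c]) auto
  ultimately have "bounded (range X)" by (rule bounded_subset[rotated])
  moreover have "(\<lambda>x. X x $ i $ j) \<in> borel_measurable borel" for i j
    by (intro borel_measurable_continuous_onI continuous_on_component c)
  ultimately show ?thesis by (simp add: bdd_symbol_def)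
qed

text \<open>Multiplication is a block Toeplitz operator: its matrix depends only on the difference
  of the modes.\<close>

lemma cinner_mult_op_basis:
  fixes X :: "real \<Rightarrow> complex^'n::finite^'n"
  assumes "bdd_symbol X"
  shows "cinner (basis_wave (j, i)) (app (mult_op X) (basis_wave (k, l))) = fourier_coeff X (j - k) $ i $ l"
proof -
  have "(\<Sum>m\<in>UNIV. cnj ((cis (real_of_int j * x) *s axis i 1) $ m) * (X x *v (cis (real_of_int k * x) *s axis l 1)) $ m)
     = cis (- (real_of_int (j - k) * x)) * X x $ i $ l" for x
  proof -
    have "(X x *v (cis (real_of_int k * x) *s axis l 1)) $ i = X x $ i $ l * cis (real_of_int k * x)"
      by (simp add: matrix_vector_mult_def axis_def if_distrib[of "\<lambda>t. _ * t"] cong: if_cong)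
    moreover have "(\<Sum>m\<in>UNIV. cnj ((cis (real_of_int j * x) *s axis i 1) $ m) * v $ m) = cis (- (real_of_int j * x)) * v $ i" for v :: "complex^'n"
      by (simp add: axis_def cis_cnj if_distrib[of cnj] if_distrib[of "\<lambda>t. _ * t"] if_distrib[of "\<lambda>t. t * _"] cong: if_cong)
    moreover have "cis (- (real_of_int j * x)) * (X x $ i $ l * cis (real_of_int k * x)) = (cis (- (real_of_int j * x)) * cis (real_of_int k * x)) * X x $ i $ l"
      by (simp add: mult_ac)
    moreover have "cis (- (real_of_int j * x)) * cis (real_of_int k * x) = cis (- (real_of_int (j - k) * x))"
      by (simp add: cis_mult algebra_simps)
    ultimately show ?thesis by simp
  qed
  then show ?thesis
    unfolding basis_wave_def prod.case app_mult_op wave_def mult_l2_class[OF assms square_integrable_wave]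
      cinner_l2_class[OF square_integrable_wave square_integrable_mult[OF assms square_integrable_wave]]
    by (simp add: fourier_coeff_def)
qed

text \<open>An entry from a negative mode k to a nonnegative mode j is the Fourier coefficient of
  index j - k > 0, hence zero.\<close>

lemma triangular_minus:
  fixes X :: "real \<Rightarrow> complex^'n::finite^'n"
  assumes X: "bdd_symbol X" and z: "\<And>k. k \<ge> 0 \<Longrightarrow> fourier_coeff X k = 0"
  shows "(1 + pol) * mult_op X * (1 - pol) = 0"
proof (rule bop_eq_on_basis)
  fix b :: "int \<times> 'n"
  have "cinner (basis_wave c) (app ((1 + pol) * mult_op X * (1 - pol)) (basis_wave b)) = 0" for c
  proof (cases "fst b \<ge> 0 \<or> fst c < 0")
    case True
    then show ?thesis
    proof
      assume "fst b \<ge> 0"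
      then show ?thesis by (simp add: app_times app_diff app_one app_pol_basis)
    next
      assume "fst c < 0"
      then show ?thesis by (simp add: app_times app_add app_one cinner_add_right cinner_pol)
    qed
  next
    case False
    then have "cinner (basis_wave c) (app (mult_op X) (basis_wave b)) = 0"
      using cinner_mult_op_basis[OF X, of "fst c" "snd c" "fst b" "snd b"] z[of "fst c - fst b"] by simp
    then show ?thesis
      using False by (simp add: app_times app_add app_diff app_one app_pol_basis cinner_add_right cinner_pol
          app_add_right)
  qed
  then have "app ((1 + pol) * mult_op X * (1 - pol)) (basis_wave b) = 0"
    by (rule basis_wave_total)
  then show "app ((1 + pol) * mult_op X * (1 - pol)) (basis_wave b) = app 0 (basis_wave b)" by simp
qed

text \<open>Entries from nonnegative to negative modes are Fourier coefficients of negative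
  index.\<close>

lemma triangular_plus:
  fixes X :: "real \<Rightarrow> complex^'n::finite^'n"
  assumes X: "bdd_symbol X" and z: "\<And>k. k < 0 \<Longrightarrow> fourier_coeff X k = 0"
  shows "(1 - pol) * mult_op X * (1 + pol) = 0"
proof (rule bop_eq_on_basis)
  fix b :: "int \<times> 'n"
  have "cinner (basis_wave c) (app ((1 - pol) * mult_op X * (1 + pol)) (basis_wave b)) = 0" for c
  proof (cases "fst b < 0 \<or> fst c \<ge> 0")
    case True
    then show ?thesis
    proof
      assume "fst b < 0"
      then show ?thesis by (simp add: app_times app_add app_one app_pol_basis)
    next
      assume "fst c \<ge> 0"
      then show ?thesis by (simp add: app_times app_diff app_one cinner_diff_right cinner_pol)
    qed
  next
    case False
    then have "cinner (basis_wave c) (app (mult_op X) (basis_wave b)) = 0"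
      using cinner_mult_op_basis[OF X, of "fst c" "snd c" "fst b" "snd b"] z[of "fst c - fst b"] by simp
    then show ?thesis
      using False by (simp add: app_times app_add app_diff app_one app_pol_basis cinner_diff_right cinner_add_right cinner_pol
          app_add_right)
  qed
  then have "app ((1 - pol) * mult_op X * (1 + pol)) (basis_wave b) = 0"
    by (rule basis_wave_total)
  then show "app ((1 - pol) * mult_op X * (1 + pol)) (basis_wave b) = app 0 (basis_wave b)" by simp
qed

lemma loop_algebra_bdd_symbol: "X \<in> loop_algebra \<gg> q \<Longrightarrow> bdd_symbol X"
  by (rule periodic_bdd_symbol) (auto simp: loop_algebra_def)

theorem theorem4p1:
  fixes G :: "'g monoid" and T :: "'g topology" and \<rho> :: "'g \<Rightarrow> complex^'n::finite^'n"
    and p :: nat and q :: real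
  assumes "lie_group G T" and "compact_space T"
    and "faithful_rep G T \<rho>"
    and "semisimple (lie_algebra G T \<rho>)"
    and "p \<ge> 1" and "q > 0" and "real p \<ge> max (1/2) (1 / (2 * q))"
  shows "\<exists>c :: 'n bop \<Rightarrow> 'n bop \<Rightarrow> 'n bop \<Rightarrow> complex.
    cocycle2 (real p) c \<and> cohomologous2 (real p) (c_tilde p) c \<and>
    (\<forall>X\<in>loop_algebra_minus (lie_algebra G T \<rho>) q. \<forall>Y\<in>loop_algebra_minus (lie_algebra G T \<rho>) q.
       \<forall>B\<in>flat_conn (real p). c (mult_op X) (mult_op Y) B = 0) \<and>
    (\<forall>X\<in>loop_algebra_plus (lie_algebra G T \<rho>) q. \<forall>Y\<in>loop_algebra_plus (lie_algebra G T \<rho>) q.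
       \<forall>B\<in>flat_conn (real p). c (mult_op X) (mult_op Y) B = 0)"
proof (intro exI[of _ "modified_cocycle p"] conjI ballI)
  note p = \<open>p \<ge> 1\<close>
  show "cocycle2 (real p) (modified_cocycle p :: 'n bop \<Rightarrow> _)" by (rule cocycle2_modified[OF p])
  show "cohomologous2 (real p) (c_tilde p) (modified_cocycle p :: 'n bop \<Rightarrow> _)" by (rule cohomologous2_modified[OF p])
  fix X Y :: "real \<Rightarrow> complex^'n^'n" and B :: "'n bop"
  assume B: "B \<in> flat_conn (real p)"
  interpret flat_point p B by (rule flat_point_flat_conn[OF p B])
  {
    assume "X \<in> loop_algebra_minus (lie_algebra G T \<rho>) q" "Y \<in> loop_algebra_minus (lie_algebra G T \<rho>) q"
    then show "modified_cocycle p (mult_op X) (mult_op Y) B = 0"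
      by (intro modified_lower triangular_minus) (auto simp: loop_algebra_minus_def intro: loop_algebra_bdd_symbol)
  next
    assume "X \<in> loop_algebra_plus (lie_algebra G T \<rho>) q" "Y \<in> loop_algebra_plus (lie_algebra G T \<rho>) q"
    then show "modified_cocycle p (mult_op X) (mult_op Y) B = 0"
      by (intro modified_upper triangular_plus) (auto simp: loop_algebra_plus_def intro: loop_algebra_bdd_symbol)
  }
qed

end
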